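(* Let $R$ be a local domain and let $\mathcal I=\{I_n\}$ be a divisorial filtration on $R$, where $I_n=\bigcap_{i=1}^rI(\nu_i)_{na_i}$ for all $n\ge 1$. Suppose that $I_1=\bigcap_{i=1}^rI(\nu_i)_{a_i}$ is a minimal primary decomposition of $I_1$ and that $\ell(\mathcal I_a)<\dim R$ for some $a\ge 1$, where $\mathcal I_a$ is the $a$-th truncated filtration of $\mathcal I$. Then $\ell(\mathcal I)<\dim R$.
   Context: Local rings are Noetherian. A filtration $\mathcal I=\{I_n\}_{n\in\mathbb N}$ on a ring $R$ is a descending chain of ideals $R=I_0\supset I_1\supset I_2\supset\cdots$ with $I_iI_j\subset I_{i+j}$ for all $i,j$. Its Rees ring is $R[\mathcal I]=\sum_{n\ge 0}I_nt^n\subset R[t]$ (not assumed Noetherian). For $R$ local with maximal ideal $m_R$, the analytic spread is $\ell(\mathcal I)=\dim R[\mathcal I]/m_RR[\mathcal I]$. For $a\in\mathbb Z_{>0}$, the $a$-th truncated filtration $\mathcal I_a=\{I_{a,n}\}$ of $\mathcal I$ is defined by $I_{a,n}=I_n$ if $n\le a$ and $I_{a,n}=\sum_{i,j>0,\ i+j=n}I_{a,i}I_{a,j}$ if $n>a$. Let $R$ be a local domain with quotient field $K$. A divisorial valuation of $R$ is a valuation $\nu$ of $K$ with valuation ring $\mathcal O_\nu$ and maximal ideal $m_\nu$ such that $R\subset\mathcal O_\nu$ and, with $\mathfrak p=m_\nu\cap R$ (the center of $\nu$), $\mathrm{trdeg}_{\kappa(\mathfrak p)}\kappa(\nu)=\mathrm{ht}(\mathfrak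 p)-1$, where $\kappa(\mathfrak p)$ and $\kappa(\nu)$ are the residue fields of $R_{\mathfrak p}$ and $\mathcal O_\nu$. Such $\nu$ is discrete (value group normalized to $\mathbb Z$). For $n\in\mathbb N$, $I(\nu)_n=\{f\in R\mid \nu(f)\ge n\}$; for $n>0$ it is primary to the center of $\nu$. A divisorial filtration on $R$ is a filtration $\mathcal I=\{I_n\}$ for which there are divisorial valuations $\nu_1,\dots,\nu_r$ of $R$ and $a_1,\dots,a_r\in\mathbb Z_{\ge 0}$ with $I_n=I(\nu_1)_{na_1}\cap\cdots\cap I(\nu_r)_{na_r}$ for all $n\in\mathbb N$. *)

theory Defs
  imports "HOL-Algebra.Algebra" "HOL-Library.Extended_Nat"
begin

section \<open>Dimension, height, local rings\<close>

definition prime_chain :: "('a, 'b) ring_scheme \<Rightarrow> (nat \<Rightarrow> 'a set) \<Rightarrow> nat \<Rightarrow> bool" where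
  "prime_chain R C n \<longleftrightarrow> (\<forall>i\<le>n. primeideal (C i) R) \<and> (\<forall>i<n. C i \<subset> C (Suc i))"

definition krull_dim :: "('a, 'b) ring_scheme \<Rightarrow> enat" where
  "krull_dim R = Sup {enat n | n. \<exists>C. prime_chain R C n}"

definition height :: "('a, 'b) ring_scheme \<Rightarrow> 'a set \<Rightarrow> enat" where
  "height R P = Sup {enat n | n. \<exists>C. prime_chain R C n \<and> C n = P}"

text \<open>Local rings are Noetherian by convention.\<close>

definition local_ring :: "('a, 'b) ring_scheme \<Rightarrow> bool" where
  "local_ring R \<longleftrightarrow> cring R \<and> noetherian_ring R \<and> (\<exists>!M. maximalideal M R)"

definition max_ideal :: "('a, 'b) ring_scheme \<Rightarrow> 'a set" where
  "max_ideal R = (THE M. maximalideal M R)"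

section \<open>Primary decomposition\<close>

definition radical :: "('a, 'b) ring_scheme \<Rightarrow> 'a set \<Rightarrow> 'a set" where
  "radical R Q = {x \<in> carrier R. \<exists>n::nat. x [^]\<^bsub>R\<^esub> n \<in> Q}"

definition primary_ideal :: "('a, 'b) ring_scheme \<Rightarrow> 'a set \<Rightarrow> bool" where
  "primary_ideal R Q \<longleftrightarrow> ideal Q R \<and> Q \<noteq> carrier R \<and>
     (\<forall>x\<in>carrier R. \<forall>y\<in>carrier R. x \<otimes>\<^bsub>R\<^esub> y \<in> Q \<longrightarrow> x \<in> Q \<or> y \<in> radical R Q)"

text \<open>The intersection is taken inside the carrier, so that the empty intersection is the
  whole ring.\<close>

definition minimal_primary_decomposition ::
  "('a, 'b) ring_scheme \<Rightarrow> 'i set \<Rightarrow> ('i \<Rightarrow> 'a set) \<Rightarrow> 'a set \<Rightarrow> bool" where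
  "minimal_primary_decomposition R A Q J \<longleftrightarrow>
     finite A \<and> (\<forall>i\<in>A. primary_ideal R (Q i)) \<and>
     J = carrier R \<inter> (\<Inter>i\<in>A. Q i) \<and>
     inj_on (\<lambda>i. radical R (Q i)) A \<and>
     (\<forall>i\<in>A. \<not> carrier R \<inter> (\<Inter>j\<in>A - {i}. Q j) \<subseteq> Q i)"

section \<open>Filtrations, Rees rings, analytic spread\<close>

definition filtration :: "('a, 'b) ring_scheme \<Rightarrow> (nat \<Rightarrow> 'a set) \<Rightarrow> bool" where
  "filtration R I \<longleftrightarrow> (\<forall>n. ideal (I n) R) \<and> I 0 = carrier R \<and>
     (\<forall>n. I (Suc n) \<subseteq> I n) \<and> (\<forall>i j. ideal_prod R (I i) (I j) \<subseteq> I (i + j))"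

definition rees_ring :: "('a, 'b) ring_scheme \<Rightarrow> (nat \<Rightarrow> 'a set) \<Rightarrow> ('a, nat \<Rightarrow> 'a) up_ring" where
  "rees_ring R I = (UP R)\<lparr>carrier := {p \<in> carrier (UP R). \<forall>n. coeff (UP R) p n \<in> I n}\<rparr>"

definition analytic_spread :: "('a, 'b) ring_scheme \<Rightarrow> (nat \<Rightarrow> 'a set) \<Rightarrow> enat" where
  "analytic_spread R I =
     krull_dim (rees_ring R I Quot
       genideal (rees_ring R I) ((\<lambda>x. monom (UP R) x 0) ` max_ideal R))"

text \<open>The finite sum of the products is the ideal generated by their union.\<close>

fun truncated :: "('a, 'b) ring_scheme \<Rightarrow> (nat \<Rightarrow> 'a set) \<Rightarrow> nat \<Rightarrow> nat \<Rightarrow> 'a set" where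
  "truncated R I a n =
     (if n \<le> a then I n
      else genideal R (\<Union>i\<in>{1..<n}. ideal_prod R (truncated R I a i) (truncated R I a (n - i))))"

declare truncated.simps [simp del]

section \<open>Transcendence degree\<close>

text \<open>Algebraic independence of \<open>B\<close> over the subfield \<open>k\<close> of \<open>F\<close>: the monomials in elements
  of \<open>B\<close> are linearly independent over \<open>k\<close>. A monomial is given by its finitely supported
  exponent function.\<close>

definition alg_independent :: "('a, 'b) ring_scheme \<Rightarrow> 'a set \<Rightarrow> 'a set \<Rightarrow> bool" where
  "alg_independent F k B \<longleftrightarrow>
     (\<forall>(E :: ('a \<Rightarrow> nat) set) c.
        finite E \<and> (\<forall>e\<in>E. finite {s. e s \<noteq> 0} \<and> {s. e s \<noteq> 0} \<subseteq> B \<and> c e \<in> k) \<and>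
        (\<Oplus>\<^bsub>F\<^esub>e\<in>E. c e \<otimes>\<^bsub>F\<^esub> (\<Otimes>\<^bsub>F\<^esub>s\<in>{s. e s \<noteq> 0}. s [^]\<^bsub>F\<^esub> e s)) = \<zero>\<^bsub>F\<^esub>
        \<longrightarrow> (\<forall>e\<in>E. c e = \<zero>\<^bsub>F\<^esub>))"

definition transcendence_basis :: "('a, 'b) ring_scheme \<Rightarrow> 'a set \<Rightarrow> 'a set \<Rightarrow> bool" where
  "transcendence_basis F k B \<longleftrightarrow> B \<subseteq> carrier F \<and> alg_independent F k B \<and>
     (\<forall>x\<in>carrier F. (ring.algebraic F over generate_field F (k \<union> B)) x)"

definition has_trdeg :: "('a, 'b) ring_scheme \<Rightarrow> 'a set \<Rightarrow> nat \<Rightarrow> bool" where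
  "has_trdeg F k n \<longleftrightarrow> (\<exists>B. transcendence_basis F k B \<and> finite B \<and> card B = n)"

section \<open>Divisorial valuations and divisorial filtrations\<close>

text \<open>\<open>K\<close> is a quotient field of \<open>R\<close> via the embedding \<open>h\<close>.\<close>

definition quotient_field ::
  "('a, 'b) ring_scheme \<Rightarrow> ('k, 'c) ring_scheme \<Rightarrow> ('a \<Rightarrow> 'k) \<Rightarrow> bool" where
  "quotient_field R K h \<longleftrightarrow> field K \<and> h \<in> ring_hom R K \<and> inj_on h (carrier R) \<and>
     carrier K = {h x \<otimes>\<^bsub>K\<^esub> inv\<^bsub>K\<^esub> h y | x y. x \<in> carrier R \<and> y \<in> carrier R - {\<zero>\<^bsub>R\<^esub>}}"

text \<open>A discrete valuation with value group exactly the integers. Only the values on nonzero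
  elements matter; \<open>\<nu> \<zero>\<close> is a junk value standing for infinity.\<close>

definition discrete_valuation :: "('k, 'c) ring_scheme \<Rightarrow> ('k \<Rightarrow> int) \<Rightarrow> bool" where
  "discrete_valuation K \<nu> \<longleftrightarrow>
     (\<forall>x\<in>carrier K - {\<zero>\<^bsub>K\<^esub>}. \<forall>y\<in>carrier K - {\<zero>\<^bsub>K\<^esub>}. \<nu> (x \<otimes>\<^bsub>K\<^esub> y) = \<nu> x + \<nu> y) \<and>
     (\<forall>x\<in>carrier K - {\<zero>\<^bsub>K\<^esub>}. \<forall>y\<in>carrier K - {\<zero>\<^bsub>K\<^esub>}.
        x \<oplus>\<^bsub>K\<^esub> y \<noteq> \<zero>\<^bsub>K\<^esub> \<longrightarrow> min (\<nu> x) (\<nu> y) \<le> \<nu> (x \<oplus>\<^bsub>K\<^esub> y)) \<and>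
     \<nu> ` (carrier K - {\<zero>\<^bsub>K\<^esub>}) = UNIV"

definition val_ring :: "('k, 'c) ring_scheme \<Rightarrow> ('k \<Rightarrow> int) \<Rightarrow> ('k, 'c) ring_scheme" where
  "val_ring K \<nu> = K\<lparr>carrier := {x \<in> carrier K. x = \<zero>\<^bsub>K\<^esub> \<or> 0 \<le> \<nu> x}\<rparr>"

definition val_max :: "('k, 'c) ring_scheme \<Rightarrow> ('k \<Rightarrow> int) \<Rightarrow> 'k set" where
  "val_max K \<nu> = {x \<in> carrier K. x = \<zero>\<^bsub>K\<^esub> \<or> 0 < \<nu> x}"

definition val_residue_field :: "('k, 'c) ring_scheme \<Rightarrow> ('k \<Rightarrow> int) \<Rightarrow> 'k set ring" where
  "val_residue_field K \<nu> = val_ring K \<nu> Quot val_max K \<nu>"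

definition center ::
  "('a, 'b) ring_scheme \<Rightarrow> ('k, 'c) ring_scheme \<Rightarrow> ('a \<Rightarrow> 'k) \<Rightarrow> ('k \<Rightarrow> int) \<Rightarrow> 'a set" where
  "center R K h \<nu> = {x \<in> carrier R. h x \<in> val_max K \<nu>}"

text \<open>The localization of \<open>R\<close> at \<open>P\<close>, as a subset of the quotient field.\<close>

definition localization ::
  "('a, 'b) ring_scheme \<Rightarrow> ('k, 'c) ring_scheme \<Rightarrow> ('a \<Rightarrow> 'k) \<Rightarrow> 'a set \<Rightarrow> 'k set" where
  "localization R K h P =
     {h x \<otimes>\<^bsub>K\<^esub> inv\<^bsub>K\<^esub> h y | x y. x \<in> carrier R \<and> y \<in> carrier R - P}"

text \<open>If \<open>P\<close> is the center of \<open>\<nu>\<close>, then the local ring \<open>R\<^sub>P\<close> is dominated by the valuation ring,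
  so its residue field embeds canonically into that of \<open>\<nu>\<close>; we take the image of this
  embedding, a subfield of \<^term>\<open>val_residue_field K \<nu>\<close>.\<close>

definition center_residue_field ::
  "('a, 'b) ring_scheme \<Rightarrow> ('k, 'c) ring_scheme \<Rightarrow> ('a \<Rightarrow> 'k) \<Rightarrow> ('k \<Rightarrow> int) \<Rightarrow> 'k set set" where
  "center_residue_field R K h \<nu> =
     (\<lambda>x. val_max K \<nu> +>\<^bsub>val_ring K \<nu>\<^esub> x) ` localization R K h (center R K h \<nu>)"

text \<open>The condition on the transcendence degree \<open>t\<close> is \<open>t = ht - 1\<close>, written without truncated
  subtraction (so that a center of height zero is excluded).\<close>

definition divisorial_valuation ::
  "('a, 'b) ring_scheme \<Rightarrow> ('k, 'c) ring_scheme \<Rightarrow> ('a \<Rightarrow> 'k) \<Rightarrow> ('k \<Rightarrow> int) \<Rightarrow> bool" where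
  "divisorial_valuation R K h \<nu> \<longleftrightarrow> discrete_valuation K \<nu> \<and>
     h ` carrier R \<subseteq> carrier (val_ring K \<nu>) \<and>
     (\<exists>t. has_trdeg (val_residue_field K \<nu>) (center_residue_field R K h \<nu>) t \<and>
          enat t + 1 = height R (center R K h \<nu>))"

definition val_ideal ::
  "('a, 'b) ring_scheme \<Rightarrow> ('k, 'c) ring_scheme \<Rightarrow> ('a \<Rightarrow> 'k) \<Rightarrow> ('k \<Rightarrow> int) \<Rightarrow> nat \<Rightarrow> 'a set" where
  "val_ideal R K h \<nu> n = {f \<in> carrier R. h f = \<zero>\<^bsub>K\<^esub> \<or> int n \<le> \<nu> (h f)}"

definition divisorial_filtration ::
  "('a, 'b) ring_scheme \<Rightarrow> ('k, 'c) ring_scheme \<Rightarrow> ('a \<Rightarrow> 'k) \<Rightarrow> (nat \<Rightarrow> 'a set) \<Rightarrow> bool" where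
  "divisorial_filtration R K h I \<longleftrightarrow> filtration R I \<and>
     (\<exists>(r::nat) \<nu> (a :: nat \<Rightarrow> nat). (\<forall>i\<in>{1..r}. divisorial_valuation R K h (\<nu> i)) \<and>
        (\<forall>n. I n = carrier R \<inter> (\<Inter>i\<in>{1..r}. val_ideal R K h (\<nu> i) (n * a i))))"

end

theory Submission
  imports Defs
begin

text \<open>
  Write \<open>m\<close> for the maximal ideal, \<open>d = dim R\<close> and \<open>\<I>\<close> for the filtration. For \<open>r = 0\<close> every
  \<open>I\<^sub>n\<close> is \<open>R\<close> and truncation changes nothing. Otherwise the proof splits according to whether some
  \<open>\<nu>\<^sub>i\<close> is centred at \<open>m\<close>.

  If \<open>\<nu> = \<nu>\<^sub>i\<close> has centre \<open>m\<close>, the hypothesis on the truncation is contradicted. Since the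
  decomposition of \<open>I\<^sub>1\<close> is irredundant, some \<open>f\<close> lies in all components except the \<open>i\<close>-th; choosing
  \<open>\<nu>(f)\<close> as large as possible forces \<open>f m \<subseteq> I\<^sub>1\<close>. Let \<open>A = (A\<^sub>n)\<close> be the truncated filtration, a
  finitely generated graded algebra. The residue field of \<open>\<nu>\<close> has transcendence degree \<open>d - 1\<close> over
  that of \<open>R\<close>; multiplying \<open>f\<^sup>n\<close> by elements of \<open>R\<close> that lift monomials in a transcendence basis,
  one finds that the length of \<open>A\<^sub>n + f A\<^sub>n\<^sub>-\<^sub>1 + \<dots> + f\<^sup>n A\<^sub>0\<close> over \<open>A\<^sub>n\<close> grows at least like \<open>n\<^sup>d\<close>
  (\<open>hc_lower\<close>). On the other hand the layer \<open>f\<^sup>s A\<^sub>n\<^sub>-\<^sub>s\<close> is, modulo the previous ones, an image of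
  \<open>A\<^sub>n\<^sub>-\<^sub>s\<close> modulo the graded ideal of all \<open>b\<close> with \<open>f b\<close> in one degree higher, which contains \<open>m\<close>; so the
  length is bounded by a Hilbert sum of the quotient of \<open>A\<close> by that ideal. Hilbert sums grow with exponent at
  most the length of the longest chain of graded primes (\<open>growth_le\<close>), so \<open>A\<close> has a chain of
  graded primes over \<open>m\<close> of length \<open>d\<close>, and the analytic spread of the truncation is at least \<open>d\<close>
  (\<open>spread_truncated_ge\<close>).

  If no centre is \<open>m\<close>, prime avoidance yields \<open>x \<in> m\<close> outside all centres. All \<open>\<nu>\<^sub>i(x)\<close> vanish, so \<open>x\<close>
  can be cancelled modulo each \<open>I\<^sub>n\<close>. The Rees ring may fail to be Noetherian, so
  dimension theory does not apply to it directly. Instead, start from a chain of primes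
  \<open>Q\<^sub>0 \<subset> \<dots> \<subset> Q\<^sub>n\<close> of the Rees ring over \<open>m\<close>. There is a prime \<open>p \<noteq> m\<close> of \<open>R\<close> containing \<open>x\<close> whose
  extension \<open>p R[t]\<close> meets the Rees ring inside \<open>Q\<^sub>0\<close> (\<open>exists_prime\<close>), so the chain
  survives in the image of the Rees ring in \<open>(R/p)[t]\<close>. That image contains \<open>g t\<close> for a nonzero
  constant \<open>g\<close>, and for such subrings of a polynomial ring over a Noetherian local domain counting
  lengths shows that \<open>n\<close> is at most the number of elements generating an ideal of finite
  colength in \<open>R/p\<close> (\<open>dim_bound\<close>). As \<open>p \<noteq> 0\<close>, that many can be taken to be \<open>d - 1\<close> (\<open>parameters\<close>), whence
  the analytic spread of \<open>\<I>\<close> is less than \<open>d\<close>.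

  Both arguments compare polynomial growth of lengths. Lengths are measured by chains of submodules,
  all living inside one ambient ring \<open>S\<close>, over a subring \<open>Z\<close> that acts as the ring of constants.
\<close>

section \<open>Submodules over a ring of constants\<close>

text \<open>Keeping modules as subsets of one ring \<open>S\<close>, closed under multiplication by the subring \<open>Z\<close>,
  avoids quotients: the length of \<open>M/N\<close> is read off from chains between \<open>N\<close> and \<open>M\<close>. The locale is
  mainly used with \<open>Z = S = R\<close> for ideals of \<open>R\<close> and with \<open>Z = R/p\<close> inside \<open>S = (R/p)[t]\<close>.\<close>
locale const_ring = cring S for S (structure) +
  fixes Z :: "'a set"
  assumes Z: "subring Z S"
begin

lemma Z_carr [intro, simp]: "z \<in> Z \<Longrightarrow> z \<in> carrier S"
  using subringE(1)[OF Z] by blast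
lemma Z_0 [intro, simp]: "\<zero> \<in> Z" using subringE(2)[OF Z] .
lemma Z_1 [intro, simp]: "\<one> \<in> Z" using subringE(3)[OF Z] .
lemma Z_neg [intro, simp]: "z \<in> Z \<Longrightarrow> \<ominus> z \<in> Z" using subringE(5)[OF Z] .
lemma Z_mult [intro, simp]: "z \<in> Z \<Longrightarrow> w \<in> Z \<Longrightarrow> z \<otimes> w \<in> Z" using subringE(6)[OF Z] .
lemma Z_add [intro, simp]: "z \<in> Z \<Longrightarrow> w \<in> Z \<Longrightarrow> z \<oplus> w \<in> Z" using subringE(7)[OF Z] .
lemma Z_pow [intro, simp]: "z \<in> Z \<Longrightarrow> z [^] (n::nat) \<in> Z"
  by (induction n) auto

definition smod :: "'a set \<Rightarrow> bool" where
  "smod N \<longleftrightarrow> N \<subseteq> carrier S \<and> \<zero> \<in> N \<and> (\<forall>a\<in>N. \<forall>b\<in>N. a \<oplus> b \<in> N) \<and> (\<forall>z\<in>Z. \<forall>a\<in>N. z \<otimes> a \<in> N)"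

lemma smodI:
  assumes "N \<subseteq> carrier S" "\<zero> \<in> N" "\<And>a b. a \<in> N \<Longrightarrow> b \<in> N \<Longrightarrow> a \<oplus> b \<in> N"
    "\<And>z a. z \<in> Z \<Longrightarrow> a \<in> N \<Longrightarrow> z \<otimes> a \<in> N"
  shows "smod N"
  using assms unfolding smod_def by auto

lemma smod_carr: "smod N \<Longrightarrow> a \<in> N \<Longrightarrow> a \<in> carrier S" unfolding smod_def by auto
lemma smod_sub: "smod N \<Longrightarrow> N \<subseteq> carrier S" unfolding smod_def by auto
lemma smod_0: "smod N \<Longrightarrow> \<zero> \<in> N" unfolding smod_def by auto
lemma smod_add: "smod N \<Longrightarrow> a \<in> N \<Longrightarrow> b \<in> N \<Longrightarrow> a \<oplus> b \<in> N" unfolding smod_def by auto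
lemma smod_mult: "smod N \<Longrightarrow> z \<in> Z \<Longrightarrow> a \<in> N \<Longrightarrow> z \<otimes> a \<in> N" unfolding smod_def by auto
lemma smod_neg: "smod N \<Longrightarrow> a \<in> N \<Longrightarrow> \<ominus> a \<in> N"
proof -
  assume N: "smod N" and a: "a \<in> N"
  have "(\<ominus> \<one>) \<otimes> a \<in> N" using smod_mult[OF N _ a, of "\<ominus> \<one>"] by auto
  moreover have "(\<ominus> \<one>) \<otimes> a = \<ominus> a" using smod_carr[OF N a] by algebra
  ultimately show ?thesis by simp
qed
lemma smod_diff: "smod N \<Longrightarrow> a \<in> N \<Longrightarrow> b \<in> N \<Longrightarrow> a \<ominus> b \<in> N"
  unfolding a_minus_def using smod_add smod_neg by blast
lemma smod_add_cancel: "smod N \<Longrightarrow> a \<in> N \<Longrightarrow> b \<in> carrier S \<Longrightarrow> a \<oplus> b \<in> N \<Longrightarrow> b \<in> N"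
proof -
  assume N: "smod N" and a: "a \<in> N" and b: "b \<in> carrier S" and ab: "a \<oplus> b \<in> N"
  have "(a \<oplus> b) \<ominus> a \<in> N" using smod_diff[OF N ab a] .
  moreover have "(a \<oplus> b) \<ominus> a = b" using smod_carr[OF N a] b by algebra
  ultimately show ?thesis by simp
qed
lemma smod_Int: "smod N \<Longrightarrow> smod M \<Longrightarrow> smod (N \<inter> M)"
  unfolding smod_def by auto

lemma smod_zero: "smod {\<zero>}"
  by (rule smodI) auto

lemma smod_Z: "smod Z"
  by (rule smodI) auto

definition sadd :: "'a set \<Rightarrow> 'a set \<Rightarrow> 'a set" where
  "sadd N M = {a \<oplus> b | a b. a \<in> N \<and> b \<in> M}"

definition scale :: "'a \<Rightarrow> 'a set \<Rightarrow> 'a set" where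
  "scale x N = (\<lambda>a. x \<otimes> a) ` N"

lemma saddI: "a \<in> N \<Longrightarrow> b \<in> M \<Longrightarrow> a \<oplus> b \<in> sadd N M" unfolding sadd_def by auto
lemma saddE: assumes "u \<in> sadd N M" obtains a b where "a \<in> N" "b \<in> M" "u = a \<oplus> b"
  using assms unfolding sadd_def by auto

lemma smod_sadd: assumes N: "smod N" and M: "smod M" shows "smod (sadd N M)"
proof (rule smodI)
  show "sadd N M \<subseteq> carrier S" using smod_carr[OF N] smod_carr[OF M] unfolding sadd_def by auto
  show "\<zero> \<in> sadd N M" using saddI[OF smod_0[OF N] smod_0[OF M]] by simp
next
  fix u v assume "u \<in> sadd N M" "v \<in> sadd N M"
  then obtain a b c d where *: "a \<in> N" "b \<in> M" "u = a \<oplus> b" "c \<in> N" "d \<in> M" "v = c \<oplus> d"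
    by (metis saddE)
  have "u \<oplus> v = (a \<oplus> c) \<oplus> (b \<oplus> d)"
    using * smod_carr[OF N] smod_carr[OF M] by (simp add: a_ac)
  thus "u \<oplus> v \<in> sadd N M" using * saddI smod_add[OF N] smod_add[OF M] by metis
next
  fix z u assume z: "z \<in> Z" and "u \<in> sadd N M"
  then obtain a b where *: "a \<in> N" "b \<in> M" "u = a \<oplus> b" by (metis saddE)
  have "z \<otimes> u = z \<otimes> a \<oplus> z \<otimes> b" using * z smod_carr[OF N] smod_carr[OF M] by (simp add: r_distr)
  thus "z \<otimes> u \<in> sadd N M" using * z saddI smod_mult[OF N z] smod_mult[OF M z] by metis
qed

lemma smod_scale: assumes N: "smod N" and x: "x \<in> carrier S" shows "smod (scale x N)"
proof (rule smodI)
  show "scale x N \<subseteq> carrier S" using smod_carr[OF N] x unfolding scale_def by auto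
  show "\<zero> \<in> scale x N" unfolding scale_def using smod_0[OF N] x by (force simp: image_iff)
next
  fix u v assume "u \<in> scale x N" "v \<in> scale x N"
  then obtain a b where *: "a \<in> N" "b \<in> N" "u = x \<otimes> a" "v = x \<otimes> b" unfolding scale_def by auto
  have "u \<oplus> v = x \<otimes> (a \<oplus> b)" using * smod_carr[OF N] x by (simp add: r_distr)
  thus "u \<oplus> v \<in> scale x N" unfolding scale_def using * smod_add[OF N] by auto
next
  fix z u assume z: "z \<in> Z" and "u \<in> scale x N"
  then obtain a where *: "a \<in> N" "u = x \<otimes> a" unfolding scale_def by auto
  have "z \<otimes> u = x \<otimes> (z \<otimes> a)" using * smod_carr[OF N] x z by (simp add: m_lcomm)
  thus "z \<otimes> u \<in> scale x N" unfolding scale_def using * smod_mult[OF N z] by auto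
qed

lemma sadd_sup1: "N \<subseteq> carrier S \<Longrightarrow> smod M \<Longrightarrow> N \<subseteq> sadd N M"
proof
  fix a assume "N \<subseteq> carrier S" "smod M" "a \<in> N"
  thus "a \<in> sadd N M" using saddI[of a N \<zero> M] smod_0 by auto
qed
lemma sadd_sup2: "M \<subseteq> carrier S \<Longrightarrow> smod N \<Longrightarrow> M \<subseteq> sadd N M"
proof
  fix a assume "M \<subseteq> carrier S" "smod N" "a \<in> M"
  thus "a \<in> sadd N M" using saddI[of \<zero> N a M] smod_0 by auto
qed
lemma sadd_least: "smod K \<Longrightarrow> N \<subseteq> K \<Longrightarrow> M \<subseteq> K \<Longrightarrow> sadd N M \<subseteq> K"
  unfolding sadd_def using smod_add by blast
lemma sadd_mono: "N \<subseteq> N' \<Longrightarrow> M \<subseteq> M' \<Longrightarrow> sadd N M \<subseteq> sadd N' M'"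
  unfolding sadd_def by blast
lemma scale_sub: "smod N \<Longrightarrow> x \<in> Z \<Longrightarrow> scale x N \<subseteq> N"
  unfolding scale_def using smod_mult by blast
lemma scale_mono: "N \<subseteq> N' \<Longrightarrow> scale x N \<subseteq> scale x N'"
  unfolding scale_def by blast

section \<open>Length\<close>

text \<open>Only the end points are constrained by inclusions, so that neither \<open>N\<close> nor \<open>M\<close> has to be
  a submodule.\<close>
definition schain :: "'a set \<Rightarrow> 'a set \<Rightarrow> (nat \<Rightarrow> 'a set) \<Rightarrow> nat \<Rightarrow> bool" where
  "schain N M C n \<longleftrightarrow> (\<forall>i\<le>n. smod (C i)) \<and> (\<forall>i<n. C i \<subset> C (Suc i)) \<and> N \<subseteq> C 0 \<and> C n \<subseteq> M"

definition hc :: "'a set \<Rightarrow> 'a set \<Rightarrow> nat \<Rightarrow> bool" where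
  "hc N M n \<longleftrightarrow> (\<exists>C. schain N M C n)"

text \<open>For submodules \<open>N \<subseteq> M\<close> this is the length of the \<open>Z\<close>-module \<open>M/N\<close>.\<close>
definition len :: "'a set \<Rightarrow> 'a set \<Rightarrow> enat" where
  "len N M = (SUP n\<in>{n. hc N M n}. enat n)"

lemma len_ge: "hc N M n \<Longrightarrow> enat n \<le> len N M"
  unfolding len_def by (rule SUP_upper) simp
lemma len_leI: "(\<And>n. hc N M n \<Longrightarrow> enat n \<le> b) \<Longrightarrow> len N M \<le> b"
  unfolding len_def by (rule SUP_least) simp

lemma hc_mono: "hc N M n \<Longrightarrow> N' \<subseteq> N \<Longrightarrow> M \<subseteq> M' \<Longrightarrow> hc N' M' n"
  unfolding hc_def schain_def by (metis order_trans)

lemma len_mono: "N' \<subseteq> N \<Longrightarrow> M \<subseteq> M' \<Longrightarrow> len N M \<le> len N' M'"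
  by (rule len_leI) (auto intro: len_ge hc_mono)

lemma hc_0: "smod K \<Longrightarrow> N \<subseteq> K \<Longrightarrow> K \<subseteq> M \<Longrightarrow> hc N M 0"
  unfolding hc_def schain_def by (intro exI[of _ "\<lambda>_. K"]) auto

lemma schain_mono: "schain N M C n \<Longrightarrow> i \<le> j \<Longrightarrow> j \<le> n \<Longrightarrow> C i \<subseteq> C j"
proof (induction j)
  case (Suc j)
  show ?case
  proof (cases "i = Suc j")
    case False
    hence "C i \<subseteq> C j" using Suc by auto
    moreover have "C j \<subset> C (Suc j)" using Suc.prems unfolding schain_def by auto
    ultimately show ?thesis by auto
  qed auto
qed auto

lemma hc_Suc: assumes "hc N K n" "smod M" "K \<subset> M" shows "hc N M (Suc n)"
proof -
  obtain C where C: "schain N K C n" using assms unfolding hc_def by auto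
  have "schain N M (\<lambda>i. if i \<le> n then C i else M) (Suc n)"
    using C assms(2,3) unfolding schain_def by (auto simp: le_Suc_eq less_Suc_eq)
  thus ?thesis unfolding hc_def by blast
qed

lemma hc_trans: assumes a: "hc N K a" and b: "hc K M b" shows "hc N M (a + b)"
proof -
  obtain D where D: "schain K M D b" using b unfolding hc_def by auto
  have "i \<le> b \<Longrightarrow> hc N (D i) (a + i)" for i
  proof (induction i)
    case 0
    show ?case using hc_mono[OF a, of N "D 0"] D unfolding schain_def by auto
  next
    case (Suc i)
    show ?case using hc_Suc[OF Suc.IH, of "D (Suc i)"] Suc.prems D unfolding schain_def by auto
  qed
  from this[of b] show ?thesis using D hc_mono[of N "D b" "a+b" N M] unfolding schain_def by auto
qed

text \<open>A weakly ascending chain becomes strict after discarding repetitions, so its strict steps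
  bound the length from below.\<close>
lemma weak_chain:
  assumes "\<And>i. i \<le> n \<Longrightarrow> smod (D i)" "\<And>i. i < n \<Longrightarrow> D i \<subseteq> D (Suc i)"
  shows "hc (D 0) (D n) (card {i. i < n \<and> D i \<noteq> D (Suc i)})"
  using assms
proof (induction n)
  case 0
  show ?case using hc_0[of "D 0" "D 0" "D 0"] 0 by auto
next
  case (Suc n)
  have IH: "hc (D 0) (D n) (card {i. i < n \<and> D i \<noteq> D (Suc i)})" using Suc by auto
  show ?case
  proof (cases "D n = D (Suc n)")
    case True
    have "{i. i < Suc n \<and> D i \<noteq> D (Suc i)} = {i. i < n \<and> D i \<noteq> D (Suc i)}"
      using True by (auto simp: less_Suc_eq)
    thus ?thesis using IH True by simp
  next
    case False
    have "{i. i < Suc n \<and> D i \<noteq> D (Suc i)} = insert n {i. i < n \<and> D i \<noteq> D (Suc i)}"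
      using False by (auto simp: less_Suc_eq)
    hence "card {i. i < Suc n \<and> D i \<noteq> D (Suc i)} = Suc (card {i. i < n \<and> D i \<noteq> D (Suc i)})"
      by simp
    moreover have "D n \<subset> D (Suc n)" using False Suc.prems(2)[of n] by auto
    ultimately show ?thesis using hc_Suc[OF IH] Suc.prems(1)[of "Suc n"] by simp
  qed
qed

text \<open>The modular law: an element of \<open>D\<close> is \<open>c + k\<close> with \<open>c \<in> C\<close>, and then \<open>k\<close> lies in \<open>D \<inter> K = C \<inter> K\<close>.\<close>
lemma modular_eq:
  assumes C: "smod C" and D: "smod D" and K: "smod K" and sub: "C \<subseteq> D"
    and i: "C \<inter> K = D \<inter> K" and s: "sadd C K = sadd D K"
  shows "C = D"
proof (rule equalityI[OF sub], rule subsetI)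
  fix d assume d: "d \<in> D"
  have "d \<in> sadd C K" using s sadd_sup1[OF smod_sub[OF D] K] d by auto
  then obtain c k where *: "c \<in> C" "k \<in> K" "d = c \<oplus> k" by (metis saddE)
  have "k \<in> D" using smod_add_cancel[OF D, of c k] * d sub smod_carr[OF K] by auto
  hence "k \<in> C" using i * by auto
  thus "d \<in> C" using * smod_add[OF C] by auto
qed

text \<open>Each strict step of a chain from \<open>N\<close> to \<open>M\<close> stays strict after intersecting with \<open>K\<close> or after
  adding \<open>K\<close>, by the modular law.\<close>
lemma len_sub:
  assumes N: "smod N" and K: "smod K" and M: "smod M" and NK: "N \<subseteq> K" and KM: "K \<subseteq> M"
  shows "len N M \<le> len N K + len K M"
proof (rule len_leI)
  fix n assume "hc N M n"
  then obtain C where C: "schain N M C n" unfolding hc_def by auto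
  let ?D = "\<lambda>i. C i \<inter> K" and ?E = "\<lambda>i. sadd (C i) K"
  let ?d = "{i. i < n \<and> ?D i \<noteq> ?D (Suc i)}" and ?e = "{i. i < n \<and> ?E i \<noteq> ?E (Suc i)}"
  have sC: "i \<le> n \<Longrightarrow> smod (C i)" for i using C unfolding schain_def by auto
  have st: "i < n \<Longrightarrow> C i \<subset> C (Suc i)" for i using C unfolding schain_def by auto
  have "hc (?D 0) (?D n) (card ?d)"
  proof (rule weak_chain)
    show "smod (?D i)" if "i \<le> n" for i using smod_Int[OF sC[OF that] K] .
    show "?D i \<subseteq> ?D (Suc i)" if "i < n" for i using st[OF that] by blast
  qed
  moreover have "N \<subseteq> ?D 0" "?D n \<subseteq> K" using C NK unfolding schain_def by auto
  ultimately have 1: "hc N K (card ?d)" by (rule hc_mono)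
  have "hc (?E 0) (?E n) (card ?e)"
  proof (rule weak_chain)
    show "smod (?E i)" if "i \<le> n" for i using smod_sadd[OF sC[OF that] K] .
    show "?E i \<subseteq> ?E (Suc i)" if "i < n" for i using sadd_mono[of "C i" "C (Suc i)" K K] st[OF that] by blast
  qed
  moreover have "K \<subseteq> ?E 0" by (rule sadd_sup2[OF smod_sub[OF K] sC]) simp
  moreover have "?E n \<subseteq> M" using C KM by (intro sadd_least[OF M]) (auto simp: schain_def)
  ultimately have 2: "hc K M (card ?e)" by (rule hc_mono)
  have "{..<n} \<subseteq> ?d \<union> ?e"
  proof
    fix i assume "i \<in> {..<n}"
    hence i: "i < n" by simp
    show "i \<in> ?d \<union> ?e"
      using modular_eq[OF sC[of i] sC[of "Suc i"] K] st[OF i] i by auto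
  qed
  hence "card {..<n} \<le> card (?d \<union> ?e)" by (intro card_mono) auto
  also have "\<dots> \<le> card ?d + card ?e" by (rule card_Un_le)
  finally have "enat n \<le> enat (card ?d) + enat (card ?e)" by simp
  also have "\<dots> \<le> len N K + len K M" using len_ge[OF 1] len_ge[OF 2] by (rule add_mono)
  finally show "enat n \<le> len N K + len K M" .
qed

text \<open>Multiplication by \<open>z\<close> maps \<open>A/B\<close> onto \<open>(N + zA)/N\<close>; a chain upstairs is pulled back along it.\<close>
lemma len_mult:
  assumes N: "smod N" and A: "smod A" and z: "z \<in> carrier S"
    and B: "\<And>b. b \<in> B \<Longrightarrow> z \<otimes> b \<in> N" "B \<subseteq> A"
  shows "len N (sadd N (scale z A)) \<le> len B A"
proof (rule len_leI)
  fix n assume "hc N (sadd N (scale z A)) n"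
  then obtain C where C: "schain N (sadd N (scale z A)) C n" unfolding hc_def by auto
  define D where "D i = {a \<in> A. z \<otimes> a \<in> C i}" for i
  have sC: "i \<le> n \<Longrightarrow> smod (C i)" for i using C unfolding schain_def by auto
  have NC: "i \<le> n \<Longrightarrow> N \<subseteq> C i" for i using C schain_mono[OF C, of 0 i] unfolding schain_def by auto
  have CM: "i \<le> n \<Longrightarrow> C i \<subseteq> sadd N (scale z A)" for i using C schain_mono[OF C, of i n] unfolding schain_def by auto
  have st: "i < n \<Longrightarrow> C i \<subset> C (Suc i)" for i using C unfolding schain_def by auto
  have sD: "smod (D i)" if i: "i \<le> n" for i
  proof (rule smodI)
    show "D i \<subseteq> carrier S" using smod_sub[OF A] unfolding D_def by auto
    show "\<zero> \<in> D i" using smod_0[OF A] smod_0[OF sC[OF i]] z unfolding D_def by auto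
  next
    fix a b assume "a \<in> D i" "b \<in> D i"
    thus "a \<oplus> b \<in> D i" unfolding D_def using smod_add[OF A] smod_add[OF sC[OF i]] smod_carr[OF A] z
      by (auto simp: r_distr)
  next
    fix y a assume "y \<in> Z" "a \<in> D i"
    thus "y \<otimes> a \<in> D i" unfolding D_def using smod_mult[OF A] smod_mult[OF sC[OF i]] smod_carr[OF A] z
      by (auto simp: m_lcomm[of z y a])
  qed
  have str: "D i \<subset> D (Suc i)" if i: "i < n" for i
  proof -
    obtain c where c: "c \<in> C (Suc i)" "c \<notin> C i" using st[OF i] by auto
    obtain m a where ma: "m \<in> N" "a \<in> A" "c = m \<oplus> z \<otimes> a"
      using CM[of "Suc i"] i c unfolding sadd_def scale_def by auto
    have za: "z \<otimes> a \<in> carrier S" using ma z smod_carr[OF A] by auto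
    have "z \<otimes> a \<in> C (Suc i)" using smod_add_cancel[OF sC[of "Suc i"] _ za, of m] ma c NC[of "Suc i"] i by auto
    moreover have "z \<otimes> a \<notin> C i" using smod_add[OF sC[of i], of m "z \<otimes> a"] ma c NC[of i] i by auto
    moreover have "D i \<subseteq> D (Suc i)" using st[OF i] unfolding D_def by auto
    ultimately show ?thesis using ma unfolding D_def by auto
  qed
  have "schain B A D n"
    unfolding schain_def using sD str B NC[of 0] by (auto simp: D_def)
  thus "enat n \<le> len B A" using len_ge unfolding hc_def by blast
qed

text \<open>Dually to \<open>len_mult\<close>, multiplication by \<open>z\<close> embeds \<open>A/B\<close> into \<open>(N + zA)/N\<close> as soon as \<open>B\<close>
  contains the preimage of \<open>N\<close>, and chains are pushed forward. The polynomial lower bounds for lengths come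
  from this lemma and \<open>indep_hc\<close>.\<close>
lemma hc_mult_up:
  assumes h: "hc B A n" and N: "smod N" and z: "z \<in> carrier S" and A: "A \<subseteq> carrier S"
    and B: "\<And>a. a \<in> A \<Longrightarrow> z \<otimes> a \<in> N \<Longrightarrow> a \<in> B"
  shows "hc N (sadd N (scale z A)) n"
proof -
  obtain C where C: "schain B A C n" using h unfolding hc_def by auto
  have sC: "i \<le> n \<Longrightarrow> smod (C i)" for i using C unfolding schain_def by auto
  have BC: "i \<le> n \<Longrightarrow> B \<subseteq> C i" for i using C schain_mono[OF C, of 0 i] unfolding schain_def by auto
  have CA: "i \<le> n \<Longrightarrow> C i \<subseteq> A" for i using C schain_mono[OF C, of i n] unfolding schain_def by auto
  have st: "i < n \<Longrightarrow> C i \<subset> C (Suc i)" for i using C unfolding schain_def by auto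
  have "schain N (sadd N (scale z A)) (\<lambda>i. sadd N (scale z (C i))) n"
    unfolding schain_def
  proof (intro conjI allI impI)
    fix i assume "i \<le> n" thus "smod (sadd N (scale z (C i)))" using sC N z smod_sadd smod_scale by auto
  next
    show "N \<subseteq> sadd N (scale z (C 0))" using sadd_sup1[OF smod_sub[OF N]] smod_scale[OF sC[of 0] z] by auto
    show "sadd N (scale z (C n)) \<subseteq> sadd N (scale z A)" using CA[of n] sadd_mono scale_mono by auto
  next
    fix i assume i: "i < n"
    obtain c where c: "c \<in> C (Suc i)" "c \<notin> C i" using st[OF i] by auto
    have cX: "c \<in> carrier S" using c smod_carr[OF sC[of "Suc i"]] i by auto
    have "z \<otimes> c \<in> sadd N (scale z (C (Suc i)))"
      using sadd_sup2[OF smod_sub[OF smod_scale[OF sC[of "Suc i"] z]] N] i c unfolding scale_def by auto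
    moreover have "z \<otimes> c \<notin> sadd N (scale z (C i))"
    proof
      assume "z \<otimes> c \<in> sadd N (scale z (C i))"
      then obtain m b where mb: "m \<in> N" "b \<in> C i" "z \<otimes> c = m \<oplus> z \<otimes> b"
        unfolding sadd_def scale_def by auto
      have bX: "b \<in> carrier S" using mb smod_carr[OF sC[of i]] i by auto
      have mX: "m \<in> carrier S" using mb smod_carr[OF N] by auto
      have "z \<otimes> (c \<ominus> b) = z \<otimes> c \<ominus> z \<otimes> b" using z cX bX by algebra
      also have "\<dots> = m" unfolding mb(3) using z bX mX by algebra
      finally have zc: "z \<otimes> (c \<ominus> b) \<in> N" using mb by simp
      have "b \<in> C (Suc i)" using mb st[OF i] by auto
      hence "c \<ominus> b \<in> A" using smod_diff[OF sC[of "Suc i"]] c CA[of "Suc i"] i by auto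
      hence "c \<ominus> b \<in> C i" using B zc BC[of i] i by auto
      hence "(c \<ominus> b) \<oplus> b \<in> C i" using smod_add[OF sC[of i]] mb i by auto
      moreover have "(c \<ominus> b) \<oplus> b = c" using cX bX by algebra
      ultimately show False using c by simp
    qed
    moreover have "sadd N (scale z (C i)) \<subseteq> sadd N (scale z (C (Suc i)))"
      using st[OF i] sadd_mono scale_mono by (metis order_refl psubset_imp_subset)
    ultimately show "sadd N (scale z (C i)) \<subset> sadd N (scale z (C (Suc i)))" by auto
  qed
  thus ?thesis unfolding hc_def by blast
qed

text \<open>The chains are concatenated downwards, because the filtrations in the applications descend.\<close>
lemma hc_iterate:
  assumes "\<And>i. i < T \<Longrightarrow> hc (V (Suc i)) (V i) s"  "smod (V 0)"
  shows "hc (V T) (V 0) (T * s)"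
  using assms
proof (induction T)
  case 0
  thus ?case using hc_0[of "V 0" "V 0" "V 0"] by auto
next
  case (Suc T)
  have h: "hc (V (Suc T)) (V T) s" using Suc by auto
  have "hc (V T) (V 0) (T * s)" using Suc by auto
  from hc_trans[OF h this] show ?case by (simp add: add.commute)
qed

end

text \<open>Noetherian induction in the form used throughout: a property without infinite ascending
  sequences has a maximal instance. It is stated for an arbitrary relation so as to apply to ideals and
  to graded ideals.\<close>
lemma exists_maximal_no_chain:
  assumes "P x0" "\<And>f::nat \<Rightarrow> 'x. (\<And>i. P (f i)) \<Longrightarrow> (\<And>i. R (f i) (f (Suc i))) \<Longrightarrow> False"
  shows "\<exists>x. P x \<and> (\<forall>y. P y \<longrightarrow> \<not> R x y)"
proof (rule ccontr)
  assume "\<not> ?thesis"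
  hence *: "\<And>x. P x \<Longrightarrow> \<exists>y. P y \<and> R x y" by blast
  obtain f where "\<forall>i::nat. P (f i) \<and> R (f i) (f (Suc i))"
    using dependent_nat_choice[of "\<lambda>_. P" "\<lambda>_. R"] assms(1) * by metis
  thus False using assms(2)[of f] by blast
qed

context const_ring
begin

lemma ring_aux:
  assumes "a \<in> carrier S" "b \<in> carrier S" "c \<in> carrier S" "d \<in> carrier S"
  shows "\<ominus> a \<otimes> b = (\<ominus> \<one>) \<otimes> (a \<otimes> b)"
    and "\<one> \<otimes> a \<oplus> (\<ominus> \<one>) \<otimes> b = a \<ominus> b"
    and "(a \<oplus> b) \<ominus> b = a"
    and "a \<oplus> (b \<otimes> c \<oplus> d) = (a \<oplus> d) \<oplus> c \<otimes> b"
  using assms by algebra+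

text \<open>Adding the elements \<open>v e\<close> to \<open>N\<close> one at a time gives a strict chain: if an element were
  already contained, solving for it would give a relation in which its coefficient is one. The condition on
  \<open>rel\<close> is linear independence over a residue field, phrased without passing to that field, since
  over a local ring every coefficient outside the maximal ideal can be normalised to one.\<close>
lemma indep_hc:
  assumes E: "finite E" and N: "smod N" and M: "smod M" and NM: "N \<subseteq> M"
    and v: "\<And>e. e \<in> E \<Longrightarrow> v e \<in> M"
    and rel: "\<And>r. r \<in> E \<rightarrow> Z \<Longrightarrow> (\<Oplus>e\<in>E. r e \<otimes> v e) \<in> N \<Longrightarrow> (\<forall>e\<in>E. r e \<noteq> \<one>)"
  shows "hc N M (card E)"
proof -
  have "\<exists>K. smod K \<and> hc N K (card E) \<and> N \<subseteq> K \<and> K \<subseteq> M \<and>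
     (\<forall>u\<in>K. \<exists>n\<in>N. \<exists>r\<in>E\<rightarrow>Z. u = n \<oplus> (\<Oplus>e\<in>E. r e \<otimes> v e))"
    using E v rel
  proof (induction E)
    case empty
    have "\<forall>u\<in>N. \<exists>n\<in>N. \<exists>r\<in>{}\<rightarrow>Z. u = n \<oplus> (\<Oplus>e\<in>{}. r e \<otimes> v e)"
      using smod_carr[OF N] by auto
    thus ?case using N NM hc_0[OF N, of N N] by (intro exI[of _ N]) auto
  next
    case (insert a E)
    have vX: "e \<in> insert a E \<Longrightarrow> v e \<in> carrier S" for e using insert.prems(1) smod_carr[OF M] by blast
    have sc: "(\<lambda>e. r e \<otimes> v e) \<in> E \<rightarrow> carrier S" if "r \<in> E \<rightarrow> Z" for r
      using that vX by (auto simp: Pi_def)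
    have ins: "(\<Oplus>e\<in>insert a E. r e \<otimes> v e) = r a \<otimes> v a \<oplus> (\<Oplus>e\<in>E. r e \<otimes> v e)"
      if "r \<in> E \<rightarrow> Z" "r a \<in> Z" for r
      by (rule finsum_insert) (use insert.hyps that vX sc in auto)
    have cong: "(\<Oplus>e\<in>E. r e \<otimes> v e) = (\<Oplus>e\<in>E. r' e \<otimes> v e)" if "r \<in> E \<rightarrow> Z" "\<And>e. e \<in> E \<Longrightarrow> r' e = r e" for r r'
      by (rule finsum_cong') (use that vX in \<open>auto simp: Pi_def\<close>)
    have "\<exists>K. smod K \<and> hc N K (card E) \<and> N \<subseteq> K \<and> K \<subseteq> M \<and>
     (\<forall>u\<in>K. \<exists>n\<in>N. \<exists>r\<in>E\<rightarrow>Z. u = n \<oplus> (\<Oplus>e\<in>E. r e \<otimes> v e))"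
    proof (rule insert.IH)
      show "v e \<in> M" if "e \<in> E" for e using insert.prems(1) that by auto
      fix r assume r: "r \<in> E \<rightarrow> Z" "(\<Oplus>e\<in>E. r e \<otimes> v e) \<in> N"
      let ?r = "\<lambda>e. if e = a then \<zero> else r e"
      have "(\<Oplus>e\<in>insert a E. ?r e \<otimes> v e) = ?r a \<otimes> v a \<oplus> (\<Oplus>e\<in>E. ?r e \<otimes> v e)"
        by (rule ins) (use r in \<open>auto simp: Pi_def\<close>)
      also have "(\<Oplus>e\<in>E. ?r e \<otimes> v e) = (\<Oplus>e\<in>E. r e \<otimes> v e)"
        by (rule cong[symmetric]) (use r insert.hyps in auto)
      also have "?r a \<otimes> v a \<oplus> (\<Oplus>e\<in>E. r e \<otimes> v e) = (\<Oplus>e\<in>E. r e \<otimes> v e)"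
        using vX smod_carr[OF N r(2)] by auto
      finally have "(\<Oplus>e\<in>insert a E. ?r e \<otimes> v e) \<in> N" using r by simp
      moreover have "?r \<in> insert a E \<rightarrow> Z" using r by (auto simp: Pi_def)
      ultimately have "\<forall>e\<in>insert a E. ?r e \<noteq> \<one>" by (rule insert.prems(2)[rotated])
      thus "\<forall>e\<in>E. r e \<noteq> \<one>" using insert.hyps by (metis insert_iff)
    qed
    then obtain K where K: "smod K" "hc N K (card E)" "N \<subseteq> K" "K \<subseteq> M"
      "\<And>u. u\<in>K \<Longrightarrow> \<exists>n\<in>N. \<exists>r\<in>E\<rightarrow>Z. u = n \<oplus> (\<Oplus>e\<in>E. r e \<otimes> v e)" by blast
    let ?K = "sadd K (scale (v a) Z)"
    have va: "v a \<in> carrier S" using vX by auto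
    have sK: "smod ?K" using K smod_sadd smod_scale smod_Z va by auto
    have KK: "K \<subseteq> ?K" using sadd_sup1[OF smod_sub[OF K(1)] smod_scale[OF smod_Z va]] .
    have "scale (v a) Z \<subseteq> M"
    proof
      fix u assume "u \<in> scale (v a) Z"
      then obtain z where z: "z \<in> Z" "u = v a \<otimes> z" unfolding scale_def by auto
      hence "u = z \<otimes> v a" using va m_comm by auto
      thus "u \<in> M" using smod_mult[OF M z(1)] insert.prems(1) by auto
    qed
    hence KM: "?K \<subseteq> M" using sadd_least[OF M K(4)] by auto
    have "v a \<otimes> \<one> \<in> scale (v a) Z" unfolding scale_def by blast
    hence vaK: "v a \<in> ?K" using sadd_sup2[OF smod_sub[OF smod_scale[OF smod_Z va]] K(1)] va by auto
    have vaK': "v a \<notin> K"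
    proof
      assume "v a \<in> K"
      then obtain n r where nr: "n \<in> N" "r \<in> E \<rightarrow> Z" "v a = n \<oplus> (\<Oplus>e\<in>E. r e \<otimes> v e)" using K(5) by blast
      let ?r = "\<lambda>e. if e = a then \<one> else \<ominus> r e"
      have s: "(\<Oplus>e\<in>E. r e \<otimes> v e) \<in> carrier S" by (rule finsum_closed) (use sc[OF nr(2)] in auto)
      have "(\<Oplus>e\<in>insert a E. ?r e \<otimes> v e) = ?r a \<otimes> v a \<oplus> (\<Oplus>e\<in>E. ?r e \<otimes> v e)"
        by (rule ins) (use nr in \<open>auto simp: Pi_def\<close>)
      also have "(\<Oplus>e\<in>E. ?r e \<otimes> v e) = (\<Oplus>e\<in>E. (\<ominus> \<one>) \<otimes> (r e \<otimes> v e))"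
      proof (rule finsum_cong'[OF refl])
        show "(\<lambda>e. (\<ominus> \<one>) \<otimes> (r e \<otimes> v e)) \<in> E \<rightarrow> carrier S" using sc[OF nr(2)] by (auto simp: Pi_def)
        fix e assume e: "e \<in> E"
        have "\<ominus> r e \<otimes> v e = (\<ominus> \<one>) \<otimes> (r e \<otimes> v e)"
        proof -
          have c: "r e \<in> carrier S" "v e \<in> carrier S" using nr(2) e vX by auto
          show ?thesis using ring_aux(1) c by blast
        qed
        thus "?r e \<otimes> v e = (\<ominus> \<one>) \<otimes> (r e \<otimes> v e)" using insert.hyps e by auto
      qed
      also have "\<dots> = (\<ominus> \<one>) \<otimes> (\<Oplus>e\<in>E. r e \<otimes> v e)"
        by (rule finsum_rdistr[symmetric]) (use insert.hyps sc[OF nr(2)] in auto)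
      also have "?r a \<otimes> v a \<oplus> (\<ominus> \<one>) \<otimes> (\<Oplus>e\<in>E. r e \<otimes> v e) = v a \<ominus> (\<Oplus>e\<in>E. r e \<otimes> v e)"
      proof -
        have "\<one> \<otimes> v a \<oplus> (\<ominus> \<one>) \<otimes> (\<Oplus>e\<in>E. r e \<otimes> v e) = v a \<ominus> (\<Oplus>e\<in>E. r e \<otimes> v e)"
          using ring_aux(2) s vX[of a] by blast
        thus ?thesis by simp
      qed
      also have "\<dots> = n"
      proof -
        have "n \<in> carrier S" using smod_carr[OF N nr(1)] .
        thus ?thesis unfolding nr(3) using s ring_aux(3) by blast
      qed
      finally have "(\<Oplus>e\<in>insert a E. ?r e \<otimes> v e) \<in> N" using nr by simp
      moreover have "?r \<in> insert a E \<rightarrow> Z" using nr by (auto simp: Pi_def)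
      ultimately have "?r a \<noteq> \<one>" using insert.prems(2)[of ?r] by blast
      thus False by simp
    qed
    have "hc N ?K (Suc (card E))" using hc_Suc[OF K(2) sK] KK vaK vaK' by blast
    hence hcK: "hc N ?K (card (insert a E))" using insert.hyps by simp
    have "\<exists>n\<in>N. \<exists>r\<in>insert a E\<rightarrow>Z. u = n \<oplus> (\<Oplus>e\<in>insert a E. r e \<otimes> v e)" if u: "u \<in> ?K" for u
    proof -
      obtain k z where kz: "k \<in> K" "z \<in> Z" "u = k \<oplus> v a \<otimes> z" using u unfolding sadd_def scale_def by auto
      obtain n r where nr: "n \<in> N" "r \<in> E \<rightarrow> Z" "k = n \<oplus> (\<Oplus>e\<in>E. r e \<otimes> v e)" using K(5) kz by blast
      let ?r = "\<lambda>e. if e = a then z else r e"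
      have s: "(\<Oplus>e\<in>E. r e \<otimes> v e) \<in> carrier S" by (rule finsum_closed) (use sc[OF nr(2)] in auto)
      have "(\<Oplus>e\<in>insert a E. ?r e \<otimes> v e) = ?r a \<otimes> v a \<oplus> (\<Oplus>e\<in>E. ?r e \<otimes> v e)"
        by (rule ins) (use nr kz in \<open>auto simp: Pi_def\<close>)
      also have "(\<Oplus>e\<in>E. ?r e \<otimes> v e) = (\<Oplus>e\<in>E. r e \<otimes> v e)"
        by (rule cong[symmetric]) (use nr insert.hyps in auto)
      finally have "n \<oplus> (\<Oplus>e\<in>insert a E. ?r e \<otimes> v e) = n \<oplus> (z \<otimes> v a \<oplus> (\<Oplus>e\<in>E. r e \<otimes> v e))" by simp
      also have "\<dots> = u"
      proof -
        have "n \<in> carrier S" "z \<in> carrier S" using smod_carr[OF N nr(1)] kz by auto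
        thus ?thesis unfolding kz(3) nr(3) using s va ring_aux(4) by blast
      qed
      finally show ?thesis using nr kz by (intro bexI[of _ n] bexI[of _ ?r]) (auto simp: Pi_def)
    qed
    thus ?case using sK hcK KK K(3) KM by (intro exI[of _ ?K]) auto
  qed
  thus ?thesis using hc_mono[OF _ order_refl] by blast
qed

section \<open>Length modulo powers\<close>

lemma sadd_swap: 
  assumes "smod A" "smod B" "smod C" shows "sadd (sadd A B) C = sadd (sadd A C) B"
proof -
  have "sadd (sadd A B) C \<subseteq> sadd (sadd A C) B" if "smod A" "smod B" "smod C" for A B C
  proof
    fix u assume "u \<in> sadd (sadd A B) C"
    then obtain x y z where u: "x \<in> A" "y \<in> B" "z \<in> C" "u = (x \<oplus> y) \<oplus> z" unfolding sadd_def by auto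
    have "u = (x \<oplus> z) \<oplus> y" using u that smod_carr by (simp add: a_ac)
    thus "u \<in> sadd (sadd A C) B" using u unfolding sadd_def by blast
  qed
  thus ?thesis using assms by blast
qed

text \<open>This is \<open>N\<close> plus the ideal of all \<open>x\<^sup>s\<close> with \<open>x\<close> in \<open>xs\<close>, built by recursion so that lengths can be
  estimated one generator at a time.\<close>
fun sgen :: "'a set \<Rightarrow> 'a list \<Rightarrow> nat \<Rightarrow> 'a set" where
  "sgen N [] s = N"
| "sgen N (x # xs) s = sgen (sadd N (scale (x [^] s) Z)) xs s"

lemma smod_sZ: "x \<in> Z \<Longrightarrow> smod (scale x Z)" using smod_scale smod_Z by auto

lemma sgen_smod: "smod N \<Longrightarrow> set xs \<subseteq> Z \<Longrightarrow> smod (sgen N xs s)"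
  by (induction xs arbitrary: N) (simp_all add: smod_sadd smod_sZ Z_pow)

lemma sgen_sub: "smod N \<Longrightarrow> set xs \<subseteq> Z \<Longrightarrow> N \<subseteq> sgen N xs s"
proof (induction xs arbitrary: N)
  case (Cons x xs)
  have "N \<subseteq> sadd N (scale (x [^] s) Z)" using Cons by (intro sadd_sup1 smod_sub smod_sZ) auto
  also have "\<dots> \<subseteq> sgen N (x # xs) s" using Cons.IH[of "sadd N (scale (x [^] s) Z)"] Cons.prems
    by (auto intro!: smod_sadd smod_sZ)
  finally show ?case .
qed auto

lemma sgen_least: "smod K \<Longrightarrow> N \<subseteq> K \<Longrightarrow> (\<And>x. x \<in> set xs \<Longrightarrow> x \<in> Z \<and> x [^] s \<in> K) \<Longrightarrow> sgen N xs s \<subseteq> K"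
proof (induction xs arbitrary: N)
  case (Cons x xs)
  have xZ: "x \<in> Z" using Cons.prems(3) by auto
  have "scale (x [^] s) Z \<subseteq> K"
  proof
    fix u assume "u \<in> scale (x [^] s) Z"
    then obtain z where z: "z \<in> Z" "u = x [^] s \<otimes> z" unfolding scale_def by auto
    hence "u = z \<otimes> x [^] s" using xZ m_comm by auto
    thus "u \<in> K" using smod_mult[OF Cons.prems(1) z(1)] Cons.prems(3) by auto
  qed
  thus ?case using Cons.IH[of "sadd N (scale (x [^] s) Z)"] Cons.prems sadd_least[OF Cons.prems(1,2)] by auto
qed auto

lemma sgen_add: "smod N \<Longrightarrow> smod B \<Longrightarrow> set xs \<subseteq> Z \<Longrightarrow> sgen (sadd N B) xs s = sadd (sgen N xs s) B"
proof (induction xs arbitrary: N)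
  case (Cons x xs)
  have s: "smod (scale (x [^] s) Z)" using Cons by (intro smod_sZ) auto
  show ?case using Cons s by (simp add: sadd_swap[of N B] smod_sadd)
qed auto

lemma len_eq_0: "smod M \<Longrightarrow> M \<subseteq> N \<Longrightarrow> len N M = 0"
proof -
  assume M: "smod M" "M \<subseteq> N"
  have "len N M \<le> 0"
  proof (rule len_leI)
    fix n assume "hc N M n"
    then obtain C where C: "schain N M C n" unfolding hc_def by auto
    have "n = 0"
    proof (rule ccontr)
      assume "n \<noteq> 0"
      hence "C 0 \<subset> C (Suc 0)" "C (Suc 0) \<subseteq> C n" "N \<subseteq> C 0" "C n \<subseteq> M"
        using C schain_mono[OF C, of "Suc 0" n] unfolding schain_def by auto
      thus False using M by blast
    qed
    thus "enat n \<le> 0" by (simp add: zero_enat_def)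
  qed
  thus ?thesis by simp
qed

text \<open>The quotient of \<open>P + (x\<^sup>s)\<close> by \<open>P + (x\<^sup>s\<^sup>+\<^sup>1)\<close> is a quotient of \<open>Z/(P + (x))\<close> under multiplication by
  \<open>x\<^sup>s\<close>, so each further power costs at most \<open>c\<close>.\<close>
lemma len_power1:
  assumes P: "smod P" "P \<subseteq> Z" and x: "x \<in> Z" and c: "len (sadd P (scale x Z)) Z \<le> enat c"
  shows "len (sadd P (scale (x [^] s) Z)) Z \<le> enat (s * c)"
proof (induction s)
  case 0
  have "Z \<subseteq> scale \<one> Z" unfolding scale_def by force
  hence "Z \<subseteq> sadd P (scale (x [^] (0::nat)) Z)" using sadd_sup2[OF smod_sub[OF smod_sZ[of \<one>]] P(1)] by auto
  thus ?case using len_eq_0[OF smod_Z] by simp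
next
  case (Suc s)
  have xs: "x [^] s \<in> Z" "x [^] Suc s \<in> Z" using x Z_pow by blast+
  let ?A = "sadd P (scale (x [^] Suc s) Z)" and ?B = "sadd P (scale (x [^] s) Z)" and ?Q = "sadd P (scale x Z)"
  have sA: "smod ?A" and sB: "smod ?B" and sQ: "smod ?Q" using P x xs by (auto intro!: smod_sadd smod_sZ simp del: nat_pow_Suc)
  have subZ: "scale y Z \<subseteq> Z" if "y \<in> Z" for y using scale_sub[OF smod_Z that] .
  have BZ: "?B \<subseteq> Z" using sadd_least[OF smod_Z P(2) subZ[OF xs(1)]] .
  have QZ: "?Q \<subseteq> Z" using sadd_least[OF smod_Z P(2) subZ[OF x]] .
  have "scale (x [^] Suc s) Z \<subseteq> scale (x [^] s) Z"
  proof
    fix u assume "u \<in> scale (x [^] Suc s) Z"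
    then obtain z where z: "z \<in> Z" "u = x [^] Suc s \<otimes> z" unfolding scale_def by auto
    hence "u = x [^] s \<otimes> (x \<otimes> z)" using x xs by (simp add: m_assoc)
    thus "u \<in> scale (x [^] s) Z" unfolding scale_def using x z by blast
  qed
  hence AB: "?A \<subseteq> ?B" using sadd_mono by blast
  have eq: "?B \<subseteq> sadd ?A (scale (x [^] s) Z)"
    by (rule sadd_mono[OF sadd_sup1 order_refl]) (use P xs in \<open>auto intro: smod_sub smod_sZ simp del: nat_pow_Suc\<close>)
  have "len ?A ?B \<le> len ?A (sadd ?A (scale (x [^] s) Z))" by (rule len_mono[OF order_refl eq])
  also have "\<dots> \<le> len ?Q Z"
  proof (rule len_mult[OF sA smod_Z])
    show "x [^] s \<in> carrier S" using xs by auto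
    show "?Q \<subseteq> Z" by (rule QZ)
    fix b assume "b \<in> ?Q"
    then obtain p z where pz: "p \<in> P" "z \<in> Z" "b = p \<oplus> x \<otimes> z" unfolding sadd_def scale_def by auto
    have pZ: "p \<in> carrier S" using pz P by auto
    have "x [^] s \<otimes> b = x [^] s \<otimes> p \<oplus> x [^] Suc s \<otimes> z"
      using pz(2,3) pZ xs(1) x by (simp add: r_distr m_assoc)
    thus "x [^] s \<otimes> b \<in> ?A" using saddI[of "x [^] s \<otimes> p" P "x [^] Suc s \<otimes> z"] pz smod_mult[OF P(1) xs(1)]
      unfolding scale_def by auto
  qed
  finally have 1: "len ?A ?B \<le> enat c" using c by auto
  have "len ?A Z \<le> len ?A ?B + len ?B Z" by (rule len_sub[OF sA sB smod_Z AB BZ])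
  also have "\<dots> \<le> enat c + enat (s * c)" using 1 Suc.IH by (rule add_mono)
  finally show ?case by simp
qed

text \<open>The polynomial upper bound of degree \<open>length xs\<close> behind the dimension inequality; it replaces the
  Hilbert-Samuel polynomial.\<close>
lemma len_powers:
  assumes "smod N" "N \<subseteq> Z" "set xs \<subseteq> Z" "len (sgen N xs 1) Z \<le> enat c"
  shows "len (sgen N xs s) Z \<le> enat (s ^ length xs * c)"
  using assms
proof (induction xs arbitrary: N c)
  case (Cons x xs)
  have x: "x \<in> Z" "x [^] s \<in> Z" using Cons.prems by auto
  have sx: "smod (scale x Z)" "smod (scale (x [^] s) Z)" using x smod_sZ by auto
  have g: "smod (sgen N xs 1)" using sgen_smod Cons.prems by auto
  have gZ: "sgen N xs 1 \<subseteq> Z" by (rule sgen_least) (use Cons.prems smod_Z in auto)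
  have "sgen N (x # xs) 1 = sadd (sgen N xs 1) (scale x Z)"
    using sgen_add[of N "scale x Z" xs 1] Cons.prems sx x by simp
  hence "len (sadd (sgen N xs 1) (scale x Z)) Z \<le> enat c" using Cons.prems by simp
  hence "len (sadd (sgen N xs 1) (scale (x [^] s) Z)) Z \<le> enat (s * c)"
    by (rule len_power1[OF g gZ x(1)])
  hence "len (sgen (sadd N (scale (x [^] s) Z)) xs 1) Z \<le> enat (s * c)"
    using sgen_add[of N "scale (x [^] s) Z" xs 1] Cons.prems sx x by simp
  hence "len (sgen (sadd N (scale (x [^] s) Z)) xs s) Z \<le> enat (s ^ length xs * (s * c))"
    using Cons.IH[of "sadd N (scale (x [^] s) Z)" "s * c"] Cons.prems smod_sadd sx sadd_least[OF smod_Z, of N]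
      scale_sub[OF smod_Z x(2)] by auto
  thus ?case by (simp add: mult.assoc mult.left_commute)
qed auto

definition zprime :: "'a set \<Rightarrow> bool" where
  "zprime P \<longleftrightarrow> smod P \<and> P \<subseteq> Z \<and> \<one> \<notin> P \<and> (\<forall>a\<in>Z. \<forall>b\<in>Z. a \<otimes> b \<in> P \<longrightarrow> a \<in> P \<or> b \<in> P)"

definition zcolon :: "'a set \<Rightarrow> 'a \<Rightarrow> 'a set" where
  "zcolon N x = {z \<in> Z. x \<otimes> z \<in> N}"

lemma smod_zcolon: "smod N \<Longrightarrow> x \<in> carrier S \<Longrightarrow> smod (zcolon N x)"
proof (rule smodI)
  assume N: "smod N" and x: "x \<in> carrier S"
  show "zcolon N x \<subseteq> carrier S" unfolding zcolon_def by auto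
  show "\<zero> \<in> zcolon N x" unfolding zcolon_def using x smod_0[OF N] by auto
  show "a \<oplus> b \<in> zcolon N x" if "a \<in> zcolon N x" "b \<in> zcolon N x" for a b
    using that x smod_add[OF N] unfolding zcolon_def by (auto simp: r_distr)
  show "a \<otimes> b \<in> zcolon N x" if "a \<in> Z" "b \<in> zcolon N x" for a b
    using that x smod_mult[OF N] unfolding zcolon_def by (auto simp: m_lcomm[of x a b])
qed

text \<open>Both ideals on the right are strictly larger than \<open>N\<close> when \<open>N\<close> is not prime and \<open>x\<close> is suitably
  chosen, which drives the inductions over ideals of possibly infinite colength.\<close>
lemma len_colon:
  assumes N: "smod N" "N \<subseteq> Z" and x: "x \<in> Z"
  shows "len N Z \<le> len (zcolon N x) Z + len (sadd N (scale x Z)) Z"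
proof -
  have s: "smod (sadd N (scale x Z))" using N x smod_sadd smod_sZ by auto
  have "len N Z \<le> len N (sadd N (scale x Z)) + len (sadd N (scale x Z)) Z"
    by (rule len_sub) (use N s smod_Z x sadd_sup1 smod_sub smod_sZ sadd_least[OF smod_Z] scale_sub[OF smod_Z x] in auto)
  also have "len N (sadd N (scale x Z)) \<le> len (zcolon N x) Z"
    by (rule len_mult) (use N smod_Z x in \<open>auto simp: zcolon_def\<close>)
  finally show ?thesis by (simp add: add_right_mono)
qed

end

section \<open>Local rings of constants\<close>

text \<open>Noetherian local rings as rings of constants; an ideal of \<open>Z\<close> is a submodule of the ambient ring
  inside \<open>Z\<close>.\<close>
locale local_base = const_ring +
  fixes m :: "'a set"
  assumes m: "smod m" "m \<subseteq> Z" "\<one> \<notin> m"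
    and units: "\<And>z. z \<in> Z \<Longrightarrow> z \<notin> m \<Longrightarrow> \<exists>w\<in>Z. z \<otimes> w = \<one>"
    and acc_Z: "\<And>L::nat \<Rightarrow> 'a set. (\<And>i. smod (L i)) \<Longrightarrow> (\<And>i. L i \<subseteq> Z) \<Longrightarrow> (\<And>i. L i \<subseteq> L (Suc i)) \<Longrightarrow> \<exists>k. \<forall>i\<ge>k. L i = L k"
begin

lemma max_smod:
  assumes "smod N0" "N0 \<subseteq> Z" "Q N0"
  shows "\<exists>N. smod N \<and> N \<subseteq> Z \<and> Q N \<and> (\<forall>N'. smod N' \<longrightarrow> N' \<subseteq> Z \<longrightarrow> N \<subset> N' \<longrightarrow> \<not> Q N')"
proof -
  have "\<exists>N. (smod N \<and> N \<subseteq> Z \<and> Q N) \<and> (\<forall>N'. (smod N' \<and> N' \<subseteq> Z \<and> Q N') \<longrightarrow> \<not> N \<subset> N')"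
  proof (rule exists_maximal_no_chain[where R = "(\<subset>)"])
    show "smod N0 \<and> N0 \<subseteq> Z \<and> Q N0" using assms by auto
    fix f :: "nat \<Rightarrow> 'a set" assume f: "\<And>i. smod (f i) \<and> f i \<subseteq> Z \<and> Q (f i)" "\<And>i. f i \<subset> f (Suc i)"
    obtain k where k: "\<forall>i\<ge>k. f i = f k" using acc_Z[of f] f by blast
    have "f (Suc k) = f k" using k[rule_format, of "Suc k"] by linarith
    thus False using f(2)[of k] by auto
  qed
  thus ?thesis by blast
qed

lemma smod_unit: assumes "smod N" "z \<in> Z" "z \<notin> m" "x \<in> carrier S" "z \<otimes> x \<in> N" shows "x \<in> N"
proof -
  obtain w where w: "w \<in> Z" "z \<otimes> w = \<one>" using units assms by blast
  have "w \<otimes> (z \<otimes> x) \<in> N" using smod_mult assms w by auto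
  moreover have "w \<otimes> (z \<otimes> x) = (z \<otimes> w) \<otimes> x" using Z_carr[OF w(1)] Z_carr[OF assms(2)] assms(4) by algebra
  ultimately show ?thesis unfolding w(2) using assms by simp
qed

lemma one_minus_m: "x \<in> m \<Longrightarrow> \<one> \<ominus> x \<in> Z \<and> \<one> \<ominus> x \<notin> m"
proof
  assume x: "x \<in> m"
  hence xZ: "x \<in> Z" using m by auto
  thus "\<one> \<ominus> x \<in> Z" unfolding a_minus_def by auto
  show "\<one> \<ominus> x \<notin> m"
  proof
    assume "\<one> \<ominus> x \<in> m"
    hence "(\<one> \<ominus> x) \<oplus> x \<in> m" using smod_add[OF m(1)] x by auto
    moreover have "(\<one> \<ominus> x) \<oplus> x = \<one>" using xZ Z_carr[OF xZ] by algebra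
    ultimately show False using m by simp
  qed
qed

lemma len_m: "len m Z \<le> 1"
proof (rule len_leI)
  fix n assume "hc m Z n"
  then obtain C where C: "schain m Z C n" unfolding hc_def by auto
  have "\<not> n \<ge> 2"
  proof
    assume n: "n \<ge> 2"
    have c: "C 0 \<subset> C 1" "C 1 \<subset> C 2" "smod (C 1)" "C 2 \<subseteq> Z" "m \<subseteq> C 0"
      using C n schain_mono[OF C, of 2 n] unfolding schain_def by (auto simp: numeral_2_eq_2)
    obtain u where u: "u \<in> C 1" "u \<notin> C 0" using c by auto
    have "u \<in> Z" "u \<notin> m" using u c by auto
    then have "\<one> \<in> C 1" using smod_unit[OF c(3), of u \<one>] u by auto
    hence "Z \<subseteq> C 1" using smod_mult[OF c(3), of _ \<one>] by force
    thus False using c by auto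
  qed
  thus "enat n \<le> 1" by (simp add: one_enat_def)
qed

lemma zprime_m: "zprime m"
  unfolding zprime_def
proof (intro conjI ballI impI)
  fix a b assume ab: "a \<in> Z" "b \<in> Z" "a \<otimes> b \<in> m"
  show "a \<in> m \<or> b \<in> m" using smod_unit[OF m(1) ab(1), of b] ab by auto
qed (use m in auto)

lemma proper_sub_m: "smod N \<Longrightarrow> N \<subseteq> Z \<Longrightarrow> \<one> \<notin> N \<Longrightarrow> N \<subseteq> m"
proof
  fix z assume "smod N" "N \<subseteq> Z" "\<one> \<notin> N" "z \<in> N"
  thus "z \<in> m" using smod_unit[of N z \<one>] by force
qed

text \<open>An ideal maximal among those of infinite colength above \<open>q\<close> is prime: otherwise its colength
  is bounded by those of a proper colon ideal and a proper enlargement. But the only prime above \<open>q\<close> is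
  \<open>m\<close>, which has colength one.\<close>
lemma finite_len:
  assumes q: "smod q" "q \<subseteq> Z" and pr: "\<And>P. zprime P \<Longrightarrow> q \<subseteq> P \<Longrightarrow> P = m"
  shows "\<exists>c::nat. len q Z \<le> enat c"
proof (rule ccontr)
  let ?Q = "\<lambda>N. q \<subseteq> N \<and> \<not> (\<exists>c::nat. len N Z \<le> enat c)"
  assume "\<not> ?thesis"
  then obtain N where N: "smod N" "N \<subseteq> Z" "?Q N" "\<forall>N'. smod N' \<longrightarrow> N' \<subseteq> Z \<longrightarrow> N \<subset> N' \<longrightarrow> \<not> ?Q N'"
    using max_smod[OF q, of ?Q] by blast
  have 1: "\<one> \<notin> N"
  proof
    assume "\<one> \<in> N"
    hence "Z \<subseteq> N" using smod_mult[OF N(1), of _ \<one>] by force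
    hence "len N Z \<le> enat 0" using len_eq_0[OF smod_Z] by (simp add: zero_enat_def)
    thus False using N by blast
  qed
  show False
  proof (cases "zprime N")
    case True
    hence "len N Z \<le> enat 1" using pr[of N] N len_m by (auto simp: one_enat_def)
    thus False using N by blast
  next
    case False
    then obtain a b where ab: "a \<in> Z" "b \<in> Z" "a \<otimes> b \<in> N" "a \<notin> N" "b \<notin> N"
      using N 1 unfolding zprime_def by auto
    have s: "smod (zcolon N a)" "smod (sadd N (scale a Z))" using smod_zcolon N ab smod_sadd smod_sZ by auto
    have "N \<subseteq> zcolon N a" unfolding zcolon_def using N smod_mult[OF N(1)] ab by auto
    moreover have "b \<in> zcolon N a" using ab unfolding zcolon_def by auto
    ultimately have c: "N \<subset> zcolon N a" "zcolon N a \<subseteq> Z" using ab unfolding zcolon_def by auto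
    have "N \<subseteq> sadd N (scale a Z)" using sadd_sup1 smod_sub N smod_sZ ab by auto
    moreover have "a \<otimes> \<one> \<in> scale a Z" unfolding scale_def by blast
    hence "a \<in> sadd N (scale a Z)" using sadd_sup2[OF smod_sub[OF smod_sZ[OF ab(1)]] N(1)] ab by auto
    ultimately have d: "N \<subset> sadd N (scale a Z)" using ab by auto
    have e: "sadd N (scale a Z) \<subseteq> Z" using sadd_least[OF smod_Z N(2) scale_sub[OF smod_Z ab(1)]] .
    obtain c1 where c1: "len (zcolon N a) Z \<le> enat c1" using N(4) s c N(3) by blast
    obtain c2 where c2: "len (sadd N (scale a Z)) Z \<le> enat c2" using N(4) s d e N(3) by blast
    have "len N Z \<le> enat c1 + enat c2" using len_colon[OF N(1,2) ab(1)] add_mono[OF c1 c2] by (rule order_trans)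
    thus False using N(3) by (metis plus_enat_simps(1))
  qed
qed

text \<open>If no power of \<open>g\<close> is in \<open>q\<close>, the ideals \<open>q + (g\<^sup>j)\<close> descend strictly forever, because
  \<open>1 - z g\<close> is a unit.\<close>
lemma power_in_finite_len:
  assumes q: "smod q" "q \<subseteq> Z" and c: "len q Z \<le> enat c" and g: "g \<in> m"
  shows "\<exists>n::nat. g [^] n \<in> q"
proof (rule ccontr)
  assume "\<not> ?thesis"
  hence no: "\<And>n::nat. g [^] n \<notin> q" by blast
  have gZ: "g \<in> Z" using g m by auto
  let ?V = "\<lambda>j::nat. sadd q (scale (g [^] j) Z)"
  have gp: "g [^] j \<in> Z" for j :: nat using gZ by auto
  have sV: "smod (?V j)" for j using q smod_sadd smod_sZ gp by auto
  have "hc (?V (Suc j)) (?V j) 1" for j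
  proof -
    have "g [^] j \<otimes> \<one> \<in> scale (g [^] j) Z" unfolding scale_def by blast
    hence inj: "g [^] j \<in> ?V j" using sadd_sup2[OF smod_sub[OF smod_sZ[OF gp]] q(1)] gp by auto
    have nin: "g [^] j \<notin> ?V (Suc j)"
    proof
      assume "g [^] j \<in> ?V (Suc j)"
      then obtain p z where pz: "p \<in> q" "z \<in> Z" "g [^] j = p \<oplus> g [^] (Suc j) \<otimes> z"
        unfolding sadd_def scale_def by auto
      have pX: "p \<in> carrier S" using pz q by auto
      have gX: "g \<in> carrier S" "g [^] j \<in> carrier S" "z \<in> carrier S" using gZ gp pz by auto
      have gz: "z \<otimes> g \<in> m" using smod_mult[OF m(1) pz(2) g] .
      have "(\<one> \<ominus> z \<otimes> g) \<otimes> g [^] j = g [^] j \<ominus> (g [^] j \<otimes> g) \<otimes> z" using gX by algebra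
      also have "\<dots> = p"
      proof -
        have e: "g [^] j = p \<oplus> (g [^] j \<otimes> g) \<otimes> z" using pz(3) unfolding nat_pow_Suc .
        have "p = (p \<oplus> (g [^] j \<otimes> g) \<otimes> z) \<ominus> (g [^] j \<otimes> g) \<otimes> z" using gX pX by algebra
        thus ?thesis by (simp only: e[symmetric])
      qed
      finally have "(\<one> \<ominus> z \<otimes> g) \<otimes> g [^] j \<in> q" using pz(1) by simp
      hence "g [^] j \<in> q" using smod_unit[OF q(1)] one_minus_m[OF gz] gX by blast
      thus False using no by blast
    qed
    have "scale (g [^] Suc j) Z \<subseteq> scale (g [^] j) Z"
    proof
      fix u assume "u \<in> scale (g [^] Suc j) Z"
      then obtain z where z: "z \<in> Z" "u = g [^] Suc j \<otimes> z" unfolding scale_def by auto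
      hence "u = g [^] j \<otimes> (g \<otimes> z)" using gZ gp by (simp add: m_assoc)
      thus "u \<in> scale (g [^] j) Z" unfolding scale_def using gZ z by blast
    qed
    hence "?V (Suc j) \<subseteq> ?V j" using sadd_mono by blast
    hence "?V (Suc j) \<subset> ?V j" using inj nin by blast
    from hc_Suc[OF hc_0[OF sV[of "Suc j"] order_refl order_refl] sV this]
    show ?thesis by simp
  qed
  hence "hc (?V (Suc c)) (?V 0) (Suc c * 1)" by (rule hc_iterate) (rule sV)
  moreover have "q \<subseteq> ?V (Suc c)" by (rule sadd_sup1[OF smod_sub[OF q(1)] smod_sZ[OF gp]])
  moreover have "?V 0 \<subseteq> Z" using sadd_least[OF smod_Z q(2) scale_sub[OF smod_Z gp]] .
  ultimately have "hc q Z (Suc c * 1)" using hc_mono by blast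
  hence "enat (Suc c) \<le> enat c" using order_trans[OF len_ge c] by simp
  thus False by simp
qed

text \<open>Nakayama's lemma for a subset \<open>M\<close> of the ring with \<open>M \<subseteq> N + xM\<close>: unwinding
  \<open>u = n + x v\<close> repeatedly gives a sequence in \<open>M\<close> whose spans over \<open>N\<close> ascend and therefore stabilise.\<close>
lemma nakayama:
  assumes N: "smod N" "N \<subseteq> Z" and M: "M \<subseteq> Z" and x: "x \<in> m"
    and h: "\<And>u. u \<in> M \<Longrightarrow> \<exists>n\<in>N. \<exists>v\<in>M. u = n \<oplus> x \<otimes> v" and z: "z \<in> M"
  shows "z \<in> N"
proof -
  obtain g f where gf: "\<And>u. u \<in> M \<Longrightarrow> f u \<in> N \<and> g u \<in> M \<and> u = f u \<oplus> x \<otimes> g u" using h by metis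
  define y where "y k = (g ^^ k) z" for k
  have y: "y k \<in> M" for k by (induction k) (auto simp: y_def z gf)
  hence yZ: "y k \<in> Z" for k using M by auto
  have xZ: "x \<in> Z" using x m by auto
  have yS: "y k = f (y k) \<oplus> x \<otimes> y (Suc k)" for k using gf[OF y[of k]] by (simp add: y_def)
  have fN: "f (y k) \<in> N" for k using gf y by blast
  let ?L = "\<lambda>k. sadd N (scale (y k) Z)"
  have sL: "smod (?L k)" for k using N smod_sadd smod_sZ yZ by auto
  have LZ: "?L k \<subseteq> Z" for k using sadd_least[OF smod_Z N(2) scale_sub[OF smod_Z yZ]] .
  have NL: "N \<subseteq> ?L k" for k by (rule sadd_sup1[OF smod_sub[OF N(1)] smod_sZ[OF yZ]])
  have "y k \<otimes> \<one> \<in> scale (y k) Z" for k unfolding scale_def by blast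
  hence yL: "y k \<in> ?L k" for k using sadd_sup2[OF smod_sub[OF smod_sZ[OF yZ]] N(1)] yZ by auto
  have LS: "?L k \<subseteq> ?L (Suc k)" for k
  proof (rule sadd_least[OF sL NL])
    have "x \<otimes> y (Suc k) \<in> ?L (Suc k)" using smod_mult[OF sL xZ yL] .
    hence "f (y k) \<oplus> x \<otimes> y (Suc k) \<in> ?L (Suc k)" using smod_add[OF sL] fN[of k] NL[of "Suc k"] by blast
    hence yk: "y k \<in> ?L (Suc k)" unfolding yS[of k, symmetric] .
    show "scale (y k) Z \<subseteq> ?L (Suc k)"
    proof
      fix u assume "u \<in> scale (y k) Z"
      then obtain w where w: "w \<in> Z" "u = w \<otimes> y k" unfolding scale_def using m_comm yZ by auto
      thus "u \<in> ?L (Suc k)" using smod_mult[OF sL w(1) yk] by simp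
    qed
  qed
  obtain k where k: "\<forall>i\<ge>k. ?L i = ?L k" using acc_Z[of ?L, OF sL LZ LS] by blast
  have "?L (Suc k) = ?L k" using k[rule_format, of "Suc k"] by linarith
  hence "y (Suc k) \<in> ?L k" using yL[of "Suc k"] by blast
  then obtain n r where nr: "n \<in> N" "r \<in> Z" "y (Suc k) = n \<oplus> y k \<otimes> r" unfolding sadd_def scale_def by auto
  have c: "n \<in> carrier S" "r \<in> carrier S" "f (y k) \<in> carrier S" "x \<in> carrier S" "y k \<in> carrier S" "y (Suc k) \<in> carrier S"
    using nr N fN xZ yZ by auto
  have rx: "r \<otimes> x \<in> m" using smod_mult[OF m(1) nr(2) x] .
  have "y (Suc k) = n \<oplus> (f (y k) \<oplus> x \<otimes> y (Suc k)) \<otimes> r" using nr(3) yS[of k] by metis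
  hence "(\<one> \<ominus> r \<otimes> x) \<otimes> y (Suc k) = (n \<oplus> (f (y k) \<oplus> x \<otimes> y (Suc k)) \<otimes> r) \<ominus> r \<otimes> x \<otimes> y (Suc k)"
  proof -
    assume e: "y (Suc k) = n \<oplus> (f (y k) \<oplus> x \<otimes> y (Suc k)) \<otimes> r"
    have "(\<one> \<ominus> r \<otimes> x) \<otimes> y (Suc k) = y (Suc k) \<ominus> r \<otimes> x \<otimes> y (Suc k)" using c by algebra
    thus ?thesis using e by metis
  qed
  also have "\<dots> = n \<oplus> r \<otimes> f (y k)" using c by algebra
  also have "\<dots> \<in> N" using smod_add[OF N(1) nr(1) smod_mult[OF N(1) nr(2) fN]] .
  \<comment> \<open>At the stable stage \<open>y (Suc k)\<close> is a multiple of \<open>y k\<close> modulo \<open>N\<close>, and \<open>y k\<close> is \<open>x\<close> times \<open>y (Suc k)\<close> modulo \<open>N\<close>; \<open>1 - r x\<close> is a unit.\<close>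
  finally have yk: "y (Suc k) \<in> N" using smod_unit[OF N(1)] one_minus_m[OF rx] c by blast
  have "j \<le> Suc k \<Longrightarrow> y (Suc k - j) \<in> N" for j
  proof (induction j)
    case (Suc j)
    have e: "Suc (Suc k - Suc j) = Suc k - j" using Suc.prems by simp
    have "f (y (Suc k - Suc j)) \<oplus> x \<otimes> y (Suc k - j) \<in> N"
      using smod_add[OF N(1) fN smod_mult[OF N(1) xZ]] Suc by simp
    thus ?case using yS[of "Suc k - Suc j"] e by metis
  qed (use yk in auto)
  from this[of "Suc k"] show ?thesis by (simp add: y_def)
qed

end

section \<open>Graded subrings and the Hilbert basis theorem\<close>

text \<open>The diagonal stabilises at some \<open>d\<close>, which settles all entries with both indices at least \<open>d\<close>; the
  finitely many columns \<open>j < d\<close> stabilise separately.\<close>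
lemma double_chain_stabilizes:
  fixes F :: "nat \<Rightarrow> nat \<Rightarrow> 'b::order"
  assumes st: "\<And>f::nat \<Rightarrow> 'b. (\<And>i. P (f i)) \<Longrightarrow> (\<And>i. f i \<le> f (Suc i)) \<Longrightarrow> \<exists>k. \<forall>i\<ge>k. f i = f k"
    and P: "\<And>i j. P (F i j)" and 1: "\<And>i j. F i j \<le> F (Suc i) j" and 2: "\<And>i j. F i j \<le> F i (Suc j)"
  shows "\<exists>k. \<forall>i\<ge>k. \<forall>j. F i j = F k j"
proof -
  have m1: "i \<le> i' \<Longrightarrow> F i j \<le> F i' j" for i i' j using lift_Suc_mono_le[of "\<lambda>i. F i j"] 1 by blast
  have m2: "j \<le> j' \<Longrightarrow> F i j \<le> F i j'" for i j j' using lift_Suc_mono_le[of "F i"] 2 by blast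
  obtain d where d: "\<And>i. i \<ge> d \<Longrightarrow> F i i = F d d"
    using st[of "\<lambda>i. F i i"] P m1 m2 by (metis le_SucI order_refl order_trans)
  have "\<exists>k. \<forall>i\<ge>k. F i j = F k j" for j using st[of "\<lambda>i. F i j"] P 1 by blast
  then obtain k where k: "\<And>i j. i \<ge> k j \<Longrightarrow> F i j = F (k j) j" by metis
  define K where "K = Max (insert d (k ` {..<d}))"
  have Kd: "d \<le> K" unfolding K_def by (intro Max_ge) auto
  have Kk: "j < d \<Longrightarrow> k j \<le> K" for j unfolding K_def by (intro Max_ge) auto
  have diag: "F i j = F d d" if "i \<ge> d" "j \<ge> d" for i j
  proof (rule antisym)
    have "F i j \<le> F (max i j) (max i j)" using m1[of i "max i j" j] m2[of j "max i j" "max i j"] by (meson max.cobounded1 max.cobounded2 order_trans)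
    thus "F i j \<le> F d d" using d[of "max i j"] that by simp
    show "F d d \<le> F i j" using m1[of d i d] m2[of d j i] that by (meson order_trans)
  qed
  have "F i j = F K j" if "i \<ge> K" for i j
  proof (cases "j < d")
    case True
    have "F i j = F (k j) j" "F K j = F (k j) j" using Kk[OF True] that by (auto intro!: k)
    thus ?thesis by simp
  next
    case False
    hence "F i j = F d d" "F K j = F d d" using diag[of i j] diag[of K j] that Kd by auto
    thus ?thesis by simp
  qed
  thus ?thesis by blast
qed

context const_ring
begin

text \<open>A graded ring is kept as its sequence of homogeneous components in \<open>S\<close>, that is, \<open>A\<close> stands for
  the sum of all \<open>A\<^sub>n t\<^sup>n\<close>. The components need not be disjoint, as for Rees rings, where they form a
  descending filtration.\<close>
definition gring :: "(nat \<Rightarrow> 'a set) \<Rightarrow> bool" where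
  "gring A \<longleftrightarrow> (\<forall>n. A n \<subseteq> carrier S \<and> \<zero> \<in> A n \<and> (\<forall>a\<in>A n. \<forall>b\<in>A n. a \<oplus> b \<in> A n)) \<and> Z \<subseteq> A 0 \<and>
     (\<forall>i j. \<forall>a\<in>A i. \<forall>b\<in>A j. a \<otimes> b \<in> A (i + j))"

definition gideal :: "(nat \<Rightarrow> 'a set) \<Rightarrow> (nat \<Rightarrow> 'a set) \<Rightarrow> bool" where
  "gideal A L \<longleftrightarrow> (\<forall>n. L n \<subseteq> A n \<and> \<zero> \<in> L n \<and> (\<forall>a\<in>L n. \<forall>b\<in>L n. a \<oplus> b \<in> L n)) \<and>
     (\<forall>i j. \<forall>a\<in>A i. \<forall>b\<in>L j. a \<otimes> b \<in> L (i + j))"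

text \<open>Chains are compared as functions of the degree, so that one index serves all degrees.\<close>
definition gacc :: "(nat \<Rightarrow> 'a set) \<Rightarrow> bool" where
  "gacc A \<longleftrightarrow> (\<forall>L :: nat \<Rightarrow> nat \<Rightarrow> 'a set. (\<forall>i. gideal A (L i)) \<longrightarrow> (\<forall>i. L i \<le> L (Suc i)) \<longrightarrow> (\<exists>k. \<forall>i\<ge>k. L i = L k))"

lemma gringI:
  assumes "\<And>n. A n \<subseteq> carrier S" "\<And>n. \<zero> \<in> A n" "\<And>n a b. a \<in> A n \<Longrightarrow> b \<in> A n \<Longrightarrow> a \<oplus> b \<in> A n"
    "Z \<subseteq> A 0" "\<And>i j a b. a \<in> A i \<Longrightarrow> b \<in> A j \<Longrightarrow> a \<otimes> b \<in> A (i + j)"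
  shows "gring A"
  using assms unfolding gring_def by auto

lemma gringD:
  assumes "gring A"
  shows "A n \<subseteq> carrier S" "\<zero> \<in> A n" "a \<in> A n \<Longrightarrow> b \<in> A n \<Longrightarrow> a \<oplus> b \<in> A n" "z \<in> Z \<Longrightarrow> z \<in> A 0"
    "a \<in> A i \<Longrightarrow> b \<in> A j \<Longrightarrow> a \<otimes> b \<in> A (i + j)" "a \<in> A n \<Longrightarrow> a \<in> carrier S"
  using assms unfolding gring_def by auto

lemma gidealI:
  assumes "\<And>n. L n \<subseteq> A n" "\<And>n. \<zero> \<in> L n" "\<And>n a b. a \<in> L n \<Longrightarrow> b \<in> L n \<Longrightarrow> a \<oplus> b \<in> L n"
    "\<And>i j a b. a \<in> A i \<Longrightarrow> b \<in> L j \<Longrightarrow> a \<otimes> b \<in> L (i + j)"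
  shows "gideal A L"
  using assms unfolding gideal_def by auto

lemma gidealD:
  assumes "gideal A L"
  shows "L n \<subseteq> A n" "\<zero> \<in> L n" "a \<in> L n \<Longrightarrow> b \<in> L n \<Longrightarrow> a \<oplus> b \<in> L n"
    "a \<in> A i \<Longrightarrow> b \<in> L j \<Longrightarrow> a \<otimes> b \<in> L (i + j)"
  using assms unfolding gideal_def by auto

lemma gring_smod: assumes A: "gring A" shows "smod (A n)"
proof (rule smodI)
  show "z \<otimes> a \<in> A n" if "z \<in> Z" "a \<in> A n" for z a using gringD(5)[OF A gringD(4)[OF A that(1)] that(2)] by simp
qed (use gringD(1-3)[OF A] in auto)

lemma gideal_smod: assumes A: "gring A" and L: "gideal A L" shows "smod (L n)"
proof (rule smodI)
  show "L n \<subseteq> carrier S" using gringD(1)[OF A] gidealD(1)[OF L] by blast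
  show "z \<otimes> a \<in> L n" if "z \<in> Z" "a \<in> L n" for z a using gidealD(4)[OF L gringD(4)[OF A that(1)] that(2)] by simp
qed (use gidealD(2,3)[OF L] in auto)

text \<open>The graded \<open>Z\<close>-algebra generated by elements with prescribed degrees; \<open>(g, e)\<close> contributes \<open>g t\<^sup>e\<close>.\<close>
inductive galg :: "('a \<times> nat) set \<Rightarrow> nat \<Rightarrow> 'a \<Rightarrow> bool" for G where
  gzero: "galg G n \<zero>"
| gconst: "z \<in> Z \<Longrightarrow> galg G 0 z"
| ggen: "(g, e) \<in> G \<Longrightarrow> galg G e g"
| gadd: "galg G n a \<Longrightarrow> galg G n b \<Longrightarrow> galg G n (a \<oplus> b)"
| gmult: "galg G i a \<Longrightarrow> galg G j b \<Longrightarrow> galg G (i + j) (a \<otimes> b)"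

definition gal :: "('a \<times> nat) set \<Rightarrow> nat \<Rightarrow> 'a set" where
  "gal G n = {a. galg G n a}"

lemma gal_least:
  assumes A: "gring A" and G: "\<And>g e. (g, e) \<in> G \<Longrightarrow> g \<in> A e"
  shows "gal G n \<subseteq> A n"
proof
  fix a assume "a \<in> gal G n"
  hence "galg G n a" by (simp add: gal_def)
  thus "a \<in> A n"
  proof induction
    case (gzero n) show ?case by (rule gringD(2)[OF A])
  next
    case (gconst z) thus ?case by (rule gringD(4)[OF A])
  next
    case (ggen g e) thus ?case by (rule G)
  next
    case (gadd n a b) thus ?case using gringD(3)[OF A] by blast
  next
    case (gmult i a j b) thus ?case using gringD(5)[OF A] by blast
  qed
qed

lemma gal_gring: assumes "G \<subseteq> carrier S \<times> UNIV" shows "gring (gal G)"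
proof (rule gringI)
  have "galg G n a \<Longrightarrow> a \<in> carrier S" for n a
    by (induction rule: galg.induct) (use assms in auto)
  thus "gal G n \<subseteq> carrier S" for n unfolding gal_def by auto
qed (auto simp: gal_def intro: galg.intros)

lemma gal_gen: "(g, e) \<in> G \<Longrightarrow> g \<in> gal G e"
  by (simp add: gal_def ggen)

text \<open>Elements of degree \<open>n\<close> in \<open>A[z t\<^sup>e]\<close> having a representation in which \<open>z\<close> occurs only with exponents
  below \<open>J\<close>.\<close>
fun adj :: "(nat \<Rightarrow> 'a set) \<Rightarrow> 'a \<Rightarrow> nat \<Rightarrow> nat \<Rightarrow> nat \<Rightarrow> 'a set" where
  "adj A z e n 0 = {\<zero>}"
| "adj A z e n (Suc J) = sadd (adj A z e n J) (if J * e \<le> n then scale (z [^] J) (A (n - J * e)) else {\<zero>})"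

context
  fixes A :: "nat \<Rightarrow> 'a set" and z :: 'a and e :: nat
  assumes A: "gring A" and z: "z \<in> carrier S"
begin

lemma adj_top_smod: "smod (if J * e \<le> n then scale (z [^] J) (A (n - J * e)) else {\<zero>})"
  using smod_scale[OF gring_smod[OF A]] z smod_zero by simp

lemma adj_smod: "smod (adj A z e n J)"
  by (induction J) (use smod_zero smod_sadd adj_top_smod in auto)

lemma adj_carr: "u \<in> adj A z e n J \<Longrightarrow> u \<in> carrier S"
  using smod_carr[OF adj_smod] .

lemma adj_Suc: "adj A z e n J \<subseteq> adj A z e n (Suc J)"
  using sadd_sup1[OF smod_sub[OF adj_smod] adj_top_smod] by auto

lemma adj_mono: "J \<le> J' \<Longrightarrow> adj A z e n J \<subseteq> adj A z e n J'"
  using lift_Suc_mono_le[of "adj A z e n"] adj_Suc by blast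

lemma adj_top: "a \<in> A n \<Longrightarrow> z [^] J \<otimes> a \<in> adj A z e (n + J * e) (Suc J)"
proof -
  assume a: "a \<in> A n"
  have "z [^] J \<otimes> a \<in> (if J * e \<le> n + J * e then scale (z [^] J) (A (n + J * e - J * e)) else {\<zero>})"
    using a unfolding scale_def by auto
  thus ?thesis using sadd_sup2[OF smod_sub[OF adj_top_smod] adj_smod] by fastforce
qed

lemma adj_cases:
  assumes "u \<in> adj A z e n (Suc J)"
  shows "u \<in> adj A z e n J \<or> (J * e \<le> n \<and> (\<exists>v\<in>adj A z e n J. \<exists>a\<in>A (n - J * e). u = v \<oplus> z [^] J \<otimes> a))"
  using assms adj_carr unfolding adj.simps sadd_def scale_def by (auto split: if_splits)

lemma adj_multA: "a \<in> A i \<Longrightarrow> u \<in> adj A z e n J \<Longrightarrow> a \<otimes> u \<in> adj A z e (i + n) J"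
proof (induction J arbitrary: u)
  case 0
  thus ?case using gringD(6)[OF A] by auto
next
  case (Suc J)
  have aS: "a \<in> carrier S" using Suc gringD(6)[OF A] by auto
  from adj_cases[OF Suc.prems(2)] show ?case
  proof
    assume "u \<in> adj A z e n J"
    thus ?thesis using Suc.IH[OF Suc.prems(1)] adj_Suc by blast
  next
    assume "J * e \<le> n \<and> (\<exists>v\<in>adj A z e n J. \<exists>a\<in>A (n - J * e). u = v \<oplus> z [^] J \<otimes> a)"
    then obtain v b where vb: "J * e \<le> n" "v \<in> adj A z e n J" "b \<in> A (n - J * e)" "u = v \<oplus> z [^] J \<otimes> b" by blast
    have c: "v \<in> carrier S" "b \<in> carrier S" "z [^] J \<in> carrier S" using vb adj_carr gringD(6)[OF A] z by auto
    have eq: "a \<otimes> u = a \<otimes> v \<oplus> z [^] J \<otimes> (a \<otimes> b)" unfolding vb(4) using c aS by algebra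
    have "a \<otimes> b \<in> A (i + (n - J * e))" using gringD(5)[OF A Suc.prems(1) vb(3)] .
    from adj_top[OF this, of J] have "z [^] J \<otimes> (a \<otimes> b) \<in> adj A z e (i + n) (Suc J)" using vb(1) by simp
    moreover have "a \<otimes> v \<in> adj A z e (i + n) (Suc J)" using Suc.IH[OF Suc.prems(1) vb(2)] adj_Suc by blast
    ultimately show ?thesis unfolding eq using smod_add[OF adj_smod] by blast
  qed
qed

lemma adj_multz: "u \<in> adj A z e n J \<Longrightarrow> z \<otimes> u \<in> adj A z e (n + e) (Suc J)"
proof (induction J arbitrary: u)
  case 0
  thus ?case using z smod_0[OF adj_smod, of "n + e" "Suc 0"] by auto
next
  case (Suc J)
  from adj_cases[OF Suc.prems] show ?case
  proof
    assume "u \<in> adj A z e n J"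
    thus ?thesis using Suc.IH adj_Suc by blast
  next
    assume "J * e \<le> n \<and> (\<exists>v\<in>adj A z e n J. \<exists>a\<in>A (n - J * e). u = v \<oplus> z [^] J \<otimes> a)"
    then obtain v b where vb: "J * e \<le> n" "v \<in> adj A z e n J" "b \<in> A (n - J * e)" "u = v \<oplus> z [^] J \<otimes> b" by blast
    have c: "v \<in> carrier S" "b \<in> carrier S" "z [^] J \<in> carrier S" using vb adj_carr gringD(6)[OF A] z by auto
    have "z \<otimes> u = z \<otimes> v \<oplus> (z [^] J \<otimes> z) \<otimes> b" unfolding vb(4) using c z by algebra
    hence eq: "z \<otimes> u = z \<otimes> v \<oplus> z [^] Suc J \<otimes> b" by simp
    from adj_top[OF vb(3), of "Suc J"] have "z [^] Suc J \<otimes> b \<in> adj A z e (n + e) (Suc (Suc J))"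
      using vb(1) by (simp del: adj.simps nat_pow_Suc add: algebra_simps)
    moreover have "z \<otimes> v \<in> adj A z e (n + e) (Suc (Suc J))" using Suc.IH[OF vb(2)] adj_Suc by blast
    ultimately show ?thesis unfolding eq using smod_add[OF adj_smod] by blast
  qed
qed

lemma adj_multzpow: "u \<in> adj A z e n J \<Longrightarrow> z [^] k \<otimes> u \<in> adj A z e (n + k * e) (J + k)"
proof (induction k)
  case 0
  thus ?case using adj_carr by auto
next
  case (Suc k)
  have "z [^] Suc k \<otimes> u = z \<otimes> (z [^] k \<otimes> u)" using z adj_carr[OF Suc.prems] by (simp add: m_ac)
  thus ?case using adj_multz[OF Suc.IH[OF Suc.prems]] by (simp del: adj.simps nat_pow_Suc add: algebra_simps)
qed

lemma adj_mult: "u \<in> adj A z e n J \<Longrightarrow> v \<in> adj A z e k K \<Longrightarrow> u \<otimes> v \<in> adj A z e (n + k) (J + K)"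
proof (induction K arbitrary: v)
  case 0
  thus ?case using smod_0[OF adj_smod] adj_carr by auto
next
  case (Suc K)
  from adj_cases[OF Suc.prems(2)] show ?case
  proof
    assume "v \<in> adj A z e k K"
    thus ?thesis using Suc.IH[OF Suc.prems(1)] adj_Suc by fastforce
  next
    assume "K * e \<le> k \<and> (\<exists>w\<in>adj A z e k K. \<exists>a\<in>A (k - K * e). v = w \<oplus> z [^] K \<otimes> a)"
    then obtain w b where vb: "K * e \<le> k" "w \<in> adj A z e k K" "b \<in> A (k - K * e)" "v = w \<oplus> z [^] K \<otimes> b" by blast
    have c: "w \<in> carrier S" "b \<in> carrier S" "z [^] K \<in> carrier S" "u \<in> carrier S" using vb adj_carr gringD(6)[OF A] z Suc.prems by auto
    have eq: "u \<otimes> v = u \<otimes> w \<oplus> b \<otimes> (z [^] K \<otimes> u)" unfolding vb(4) using c by algebra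
    have "b \<otimes> (z [^] K \<otimes> u) \<in> adj A z e ((k - K * e) + (n + K * e)) (J + K)"
      by (rule adj_multA[OF vb(3) adj_multzpow[OF Suc.prems(1)]])
    hence "b \<otimes> (z [^] K \<otimes> u) \<in> adj A z e (n + k) (J + K)" using vb(1) by (simp add: algebra_simps)
    hence "u \<otimes> v \<in> adj A z e (n + k) (J + K)" unfolding eq using smod_add[OF adj_smod Suc.IH[OF Suc.prems(1) vb(2)]] by blast
    thus ?thesis using adj_Suc by fastforce
  qed
qed

lemma adj_gring: "gring (\<lambda>n. \<Union>J. adj A z e n J)"
proof (rule gringI)
  show "(\<Union>J. adj A z e n J) \<subseteq> carrier S" for n using adj_carr by auto
  show "\<zero> \<in> (\<Union>J. adj A z e n J)" for n using smod_0[OF adj_smod] by auto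
  show "a \<oplus> b \<in> (\<Union>J. adj A z e n J)" if ab: "a \<in> (\<Union>J. adj A z e n J)" "b \<in> (\<Union>J. adj A z e n J)" for n a b
  proof -
    obtain J K where "a \<in> adj A z e n J" "b \<in> adj A z e n K" using ab by blast
    hence "a \<in> adj A z e n (max J K)" "b \<in> adj A z e n (max J K)"
      using adj_mono[OF max.cobounded1, of n J K] adj_mono[OF max.cobounded2, of n K J] by blast+
    thus ?thesis using smod_add[OF adj_smod] by blast
  qed
  show "Z \<subseteq> (\<Union>J. adj A z e 0 J)"
  proof
    fix y assume "y \<in> Z"
    hence "z [^] (0::nat) \<otimes> y \<in> adj A z e (0 + 0 * e) (Suc 0)" by (intro adj_top gringD(4)[OF A])
    thus "y \<in> (\<Union>J. adj A z e 0 J)" using \<open>y \<in> Z\<close> by (auto simp del: adj.simps)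
  qed
  show "a \<otimes> b \<in> (\<Union>J. adj A z e (i + j) J)" if ab: "a \<in> (\<Union>J. adj A z e i J)" "b \<in> (\<Union>J. adj A z e j J)" for i j a b
  proof -
    obtain J K where "a \<in> adj A z e i J" "b \<in> adj A z e j K" using ab by blast
    from adj_mult[OF this] show ?thesis by blast
  qed
qed

lemma adj_contains: "a \<in> A n \<Longrightarrow> a \<in> (\<Union>J. adj A z e n J)" "z \<in> (\<Union>J. adj A z e e J)"
proof -
  show "a \<in> A n \<Longrightarrow> a \<in> (\<Union>J. adj A z e n J)"
    using adj_top[of a n 0] gringD(6)[OF A] by (auto simp del: adj.simps)
  show "z \<in> (\<Union>J. adj A z e e J)"
    using adj_top[of \<one> 0 1] gringD(4)[OF A] z by (auto simp del: adj.simps)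
qed

text \<open>The classical leading coefficients in the proof of the Hilbert basis theorem: coefficients of
  \<open>z\<^sup>j\<close> in elements of \<open>L\<close> having a representation of degree at most \<open>j\<close> in \<open>z\<close>. As \<open>z\<close> may
  satisfy relations over \<open>A\<close>, leading terms belong to representations and not to elements.\<close>
definition lead :: "(nat \<Rightarrow> 'a set) \<Rightarrow> nat \<Rightarrow> nat \<Rightarrow> 'a set" where
  "lead L j n = {c \<in> A n. \<exists>u\<in>adj A z e (n + j * e) j. z [^] j \<otimes> c \<oplus> u \<in> L (n + j * e)}"

context
  fixes B :: "nat \<Rightarrow> 'a set"
  assumes B: "gring B" and AB: "\<And>n. A n \<subseteq> B n" and zB: "z \<in> B e" and Badj: "\<And>n. B n \<subseteq> (\<Union>J. adj A z e n J)"
begin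

lemma lead_gideal: assumes L: "gideal B L" shows "gideal A (lead L j)"
proof (rule gidealI)
  have zj: "z [^] j \<in> carrier S" using z by auto
  show "lead L j n \<subseteq> A n" for n unfolding lead_def by auto
  show "\<zero> \<in> lead L j n" for n unfolding lead_def
    using gringD(2)[OF A] smod_0[OF adj_smod] gidealD(2)[OF L] zj by force
  show "a \<oplus> b \<in> lead L j n" if ab: "a \<in> lead L j n" "b \<in> lead L j n" for n a b
  proof -
    obtain u v where uv: "u\<in>adj A z e (n + j * e) j" "z [^] j \<otimes> a \<oplus> u \<in> L (n + j * e)"
      "v\<in>adj A z e (n + j * e) j" "z [^] j \<otimes> b \<oplus> v \<in> L (n + j * e)" "a \<in> A n" "b \<in> A n" using ab unfolding lead_def by auto
    have c: "u \<in> carrier S" "v \<in> carrier S" "a \<in> carrier S" "b \<in> carrier S" using uv adj_carr gringD(6)[OF A] by auto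
    have "z [^] j \<otimes> (a \<oplus> b) \<oplus> (u \<oplus> v) = (z [^] j \<otimes> a \<oplus> u) \<oplus> (z [^] j \<otimes> b \<oplus> v)" using c zj by algebra
    hence "z [^] j \<otimes> (a \<oplus> b) \<oplus> (u \<oplus> v) \<in> L (n + j * e)" using gidealD(3)[OF L] uv by auto
    thus ?thesis unfolding lead_def using gringD(3)[OF A] smod_add[OF adj_smod] uv by blast
  qed
  show "a \<otimes> b \<in> lead L j (i + n)" if ab: "a \<in> A i" "b \<in> lead L j n" for i n a b
  proof -
    obtain u where u: "u\<in>adj A z e (n + j * e) j" "z [^] j \<otimes> b \<oplus> u \<in> L (n + j * e)" "b \<in> A n" using ab unfolding lead_def by auto
    have c: "u \<in> carrier S" "a \<in> carrier S" "b \<in> carrier S" using u ab adj_carr gringD(6)[OF A] by auto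
    have "z [^] j \<otimes> (a \<otimes> b) \<oplus> a \<otimes> u = a \<otimes> (z [^] j \<otimes> b \<oplus> u)" using c zj by algebra
    moreover have "a \<otimes> (z [^] j \<otimes> b \<oplus> u) \<in> L (i + (n + j * e))" using gidealD(4)[OF L] u ab AB by blast
    ultimately have "z [^] j \<otimes> (a \<otimes> b) \<oplus> a \<otimes> u \<in> L (i + n + j * e)" by (simp add: algebra_simps)
    moreover have "a \<otimes> u \<in> adj A z e (i + n + j * e) j" using adj_multA[OF ab(1) u(1)] by (simp add: algebra_simps)
    ultimately show ?thesis unfolding lead_def using gringD(5)[OF A ab(1) u(3)] by blast
  qed
qed

lemma lead_mono: assumes "L \<le> L'" shows "lead L j \<le> lead L' j"
proof (rule le_funI, rule subsetI)
  fix n c assume "c \<in> lead L j n"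
  then obtain u where "u\<in>adj A z e (n + j * e) j" "z [^] j \<otimes> c \<oplus> u \<in> L (n + j * e)" "c \<in> A n" unfolding lead_def by auto
  moreover from this have "z [^] j \<otimes> c \<oplus> u \<in> L' (n + j * e)" using assms by (auto simp: le_fun_def)
  ultimately show "c \<in> lead L' j n" unfolding lead_def by blast
qed

lemma lead_Suc: assumes L: "gideal B L" shows "lead L j \<le> lead L (Suc j)"
proof (rule le_funI, rule subsetI)
  fix n c assume "c \<in> lead L j n"
  then obtain u where u: "u\<in>adj A z e (n + j * e) j" "z [^] j \<otimes> c \<oplus> u \<in> L (n + j * e)" "c \<in> A n" unfolding lead_def by auto
  have c: "u \<in> carrier S" "c \<in> carrier S" "z [^] j \<in> carrier S" using u adj_carr gringD(6)[OF A] z by auto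
  have "z \<otimes> (z [^] j \<otimes> c \<oplus> u) = (z [^] j \<otimes> z) \<otimes> c \<oplus> z \<otimes> u" using c z by algebra
  hence "z [^] Suc j \<otimes> c \<oplus> z \<otimes> u \<in> L (e + (n + j * e))" using gidealD(4)[OF L zB u(2)] by simp
  hence "z [^] Suc j \<otimes> c \<oplus> z \<otimes> u \<in> L (n + Suc j * e)" by (simp add: algebra_simps del: nat_pow_Suc)
  moreover have "z \<otimes> u \<in> adj A z e (n + Suc j * e) (Suc j)" using adj_multz[OF u(1)] by (simp add: algebra_simps del: adj.simps)
  ultimately show "c \<in> lead L (Suc j) n" unfolding lead_def using u(3) by blast
qed

text \<open>Division with remainder: an element of \<open>L'\<close> is reduced, by subtracting an element of \<open>L\<close> with the
  same leading coefficient, to an element of smaller degree in \<open>z\<close>.\<close>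
lemma lead_eqD:
  assumes L: "gideal B L" and L': "gideal B L'" and sub: "L \<le> L'" and eq: "\<And>j. lead L' j = lead L j"
  shows "L' = L"
proof (rule antisym[OF _ sub], rule le_funI, rule subsetI)
  fix n u assume u: "u \<in> L' n"
  have "u \<in> L' n \<Longrightarrow> u \<in> adj A z e n J \<Longrightarrow> u \<in> L n" for J u
  proof (induction J arbitrary: u)
    case 0
    thus ?case using gidealD(2)[OF L] by auto
  next
    case (Suc J)
    from adj_cases[OF Suc.prems(2)] show ?case
    proof
      assume "u \<in> adj A z e n J" thus ?thesis using Suc by auto
    next
      assume "J * e \<le> n \<and> (\<exists>v\<in>adj A z e n J. \<exists>a\<in>A (n - J * e). u = v \<oplus> z [^] J \<otimes> a)"
      then obtain v c where vc: "J * e \<le> n" "v \<in> adj A z e n J" "c \<in> A (n - J * e)" "u = v \<oplus> z [^] J \<otimes> c" by blast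
      have n: "n - J * e + J * e = n" using vc by simp
      have cc: "v \<in> carrier S" "c \<in> carrier S" "z [^] J \<in> carrier S" using vc adj_carr gringD(6)[OF A] z by auto
      have "z [^] J \<otimes> c \<oplus> v \<in> L' n" using Suc.prems(1) vc(4) cc by (simp add: a_comm)
      hence "c \<in> lead L' J (n - J * e)" unfolding lead_def using vc n by auto
      hence "c \<in> lead L J (n - J * e)" using eq by simp
      then obtain w where w: "w \<in> adj A z e n J" "z [^] J \<otimes> c \<oplus> w \<in> L n" unfolding lead_def using n by auto
      have wc: "w \<in> carrier S" using w adj_carr by auto
      have "u \<ominus> (z [^] J \<otimes> c \<oplus> w) = v \<ominus> w" unfolding vc(4) using cc wc by algebra
      moreover have "u \<ominus> (z [^] J \<otimes> c \<oplus> w) \<in> L' n"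
        using smod_diff[OF gideal_smod[OF B L'] Suc.prems(1)] w sub by (auto simp: le_fun_def)
      ultimately have "v \<ominus> w \<in> L' n" by simp
      moreover have "v \<ominus> w \<in> adj A z e n J" using smod_diff[OF adj_smod vc(2) w(1)] .
      ultimately have "v \<ominus> w \<in> L n" by (rule Suc.IH)
      hence "(v \<ominus> w) \<oplus> (z [^] J \<otimes> c \<oplus> w) \<in> L n" using gidealD(3)[OF L] w by auto
      moreover have "(v \<ominus> w) \<oplus> (z [^] J \<otimes> c \<oplus> w) = u" unfolding vc(4) using cc wc by algebra
      ultimately show ?thesis by simp
    qed
  qed
  moreover obtain J where "u \<in> adj A z e n J" using u gidealD(1)[OF L'] Badj by blast
  ultimately show "u \<in> L n" using u by blast
qed

text \<open>The leading ideals form an array that ascends in both directions, so they are stationary in all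
  rows at once, and equal leading ideals force equal ideals.\<close>
lemma hilbert_basis_step: assumes acc: "gacc A" shows "gacc B"
  unfolding gacc_def
proof (intro allI impI)
  fix L :: "nat \<Rightarrow> nat \<Rightarrow> 'a set"
  assume L: "\<forall>i. gideal B (L i)" and asc: "\<forall>i. L i \<le> L (Suc i)"
  have "\<exists>k. \<forall>i\<ge>k. \<forall>j. lead (L i) j = lead (L k) j"
  proof (rule double_chain_stabilizes[where P = "gideal A"])
    fix f :: "nat \<Rightarrow> nat \<Rightarrow> 'a set"
    assume "\<And>i. gideal A (f i)" "\<And>i. f i \<le> f (Suc i)"
    thus "\<exists>k. \<forall>i\<ge>k. f i = f k" using acc unfolding gacc_def by blast
  next
    show "gideal A (lead (L i) j)" for i j using lead_gideal L by blast
    show "lead (L i) j \<le> lead (L (Suc i)) j" for i j using lead_mono asc by blast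
    show "lead (L i) j \<le> lead (L i) (Suc j)" for i j using lead_Suc L by blast
  qed
  then obtain k where k: "\<And>i j. i \<ge> k \<Longrightarrow> lead (L i) j = lead (L k) j" by blast
  have mono: "k \<le> i \<Longrightarrow> L k \<le> L i" for i using lift_Suc_mono_le[of L] asc by blast
  have "L i = L k" if "i \<ge> k" for i
    using lead_eqD[of "L k" "L i"] L mono[OF that] k[OF that] by blast
  thus "\<exists>k. \<forall>i\<ge>k. L i = L k" by blast
qed

end

end

lemma gal_insert: 
  assumes G: "insert (z, e) G \<subseteq> carrier S \<times> UNIV" and acc: "gacc (gal G)"
  shows "gacc (gal (insert (z, e) G))"
proof (rule hilbert_basis_step[of "gal G" z _ e])
  show A: "gring (gal G)" using G by (intro gal_gring) auto
  show z: "z \<in> carrier S" using G by auto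
  show B: "gring (gal (insert (z, e) G))" using G by (intro gal_gring)
  show "gal G n \<subseteq> gal (insert (z, e) G) n" for n
    by (rule gal_least[OF B]) (auto intro: gal_gen)
  show "z \<in> gal (insert (z, e) G) e" by (auto intro: gal_gen)
  show "gal (insert (z, e) G) n \<subseteq> (\<Union>J. adj (gal G) z e n J)" for n
    by (rule gal_least[OF adj_gring[OF A z]]) (use adj_contains[OF A z] gal_gen in auto)
  show "gacc (gal G)" by (rule acc)
qed

end

context local_base
begin

lemma gacc_base: "gacc (gal {})"
  unfolding gacc_def
proof (intro allI impI)
  fix L :: "nat \<Rightarrow> nat \<Rightarrow> 'a set"
  assume L: "\<forall>i. gideal (gal {}) (L i)" and asc: "\<forall>i. L i \<le> L (Suc i)"
  have A: "gring (gal {})" by (rule gal_gring) auto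
  have T: "gring (\<lambda>n. if n = 0 then Z else {\<zero>})"
  proof (rule gringI)
    fix i j :: nat and a b assume "a \<in> (if i = 0 then Z else {\<zero>})" "b \<in> (if j = 0 then Z else {\<zero>})"
    thus "a \<otimes> b \<in> (if i + j = 0 then Z else {\<zero>})" by (cases "i = 0"; cases "j = 0") auto
  qed (auto split: if_splits)
  have sub: "gal {} n \<subseteq> (if n = 0 then Z else {\<zero>})" for n using gal_least[OF T] by blast
  have L0: "L i n = {\<zero>}" if "n \<noteq> 0" for i n
    using sub[of n] that gidealD(1)[OF L[rule_format], of i n] gidealD(2)[OF L[rule_format], of i n] by auto
  have "\<exists>k. \<forall>i\<ge>k. L i 0 = L k 0"
  proof (rule acc_Z)
    show "smod (L i 0)" for i using gideal_smod[OF A] L by blast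
    show "L i 0 \<subseteq> Z" for i using sub[of 0] gidealD(1)[OF L[rule_format], of i 0] by auto
    show "L i 0 \<subseteq> L (Suc i) 0" for i using asc by (auto simp: le_fun_def)
  qed
  then obtain k where k: "\<And>i. i \<ge> k \<Longrightarrow> L i 0 = L k 0" by blast
  have "L i = L k" if "i \<ge> k" for i
  proof
    fix n show "L i n = L k n" using k[OF that] L0[of n i] L0[of n k] by (cases "n = 0") auto
  qed
  thus "\<exists>k. \<forall>i\<ge>k. L i = L k" by blast
qed

theorem hilbert_basis: "finite G \<Longrightarrow> G \<subseteq> carrier S \<times> UNIV \<Longrightarrow> gacc (gal G)"
proof (induction G rule: finite_induct)
  case empty
  show ?case by (rule gacc_base)
next
  case (insert x G)
  obtain z e where x: "x = (z, e)" by fastforce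
  show ?case unfolding x by (rule gal_insert) (use insert x in auto)
qed

text \<open>Consider in each degree \<open>c\<close> the multiples \<open>w z\<close> that lie in that component with \<open>z\<close> in the
  component \<open>c - i\<close>. These form graded ideals ascending with \<open>i\<close>, and the index where they
  stabilise is the Artin-Rees constant.\<close>
lemma artin_rees:
  assumes dom: "domain S" and G: "finite G" "G \<subseteq> carrier S \<times> UNIV"
    and dec: "\<And>n. gal G (Suc n) \<subseteq> gal G n" and w: "w \<in> gal G 0" "w \<noteq> \<zero>"
  shows "\<exists>\<kappa>. \<forall>c z. z \<in> gal G 0 \<longrightarrow> w \<otimes> z \<in> gal G c \<longrightarrow> z \<in> gal G (c - \<kappa>)"
proof -
  interpret domain S by (rule dom)
  let ?A = "gal G"
  have A: "gring ?A" by (rule gal_gring[OF G(2)])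
  have wS: "w \<in> carrier S" using gringD(6)[OF A w(1)] .
  have decm: "i \<le> j \<Longrightarrow> ?A j \<subseteq> ?A i" for i j using lift_Suc_antimono_le[of ?A] dec by blast
  define L where "L i c = {u \<in> ?A c. \<exists>z\<in>?A (c - i). u = w \<otimes> z}" for i c
  have "gideal ?A (L i)" for i
  proof (rule gidealI)
    show "L i n \<subseteq> ?A n" for n unfolding L_def by auto
    show "\<zero> \<in> L i n" for n unfolding L_def using gringD(2)[OF A] wS by force
    show "a \<oplus> b \<in> L i n" if ab: "a \<in> L i n" "b \<in> L i n" for n a b
    proof -
      obtain y z where "y \<in> ?A (n - i)" "z \<in> ?A (n - i)" "a = w \<otimes> y" "b = w \<otimes> z" using ab unfolding L_def by auto
      moreover from this have "a \<oplus> b = w \<otimes> (y \<oplus> z)" using wS gringD(6)[OF A] by (simp add: r_distr)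
      ultimately show ?thesis using ab gringD(3)[OF A] unfolding L_def by blast
    qed
    show "a \<otimes> b \<in> L i (k + n)" if ab: "a \<in> ?A k" "b \<in> L i n" for k n a b
    proof -
      obtain z where z: "z \<in> ?A (n - i)" "b = w \<otimes> z" "b \<in> ?A n" using ab unfolding L_def by auto
      have eq: "a \<otimes> b = w \<otimes> (a \<otimes> z)" using z wS ab gringD(6)[OF A] by (simp add: m_lcomm)
      have "a \<otimes> z \<in> ?A (k + (n - i))" using gringD(5)[OF A ab(1) z(1)] .
      moreover have "k + n - i \<le> k + (n - i)" by arith
      ultimately have "a \<otimes> z \<in> ?A (k + n - i)" using decm by blast
      thus ?thesis using eq gringD(5)[OF A ab(1) z(3)] unfolding L_def by blast
    qed
  qed
  moreover have "L i \<le> L (Suc i)" for i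
    unfolding le_fun_def L_def using decm by (auto intro!: bexI decm[THEN subsetD, of "_ - Suc i" "_ - i"])
  ultimately obtain \<kappa> where k: "\<And>i. i \<ge> \<kappa> \<Longrightarrow> L i = L \<kappa>" using hilbert_basis[OF G] unfolding gacc_def by metis
  show ?thesis
  proof (intro exI allI impI)
    fix c z assume z: "z \<in> ?A 0" "w \<otimes> z \<in> ?A c"
    show "z \<in> ?A (c - \<kappa>)"
    proof (cases "c \<ge> \<kappa>")
      case True
      \<comment> \<open>in \<open>L c\<close> the cofactor is unrestricted, since \<open>c - c = 0\<close>\<close>
      have "w \<otimes> z \<in> L c c" unfolding L_def using z by auto
      hence "w \<otimes> z \<in> L \<kappa> c" using k[OF True] by simp
      then obtain z' where z': "z' \<in> ?A (c - \<kappa>)" "w \<otimes> z = w \<otimes> z'" unfolding L_def by auto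
      hence "z = z'" using m_lcancel[OF w(2) wS] z gringD(6)[OF A] by blast
      thus ?thesis using z' by simp
    qed (use z in auto)
  qed
qed

end

section \<open>Growth of Hilbert sums and chains of graded primes\<close>

lemma sum_shift_enat:
  fixes g :: "nat \<Rightarrow> enat"
  shows "(\<Sum>i\<le>N. if d \<le> i then g (i - d) else 0) = (if d \<le> N then (\<Sum>i\<le>N - d. g i) else 0)"
proof (cases "d \<le> N")
  case True
  have "(\<Sum>i\<le>N. if d \<le> i then g (i - d) else 0) = (\<Sum>i\<in>{d..N}. g (i - d))"
    by (rule sum.mono_neutral_cong_right) auto
  also have "\<dots> = (\<Sum>i\<le>N - d. g i)"
    by (rule sum.reindex_bij_witness[of _ "\<lambda>i. i + d" "\<lambda>i. i - d"]) (use True in auto)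
  finally show ?thesis using True by simp
next
  case False
  have "(\<Sum>i\<le>N. if d \<le> i then g (i - d) else 0) = 0"
    by (rule sum.neutral) (use False in auto)
  thus ?thesis using False by simp
qed

lemma seq_lessI:
  fixes M P :: "nat \<Rightarrow> 'x set"
  assumes "M \<le> P" "x \<in> P d" "x \<notin> M d" shows "M < P"
  using assms by (metis order_le_imp_less_or_eq)

context const_ring
begin

definition gprime :: "(nat \<Rightarrow> 'a set) \<Rightarrow> (nat \<Rightarrow> 'a set) \<Rightarrow> bool" where
  "gprime A P \<longleftrightarrow> gideal A P \<and> P \<noteq> A \<and>
     (\<forall>i j. \<forall>a\<in>A i. \<forall>b\<in>A j. a \<otimes> b \<in> P (i + j) \<longrightarrow> a \<in> P i \<or> b \<in> P j)"

definition gchain :: "(nat \<Rightarrow> 'a set) \<Rightarrow> (nat \<Rightarrow> 'a set) \<Rightarrow> nat \<Rightarrow> bool" where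
  "gchain A L n \<longleftrightarrow> (\<exists>P. (\<forall>i\<le>n. gprime A (P i)) \<and> (\<forall>i<n. P i < P (Suc i)) \<and> L \<le> P 0)"

text \<open>The graded ideal generated by \<open>L\<close> and an element \<open>x\<close> of degree \<open>d\<close>.\<close>
definition gplus :: "(nat \<Rightarrow> 'a set) \<Rightarrow> (nat \<Rightarrow> 'a set) \<Rightarrow> 'a \<Rightarrow> nat \<Rightarrow> nat \<Rightarrow> 'a set" where
  "gplus A L x d n = sadd (L n) (if d \<le> n then scale x (A (n - d)) else {\<zero>})"

definition gcolon :: "(nat \<Rightarrow> 'a set) \<Rightarrow> (nat \<Rightarrow> 'a set) \<Rightarrow> 'a \<Rightarrow> nat \<Rightarrow> nat \<Rightarrow> 'a set" where
  "gcolon A L x d n = {a \<in> A n. x \<otimes> a \<in> L (n + d)}"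

text \<open>The Hilbert-Samuel function of \<open>A/L\<close>: lengths summed up to degree \<open>n\<close>. Summing makes it monotone and
  turns the shift by \<open>d\<close> in the colon ideal into a shift of the argument.\<close>
definition hsum :: "(nat \<Rightarrow> 'a set) \<Rightarrow> (nat \<Rightarrow> 'a set) \<Rightarrow> nat \<Rightarrow> enat" where
  "hsum A L n = (\<Sum>i\<le>n. len (L i) (A i))"

context
  fixes A :: "nat \<Rightarrow> 'a set" and L :: "nat \<Rightarrow> 'a set" and x :: 'a and d :: nat
  assumes A: "gring A" and L: "gideal A L" and x: "x \<in> A d"
begin

lemma xS: "x \<in> carrier S" using gringD(6)[OF A x] .

lemma gplus_part_smod: "smod (if d \<le> n then scale x (A (n - d)) else {\<zero>})"
  using smod_scale[OF gring_smod[OF A] xS] smod_zero by simp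

lemma gplus_smod: "smod (gplus A L x d n)"
  unfolding gplus_def using smod_sadd[OF gideal_smod[OF A L] gplus_part_smod] .

lemma gplus_ge: "L n \<subseteq> gplus A L x d n"
  unfolding gplus_def using sadd_sup1[OF smod_sub[OF gideal_smod[OF A L]] gplus_part_smod] .

lemma gplus_contains: "a \<in> A n \<Longrightarrow> x \<otimes> a \<in> gplus A L x d (n + d)"
proof -
  assume a: "a \<in> A n"
  have "x \<otimes> a \<in> (if d \<le> n + d then scale x (A (n + d - d)) else {\<zero>})" unfolding scale_def using a by auto
  thus ?thesis unfolding gplus_def using sadd_sup2[OF smod_sub[OF gplus_part_smod] gideal_smod[OF A L]] by blast
qed

lemma gplus_cases:
  assumes "u \<in> gplus A L x d n"
  shows "u \<in> L n \<or> (d \<le> n \<and> (\<exists>v\<in>L n. \<exists>a\<in>A (n - d). u = v \<oplus> x \<otimes> a))"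
proof (cases "d \<le> n")
  case True
  thus ?thesis using assms unfolding gplus_def sadd_def scale_def by auto
next
  case False
  thus ?thesis using assms smod_carr[OF gideal_smod[OF A L]] unfolding gplus_def sadd_def scale_def by auto
qed

lemma gplus_gideal: "gideal A (gplus A L x d)"
proof (rule gidealI)
  show sub: "gplus A L x d n \<subseteq> A n" for n
  proof
    fix u assume "u \<in> gplus A L x d n"
    from gplus_cases[OF this] show "u \<in> A n"
    proof
      assume "d \<le> n \<and> (\<exists>v\<in>L n. \<exists>a\<in>A (n - d). u = v \<oplus> x \<otimes> a)"
      then obtain v a where va: "d \<le> n" "v \<in> L n" "a \<in> A (n - d)" "u = v \<oplus> x \<otimes> a" by blast
      have "x \<otimes> a \<in> A n" using gringD(5)[OF A x va(3)] va(1) by simp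
      thus ?thesis using va gringD(3)[OF A] gidealD(1)[OF L] by blast
    qed (use gidealD(1)[OF L] in blast)
  qed
  show "\<zero> \<in> gplus A L x d n" for n using smod_0[OF gplus_smod] .
  show "a \<oplus> b \<in> gplus A L x d n" if "a \<in> gplus A L x d n" "b \<in> gplus A L x d n" for n a b
    using smod_add[OF gplus_smod that] .
  show "a \<otimes> u \<in> gplus A L x d (i + n)" if au: "a \<in> A i" "u \<in> gplus A L x d n" for i n a u
    using gplus_cases[OF au(2)]
  proof
    assume "u \<in> L n"
    thus ?thesis using gidealD(4)[OF L au(1)] gplus_ge by blast
  next
    assume "d \<le> n \<and> (\<exists>v\<in>L n. \<exists>a\<in>A (n - d). u = v \<oplus> x \<otimes> a)"
    then obtain v b where va: "d \<le> n" "v \<in> L n" "b \<in> A (n - d)" "u = v \<oplus> x \<otimes> b" by blast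
    have c: "v \<in> carrier S" "b \<in> carrier S" "a \<in> carrier S"
      using gringD(6)[OF A au(1)] gringD(6)[OF A va(3)] smod_carr[OF gideal_smod[OF A L] va(2)] by auto
    have eq: "a \<otimes> u = a \<otimes> v \<oplus> x \<otimes> (a \<otimes> b)" unfolding va(4) using c xS by algebra
    have "a \<otimes> v \<in> gplus A L x d (i + n)" using gidealD(4)[OF L au(1) va(2)] gplus_ge by blast
    moreover have "x \<otimes> (a \<otimes> b) \<in> gplus A L x d (i + n)"
      using gplus_contains[OF gringD(5)[OF A au(1) va(3)]] va(1) by simp
    ultimately show ?thesis unfolding eq by (rule smod_add[OF gplus_smod])
  qed
qed

lemma gcolon_gideal: "gideal A (gcolon A L x d)"
proof (rule gidealI)
  show "gcolon A L x d n \<subseteq> A n" for n unfolding gcolon_def by auto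
  show "\<zero> \<in> gcolon A L x d n" for n unfolding gcolon_def using gringD(2)[OF A] gidealD(2)[OF L] xS by auto
  show "a \<oplus> b \<in> gcolon A L x d n" if ab: "a \<in> gcolon A L x d n" "b \<in> gcolon A L x d n" for n a b
  proof -
    have "a \<in> A n" "b \<in> A n" using ab unfolding gcolon_def by auto
    moreover from this have "x \<otimes> (a \<oplus> b) = x \<otimes> a \<oplus> x \<otimes> b" using gringD(6)[OF A] xS r_distr by blast
    ultimately show ?thesis using ab gringD(3)[OF A] gidealD(3)[OF L] unfolding gcolon_def by simp
  qed
  show "a \<otimes> b \<in> gcolon A L x d (i + n)" if ab: "a \<in> A i" "b \<in> gcolon A L x d n" for i n a b
  proof -
    have b: "b \<in> A n" "x \<otimes> b \<in> L (n + d)" using ab unfolding gcolon_def by auto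
    have "x \<otimes> (a \<otimes> b) = a \<otimes> (x \<otimes> b)" using gringD(6)[OF A ab(1)] gringD(6)[OF A b(1)] xS m_lcomm by blast
    moreover have "a \<otimes> (x \<otimes> b) \<in> L (i + n + d)" using gidealD(4)[OF L ab(1) b(2)] by (simp add: add.assoc)
    ultimately show ?thesis using gringD(5)[OF A ab(1) b(1)] unfolding gcolon_def by simp
  qed
qed

lemma gcolon_ge: "L \<le> gcolon A L x d"
proof (rule le_funI, rule subsetI)
  fix n a assume a: "a \<in> L n"
  have "x \<otimes> a \<in> L (n + d)" using gidealD(4)[OF L x a] by (simp add: add.commute)
  thus "a \<in> gcolon A L x d n" using a gidealD(1)[OF L] unfolding gcolon_def by auto
qed

text \<open>Multiplication by \<open>x\<close> identifies \<open>A/(L : x)\<close>, shifted by \<open>d\<close>, with \<open>(L + (x))/L\<close>.\<close>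
lemma len_gplus_gcolon:
  "len (L n) (A n) \<le> len (gplus A L x d n) (A n) + (if d \<le> n then len (gcolon A L x d (n - d)) (A (n - d)) else 0)"
proof -
  have "len (L n) (A n) \<le> len (L n) (gplus A L x d n) + len (gplus A L x d n) (A n)"
    by (rule len_sub[OF gideal_smod[OF A L] gplus_smod gring_smod[OF A] gplus_ge gidealD(1)[OF gplus_gideal]])
  moreover have "len (L n) (gplus A L x d n) \<le> (if d \<le> n then len (gcolon A L x d (n - d)) (A (n - d)) else 0)"
  proof (cases "d \<le> n")
    case True
    have "len (L n) (sadd (L n) (scale x (A (n - d)))) \<le> len (gcolon A L x d (n - d)) (A (n - d))"
      by (rule len_mult[OF gideal_smod[OF A L] gring_smod[OF A] xS]) (use True in \<open>auto simp: gcolon_def\<close>)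
    thus ?thesis using True by (simp add: gplus_def)
  next
    case False
    have "gplus A L x d n \<subseteq> L n" using gplus_cases False by blast
    thus ?thesis using len_eq_0[OF gplus_smod] False by simp
  qed
  ultimately have "len (L n) (A n) \<le> (if d \<le> n then len (gcolon A L x d (n - d)) (A (n - d)) else 0) + len (gplus A L x d n) (A n)"
    by (rule order_trans[OF _ add_right_mono])
  thus ?thesis by (simp only: add.commute)
qed

lemma hsum_ineq:
  "hsum A L N \<le> hsum A (gplus A L x d) N + (if d \<le> N then hsum A (gcolon A L x d) (N - d) else 0)"
proof -
  have "hsum A L N \<le> (\<Sum>n\<le>N. len (gplus A L x d n) (A n) + (if d \<le> n then len (gcolon A L x d (n - d)) (A (n - d)) else 0))"
    unfolding hsum_def by (rule sum_mono) (rule len_gplus_gcolon)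
  also have "\<dots> = hsum A (gplus A L x d) N + (if d \<le> N then hsum A (gcolon A L x d) (N - d) else 0)"
    unfolding sum.distrib hsum_def using sum_shift_enat[where g = "\<lambda>n. len (gcolon A L x d n) (A n)" and d = d and N = N] by simp
  finally show ?thesis .
qed

end

lemma hsum_mono: "n \<le> n' \<Longrightarrow> hsum A L n \<le> hsum A L n'"
  unfolding hsum_def by (rule sum_mono2) auto

lemma gchain_mono: "gchain A L' n \<Longrightarrow> L \<le> L' \<Longrightarrow> gchain A L n"
  unfolding gchain_def using order_trans by metis

lemma gchain_extend: assumes c: "gchain A L' n" and L: "gprime A L" and lt: "L < L'" shows "gchain A L (Suc n)"
proof -
  obtain P where P: "\<forall>i\<le>n. gprime A (P i)" "\<forall>i<n. P i < P (Suc i)" "L' \<le> P 0" using c unfolding gchain_def by blast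
  show ?thesis unfolding gchain_def
  proof (intro exI[of _ "\<lambda>i. case i of 0 \<Rightarrow> L | Suc i \<Rightarrow> P i"] conjI allI impI)
    fix i assume "i \<le> Suc n"
    thus "gprime A (case i of 0 \<Rightarrow> L | Suc i \<Rightarrow> P i)" using P L by (cases i) auto
  next
    fix i assume "i < Suc n"
    thus "(case i of 0 \<Rightarrow> L | Suc i \<Rightarrow> P i) < (case Suc i of 0 \<Rightarrow> L | Suc i \<Rightarrow> P i)"
      using P lt by (cases i) auto
  qed simp
qed

end

context local_base
begin

context
  fixes A :: "nat \<Rightarrow> 'a set"
  assumes A: "gring A" and A0: "A 0 = Z" and acc: "gacc A"
begin

lemma max_gideal:
  assumes "gideal A L0" "Q L0"
  shows "\<exists>L. gideal A L \<and> Q L \<and> (\<forall>L'. gideal A L' \<longrightarrow> L < L' \<longrightarrow> \<not> Q L')"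
proof -
  have "\<exists>L. (gideal A L \<and> Q L) \<and> (\<forall>L'. (gideal A L' \<and> Q L') \<longrightarrow> \<not> L < L')"
  proof (rule exists_maximal_no_chain[where R = "(<)"])
    show "gideal A L0 \<and> Q L0" using assms by auto
    fix f :: "nat \<Rightarrow> nat \<Rightarrow> 'a set" assume f: "\<And>i. gideal A (f i) \<and> Q (f i)" "\<And>i. f i < f (Suc i)"
    have "\<forall>i. f i \<le> f (Suc i)" using f(2) less_imp_le by blast
    then obtain k where k: "\<forall>i\<ge>k. f i = f k" using acc f(1) unfolding gacc_def by blast
    have "f (Suc k) = f k" using k[rule_format, of "Suc k"] by linarith
    thus False using f(2)[of k] by auto
  qed
  thus ?thesis by blast
qed

lemma gideal_proper0:
  assumes L: "gideal A L" and ne: "L \<noteq> A" and mL: "m \<subseteq> L 0"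
  shows "L 0 = m"
proof -
  have "\<one> \<notin> L 0"
  proof
    assume 1: "\<one> \<in> L 0"
    have "A n \<subseteq> L n" for n
    proof
      fix a assume a: "a \<in> A n"
      have "a \<otimes> \<one> \<in> L (n + 0)" by (rule gidealD(4)[OF L a 1])
      thus "a \<in> L n" using gringD(6)[OF A a] by simp
    qed
    hence "L = A" using gidealD(1)[OF L] by (intro ext equalityI) auto
    thus False using ne by simp
  qed
  moreover have "L 0 \<subseteq> Z" using gidealD(1)[OF L, of 0] A0 by simp
  ultimately show ?thesis using proper_sub_m[OF gideal_smod[OF A L]] mL by blast
qed

text \<open>Under the assumption \<open>A 0 = Z\<close> this is the largest graded prime.\<close>
lemma irrelevant_gprime: "gprime A (\<lambda>n. if n = 0 then m else A n)"
  unfolding gprime_def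
proof (intro conjI allI ballI impI)
  show "gideal A (\<lambda>n. if n = 0 then m else A n)"
  proof (rule gidealI)
    show "(if n = 0 then m else A n) \<subseteq> A n" for n using A0 m by auto
    show "\<zero> \<in> (if n = 0 then m else A n)" for n using gringD(2)[OF A] smod_0[OF m(1)] by auto
    show "a \<oplus> b \<in> (if n = 0 then m else A n)" if "a \<in> (if n = 0 then m else A n)" "b \<in> (if n = 0 then m else A n)" for n a b
      using that gringD(3)[OF A] smod_add[OF m(1)] by (auto split: if_splits)
    show "a \<otimes> b \<in> (if i + j = 0 then m else A (i + j))" if ab: "a \<in> A i" "b \<in> (if j = 0 then m else A j)" for i j a b
    proof (cases "i + j = 0")
      case True
      thus ?thesis using ab A0 smod_mult[OF m(1)] by auto
    next
      case False
      have "b \<in> A j" using ab A0 m by (auto split: if_splits)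
      thus ?thesis using False gringD(5)[OF A ab(1)] by auto
    qed
  qed
  show "(\<lambda>n. if n = 0 then m else A n) \<noteq> A"
  proof
    assume "(\<lambda>n. if n = 0 then m else A n) = A"
    from fun_cong[OF this, of 0] have "m = A 0" by simp
    thus False using A0 m by auto
  qed
  fix i j a b assume ab: "a \<in> A i" "b \<in> A j" "a \<otimes> b \<in> (if i + j = 0 then m else A (i + j))"
  show "a \<in> (if i = 0 then m else A i) \<or> b \<in> (if j = 0 then m else A j)"
    using ab zprime_m A0 unfolding zprime_def by (auto split: if_splits)
qed

text \<open>Suppose \<open>L\<close> is a counterexample, maximal for the given \<open>e\<close>. It has to be prime, since
  otherwise \<open>L + (x)\<close> and \<open>L : x\<close> are larger for a suitable \<open>x\<close> and their Hilbert sums add up to at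
  least that of \<open>L\<close>. For a prime \<open>L\<close> and \<open>x \<notin> L\<close> of positive degree one has \<open>L : x = L\<close>, and chains
  above \<open>L + (x)\<close> are shorter by one because \<open>L\<close> can be put below them. The induction hypothesis then bounds
  the differences of the Hilbert sum at distance \<open>d\<close> with exponent \<open>e - 1\<close>, and summation raises the
  exponent by one.\<close>
theorem growth_le:
  assumes "gideal A L" "m \<subseteq> L 0" "\<not> gchain A L (Suc e)"
  shows "\<exists>C::nat. \<forall>n. hsum A L n \<le> enat (C * (n + 1) ^ e)"
  using assms
proof (induction e arbitrary: L rule: less_induct)
  case (less e)
  show ?case
  proof (rule ccontr)
    let ?Q = "\<lambda>L. m \<subseteq> L 0 \<and> \<not> gchain A L (Suc e) \<and> \<not> (\<exists>C::nat. \<forall>n. hsum A L n \<le> enat (C * (n + 1) ^ e))"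
    assume "\<not> ?thesis"
    hence "?Q L" using less.prems by blast
    then obtain M where M: "gideal A M" "?Q M" "\<And>L'. gideal A L' \<Longrightarrow> M < L' \<Longrightarrow> \<not> ?Q L'"
      using max_gideal[OF less.prems(1), of ?Q] by blast
    have bad: "\<And>C. \<not> (\<forall>n. hsum A M n \<le> enat (C * (n + 1) ^ e))" using M(2) by blast
    have ne: "M \<noteq> A"
    proof
      assume "M = A"
      hence "hsum A M n = 0" for n unfolding hsum_def using len_eq_0[OF gring_smod[OF A] order_refl] by simp
      thus False using bad[of 0] by simp
    qed
    have M0: "M 0 = m" using gideal_proper0[OF M(1) ne] M(2) by blast
    have up: "\<exists>C::nat. \<forall>n. hsum A L' n \<le> enat (C * (n + 1) ^ e)" if "gideal A L'" "M < L'" for L'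
    proof -
      have le: "M \<le> L'" using that(2) by simp
      have "m \<subseteq> L' 0" using M0 le by (auto simp: le_fun_def)
      moreover have "\<not> gchain A L' (Suc e)" using M(2) gchain_mono[OF _ le] by blast
      ultimately show ?thesis using M(3)[OF that] by blast
    qed
    show False
    proof (cases "gprime A M")
      case False
      then obtain i j x y where xy: "x \<in> A i" "y \<in> A j" "x \<otimes> y \<in> M (i + j)" "x \<notin> M i" "y \<notin> M j"
        using M(1) ne unfolding gprime_def by blast
      let ?P = "gplus A M x i" and ?C = "gcolon A M x i"
      have xP: "x \<in> ?P i" using gplus_contains[OF A M(1) xy(1) gringD(4)[OF A Z_1]] gringD(6)[OF A xy(1)] by simp
      have "M \<le> ?P" using gplus_ge[OF A M(1) xy(1)] by (auto simp: le_fun_def)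
      hence P: "M < ?P" using seq_lessI[of M ?P] xP xy(4) by blast
      have "y \<in> ?C j" unfolding gcolon_def using xy by (simp add: add.commute)
      hence C: "M < ?C" using seq_lessI[OF gcolon_ge[OF A M(1) xy(1)]] xy(5) by blast
      obtain C1 where C1: "\<And>n. hsum A ?P n \<le> enat (C1 * (n + 1) ^ e)" using up[OF gplus_gideal[OF A M(1) xy(1)] P] by blast
      obtain C2 where C2: "\<And>n. hsum A ?C n \<le> enat (C2 * (n + 1) ^ e)" using up[OF gcolon_gideal[OF A M(1) xy(1)] C] by blast
      have "hsum A M n \<le> enat ((C1 + C2) * (n + 1) ^ e)" for n
      proof -
        have "(if i \<le> n then hsum A ?C (n - i) else 0) \<le> hsum A ?C n" using hsum_mono[of "n - i" n] by auto
        hence "hsum A M n \<le> hsum A ?P n + hsum A ?C n"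
          using hsum_ineq[OF A M(1) xy(1), of n] by (meson add_left_mono order_trans)
        also have "\<dots> \<le> enat (C1 * (n + 1) ^ e) + enat (C2 * (n + 1) ^ e)" by (rule add_mono[OF C1 C2])
        finally show ?thesis by (simp add: algebra_simps)
      qed
      thus False using bad by blast
    next
      case True
      show False
      proof (cases "\<exists>d\<ge>1. \<exists>x\<in>A d. x \<notin> M d")
        case False
        \<comment> \<open>nothing of positive degree survives modulo \<open>M\<close>, so the Hilbert sum is the length one of \<open>Z/m\<close>\<close>
        hence MA: "M n = A n" if "n \<ge> 1" for n using that gidealD(1)[OF M(1)] by blast
        have "hsum A M n \<le> enat (1 * (n + 1) ^ e)" for n
        proof -
          have "hsum A M n \<le> (\<Sum>i\<le>n. if i = 0 then 1 else 0)" unfolding hsum_def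
          proof (rule sum_mono)
            fix i show "len (M i) (A i) \<le> (if i = 0 then 1 else 0)"
              using len_m M0 A0 MA[of i] len_eq_0[OF gring_smod[OF A], of i "M i"] by auto
          qed
          also have "\<dots> = 1" by simp
          also have "\<dots> \<le> enat (1 * (n + 1) ^ e)" by (simp add: one_enat_def)
          finally show ?thesis .
        qed
        thus False using bad by blast
      next
        case xx: True
        then obtain d x where x: "d \<ge> 1" "x \<in> A d" "x \<notin> M d" by blast
        let ?P = "gplus A M x d"
        have xP: "x \<in> ?P d" using gplus_contains[OF A M(1) x(2) gringD(4)[OF A Z_1]] gringD(6)[OF A x(2)] by simp
        have "M \<le> ?P" using gplus_ge[OF A M(1) x(2)] by (auto simp: le_fun_def)
        hence P: "M < ?P" using seq_lessI[of M ?P] xP x(3) by blast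
        \<comment> \<open>\<open>M\<close> and the irrelevant ideal already form a chain of length one, which excludes \<open>e = 0\<close>\<close>
        have "M < (\<lambda>n. if n = 0 then m else A n)"
          by (rule seq_lessI[where x = x and d = d])
            (use M0 gidealD(1)[OF M(1)] x in \<open>auto simp: le_fun_def split: if_splits\<close>)
        moreover have "gchain A (\<lambda>n. if n = 0 then m else A n) 0"
          unfolding gchain_def using irrelevant_gprime by auto
        ultimately have "gchain A M (Suc 0)" using gchain_extend True by blast
        hence e: "e \<noteq> 0" using M(2) by (metis)
        then obtain e' where e': "e = Suc e'" by (cases e) auto
        have P0: "m \<subseteq> ?P 0" using \<open>M \<le> ?P\<close> M0 by (auto simp: le_fun_def)
        have "\<not> gchain A ?P (Suc e')" using gchain_extend[OF _ True P] M(2) e' by blast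
        then obtain C where C: "\<And>n. hsum A ?P n \<le> enat (C * (n + 1) ^ e')"
          using less.IH[of e' ?P] e' gplus_gideal[OF A M(1) x(2)] P0 by blast
        have col: "gcolon A M x d = M"
        proof (rule antisym)
          show "M \<le> gcolon A M x d" by (rule gcolon_ge[OF A M(1) x(2)])
          show "gcolon A M x d \<le> M"
          proof (rule le_funI, rule subsetI)
            fix n a assume "a \<in> gcolon A M x d n"
            hence "a \<in> A n" "x \<otimes> a \<in> M (d + n)" unfolding gcolon_def by (auto simp: add.commute)
            thus "a \<in> M n" using True x unfolding gprime_def by blast
          qed
        qed
        have "hsum A M n \<le> enat (C * (n + 1) ^ e)" for n
        proof (induction n rule: less_induct)
          case (less n)
          show ?case
          proof (cases "d \<le> n")
            case True
            have nd: "n - d < n" using True x(1) by simp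
            have "hsum A M n \<le> hsum A ?P n + hsum A M (n - d)"
              using hsum_ineq[OF A M(1) x(2), of n] True col by simp
            also have "\<dots> \<le> enat (C * (n + 1) ^ e') + enat (C * (n - d + 1) ^ e)"
              by (rule add_mono[OF C less.IH[OF nd]])
            also have "\<dots> = enat (C * ((n + 1) ^ e' + (n - d + 1) ^ e))" by (simp add: algebra_simps)
            also have "\<dots> \<le> enat (C * (n + 1) ^ e)"
            proof -
              have "(n - d + 1) ^ e \<le> n ^ e" by (rule power_mono) (use nd in auto)
              also have "n ^ e = n * n ^ e'" by (simp add: e')
              also have "\<dots> \<le> n * (n + 1) ^ e'" by (intro mult_left_mono power_mono) auto
              finally have "(n + 1) ^ e' + (n - d + 1) ^ e \<le> (n + 1) ^ e" by (simp add: e')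
              thus ?thesis by (simp add: mult_left_mono)
            qed
            finally show ?thesis .
          next
            case False
            have "hsum A M n \<le> hsum A ?P n" using hsum_ineq[OF A M(1) x(2), of n] False by simp
            also have "\<dots> \<le> enat (C * (n + 1) ^ e')" by (rule C)
            also have "\<dots> \<le> enat (C * (n + 1) ^ e)" by (auto simp: e' intro!: mult_left_mono)
            finally show ?thesis .
          qed
        qed
        thus False using bad by blast
      qed
    qed
  qed
qed

end

end

section \<open>Adjoining an element of degree one\<close>

context const_ring
begin

text \<open>The part of degree \<open>n\<close> of \<open>A[f t]\<close> that is of degree at most \<open>s\<close> in \<open>f\<close>.\<close>
fun fspan :: "'a \<Rightarrow> (nat \<Rightarrow> 'a set) \<Rightarrow> nat \<Rightarrow> nat \<Rightarrow> 'a set" where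
  "fspan f A n 0 = A n"
| "fspan f A n (Suc s) = sadd (fspan f A n s) (scale (f [^] Suc s) (A (n - Suc s)))"

text \<open>The graded conductor: \<open>b t\<^sup>i\<close> is multiplied by \<open>f t\<close> into \<open>A\<close>.\<close>
definition fcolon :: "'a \<Rightarrow> (nat \<Rightarrow> 'a set) \<Rightarrow> nat \<Rightarrow> 'a set" where
  "fcolon f A i = {b \<in> A i. f \<otimes> b \<in> A (Suc i)}"

context
  fixes A :: "nat \<Rightarrow> 'a set" and f :: 'a
  assumes A: "gring A" and f: "f \<in> carrier S"
begin

lemma fspan_smod: "smod (fspan f A n s)"
  by (induction s) (auto simp del: nat_pow_Suc intro!: smod_sadd smod_scale gring_smod[OF A] nat_pow_closed f)

lemma fspan_mono: "s \<le> s' \<Longrightarrow> fspan f A n s \<subseteq> fspan f A n s'"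
proof (rule lift_Suc_mono_le[of "fspan f A n"])
  show "fspan f A n s \<subseteq> fspan f A n (Suc s)" for s
    unfolding fspan.simps
    by (rule sadd_sup1[OF smod_sub[OF fspan_smod] smod_scale[OF gring_smod[OF A] nat_pow_closed[OF f]]])
qed

lemma fspan_contains: "a \<in> A (n - s) \<Longrightarrow> f [^] s \<otimes> a \<in> fspan f A n s"
proof (cases s)
  case 0
  assume "a \<in> A (n - s)"
  thus ?thesis using 0 gringD(6)[OF A] by auto
next
  case (Suc s')
  assume "a \<in> A (n - s)"
  hence "f [^] s \<otimes> a \<in> scale (f [^] s) (A (n - s))" unfolding scale_def by auto
  thus ?thesis unfolding Suc fspan.simps
    using sadd_sup2[OF smod_sub[OF smod_scale[OF gring_smod[OF A] nat_pow_closed[OF f]]] fspan_smod] by blast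
qed

lemma fcolon_gideal: "gideal A (fcolon f A)"
proof (rule gidealI)
  show "fcolon f A n \<subseteq> A n" for n unfolding fcolon_def by auto
  show "\<zero> \<in> fcolon f A n" for n unfolding fcolon_def using gringD(2)[OF A] f by auto
  show "a \<oplus> b \<in> fcolon f A n" if ab: "a \<in> fcolon f A n" "b \<in> fcolon f A n" for n a b
  proof -
    have "a \<in> A n" "b \<in> A n" using ab unfolding fcolon_def by auto
    moreover from this have "f \<otimes> (a \<oplus> b) = f \<otimes> a \<oplus> f \<otimes> b" using gringD(6)[OF A] f r_distr by blast
    ultimately show ?thesis using ab gringD(3)[OF A] unfolding fcolon_def by simp
  qed
  show "a \<otimes> b \<in> fcolon f A (i + n)" if ab: "a \<in> A i" "b \<in> fcolon f A n" for i n a b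
  proof -
    have b: "b \<in> A n" "f \<otimes> b \<in> A (Suc n)" using ab unfolding fcolon_def by auto
    have "f \<otimes> (a \<otimes> b) = a \<otimes> (f \<otimes> b)" using gringD(6)[OF A ab(1)] gringD(6)[OF A b(1)] f m_lcomm by blast
    moreover have "a \<otimes> (f \<otimes> b) \<in> A (Suc (i + n))" using gringD(5)[OF A ab(1) b(2)] by simp
    ultimately show ?thesis using gringD(5)[OF A ab(1) b(1)] unfolding fcolon_def by simp
  qed
qed

text \<open>The layer \<open>f\<^sup>s A\<^sub>n\<^sub>-\<^sub>s\<close> modulo the previous ones is an image of the quotient of \<open>A\<^sub>n\<^sub>-\<^sub>s\<close> by the conductor.\<close>
lemma len_fspan:
  "s \<le> n \<Longrightarrow> len (A n) (fspan f A n s) \<le> (\<Sum>j<s. len (fcolon f A (n - Suc j)) (A (n - Suc j)))"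
proof (induction s)
  case 0
  show ?case using len_eq_0[OF gring_smod[OF A]] by simp
next
  case (Suc s)
  let ?i = "n - Suc s"
  have "len (fspan f A n s) (fspan f A n (Suc s)) \<le> len (fcolon f A ?i) (A ?i)"
    unfolding fspan.simps
  proof (rule len_mult[OF fspan_smod gring_smod[OF A] nat_pow_closed[OF f]])
    show "fcolon f A ?i \<subseteq> A ?i" unfolding fcolon_def by auto
    fix b assume "b \<in> fcolon f A ?i"
    hence b: "b \<in> A ?i" "f \<otimes> b \<in> A (n - s)" unfolding fcolon_def using Suc.prems by (auto simp: Suc_diff_Suc)
    have "f [^] Suc s \<otimes> b = f [^] s \<otimes> (f \<otimes> b)" using f gringD(6)[OF A b(1)] by (simp add: m_assoc)
    thus "f [^] Suc s \<otimes> b \<in> fspan f A n s" using fspan_contains[OF b(2)] by simp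
  qed
  moreover have "len (A n) (fspan f A n (Suc s)) \<le> len (A n) (fspan f A n s) + len (fspan f A n s) (fspan f A n (Suc s))"
    by (rule len_sub[OF gring_smod[OF A] fspan_smod fspan_smod])
      (use fspan_mono[of 0 s n] fspan_mono[of s "Suc s" n] in auto)
  ultimately have "len (A n) (fspan f A n (Suc s)) \<le>
      (\<Sum>j<s. len (fcolon f A (n - Suc j)) (A (n - Suc j))) + len (fcolon f A ?i) (A ?i)"
    using Suc.IH Suc.prems by (meson Suc_leD add_mono order_trans)
  thus ?case by simp
qed

lemma len_fspan_hsum: "len (A n) (fspan f A n n) \<le> hsum A (fcolon f A) n"
proof -
  have "len (A n) (fspan f A n n) \<le> (\<Sum>j<n. len (fcolon f A (n - Suc j)) (A (n - Suc j)))"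
    by (rule len_fspan) simp
  also have "\<dots> = (\<Sum>i<n. len (fcolon f A i) (A i))"
    by (rule sum.nat_diff_reindex)
  also have "\<dots> \<le> hsum A (fcolon f A) n" unfolding hsum_def by (rule sum_mono2) auto
  finally show ?thesis .
qed

end

end

context local_base
begin

text \<open>If \<open>A[f t]\<close> is large compared with \<open>A\<close>, then so is the Hilbert sum of \<open>A\<close> modulo the conductor of
  \<open>f\<close>; by \<open>growth_le\<close> there must be a long chain of graded primes above the conductor, which contains
  \<open>m\<close> in degree zero because \<open>f m\<close> lies in \<open>A 1\<close>.\<close>
theorem gchain_of_growth:
  assumes A: "gring A" and A0: "A 0 = Z" and acc: "gacc A" and f: "f \<in> carrier S"
    and fm: "\<And>x. x \<in> m \<Longrightarrow> f \<otimes> x \<in> A 1"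
    and big: "\<And>q. q \<ge> 1 \<Longrightarrow> hc (A (k * q)) (fspan f A (k * q) (k * q)) (q ^ Suc t)"
  shows "\<exists>P. (\<forall>i\<le>Suc t. gprime A (P i)) \<and> (\<forall>i<Suc t. P i < P (Suc i)) \<and> m \<subseteq> P 0 0"
proof -
  have mc: "m \<subseteq> fcolon f A 0" unfolding fcolon_def using m A0 fm by auto
  have "gchain A (fcolon f A) (Suc t)"
  proof (rule ccontr)
    assume "\<not> ?thesis"
    then obtain C :: nat where C: "\<And>n. hsum A (fcolon f A) n \<le> enat (C * (n + 1) ^ t)"
      using growth_le[OF A A0 acc fcolon_gideal[OF A f] mc] by blast
    \<comment> \<open>large enough for \<open>q\<^sup>t\<^sup>+\<^sup>1\<close> to exceed \<open>C (k q + 1)\<^sup>t\<close>\<close>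
    define q where "q = C * (k + 1) ^ t + 1"
    have q: "q \<ge> 1" unfolding q_def by simp
    have "enat (q ^ Suc t) \<le> len (A (k * q)) (fspan f A (k * q) (k * q))" by (rule len_ge[OF big[OF q]])
    also have "\<dots> \<le> hsum A (fcolon f A) (k * q)" by (rule len_fspan_hsum[OF A f])
    also have "\<dots> \<le> enat (C * (k * q + 1) ^ t)" by (rule C)
    finally have "q ^ Suc t \<le> C * (k * q + 1) ^ t" by simp
    also have "\<dots> \<le> C * ((k + 1) * q) ^ t" using q by (intro mult_left_mono power_mono) auto
    also have "\<dots> = (C * (k + 1) ^ t) * q ^ t" by (simp only: power_mult_distrib mult.assoc)
    also have "\<dots> < q * q ^ t" using q by (intro mult_strict_right_mono) (auto simp: q_def)
    finally show False by simp
  qed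
  then obtain P where "\<forall>i\<le>Suc t. gprime A (P i)" "\<forall>i<Suc t. P i < P (Suc i)" "fcolon f A \<le> P 0"
    unfolding gchain_def by blast
  moreover from this(3) have "m \<subseteq> P 0 0" using mc by (auto simp: le_fun_def)
  ultimately show ?thesis by blast
qed

text \<open>An ideal maximal among the finitely generated ones inside \<open>N\<close> is \<open>N\<close>.\<close>
lemma finitely_generated:
  assumes N: "smod N" "N \<subseteq> Z"
  shows "\<exists>F. finite F \<and> F \<subseteq> N \<and> (\<forall>K. smod K \<longrightarrow> F \<subseteq> K \<longrightarrow> N \<subseteq> K)"
proof -
  let ?Q = "\<lambda>N'. N' \<subseteq> N \<and> (\<exists>F. finite F \<and> F \<subseteq> N \<and> (\<forall>K. smod K \<longrightarrow> F \<subseteq> K \<longrightarrow> N' \<subseteq> K))"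
  have "?Q {\<zero>}" using smod_0 N by auto
  then obtain M where M: "smod M" "?Q M" "\<forall>N'. smod N' \<longrightarrow> N' \<subseteq> Z \<longrightarrow> M \<subset> N' \<longrightarrow> \<not> ?Q N'"
    using max_smod[OF smod_zero, of ?Q] by auto
  obtain F where F: "finite F" "F \<subseteq> N" "\<And>K. smod K \<Longrightarrow> F \<subseteq> K \<Longrightarrow> M \<subseteq> K" using M(2) by blast
  have "N \<subseteq> M"
  proof
    fix x assume x: "x \<in> N"
    show "x \<in> M"
    proof (rule ccontr)
      assume xM: "x \<notin> M"
      have xZ: "x \<in> Z" using x N by auto
      let ?M = "sadd M (scale x Z)"
      have sM: "smod ?M" using M(1) xZ smod_sadd smod_sZ by auto
      have sub: "?M \<subseteq> K" if "smod K" "insert x F \<subseteq> K" for K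
      proof (rule sadd_least[OF that(1)])
        show "M \<subseteq> K" using F(3) that by auto
        show "scale x Z \<subseteq> K"
        proof
          fix u assume "u \<in> scale x Z"
          then obtain z where z: "z \<in> Z" "u = z \<otimes> x" unfolding scale_def using m_comm xZ by auto
          thus "u \<in> K" using smod_mult[OF that(1) z(1), of x] that(2) by auto
        qed
      qed
      have "x \<otimes> \<one> \<in> scale x Z" unfolding scale_def by blast
      hence "x \<in> ?M" using sadd_sup2[OF smod_sub[OF smod_sZ[OF xZ]] M(1)] xZ by auto
      moreover have "M \<subseteq> ?M" using sadd_sup1[OF smod_sub[OF M(1)] smod_sZ[OF xZ]] .
      ultimately have "M \<subset> ?M" using xM by auto
      moreover have "?M \<subseteq> N" using sub[OF N(1)] x F(2) by auto
      moreover have "?Q ?M" using sub x F \<open>?M \<subseteq> N\<close> by (intro conjI exI[of _ "insert x F"]) auto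
      ultimately show False using M(3)[rule_format, OF sM, OF subset_trans[OF _ N(2)]] by blast
    qed
  qed
  hence "\<forall>K. smod K \<longrightarrow> F \<subseteq> K \<longrightarrow> N \<subseteq> K" using F(3) by (meson order_trans)
  thus ?thesis using F(1,2) by (intro exI[of _ F]) simp
qed

end

context const_ring
begin

text \<open>The polynomials in \<open>t\<close> of degree at most \<open>D\<close> with coefficients in \<open>N\<close>. Such representations
  may be ambiguous, so only upper bounds for lengths are drawn from them.\<close>
fun pol :: "'a \<Rightarrow> 'a set \<Rightarrow> nat \<Rightarrow> 'a set" where
  "pol t N 0 = N"
| "pol t N (Suc D) = sadd (pol t N D) (scale (t [^] Suc D) N)"

context
  fixes t :: 'a
  assumes t: "t \<in> carrier S"
begin

lemma pol_smod: "smod N \<Longrightarrow> smod (pol t N D)"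
  by (induction D) (auto simp del: nat_pow_Suc intro!: smod_sadd smod_scale nat_pow_closed t)

lemma pol_mono: "smod N \<Longrightarrow> D \<le> D' \<Longrightarrow> pol t N D \<subseteq> pol t N D'"
proof (rule lift_Suc_mono_le[of "pol t N"])
  assume N: "smod N"
  show "pol t N D \<subseteq> pol t N (Suc D)" for D
    unfolding pol.simps
    by (rule sadd_sup1[OF smod_sub[OF pol_smod[OF N]] smod_scale[OF N nat_pow_closed[OF t]]])
qed

lemma pol_top: "smod N \<Longrightarrow> a \<in> N \<Longrightarrow> t [^] D \<otimes> a \<in> pol t N D"
proof (cases D)
  case 0
  assume "smod N" "a \<in> N"
  thus ?thesis using 0 smod_carr by auto
next
  case (Suc D')
  assume N: "smod N" and "a \<in> N"
  hence "t [^] D \<otimes> a \<in> scale (t [^] D) N" unfolding scale_def by auto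
  thus ?thesis unfolding Suc pol.simps
    using sadd_sup2[OF smod_sub[OF smod_scale[OF N nat_pow_closed[OF t]]] pol_smod[OF N]] by blast
qed

lemma pol_multt: "smod N \<Longrightarrow> u \<in> pol t N D \<Longrightarrow> t \<otimes> u \<in> pol t N (Suc D)"
proof (induction D arbitrary: u)
  case 0
  thus ?case using pol_top[of N u "Suc 0"] t by simp
next
  case (Suc D)
  obtain v a where va: "v \<in> pol t N D" "a \<in> N" "u = v \<oplus> t [^] Suc D \<otimes> a"
    using Suc.prems(2) unfolding pol.simps sadd_def scale_def by blast
  have c: "v \<in> carrier S" "a \<in> carrier S" "t [^] Suc D \<in> carrier S"
    using smod_carr[OF pol_smod[OF Suc.prems(1)] va(1)] smod_carr[OF Suc.prems(1) va(2)] t by auto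
  have "t \<otimes> u = t \<otimes> v \<oplus> (t [^] Suc D \<otimes> t) \<otimes> a" unfolding va(3) using c t by algebra
  hence eq: "t \<otimes> u = t \<otimes> v \<oplus> t [^] Suc (Suc D) \<otimes> a" by simp
  have "t \<otimes> v \<in> pol t N (Suc (Suc D))" using Suc.IH[OF Suc.prems(1) va(1)] pol_mono[OF Suc.prems(1), of "Suc D" "Suc (Suc D)"] by auto
  thus ?case unfolding eq using smod_add[OF pol_smod[OF Suc.prems(1)]] pol_top[OF Suc.prems(1) va(2)] by blast
qed

lemma pol_multtpow: "smod N \<Longrightarrow> u \<in> pol t N D \<Longrightarrow> t [^] k \<otimes> u \<in> pol t N (D + k)"
proof (induction k)
  case 0
  thus ?case using smod_carr[OF pol_smod] by auto
next
  case (Suc k)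
  have "t [^] Suc k \<otimes> u = t \<otimes> (t [^] k \<otimes> u)" using t smod_carr[OF pol_smod[OF Suc.prems(1)] Suc.prems(2)] by (simp add: m_ac)
  thus ?case using pol_multt[OF Suc.prems(1) Suc.IH[OF Suc.prems]] by simp
qed

lemma pol_mult: "u \<in> pol t Z D \<Longrightarrow> v \<in> pol t Z E \<Longrightarrow> u \<otimes> v \<in> pol t Z (D + E)"
proof (induction E arbitrary: v)
  case 0
  hence "v \<otimes> u \<in> pol t Z D" using smod_mult[OF pol_smod[OF smod_Z]] by auto
  thus ?case using m_comm 0 smod_carr[OF pol_smod[OF smod_Z] 0(1)] by auto
next
  case (Suc E)
  obtain w a where va: "w \<in> pol t Z E" "a \<in> Z" "v = w \<oplus> t [^] Suc E \<otimes> a"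
    using Suc.prems(2) unfolding pol.simps sadd_def scale_def by blast
  have c: "w \<in> carrier S" "a \<in> carrier S" "t [^] Suc E \<in> carrier S" "u \<in> carrier S"
    using smod_carr[OF pol_smod[OF smod_Z] va(1)] va(2) smod_carr[OF pol_smod[OF smod_Z] Suc.prems(1)] t by auto
  have eq: "u \<otimes> v = u \<otimes> w \<oplus> a \<otimes> (t [^] Suc E \<otimes> u)" unfolding va(3) using c by algebra
  have "u \<otimes> w \<in> pol t Z (D + Suc E)" using Suc.IH[OF Suc.prems(1) va(1)] pol_mono[OF smod_Z, of "D + E" "D + Suc E"] by auto
  moreover have "a \<otimes> (t [^] Suc E \<otimes> u) \<in> pol t Z (D + Suc E)"
    by (rule smod_mult[OF pol_smod[OF smod_Z] va(2) pol_multtpow[OF smod_Z Suc.prems(1)]])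
  ultimately show ?case unfolding eq by (rule smod_add[OF pol_smod[OF smod_Z]])
qed

lemma pol_pow: "u \<in> pol t Z D \<Longrightarrow> u [^] k \<in> pol t Z (k * D)"
proof (induction k)
  case 0
  show ?case using pol_mono[OF smod_Z, of 0 0] by auto
next
  case (Suc k)
  have "u [^] Suc k = u [^] k \<otimes> u" by simp
  thus ?case using pol_mult[OF Suc.IH[OF Suc.prems] Suc.prems] by (simp add: add.commute)
qed

lemma pol_sub: "N \<subseteq> M \<Longrightarrow> pol t N D \<subseteq> pol t M D"
proof (induction D)
  case (Suc D)
  show ?case unfolding pol.simps by (rule sadd_mono[OF Suc.IH[OF Suc.prems] scale_mono[OF Suc.prems]])
qed simp

text \<open>One coefficient at a time: each of the \<open>D + 1\<close> coefficients contributes at most the length of \<open>Z/N\<close>.\<close>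
lemma len_pol:
  assumes N: "smod N" "N \<subseteq> Z" and c: "len N Z \<le> enat c"
  shows "len (pol t N D) (pol t Z D) \<le> enat ((D + 1) * c)"
proof (induction D)
  case 0
  show ?case using c by simp
next
  case (Suc D)
  let ?H = "pol t N" and ?G = "pol t Z" and ?t = "t [^] Suc D"
  have tS: "?t \<in> carrier S" using t by auto
  have sH: "smod (?H D)" for D using pol_smod[OF N(1)] .
  have sG: "smod (?G D)" for D using pol_smod[OF smod_Z] .
  let ?K = "sadd (?H (Suc D)) (scale \<one> (?G D))"
  have one: "scale \<one> (?G D) = ?G D" unfolding scale_def using smod_carr[OF sG] by force
  have sK: "smod ?K" unfolding one by (rule smod_sadd[OF sH sG])
  have HG: "?H (Suc D) \<subseteq> ?G (Suc D)" using pol_sub[OF N(2)] .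
  have GG: "?G D \<subseteq> ?G (Suc D)" using pol_mono[OF smod_Z, of D "Suc D"] by simp
  have KG: "?K \<subseteq> ?G (Suc D)" unfolding one using sadd_least[OF sG HG GG] .
  have HK: "?H (Suc D) \<subseteq> ?K" unfolding one using sadd_sup1[OF smod_sub[OF sH] sG] .
  have 1: "len (?H (Suc D)) ?K \<le> len (?H D) (?G D)"
  proof (rule len_mult[OF sH sG one_closed])
    show "?H D \<subseteq> ?G D" using pol_sub[OF N(2)] .
    fix b assume "b \<in> ?H D"
    thus "\<one> \<otimes> b \<in> ?H (Suc D)" using smod_carr[OF sH] pol_mono[OF N(1), of D "Suc D"] by auto
  qed
  have "?G (Suc D) \<subseteq> sadd ?K (scale ?t Z)"
    unfolding pol.simps(2)[of t Z] one by (rule sadd_mono[OF sadd_sup2[OF smod_sub[OF sG] sH] order_refl])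
  hence "len ?K (?G (Suc D)) \<le> len ?K (sadd ?K (scale ?t Z))" by (rule len_mono[OF order_refl])
  also have "\<dots> \<le> len N Z"
  proof (rule len_mult[OF sK smod_Z tS])
    show "N \<subseteq> Z" by (rule N)
    fix b assume "b \<in> N"
    thus "?t \<otimes> b \<in> ?K" using pol_top[OF N(1), of b "Suc D"] HK by blast
  qed
  finally have 2: "len ?K (?G (Suc D)) \<le> enat c" using c by (rule order_trans)
  have "len (?H (Suc D)) (?G (Suc D)) \<le> len (?H (Suc D)) ?K + len ?K (?G (Suc D))"
    by (rule len_sub[OF sH sK sG HK KG])
  also have "\<dots> \<le> enat ((D + 1) * c) + enat c" using add_mono[OF order_trans[OF 1 Suc.IH] 2] .
  finally show ?case by (simp add: algebra_simps)
qed

end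

end

section \<open>A dimension inequality for subrings of polynomial rings\<close>

text \<open>
  The setting is a ring \<open>T\<close> between \<open>Z\<close> and \<open>Z[t]\<close>, possibly not Noetherian, with a chain of primes
  above \<open>m\<close>. For a system of parameters the claim is the inequality \<open>n \<le> dim Z\<close>, a special case of the dimension inequality for
  an extension of transcendence degree one, and the proof counts lengths of finitely generated modules only.

  Choose \<open>y\<^sub>k\<close> in the \<open>k\<close>-th prime from above but not in the next one. Monomials in the \<open>y\<^sub>k\<close> with
  exponents below \<open>M\<close> span a module having at least \<open>M\<^sup>n\<close> steps above its trace on the smallest
  prime. Powers of a nonzero \<open>w \<in> m\<close> provide \<open>M\<close> further layers of the same size, in a
  filtration induced by the powers of the extension of \<open>m\<close>, localised at the smallest prime. All of this lives
  among polynomials in \<open>t\<close> of degree \<open>O(M)\<close>, where modulo the \<open>s\<close>-th powers of parameters, with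
  \<open>s = O(M)\<close>, the length is at most \<open>O(M) O(M\<^sup>e)\<close>, where \<open>e\<close> is the number of parameters. Hence
  \<open>n + 1 \<le> e + 1\<close>.
\<close>

context local_base
begin

context
  fixes t :: 'a and T :: "'a set" and P :: "nat \<Rightarrow> 'a set" and n :: nat and h :: 'a
  assumes dom: "domain S" and t: "t \<in> carrier S"
    and TZ: "Z \<subseteq> T" and Tadd: "\<And>a b. a \<in> T \<Longrightarrow> b \<in> T \<Longrightarrow> a \<oplus> b \<in> T" and Tmult: "\<And>a b. a \<in> T \<Longrightarrow> b \<in> T \<Longrightarrow> a \<otimes> b \<in> T"
    and Tpol: "T \<subseteq> (\<Union>D. pol t Z D)"
    and PT: "\<And>i. i \<le> n \<Longrightarrow> P i \<subseteq> T" and P0: "\<And>i. i \<le> n \<Longrightarrow> \<zero> \<in> P i" and P1: "\<And>i. i \<le> n \<Longrightarrow> \<one> \<notin> P i"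
    and Padd: "\<And>i a b. i \<le> n \<Longrightarrow> a \<in> P i \<Longrightarrow> b \<in> P i \<Longrightarrow> a \<oplus> b \<in> P i"
    and Pmult: "\<And>i a b. i \<le> n \<Longrightarrow> a \<in> T \<Longrightarrow> b \<in> P i \<Longrightarrow> a \<otimes> b \<in> P i"
    and Pprime: "\<And>i a b. i \<le> n \<Longrightarrow> a \<in> T \<Longrightarrow> b \<in> T \<Longrightarrow> a \<otimes> b \<in> P i \<Longrightarrow> a \<in> P i \<or> b \<in> P i"
    and Pchain: "\<And>i. i < n \<Longrightarrow> P i \<subset> P (Suc i)" and mP: "m \<subseteq> P 0"
    and h: "h \<in> Z" "h \<noteq> \<zero>" and ht: "h \<otimes> t \<in> T"
    and m0: "m \<noteq> {\<zero>}"
begin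

lemma T_carr: "a \<in> T \<Longrightarrow> a \<in> carrier S"
  using Tpol smod_carr[OF pol_smod[OF t smod_Z]] by blast

lemma smod_T: "smod T"
  by (rule smodI) (use T_carr TZ Tadd Tmult in auto)

lemma smod_P: "i \<le> n \<Longrightarrow> smod (P i)"
  by (rule smodI) (use PT T_carr TZ P0 Padd Pmult in auto)

lemma P_pow: "i \<le> n \<Longrightarrow> y \<in> T \<Longrightarrow> y \<notin> P i \<Longrightarrow> y [^] (k::nat) \<in> T \<and> y [^] k \<notin> P i"
proof (induction k)
  case 0
  thus ?case using P1 TZ by auto
next
  case (Suc k)
  thus ?case using Tmult Pprime by (metis nat_pow_Suc)
qed

lemma T_pow: "y \<in> T \<Longrightarrow> y [^] (k::nat) \<in> T"
  by (induction k) (use TZ Tmult in auto)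

text \<open>\<open>pspan y B a\<close> collects the powers of \<open>y\<close> below \<open>a\<close> with coefficients in \<open>B\<close>, and \<open>mspan y N k\<close> is the
  \<open>Z\<close>-span of the monomials in the first \<open>k\<close> of the \<open>y\<^sub>i\<close> with all exponents below \<open>N\<close>.\<close>
fun mspan :: "(nat \<Rightarrow> 'a) \<Rightarrow> nat \<Rightarrow> nat \<Rightarrow> 'a set" and pspan :: "'a \<Rightarrow> 'a set \<Rightarrow> nat \<Rightarrow> 'a set" where
  "pspan y B 0 = {\<zero>}"
| "pspan y B (Suc a) = sadd (pspan y B a) (scale (y [^] a) B)"
| "mspan y N 0 = Z"
| "mspan y N (Suc k) = pspan (y k) (mspan y N k) N"

lemma pspan_smod: "smod B \<Longrightarrow> y \<in> carrier S \<Longrightarrow> smod (pspan y B a)"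
  by (induction a) (auto intro!: smod_sadd smod_scale smod_zero nat_pow_closed)

lemma pspan_contains:
  assumes "smod B" "y \<in> carrier S" shows "a < N \<Longrightarrow> scale (y [^] a) B \<subseteq> pspan y B N"
proof (induction N)
  case (Suc N)
  have s: "smod (pspan y B N)" "smod (scale (y [^] N) B)" using pspan_smod assms smod_scale by auto
  show ?case
  proof (cases "a = N")
    case True
    thus ?thesis using sadd_sup2[OF smod_sub[OF s(2)] s(1)] by simp
  next
    case False
    hence "scale (y [^] a) B \<subseteq> pspan y B N" using Suc by auto
    thus ?thesis using sadd_sup1[OF smod_sub[OF s(1)] s(2)] by auto
  qed
qed simp

lemma pspan_least:
  assumes "smod K" "\<And>a b. a < N \<Longrightarrow> b \<in> B \<Longrightarrow> y [^] a \<otimes> b \<in> K" shows "pspan y B N \<subseteq> K"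
  using assms(2)
proof (induction N)
  case (Suc N)
  show ?case unfolding pspan.simps
  proof (rule sadd_least[OF assms(1)])
    show "pspan y B N \<subseteq> K" by (rule Suc.IH) (use Suc.prems in auto)
    show "scale (y [^] N) B \<subseteq> K" using Suc.prems unfolding scale_def by auto
  qed
qed (use smod_0[OF assms(1)] in simp)

lemma mspan_least:
  assumes y: "\<And>i. i < n \<Longrightarrow> y i \<in> T"
    and K: "\<And>k. smod (K k)" "Z \<subseteq> K 0" "\<And>a k b. k < n \<Longrightarrow> a < N \<Longrightarrow> b \<in> K k \<Longrightarrow> y k [^] a \<otimes> b \<in> K (Suc k)"
  shows "k \<le> n \<Longrightarrow> mspan y N k \<subseteq> K k"
proof (induction k)
  case (Suc k)
  show ?case unfolding mspan.simps
    by (rule pspan_least[OF K(1)]) (use Suc K(3)[of k] in auto)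
qed (use K in simp)

lemma mspan_smod: assumes y: "\<And>i. i < n \<Longrightarrow> y i \<in> T" shows "k \<le> n \<Longrightarrow> smod (mspan y N k)"
  by (induction k) (auto intro!: pspan_smod smod_Z T_carr y)

text \<open>The powers of \<open>y\<^sub>k\<close> filter the span into \<open>N\<close> layers modulo the prime that avoids \<open>y\<^sub>k\<close>. A coefficient
  \<open>b\<close> with \<open>y\<^sub>k\<^sup>a b\<close> in the next layer differs from a multiple of \<open>y\<^sub>k\<close> by an element of that prime, hence
  lies in the next larger prime, where the induction hypothesis provides the steps.\<close>
lemma mspan_hc:
  assumes y: "\<And>k. k < n \<Longrightarrow> y k \<in> P (n - k)" "\<And>k. k < n \<Longrightarrow> y k \<notin> P (n - Suc k)"
  shows "k \<le> n \<Longrightarrow> hc (mspan y N k \<inter> P (n - k)) (mspan y N k) (N ^ k)"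
proof (induction k)
  case 0
  have s: "smod (Z \<inter> P n)" using smod_Int[OF smod_Z smod_P[of n]] by simp
  have "hc (Z \<inter> P n) (Z \<inter> P n) 0" by (rule hc_0[OF s]) auto
  from hc_Suc[OF this smod_Z] show ?case using P1[of n] by auto
next
  case (Suc k)
  have yT: "\<And>i. i < n \<Longrightarrow> y i \<in> T" using y(1) PT by (meson diff_le_self subsetD)
  let ?y = "y k" and ?Q = "P (n - Suc k)" and ?B = "mspan y N k" and ?Y = "mspan y N (Suc k)"
  have k: "k < n" using Suc by simp
  have yS: "?y \<in> carrier S" using T_carr yT[OF k] .
  have yp: "?y [^] a \<in> T" "?y [^] a \<notin> ?Q" "?y [^] a \<in> carrier S" for a :: nat using P_pow[of "n - Suc k" ?y a] yT[OF k] y(2)[OF k] T_carr by auto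
  have sB: "smod ?B" using mspan_smod[OF yT] k by simp
  have sY: "smod ?Y" using mspan_smod[OF yT Suc.prems] .
  have BT: "?B \<subseteq> T"
    by (rule mspan_least[OF yT smod_T TZ Tmult[OF T_pow[OF yT]]]) (use k in auto)
  have YT: "?Y \<subseteq> T"
    by (rule mspan_least[OF yT smod_T TZ Tmult[OF T_pow[OF yT]]]) (use k in auto)
  have sQ: "smod ?Q" using smod_P by simp
  define V where "V a = ?Y \<inter> sadd ?Q (scale (?y [^] a) T)" for a :: nat
  have sV: "smod (V a)" for a unfolding V_def using smod_Int[OF sY smod_sadd[OF sQ smod_scale[OF smod_T yp(3)]]] .
  have in_scale: "\<tau> \<in> T \<Longrightarrow> ?y [^] a \<otimes> \<tau> \<in> sadd ?Q (scale (?y [^] a) T)" for a :: nat and \<tau>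
    using sadd_sup2[OF smod_sub[OF smod_scale[OF smod_T yp(3)]] sQ] unfolding scale_def by blast
  have V0: "V 0 = ?Y"
  proof -
    have "?Y \<subseteq> sadd ?Q (scale (?y [^] (0::nat)) T)"
    proof
      fix u assume "u \<in> ?Y"
      hence u: "u \<in> T" using YT by auto
      have "?y [^] (0::nat) \<otimes> u = u" using T_carr[OF u] by simp
      thus "u \<in> sadd ?Q (scale (?y [^] (0::nat)) T)" using in_scale[OF u, of 0] by simp
    qed
    thus ?thesis unfolding V_def by blast
  qed
  have step: "hc (V (Suc a)) (V a) (N ^ k)" if a: "a < N" for a
  proof -
    have "hc (V (Suc a)) (sadd (V (Suc a)) (scale (?y [^] a) ?B)) (N ^ k)"
    proof (rule hc_mult_up[OF _ sV yp(3)])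
      show "hc (?B \<inter> P (n - k)) ?B (N ^ k)" by (rule Suc.IH) (use k in simp)
      show "?B \<subseteq> carrier S" using smod_sub[OF sB] .
      fix b assume b: "b \<in> ?B" "?y [^] a \<otimes> b \<in> V (Suc a)"
      have bT: "b \<in> T" using b BT by auto
      obtain p \<tau> where p: "p \<in> ?Q" "\<tau> \<in> T" "?y [^] a \<otimes> b = p \<oplus> ?y [^] Suc a \<otimes> \<tau>"
        using b(2) unfolding V_def sadd_def scale_def by blast
      have c: "b \<in> carrier S" "p \<in> carrier S" "\<tau> \<in> carrier S" "?y [^] a \<in> carrier S" "?y \<in> carrier S"
        using T_carr[OF bT] T_carr[OF p(2)] smod_carr[OF sQ p(1)] yp yS by auto
      have e: "?y [^] a \<otimes> b = p \<oplus> (?y [^] a \<otimes> ?y) \<otimes> \<tau>" using p(3) unfolding nat_pow_Suc .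
      \<comment> \<open>cancel \<open>y\<^sub>k\<^sup>a\<close>, which is outside the prime\<close>
      have "?y [^] a \<otimes> (b \<ominus> ?y \<otimes> \<tau>) = ?y [^] a \<otimes> b \<ominus> (?y [^] a \<otimes> ?y) \<otimes> \<tau>" using c by algebra
      also have "\<dots> = p" unfolding e using c by algebra
      finally have "?y [^] a \<otimes> (b \<ominus> ?y \<otimes> \<tau>) \<in> ?Q" using p(1) by simp
      moreover have yt: "b \<ominus> ?y \<otimes> \<tau> \<in> T" using smod_diff[OF smod_T bT Tmult[OF yT[OF k] p(2)]] .
      ultimately have bQ: "b \<ominus> ?y \<otimes> \<tau> \<in> ?Q" using Pprime[OF diff_le_self yp(1)[of a] yt] yp(2)[of a] by blast
      have "n - k = Suc (n - Suc k)" using k by simp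
      hence QP: "?Q \<subseteq> P (n - k)" using Pchain[of "n - Suc k"] k by auto
      have "\<tau> \<otimes> ?y \<in> P (n - k)" using Pmult[OF _ p(2) y(1)[OF k]] by simp
      hence "(b \<ominus> ?y \<otimes> \<tau>) \<oplus> \<tau> \<otimes> ?y \<in> P (n - k)" using Padd bQ QP by auto
      moreover have "(b \<ominus> ?y \<otimes> \<tau>) \<oplus> \<tau> \<otimes> ?y = b" using c by algebra
      ultimately show "b \<in> ?B \<inter> P (n - k)" using b by simp
    qed
    moreover have "sadd (V (Suc a)) (scale (?y [^] a) ?B) \<subseteq> V a"
    proof (rule sadd_least[OF sV])
      have "scale (?y [^] Suc a) T \<subseteq> scale (?y [^] a) T"
      proof
        fix u assume "u \<in> scale (?y [^] Suc a) T"
        then obtain \<tau> where "\<tau> \<in> T" "u = ?y [^] Suc a \<otimes> \<tau>" unfolding scale_def by auto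
        hence "u = ?y [^] a \<otimes> (?y \<otimes> \<tau>)" "?y \<otimes> \<tau> \<in> T" using yS T_carr Tmult yT[OF k] by (auto simp: m_assoc)
        thus "u \<in> scale (?y [^] a) T" unfolding scale_def by blast
      qed
      thus "V (Suc a) \<subseteq> V a" unfolding V_def using sadd_mono[OF order_refl] by blast
      show "scale (?y [^] a) ?B \<subseteq> V a"
      proof
        fix u assume u: "u \<in> scale (?y [^] a) ?B"
        then obtain b where b: "b \<in> ?B" "u = ?y [^] a \<otimes> b" unfolding scale_def by auto
        have "u \<in> ?Y" using pspan_contains[OF sB yS a] u by auto
        thus "u \<in> V a" unfolding V_def using in_scale[of b a] b BT by auto
      qed
    qed
    ultimately show ?thesis using hc_mono by blast
  qed
  have "hc (V N) (V 0) (N * N ^ k)" by (rule hc_iterate[where V = V, OF _ sV]) (rule step)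
  moreover have "?Y \<inter> ?Q \<subseteq> V N" unfolding V_def
    using sadd_sup1[OF smod_sub[OF sQ] smod_scale[OF smod_T yp(3)]] by blast
  ultimately show ?case using V0 hc_mono[OF _ _ order_refl] by simp
qed

context
  fixes xs :: "'a list" and c :: nat
  assumes xs: "set xs \<subseteq> m" and c: "len (sgen {\<zero>} xs 1) Z \<le> enat c"
begin

text \<open>If \<open>n > e\<close>, comparing the two counts gives \<open>M\<^sup>n\<^sup>+\<^sup>1 \<le> C M\<^sup>e\<^sup>+\<^sup>1\<close> for all \<open>M\<close>, which is false for \<open>M = C + 1\<close>.\<close>
theorem dim_bound: "n \<le> length xs"
proof (rule ccontr)
  interpret domain S by (rule dom)
  assume "\<not> ?thesis"
  hence nx: "Suc (length xs) \<le> n" by simp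
  have "\<exists>y. y \<in> P (n - k) \<and> y \<notin> P (n - Suc k)" if "k < n" for k
    using Pchain[of "n - Suc k"] that by (auto simp: Suc_diff_Suc)
  then obtain y where y: "\<And>k. k < n \<Longrightarrow> y k \<in> P (n - k)" "\<And>k. k < n \<Longrightarrow> y k \<notin> P (n - Suc k)" by metis
  have yT: "\<And>i. i < n \<Longrightarrow> y i \<in> T" using y(1) PT by (meson diff_le_self subsetD)
  obtain F where F: "finite F" "F \<subseteq> m" "\<And>K. smod K \<Longrightarrow> F \<subseteq> K \<Longrightarrow> m \<subseteq> K" using finitely_generated[OF m(1,2)] by blast
  have "\<exists>b. \<forall>i<n. y i \<in> pol t Z b"
  proof -
    have "\<exists>b. \<forall>i<j. y i \<in> pol t Z b" if "j \<le> n" for j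
      using that
    proof (induction j)
      case (Suc j)
      then obtain b where b: "\<forall>i<j. y i \<in> pol t Z b" by auto
      obtain b' where b': "y j \<in> pol t Z b'" using yT[of j] Tpol Suc.prems by auto
      have "\<forall>i<Suc j. y i \<in> pol t Z (max b b')"
        using b b' pol_mono[OF t smod_Z, of b "max b b'"] pol_mono[OF t smod_Z, of b' "max b b'"] by (auto simp: less_Suc_eq)
      thus ?case by blast
    qed simp
    thus ?thesis by blast
  qed
  then obtain b where b: "\<And>i. i < n \<Longrightarrow> y i \<in> pol t Z b" by blast
  \<comment> \<open>a finitely generated subring of \<open>T\<close> containing all \<open>y\<^sub>k\<close> and \<open>h t\<close>, graded by the powers of the extension of \<open>m\<close>\<close>
  define G where "G = (\<lambda>i. (y i, 0::nat)) ` {..<n} \<union> {(h \<otimes> t, 0)} \<union> (\<lambda>g. (g, 1)) ` F"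
  have finG: "finite G" unfolding G_def using F(1) by simp
  have Gc: "G \<subseteq> carrier S \<times> UNIV" unfolding G_def using yT T_carr ht F(2) m(2) by auto
  let ?A = "gal G"
  have A: "gring ?A" by (rule gal_gring[OF Gc])
  have sA: "smod (?A c)" for c using gring_smod[OF A] .
  have ZA: "z \<in> Z \<Longrightarrow> z \<in> ?A 0" for z using gringD(4)[OF A] .
  have yA: "i < n \<Longrightarrow> y i \<in> ?A 0" for i by (rule gal_gen) (auto simp: G_def)
  have htA: "h \<otimes> t \<in> ?A 0" by (rule gal_gen) (auto simp: G_def)
  have mA: "m \<subseteq> ?A 1" by (rule F(3)[OF sA]) (auto simp: G_def intro: gal_gen)
  have AT: "?A c \<subseteq> (if c = 0 then T else P 0)" for c
  proof (rule gal_least[where A = "\<lambda>c. if c = 0 then T else P 0"])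
    show "gring (\<lambda>c. if c = 0 then T else P 0)"
    proof (rule gringI)
      show "(if n = 0 then T else P 0) \<subseteq> carrier S" for n :: nat using T_carr PT[of 0] by auto
      show "\<zero> \<in> (if n = 0 then T else P 0)" for n :: nat using TZ P0[of 0] by auto
      show "a \<oplus> b \<in> (if n = 0 then T else P 0)" if "a \<in> (if n = 0 then T else P 0)" "b \<in> (if n = 0 then T else P 0)" for a b and n :: nat
        using that Tadd Padd[of 0] by (auto split: if_splits)
      fix i j :: nat and a b
      assume ab: "a \<in> (if i = 0 then T else P 0)" "b \<in> (if j = 0 then T else P 0)"
      hence aT: "a \<in> T" "b \<in> T" using PT[of 0] by (auto split: if_splits)
      show "a \<otimes> b \<in> (if i + j = 0 then T else P 0)"
        using ab Tmult[OF aT] Pmult[of 0 a b] Pmult[of 0 b a] aT m_comm[OF T_carr[OF aT(1)] T_carr[OF aT(2)]]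
        by (auto split: if_splits)
    qed (use TZ in auto)
    show "g \<in> (if e = 0 then T else P 0)" if "(g, e) \<in> G" for g e
      using that yT ht F(2) mP by (auto simp: G_def)
  qed
  have dec: "?A (Suc c) \<subseteq> ?A c" for c
  proof -
    have "?A c \<subseteq> {a \<in> ?A c. a \<in> ?A (c - 1)}" for c
    proof (rule gal_least)
      show "gring (\<lambda>c. {a \<in> ?A c. a \<in> ?A (c - 1)})"
      proof (rule gringI)
        fix i j a b assume ab: "a \<in> {a \<in> ?A i. a \<in> ?A (i - 1)}" "b \<in> {a \<in> ?A j. a \<in> ?A (j - 1)}"
        have "a \<otimes> b \<in> ?A (i + j - 1)"
        proof (cases "i = 0")
          case False
          thus ?thesis using ab gringD(5)[OF A, of a "i - 1" b j] by simp
        next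
          case True
          thus ?thesis using ab gringD(5)[OF A, of a i b "j - 1"] by simp
        qed
        thus "a \<otimes> b \<in> {a \<in> ?A (i + j). a \<in> ?A (i + j - 1)}" using ab gringD(5)[OF A, of a i b j] by simp
      qed (use gringD[OF A] in auto)
      show "g \<in> {a \<in> ?A e. a \<in> ?A (e - 1)}" if "(g, e) \<in> G" for g e
        using gal_gen[OF that] that F(2) m(2) ZA by (auto simp: G_def)
    qed
    from this[of "Suc c"] show ?thesis by auto
  qed
  have decm: "i \<le> j \<Longrightarrow> ?A j \<subseteq> ?A i" for i j using lift_Suc_antimono_le[of ?A] dec by blast
  have mpow: "x \<in> m \<Longrightarrow> x [^] k \<in> ?A k" for x and k :: nat
  proof (induction k)
    case (Suc k)
    thus ?case using gringD(5)[OF A, of "x [^] k" k x 1] mA by auto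
  qed (use ZA in auto)
  \<comment> \<open>dividing by \<open>w\<close> or \<open>h\<close> costs a bounded number of powers of the extended ideal\<close>
  obtain w where w: "w \<in> m" "w \<noteq> \<zero>" using m0 smod_0[OF m(1)] by blast
  have wZ: "w \<in> Z" using w m by auto
  obtain kw where kw: "\<And>c z. z \<in> ?A 0 \<Longrightarrow> w \<otimes> z \<in> ?A c \<Longrightarrow> z \<in> ?A (c - kw)"
    using artin_rees[OF dom finG Gc dec ZA[OF wZ] w(2)] by blast
  obtain kh where kh: "\<And>c z. z \<in> ?A 0 \<Longrightarrow> h \<otimes> z \<in> ?A c \<Longrightarrow> z \<in> ?A (c - kh)"
    using artin_rees[OF dom finG Gc dec ZA[OF h(1)] h(2)] by blast
  have iter: "z \<in> ?A (c - k * i)" if g: "g \<in> Z" and kg: "\<And>c z. z \<in> ?A 0 \<Longrightarrow> g \<otimes> z \<in> ?A c \<Longrightarrow> z \<in> ?A (c - k)"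
    and z: "z \<in> ?A 0" and gz: "g [^] i \<otimes> z \<in> ?A c" for g k z c and i :: nat
    using gz
  proof (induction i arbitrary: c)
    case 0
    thus ?case using gringD(6)[OF A z] by simp
  next
    case (Suc i)
    have zS: "z \<in> carrier S" using gringD(6)[OF A z] .
    have "g \<otimes> (g [^] i \<otimes> z) = g [^] Suc i \<otimes> z" using zS g by (simp add: m_ac)
    hence "g \<otimes> (g [^] i \<otimes> z) \<in> ?A c" using Suc.prems by simp
    hence "g [^] i \<otimes> z \<in> ?A (c - k)" by (rule kg[rotated]) (use smod_mult[OF sA Z_pow[OF g] z] in auto)
    from Suc.IH[OF this] show ?case by (simp add: algebra_simps)
  qed
  \<comment> \<open>the powers of the extended ideal localised at the smallest prime and contracted; with \<open>ord\<close> it behaves like an order function on powers of \<open>w\<close>\<close>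
  define N where "N j = {z \<in> ?A 0. \<exists>s\<in>?A 0. s \<notin> P 0 \<and> s \<otimes> z \<in> ?A j}" for j
  have A0T: "s \<in> ?A 0 \<Longrightarrow> s \<in> T" for s using AT[of 0] by auto
  have sN: "smod (N j)" for j
  proof (rule smodI)
    show "N j \<subseteq> carrier S" unfolding N_def using gringD(6)[OF A] by auto
    show "\<zero> \<in> N j" unfolding N_def using gringD(2)[OF A] P1[of 0] ZA[of \<one>] by (auto intro!: bexI[of _ \<one>])
    show "u \<oplus> v \<in> N j" if uv: "u \<in> N j" "v \<in> N j" for u v
    proof -
      obtain r s where rs: "r \<in> ?A 0" "s \<in> ?A 0" "r \<notin> P 0" "s \<notin> P 0" "r \<otimes> u \<in> ?A j" "s \<otimes> v \<in> ?A j" "u \<in> ?A 0" "v \<in> ?A 0"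
        using uv unfolding N_def by auto
      have cc: "r \<in> carrier S" "s \<in> carrier S" "u \<in> carrier S" "v \<in> carrier S" using rs gringD(6)[OF A] by blast+
      have "(r \<otimes> s) \<otimes> (u \<oplus> v) = s \<otimes> (r \<otimes> u) \<oplus> r \<otimes> (s \<otimes> v)" using cc by algebra
      moreover have "s \<otimes> (r \<otimes> u) \<oplus> r \<otimes> (s \<otimes> v) \<in> ?A j"
        using gringD(3)[OF A gringD(5)[OF A rs(2,5)]] gringD(5)[OF A rs(1,6)] by simp
      moreover have "r \<otimes> s \<in> ?A 0" using gringD(5)[OF A rs(1,2)] by simp
      moreover have "r \<otimes> s \<notin> P 0" using Pprime[of 0 r s] A0T rs by auto
      ultimately show ?thesis unfolding N_def using gringD(3)[OF A rs(7,8)] by auto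
    qed
    show "z \<otimes> u \<in> N j" if zu: "z \<in> Z" "u \<in> N j" for z u
    proof -
      obtain r where rs: "r \<in> ?A 0" "r \<notin> P 0" "r \<otimes> u \<in> ?A j" "u \<in> ?A 0" using zu unfolding N_def by auto
      have cc: "r \<in> carrier S" "u \<in> carrier S" "z \<in> carrier S" using rs gringD(6)[OF A] zu by blast+
      have "r \<otimes> (z \<otimes> u) = z \<otimes> (r \<otimes> u)" using cc by algebra
      thus ?thesis unfolding N_def using rs smod_mult[OF sA zu(1)] by auto
    qed
  qed
  have AN: "?A j \<subseteq> N j" for j
  proof
    fix u assume u: "u \<in> ?A j"
    hence "u \<in> ?A 0" using decm[of 0 j] by auto
    moreover have "\<one> \<otimes> u \<in> ?A j" using u gringD(6)[OF A u] by simp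
    ultimately show "u \<in> N j" unfolding N_def using ZA[of \<one>] P1[of 0] by auto
  qed
  have Ndec: "i \<le> j \<Longrightarrow> N j \<subseteq> N i" for i j unfolding N_def using decm[of i j] by blast
  have wp: "w [^] i \<in> Z" for i :: nat using wZ by auto
  have wN: "w [^] i \<in> N i" for i :: nat using AN mpow[OF w(1)] by blast
  have wN': "j \<le> kw * i" if wi: "w [^] i \<in> N j" for i j
  proof -
    obtain s where s: "s \<in> ?A 0" "s \<notin> P 0" "s \<otimes> w [^] i \<in> ?A j" using wi unfolding N_def by auto
    have "w [^] i \<otimes> s \<in> ?A j" using s(3) m_comm gringD(6)[OF A s(1)] wp by simp
    from iter[OF wZ kw s(1) this] have "s \<in> ?A (j - kw * i)" .
    hence "j - kw * i = 0" using AT[of "j - kw * i"] s(2) by (auto split: if_splits)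
    thus ?thesis by simp
  qed
  define ord where "ord i = (GREATEST j. w [^] i \<in> N j)" for i :: nat
  have o1: "w [^] i \<in> N (ord i)" for i unfolding ord_def by (rule GreatestI_nat[OF wN]) (use wN' in blast)
  have o2: "w [^] i \<in> N j \<Longrightarrow> j \<le> ord i" for i j unfolding ord_def by (rule Greatest_le_nat) (use wN' in blast)+
  have oS: "Suc (ord i) \<le> ord (Suc i)" for i
  proof (rule o2)
    obtain s where s: "s \<in> ?A 0" "s \<notin> P 0" "s \<otimes> w [^] i \<in> ?A (ord i)" using o1[of i] unfolding N_def by auto
    have "s \<otimes> w [^] Suc i = (s \<otimes> w [^] i) \<otimes> w" using gringD(6)[OF A s(1)] wp wZ by (simp add: m_assoc)
    moreover have "(s \<otimes> w [^] i) \<otimes> w \<in> ?A (ord i + 1)" using gringD(5)[OF A s(3), of w 1] mA w by auto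
    moreover have "w [^] Suc i \<in> ?A 0" using ZA[OF wp[of "Suc i"]] .
    ultimately show "w [^] Suc i \<in> N (Suc (ord i))" unfolding N_def using s by auto
  qed
  \<comment> \<open>lower bound against upper bound for a chain in degree at most \<open>n M b\<close>\<close>
  have key: "M ^ Suc n \<le> (n * (M * b) + 1) * (((kw + kh * n * b) * M) ^ length xs * c)" if M: "M \<ge> 1" for M :: nat
  proof -
    let ?D = "n * (M * b)"
    let ?Y = "mspan y M n"
    have sY: "smod ?Y" by (rule mspan_smod[OF yT order_refl])
    have YA: "?Y \<subseteq> ?A 0"
    proof (rule mspan_least[OF yT sA _ _ order_refl])
      show "Z \<subseteq> ?A 0" using ZA by auto
      show "y k [^] a \<otimes> b \<in> ?A 0" if "k < n" "b \<in> ?A 0" for a :: nat and k b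
      proof -
        have pw: "y k [^] a \<in> ?A 0" for a :: nat
        proof (induction a)
          case (Suc a)
          show ?case using gringD(5)[OF A Suc.IH yA[OF that(1)]] by simp
        qed (use ZA in auto)
        from gringD(5)[OF A pw[of a] that(2)] show ?thesis by simp
      qed
    qed
    have Ypol: "?Y \<subseteq> pol t Z ?D"
    proof (rule mspan_least[where K = "\<lambda>k. pol t Z (k * (M * b))", OF yT pol_smod[OF t smod_Z] _ _ order_refl])
      show "Z \<subseteq> pol t Z (0 * (M * b))" by simp
      fix a k :: nat and u assume "k < n" "a < M" "u \<in> pol t Z (k * (M * b))"
      hence "y k [^] a \<otimes> u \<in> pol t Z (a * b + k * (M * b))" using pol_mult[OF t pol_pow[OF t b]] by blast
      moreover have "a * b + k * (M * b) \<le> Suc k * (M * b)" using \<open>a < M\<close> by simp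
      ultimately show "y k [^] a \<otimes> u \<in> pol t Z (Suc k * (M * b))" using pol_mono[OF t smod_Z] by blast
    qed
    have hY: "hc (?Y \<inter> P 0) ?Y (M ^ n)" using mspan_hc[OF y, of n M] by simp
    let ?G = "pol t Z ?D"
    have sG: "smod ?G" by (rule pol_smod[OF t smod_Z])
    define W where "W i = N (ord i) \<inter> ?G" for i
    have sW: "smod (W i)" for i unfolding W_def by (rule smod_Int[OF sN sG])
    have step: "hc (W (Suc i)) (W i) (M ^ n)" for i
    proof -
      let ?N = "N (Suc (ord i)) \<inter> ?G"
      have s: "smod ?N" by (rule smod_Int[OF sN sG])
      have "hc ?N (sadd ?N (scale (w [^] i) ?Y)) (M ^ n)"
      proof (rule hc_mult_up[OF hY s Z_carr[OF wp] smod_sub[OF sY]])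
        fix u assume u: "u \<in> ?Y" "w [^] i \<otimes> u \<in> ?N"
        show "u \<in> ?Y \<inter> P 0"
        proof (rule ccontr)
          assume "u \<notin> ?Y \<inter> P 0"
          hence uP: "u \<notin> P 0" using u by simp
          have uA: "u \<in> ?A 0" using u YA by auto
          obtain s where s: "s \<in> ?A 0" "s \<notin> P 0" "s \<otimes> (w [^] i \<otimes> u) \<in> ?A (Suc (ord i))" using u(2) unfolding N_def by auto
          have cc: "s \<in> carrier S" "u \<in> carrier S" "w [^] i \<in> carrier S" using gringD(6)[OF A s(1)] gringD(6)[OF A uA] wp by auto
          have "s \<otimes> (w [^] i \<otimes> u) = (s \<otimes> u) \<otimes> w [^] i" using cc by algebra
          hence "(s \<otimes> u) \<otimes> w [^] i \<in> ?A (Suc (ord i))" using s(3) by simp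
          moreover have "s \<otimes> u \<in> ?A 0" using gringD(5)[OF A s(1) uA] by simp
          moreover have "s \<otimes> u \<notin> P 0" using Pprime[of 0 s u] A0T s uP uA by auto
          ultimately have "w [^] i \<in> N (Suc (ord i))" unfolding N_def using ZA[OF wp] by auto
          thus False using o2 by fastforce
        qed
      qed
      moreover have "W (Suc i) \<subseteq> ?N" unfolding W_def using Ndec[OF oS] by blast
      moreover have "sadd ?N (scale (w [^] i) ?Y) \<subseteq> W i"
      proof (rule sadd_least[OF sW])
        show "?N \<subseteq> W i" unfolding W_def using Ndec[of "ord i" "Suc (ord i)"] by auto
        show "scale (w [^] i) ?Y \<subseteq> W i"
        proof
          fix u assume "u \<in> scale (w [^] i) ?Y"
          then obtain v where v: "v \<in> ?Y" "u = w [^] i \<otimes> v" unfolding scale_def by auto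
          have vA: "v \<in> ?A 0" using v YA by auto
          obtain s where s: "s \<in> ?A 0" "s \<notin> P 0" "s \<otimes> w [^] i \<in> ?A (ord i)" using o1[of i] unfolding N_def by auto
          have cc: "s \<in> carrier S" "v \<in> carrier S" "w [^] i \<in> carrier S" using gringD(6)[OF A s(1)] gringD(6)[OF A vA] wp by auto
          have "s \<otimes> u = (s \<otimes> w [^] i) \<otimes> v" unfolding v(2) using cc by algebra
          moreover have "(s \<otimes> w [^] i) \<otimes> v \<in> ?A (ord i)" using gringD(5)[OF A s(3) vA] by simp
          ultimately have "u \<in> N (ord i)" unfolding N_def using s smod_mult[OF sA wp vA] v by auto
          moreover have "u \<in> ?G" using smod_mult[OF sG wp] Ypol v by auto
          ultimately show "u \<in> W i" unfolding W_def by simp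
        qed
      qed
      ultimately show ?thesis by (rule hc_mono)
    qed
    have hW: "hc (W M) (W 0) (M * M ^ n)" by (rule hc_iterate[where V = W, OF _ sW]) (rule step)
    \<comment> \<open>the order of \<open>w\<^sup>M\<close> is at most \<open>kw M\<close>, and multiplying by \<open>h\<^sup>D\<close> to bring \<open>t\<^sup>D\<close> into the subring costs \<open>kh D\<close> more\<close>
    let ?s = "(kw + kh * n * b) * M"
    let ?a = "sgen {\<zero>} xs ?s"
    have xsZ: "set xs \<subseteq> Z" using xs m by auto
    have sa: "smod ?a" by (rule sgen_smod[OF smod_zero xsZ])
    have aZ: "?a \<subseteq> Z" by (rule sgen_least) (use xsZ smod_Z in auto)
    have aA: "?a \<subseteq> ?A ?s" by (rule sgen_least[OF sA]) (use gringD(2)[OF A] xs xsZ mpow in auto)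
    have la: "len ?a Z \<le> enat (?s ^ length xs * c)" by (rule len_powers[OF smod_zero _ xsZ c]) simp
    let ?E = "pol t ?a ?D"
    have sE: "smod ?E" by (rule pol_smod[OF t sa])
    have hD: "u \<in> pol t ?a D \<Longrightarrow> h [^] D \<otimes> u \<in> ?A ?s" for u D
    proof (induction D arbitrary: u)
      case 0
      thus ?case using aA smod_carr[OF sa] by auto
    next
      case (Suc D)
      obtain v a where va: "v \<in> pol t ?a D" "a \<in> ?a" "u = v \<oplus> t [^] Suc D \<otimes> a"
        using Suc.prems unfolding pol.simps sadd_def scale_def by blast
      have cc: "v \<in> carrier S" "a \<in> carrier S" "t [^] Suc D \<in> carrier S" "h \<in> carrier S" "h [^] D \<in> carrier S" "h [^] Suc D \<in> carrier S"
        using smod_carr[OF pol_smod[OF t sa] va(1)] smod_carr[OF sa va(2)] t h by auto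
      have e1: "h [^] Suc D \<otimes> v = h \<otimes> (h [^] D \<otimes> v)" using cc by (simp add: m_ac)
      have e2: "h [^] Suc D \<otimes> u = h [^] Suc D \<otimes> v \<oplus> (h [^] Suc D \<otimes> t [^] Suc D) \<otimes> a"
        unfolding va(3) using cc by algebra
      have e3: "h [^] Suc D \<otimes> t [^] Suc D = (h \<otimes> t) [^] Suc D" using t cc nat_pow_distrib[of h t "Suc D"] by simp
      have htp: "(h \<otimes> t) [^] k \<in> ?A 0" for k :: nat
      proof (induction k)
        case (Suc k)
        show ?case using gringD(5)[OF A Suc.IH htA] by simp
      qed (use ZA in auto)
      have "(h \<otimes> t) [^] Suc D \<otimes> a \<in> ?A (0 + ?s)"
        by (rule gringD(5)[OF A htp]) (use aA va(2) in blast)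
      hence "(h \<otimes> t) [^] Suc D \<otimes> a \<in> ?A ?s" by (simp only: add_0)
      moreover have "h \<otimes> (h [^] D \<otimes> v) \<in> ?A ?s" using smod_mult[OF sA h(1) Suc.IH[OF va(1)]] .
      ultimately show ?case unfolding e2 e1 e3 using gringD(3)[OF A] by blast
    qed
    \<comment> \<open>polynomials with coefficients in a high power lie deep in the filtration, so the chain persists modulo them\<close>
    have EW: "?E \<inter> W 0 \<subseteq> W M"
    proof
      fix u assume u: "u \<in> ?E \<inter> W 0"
      have uA: "u \<in> ?A 0" using u unfolding W_def N_def by auto
      have "u \<in> ?A (?s - kh * ?D)" by (rule iter[OF h(1) kh uA hD]) (use u in auto)
      moreover have "?s - kh * ?D = kw * M" by (simp add: algebra_simps)
      moreover have "ord M \<le> kw * M" using wN'[OF o1] .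
      ultimately have "u \<in> N (ord M)" using AN[of "kw * M"] Ndec[of "ord M" "kw * M"] by auto
      thus "u \<in> W M" using u unfolding W_def by auto
    qed
    have "hc (?E \<inter> W 0) (W 0) (M * M ^ n)" by (rule hc_mono[OF hW EW order_refl])
    hence "hc ?E (sadd ?E (scale \<one> (W 0))) (M * M ^ n)"
      by (rule hc_mult_up[OF _ sE one_closed smod_sub[OF sW]]) (use smod_carr[OF sW] in auto)
    moreover have "sadd ?E (scale \<one> (W 0)) \<subseteq> ?G"
    proof (rule sadd_least[OF sG])
      show "?E \<subseteq> ?G" by (rule pol_sub[OF t aZ])
      show "scale \<one> (W 0) \<subseteq> ?G" unfolding scale_def W_def using smod_carr[OF sG] by auto
    qed
    ultimately have "hc ?E ?G (M * M ^ n)" using hc_mono[OF _ order_refl] by blast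
    hence "enat (M * M ^ n) \<le> len ?E ?G" by (rule len_ge)
    also have "\<dots> \<le> enat ((?D + 1) * (?s ^ length xs * c))" by (rule len_pol[OF t sa aZ la])
    finally show ?thesis by simp
  qed
  define e where "e = length xs"
  define C where "C = (n * b + 1) * ((kw + kh * n * b) ^ e * c)"
  define M where "M = C + 1"
  have M: "M \<ge> 1" unfolding M_def by simp
  have "M ^ Suc (Suc e) \<le> M ^ Suc n" by (rule power_increasing) (use nx M in \<open>auto simp: e_def\<close>)
  also have "\<dots> \<le> (n * (M * b) + 1) * (((kw + kh * n * b) * M) ^ e * c)" using key[OF M] by (simp add: e_def)
  also have "\<dots> \<le> ((n * b + 1) * M) * (((kw + kh * n * b) * M) ^ e * c)"
    using M by (intro mult_right_mono) (auto simp: algebra_simps)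
  also have "\<dots> = C * M ^ Suc e" unfolding C_def power_mult_distrib by (simp add: algebra_simps)
  also have "\<dots> < M * M ^ Suc e" using M by (intro mult_strict_right_mono) (auto simp: M_def)
  finally show False by simp
qed

end

end

end

section \<open>Ideals of local rings\<close>

context cring
begin

lemma const_ring_carrier: "const_ring R (carrier R)"
  by (intro const_ring.intro const_ring_axioms.intro is_cring carrier_is_subring)

lemma smod_iff_ideal: "const_ring.smod R (carrier R) N \<longleftrightarrow> ideal N R"
proof -
  interpret C: const_ring R "carrier R" by (rule const_ring_carrier)
  show ?thesis
  proof
    assume N: "C.smod N"
    show "ideal N R"
    proof (rule idealI[OF ring_axioms])
      show "subgroup N (add_monoid R)"
        by (rule add.subgroupI)
          (use N C.smod_carr C.smod_0 C.smod_add C.smod_neg in \<open>auto simp: a_inv_def[symmetric]\<close>)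
      fix a x assume ax: "a \<in> N" "x \<in> carrier R"
      show xa: "x \<otimes> a \<in> N" using C.smod_mult[OF N ax(2,1)] .
      thus "a \<otimes> x \<in> N" using m_comm[OF C.smod_carr[OF N ax(1)] ax(2)] by simp
    qed
  next
    assume "ideal N R"
    then interpret ideal N R .
    show "C.smod N" by (rule C.smodI) (auto intro: I_l_closed)
  qed
qed

lemma primeideal_one: "primeideal N R \<Longrightarrow> \<one> \<notin> N"
  using primeideal.I_notcarr ideal.one_imp_carrier primeideal.axioms(1) by fastforce

end

lemma (in noetherian_ring) acc_ideals:
  assumes L: "\<And>i::nat. ideal (L i) R" "\<And>i. L i \<subseteq> L (Suc i)"
  shows "\<exists>k. \<forall>i\<ge>k. L i = L k"
proof -
  have mono: "i \<le> j \<Longrightarrow> L i \<subseteq> L j" for i j using lift_Suc_mono_le[of L] L(2) by blast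
  have "subset.chain {I. ideal I R} (range L)"
  proof -
    have "L i \<subseteq> L j \<or> L j \<subseteq> L i" for i j using mono[of i j] mono[of j i] by linarith
    thus ?thesis unfolding subset_chain_def using L(1) by blast
  qed
  hence "\<Union>(range L) \<in> range L" by (intro ideal_chain_is_trivial) auto
  then obtain k where k: "\<Union>(range L) = L k" by auto
  have "L i = L k" if "i \<ge> k" for i
  proof
    show "L i \<subseteq> L k" using k by blast
    show "L k \<subseteq> L i" using mono[OF that] .
  qed
  thus ?thesis by blast
qed

lemma local_ringD:
  assumes "local_ring R"
  shows "cring R" "noetherian_ring R" "maximalideal (max_ideal R) R" "maximalideal M R \<Longrightarrow> M = max_ideal R"
proof -
  show "cring R" "noetherian_ring R" using assms unfolding local_ring_def by auto
  have u: "\<exists>!M. maximalideal M R" using assms unfolding local_ring_def by auto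
  show "maximalideal (max_ideal R) R" unfolding max_ideal_def by (rule theI'[OF u])
  thus "maximalideal M R \<Longrightarrow> M = max_ideal R" using u by blast
qed

lemma local_ring_proper_ideal:
  assumes R: "local_ring R" and N: "ideal N R" "N \<noteq> carrier R"
  shows "N \<subseteq> max_ideal R"
proof -
  interpret cring R by (rule local_ringD(1)[OF R])
  interpret noetherian_ring R by (rule local_ringD(2)[OF R])
  let ?P = "\<lambda>I. ideal I R \<and> N \<subseteq> I \<and> I \<noteq> carrier R"
  have "\<exists>I. ?P I \<and> (\<forall>J. ?P J \<longrightarrow> \<not> I \<subset> J)"
  proof (rule exists_maximal_no_chain[where R = "(\<subset>)"])
    show "?P N" using N by auto
    fix f :: "nat \<Rightarrow> 'a set" assume f: "\<And>i. ?P (f i)" "\<And>i. f i \<subset> f (Suc i)"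
    obtain k where k: "\<forall>i\<ge>k. f i = f k" using acc_ideals[of f] f by blast
    have "f (Suc k) = f k" using k[rule_format, of "Suc k"] by linarith
    thus False using f(2)[of k] by auto
  qed
  then obtain I where I: "?P I" "\<And>J. ?P J \<Longrightarrow> \<not> I \<subset> J" by blast
  have "maximalideal I R"
  proof (rule maximalidealI)
    show "ideal I R" "carrier R \<noteq> I" using I by auto
    fix J assume "ideal J R" "I \<subseteq> J" "J \<subseteq> carrier R"
    thus "J = I \<or> J = carrier R" using I by blast
  qed
  hence "I = max_ideal R" by (rule local_ringD(4)[OF R])
  thus ?thesis using I by simp
qed

text \<open>Local rings in the sense of \<open>local_ring\<close> are instances of the setting above, with the ring as its own
  ring of constants.\<close>
lemma local_ring_base:
  assumes R: "local_ring R"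
  shows "local_base R (carrier R) (max_ideal R)"
proof -
  interpret cring R by (rule local_ringD(1)[OF R])
  interpret C: const_ring R "carrier R" by (rule const_ring_carrier)
  interpret M: maximalideal "max_ideal R" R by (rule local_ringD(3)[OF R])
  show ?thesis
  proof (unfold_locales)
    show "C.smod (max_ideal R)" using smod_iff_ideal M.is_ideal by simp
    show "max_ideal R \<subseteq> carrier R" using M.a_subset by auto
    show "\<one>\<^bsub>R\<^esub> \<notin> max_ideal R" using M.I_notcarr ideal.one_imp_carrier[OF M.is_ideal] by auto
    fix z assume z: "z \<in> carrier R" "z \<notin> max_ideal R"
    have "z \<in> PIdl\<^bsub>R\<^esub> z" using cgenideal_self[OF z(1)] .
    hence "PIdl\<^bsub>R\<^esub> z = carrier R" using local_ring_proper_ideal[OF R cgenideal_ideal[OF z(1)]] z by auto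
    hence "\<one>\<^bsub>R\<^esub> \<in> PIdl\<^bsub>R\<^esub> z" by simp
    then obtain w where "w \<in> carrier R" "\<one>\<^bsub>R\<^esub> = w \<otimes>\<^bsub>R\<^esub> z" unfolding cgenideal_def by auto
    thus "\<exists>w\<in>carrier R. z \<otimes>\<^bsub>R\<^esub> w = \<one>\<^bsub>R\<^esub>" using z m_comm by metis
  next
    fix L :: "nat \<Rightarrow> 'a set" assume L: "\<And>i. C.smod (L i)" "\<And>i. L i \<subseteq> L (Suc i)"
    show "\<exists>k. \<forall>i\<ge>k. L i = L k"
      using noetherian_ring.acc_ideals[OF local_ringD(2)[OF R], of L] L smod_iff_ideal by simp
  qed
qed

section \<open>Primes and quotients\<close>

lemma quot_zero: "\<zero>\<^bsub>R Quot J\<^esub> = J"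
  by (simp add: FactRing_def)

lemma (in cring) primeideal_preimage:
  assumes J: "ideal J R" and P: "primeideal P (R Quot J)"
  shows "primeideal {x \<in> carrier R. J +> x \<in> P} R" "J \<subseteq> {x \<in> carrier R. J +> x \<in> P}"
proof -
  interpret J: ideal J R by (rule J)
  interpret h: ring_hom_ring R "R Quot J" "(+>) J" by (rule J.rcos_ring_hom_ring)
  interpret P: primeideal P "R Quot J" by (rule P)
  have idl: "ideal {x \<in> carrier R. J +> x \<in> P} R" by (rule h.ideal_vimage[OF P.is_ideal])
  show "primeideal {x \<in> carrier R. J +> x \<in> P} R"
  proof (rule primeidealI[OF idl is_cring])
    show "carrier R \<noteq> {x \<in> carrier R. J +> x \<in> P}"
    proof
      assume *: "carrier R = {x \<in> carrier R. J +> x \<in> P}"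
      have "\<one> \<in> carrier R" by simp
      hence "J +> \<one> \<in> P" using * by blast
      hence "\<one>\<^bsub>R Quot J\<^esub> \<in> P" using h.hom_one by simp
      hence "P = carrier (R Quot J)" by (rule P.one_imp_carrier)
      thus False using P.I_notcarr by simp
    qed
    fix a b assume ab: "a \<in> carrier R" "b \<in> carrier R" "a \<otimes> b \<in> {x \<in> carrier R. J +> x \<in> P}"
    hence "(J +> a) \<otimes>\<^bsub>R Quot J\<^esub> (J +> b) \<in> P" using h.hom_mult by simp
    hence "J +> a \<in> P \<or> J +> b \<in> P" using P.I_prime h.hom_closed ab by blast
    thus "a \<in> {x \<in> carrier R. J +> x \<in> P} \<or> b \<in> {x \<in> carrier R. J +> x \<in> P}" using ab by auto
  qed
  show "J \<subseteq> {x \<in> carrier R. J +> x \<in> P}"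
  proof
    fix x assume x: "x \<in> J"
    hence xc: "x \<in> carrier R" using J.a_subset by auto
    have "J +> x = \<zero>\<^bsub>R Quot J\<^esub>" unfolding J.a_rcos_const[OF x] by (rule quot_zero[symmetric])
    also have "\<dots> \<in> P" by (rule P.zero_closed)
    finally show "x \<in> {x \<in> carrier R. J +> x \<in> P}" using xc by simp
  qed
qed

lemma (in cring) quot_mem_image_iff:
  assumes J: "ideal J R" and P: "ideal P R" "J \<subseteq> P" and x: "x \<in> carrier R"
  shows "J +> x \<in> (+>) J ` P \<longleftrightarrow> x \<in> P"
proof
  interpret J: ideal J R by (rule J)
  interpret P: ideal P R by (rule P(1))
  assume "J +> x \<in> (+>) J ` P"
  then obtain p where p: "p \<in> P" "J +> x = J +> p" by auto
  have "x \<in> J +> x" using J.a_rcos_self[OF x] .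
  hence "x \<in> J +> p" using p by simp
  then obtain j where j: "j \<in> J" "x = j \<oplus> p" unfolding a_r_coset_def' by auto
  show "x \<in> P" using j p P(2) by auto
qed auto

lemma (in cring) primeideal_image:
  assumes J: "ideal J R" and P: "primeideal P R" "J \<subseteq> P"
  shows "primeideal ((+>) J ` P) (R Quot J)"
proof -
  interpret J: ideal J R by (rule J)
  interpret P: primeideal P R by (rule P(1))
  interpret h: ring_hom_cring R "R Quot J" "(+>) J" by (rule J.rcos_ring_hom_cring[OF is_cring])
  have sur: "carrier (R Quot J) = (+>) J ` carrier R" unfolding FactRing_simps by auto
  have mem: "x \<in> carrier R \<Longrightarrow> J +> x \<in> (+>) J ` P \<longleftrightarrow> x \<in> P" for x by (rule quot_mem_image_iff[OF J P.is_ideal P(2)])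
  have idl: "ideal ((+>) J ` P) (R Quot J)" by (rule ring_ideal_imp_quot_ideal[OF J P.is_ideal])
  show ?thesis
  proof (rule primeidealI[OF idl J.quotient_is_cring[OF is_cring]])
    show "carrier (R Quot J) \<noteq> (+>) J ` P"
    proof
      assume "carrier (R Quot J) = (+>) J ` P"
      moreover have "J +> \<one> \<in> carrier (R Quot J)" unfolding sur by (rule imageI) simp
      ultimately have "J +> \<one> \<in> (+>) J ` P" by blast
      thus False using mem[OF one_closed] P.I_notcarr P.one_imp_carrier by auto
    qed
    fix a b assume ab: "a \<in> carrier (R Quot J)" "b \<in> carrier (R Quot J)" "a \<otimes>\<^bsub>R Quot J\<^esub> b \<in> (+>) J ` P"
    then obtain x y where xy: "x \<in> carrier R" "y \<in> carrier R" "a = J +> x" "b = J +> y" using sur by auto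
    have "J +> (x \<otimes> y) \<in> (+>) J ` P" using ab xy h.hom_mult by simp
    hence "x \<otimes> y \<in> P" using mem[of "x \<otimes> y"] xy(1,2) m_closed by blast
    hence "x \<in> P \<or> y \<in> P" using P.I_prime xy by blast
    thus "a \<in> (+>) J ` P \<or> b \<in> (+>) J ` P" using xy by auto
  qed
qed

lemma (in cring) prime_chain_quotient:
  assumes J: "ideal J R"
  shows "(\<exists>C. prime_chain (R Quot J) C n) \<longleftrightarrow> (\<exists>C. prime_chain R C n \<and> J \<subseteq> C 0)"
proof
  assume "\<exists>C. prime_chain (R Quot J) C n"
  then obtain C where C: "\<And>i. i \<le> n \<Longrightarrow> primeideal (C i) (R Quot J)" "\<And>i. i < n \<Longrightarrow> C i \<subset> C (Suc i)"
    unfolding prime_chain_def by auto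
  let ?D = "\<lambda>i. {x \<in> carrier R. J +> x \<in> C i}"
  have "prime_chain R ?D n" unfolding prime_chain_def
  proof (intro conjI allI impI)
    fix i assume "i \<le> n" thus "primeideal (?D i) R" using primeideal_preimage(1)[OF J C(1)] by simp
  next
    fix i assume i: "i < n"
    obtain a where a: "a \<in> C (Suc i)" "a \<notin> C i" using C(2)[OF i] by auto
    have "ideal (C (Suc i)) (R Quot J)" using C(1)[of "Suc i"] i primeideal.axioms(1) by auto
    hence "a \<in> carrier (R Quot J)" using a additive_subgroup.a_subset ideal.axioms(1) by fastforce
    then obtain x where "x \<in> carrier R" "a = J +> x" unfolding FactRing_simps by auto
    thus "?D i \<subset> ?D (Suc i)" using a C(2)[OF i] by auto
  qed
  moreover have "J \<subseteq> ?D 0" using primeideal_preimage(2)[OF J C(1)] by simp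
  ultimately show "\<exists>C. prime_chain R C n \<and> J \<subseteq> C 0" by blast
next
  assume "\<exists>C. prime_chain R C n \<and> J \<subseteq> C 0"
  then obtain C where C: "\<And>i. i \<le> n \<Longrightarrow> primeideal (C i) R" "\<And>i. i < n \<Longrightarrow> C i \<subset> C (Suc i)" "J \<subseteq> C 0"
    unfolding prime_chain_def by auto
  have JC: "i \<le> n \<Longrightarrow> J \<subseteq> C i" for i
  proof (induction i)
    case (Suc i) thus ?case using C(2)[of i] by auto
  qed (use C in simp)
  have "prime_chain (R Quot J) (\<lambda>i. (+>) J ` C i) n" unfolding prime_chain_def
  proof (intro conjI allI impI)
    fix i assume "i \<le> n" thus "primeideal ((+>) J ` C i) (R Quot J)" using primeideal_image[OF J C(1) JC] by simp
  next
    fix i assume i: "i < n"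
    obtain x where x: "x \<in> C (Suc i)" "x \<notin> C i" using C(2)[OF i] by auto
    have id: "ideal (C i) R" "ideal (C (Suc i)) R" using C(1)[of i] C(1)[of "Suc i"] i primeideal.axioms(1) by auto
    have xc: "x \<in> carrier R" using x id(2) additive_subgroup.a_subset ideal.axioms(1) by fastforce
    have "J +> x \<notin> (+>) J ` C i" using quot_mem_image_iff[OF J id(1) JC xc] i x by simp
    thus "(+>) J ` C i \<subset> (+>) J ` C (Suc i)" using C(2)[OF i] x by blast
  qed
  thus "\<exists>C. prime_chain (R Quot J) C n" by blast
qed

section \<open>Rees rings\<close>

context const_ring
begin

lemma smod_finsum:
  assumes "smod N" "finite F" "\<And>i. i \<in> F \<Longrightarrow> g i \<in> N"
  shows "(\<Oplus>i\<in>F. g i) \<in> N"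
  using assms(2,1,3)
proof (induction F rule: finite_induct)
  case empty
  show ?case using smod_0[OF assms(1)] by simp
next
  case (insert x F)
  have gN: "g y \<in> N" if "y \<in> insert x F" for y using insert.prems(2)[OF that] .
  have gF: "g \<in> F \<rightarrow> carrier S" "g x \<in> carrier S" using gN smod_carr[OF assms(1)] by blast+
  have e: "(\<Oplus>i\<in>insert x F. g i) = g x \<oplus> (\<Oplus>i\<in>F. g i)"
    by (rule finsum_insert[OF insert.hyps(1,2) gF])
  show ?case unfolding e
    by (rule smod_add[OF assms(1)]) (use gN insert.IH[OF assms(1)] in auto)
qed

end

text \<open>Both the filtration and its truncation are graded rings in this sense, so that the locale covers
  the two Rees rings that are compared.\<close>
locale rees = cring R for R (structure) +
  fixes I :: "nat \<Rightarrow> 'a set"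
  assumes gr: "const_ring.gring R (carrier R) I"
begin

sublocale C: const_ring R "carrier R" by (rule const_ring_carrier)

abbreviation P where "P \<equiv> UP R"
abbreviation A where "A \<equiv> rees_ring R I"

sublocale UP: UP_cring R P by unfold_locales simp_all

lemma A_carrier: "carrier A = {p \<in> carrier P. \<forall>n. up_ring.coeff P p n \<in> I n}"
  unfolding rees_ring_def by simp
lemma A_mult: "monoid.mult A = monoid.mult P" and A_add: "ring.add A = ring.add P" and A_one: "\<one>\<^bsub>A\<^esub> = \<one>\<^bsub>P\<^esub>" and A_zero: "\<zero>\<^bsub>A\<^esub> = \<zero>\<^bsub>P\<^esub>"
  unfolding rees_ring_def by simp_all

lemma I0: "I 0 = carrier R" using C.gringD(1)[OF gr, of 0] C.gringD(4)[OF gr] by blast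

lemma I_smod: "C.smod (I n)" by (rule C.gring_smod[OF gr])

lemma coeff_mult_in:
  assumes "p \<in> carrier P" "q \<in> carrier P" "C.smod N" "\<And>i. i \<le> n \<Longrightarrow> up_ring.coeff P p i \<otimes> up_ring.coeff P q (n - i) \<in> N"
  shows "up_ring.coeff P (p \<otimes>\<^bsub>P\<^esub> q) n \<in> N"
  unfolding UP.coeff_mult[OF assms(1,2)] by (rule C.smod_finsum[OF assms(3)]) (use assms(4) in auto)

lemma rees_subring: "subring (carrier A) P"
proof (rule UP.P.subringI)
  show "carrier A \<subseteq> carrier P" unfolding A_carrier by auto
  show "\<one>\<^bsub>P\<^esub> \<in> carrier A" unfolding A_carrier using C.gringD(2)[OF gr] I0 by auto
  show "\<ominus>\<^bsub>P\<^esub> p \<in> carrier A" if "p \<in> carrier A" for p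
    using that C.smod_neg[OF I_smod] unfolding A_carrier by auto
  show "p \<oplus>\<^bsub>P\<^esub> q \<in> carrier A" if "p \<in> carrier A" "q \<in> carrier A" for p q
    using that C.smod_add[OF I_smod] unfolding A_carrier by auto
  show "p \<otimes>\<^bsub>P\<^esub> q \<in> carrier A" if pq: "p \<in> carrier A" "q \<in> carrier A" for p q
  proof -
    have "up_ring.coeff P (p \<otimes>\<^bsub>P\<^esub> q) n \<in> I n" for n
    proof (rule coeff_mult_in[OF _ _ I_smod])
      show "up_ring.coeff P p i \<otimes> up_ring.coeff P q (n - i) \<in> I n" if "i \<le> n" for i
        using C.gringD(5)[OF gr, of "up_ring.coeff P p i" i "up_ring.coeff P q (n - i)" "n - i"] pq that unfolding A_carrier by auto
    qed (use pq in \<open>auto simp: A_carrier\<close>)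
    thus ?thesis using pq unfolding A_carrier by auto
  qed
qed

lemma A_cring: "cring A"
proof -
  have "subcring (carrier A) P" using UP.P.subcringI' rees_subring by blast
  hence "cring (P\<lparr>carrier := carrier A\<rparr>)" using UP.P.subcring_iff rees_subring A_carrier by auto
  moreover have "P\<lparr>carrier := carrier A\<rparr> = A" unfolding rees_ring_def by simp
  ultimately show ?thesis by simp
qed

sublocale A: cring A by (rule A_cring)

lemma monom_in_A: "a \<in> I n \<Longrightarrow> up_ring.monom P a n \<in> carrier A"
  unfolding A_carrier using C.gringD(2,6)[OF gr] by auto

definition ext_max where
  "ext_max = genideal A ((\<lambda>x. up_ring.monom P x 0) ` max_ideal R)"

lemma ext_max_sub: "max_ideal R \<subseteq> carrier R \<Longrightarrow> (\<lambda>x. up_ring.monom P x 0) ` max_ideal R \<subseteq> carrier A"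
  using monom_in_A[of _ 0] I0 by auto

lemma ext_max_ideal: "max_ideal R \<subseteq> carrier R \<Longrightarrow> ideal ext_max A"
  unfolding ext_max_def by (rule A.genideal_ideal[OF ext_max_sub])

text \<open>Primes of the fibre ring correspond to primes of the Rees ring containing the extension of the
  maximal ideal, which removes the quotient from all later arguments.\<close>
lemma analytic_spread_chain:
  assumes "max_ideal R \<subseteq> carrier R"
  shows "analytic_spread R I = Sup {enat n | n. \<exists>C. prime_chain A C n \<and> (\<lambda>x. up_ring.monom P x 0) ` max_ideal R \<subseteq> C 0}"
proof -
  have "(\<exists>C. prime_chain (A Quot ext_max) C n) \<longleftrightarrow> (\<exists>C. prime_chain A C n \<and> (\<lambda>x. up_ring.monom P x 0) ` max_ideal R \<subseteq> C 0)" for n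
  proof -
    have "ext_max \<subseteq> C 0 \<longleftrightarrow> (\<lambda>x. up_ring.monom P x 0) ` max_ideal R \<subseteq> C 0" if "prime_chain A C n" for C
    proof -
      have "ideal (C 0) A" using that unfolding prime_chain_def using primeideal.axioms(1) by blast
      thus ?thesis unfolding ext_max_def using A.genideal_minimal A.genideal_self[OF ext_max_sub[OF assms]] by blast
    qed
    thus ?thesis using A.prime_chain_quotient[OF ext_max_ideal[OF assms], of n] by blast
  qed
  thus ?thesis unfolding analytic_spread_def krull_dim_def ext_max_def[symmetric] by simp
qed

text \<open>Homogeneous primality suffices: if \<open>p\<close> and \<open>q\<close> are not in the ideal, consider the lowest
  coefficients of each outside; all other terms of the corresponding coefficient of \<open>p q\<close> are inside.\<close>
lemma gprime_primeideal:
  assumes Q: "C.gprime I Q"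
  shows "primeideal {p \<in> carrier A. \<forall>n. up_ring.coeff P p n \<in> Q n} A"
proof -
  have gi: "C.gideal I Q" and ne: "Q \<noteq> I"
    and pr0: "\<forall>i j. \<forall>a\<in>I i. \<forall>b\<in>I j. a \<otimes> b \<in> Q (i + j) \<longrightarrow> a \<in> Q i \<or> b \<in> Q j"
    using Q unfolding C.gprime_def by auto
  have pr: "a \<in> Q i \<or> b \<in> Q j" if "a \<in> I i" "b \<in> I j" "a \<otimes> b \<in> Q (i + j)" for i j a b
    using pr0 that by auto
  have sQ: "C.smod (Q n)" for n by (rule C.gideal_smod[OF gr gi])
  let ?Q = "{p \<in> carrier A. \<forall>n. up_ring.coeff P p n \<in> Q n}"
  have AP: "p \<in> carrier A \<Longrightarrow> p \<in> carrier P" for p unfolding A_carrier by auto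
  have AI: "p \<in> carrier A \<Longrightarrow> up_ring.coeff P p n \<in> I n" for p n unfolding A_carrier by auto
  have mult: "p \<otimes>\<^bsub>A\<^esub> q \<in> ?Q" if p: "p \<in> carrier A" and q: "q \<in> ?Q" for p q
  proof -
    have "up_ring.coeff P (p \<otimes>\<^bsub>P\<^esub> q) n \<in> Q n" for n
    proof (rule coeff_mult_in[OF _ _ sQ])
      show "up_ring.coeff P p i \<otimes> up_ring.coeff P q (n - i) \<in> Q n" if "i \<le> n" for i
        using C.gidealD(4)[OF gi AI[OF p, of i], of "up_ring.coeff P q (n - i)" "n - i"] q that by auto
    qed (use p q AP in auto)
    thus ?thesis using p q A.m_closed[of p q] by (auto simp: A_mult)
  qed
  have Asmod: "const_ring.smod A (carrier A) ?Q"
  proof (rule const_ring.smodI[OF A.const_ring_carrier])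
    show "\<zero>\<^bsub>A\<^esub> \<in> ?Q" using A.zero_closed C.smod_0[OF sQ] by (auto simp: A_zero)
    show "p \<oplus>\<^bsub>A\<^esub> q \<in> ?Q" if "p \<in> ?Q" "q \<in> ?Q" for p q
      using that A.a_closed[of p q] AP C.smod_add[OF sQ] by (auto simp: A_add)
  qed (use mult in auto)
  hence idl: "ideal ?Q A" using A.smod_iff_ideal by simp
  show ?thesis
  proof (rule primeidealI[OF idl A_cring])
    show "carrier A \<noteq> ?Q"
    proof
      assume eq: "carrier A = ?Q"
      have "I n \<subseteq> Q n" for n
      proof
        fix a assume a: "a \<in> I n"
        hence "up_ring.monom P a n \<in> ?Q" using monom_in_A eq by auto
        hence "up_ring.coeff P (up_ring.monom P a n) n \<in> Q n" by auto
        thus "a \<in> Q n" using C.gringD(6)[OF gr a] by simp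
      qed
      hence "Q = I" using C.gidealD(1)[OF gi] by (intro ext equalityI) auto
      thus False using ne by simp
    qed
    fix p q assume pq: "p \<in> carrier A" "q \<in> carrier A" "p \<otimes>\<^bsub>A\<^esub> q \<in> ?Q"
    show "p \<in> ?Q \<or> q \<in> ?Q"
    proof (rule ccontr)
      assume "\<not> ?thesis"
      hence ex: "\<exists>n. up_ring.coeff P p n \<notin> Q n" "\<exists>n. up_ring.coeff P q n \<notin> Q n" using pq by auto
      define i where "i = (LEAST n. up_ring.coeff P p n \<notin> Q n)"
      define j where "j = (LEAST n. up_ring.coeff P q n \<notin> Q n)"
      have i: "up_ring.coeff P p i \<notin> Q i" "\<And>k. k < i \<Longrightarrow> up_ring.coeff P p k \<in> Q k"
        unfolding i_def using LeastI_ex[OF ex(1)] not_less_Least by auto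
      have j: "up_ring.coeff P q j \<notin> Q j" "\<And>k. k < j \<Longrightarrow> up_ring.coeff P q k \<in> Q k"
        unfolding j_def using LeastI_ex[OF ex(2)] not_less_Least by auto
      let ?t = "\<lambda>k. up_ring.coeff P p k \<otimes> up_ring.coeff P q (i + j - k)"
      have tc: "?t k \<in> carrier R" for k using AP pq by auto
      have in_Q: "?t k \<in> Q (i + j)" if "k \<in> {..i + j} - {i}" for k
      proof (cases "k < i")
        case True
        have "up_ring.coeff P q (i + j - k) \<otimes> up_ring.coeff P p k \<in> Q ((i + j - k) + k)"
          by (rule C.gidealD(4)[OF gi AI[OF pq(2)] i(2)[OF True]])
        thus ?thesis using True m_comm AP pq by auto
      next
        case False
        hence "i + j - k < j" using that by auto
        from C.gidealD(4)[OF gi AI[OF pq(1)] j(2)[OF this], of k] show ?thesis using that by auto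
      qed
      let ?s = "\<Oplus>k\<in>{..i + j} - {i}. ?t k"
      have s: "?s \<in> Q (i + j)" by (rule C.smod_finsum[OF sQ]) (use in_Q in auto)
      have "up_ring.coeff P (p \<otimes>\<^bsub>P\<^esub> q) (i + j) = (\<Oplus>k\<in>insert i ({..i + j} - {i}). ?t k)"
        unfolding UP.coeff_mult[OF AP[OF pq(1)] AP[OF pq(2)]] by (simp add: insert_absorb)
      also have "\<dots> = ?t i \<oplus> ?s" by (rule finsum_insert) (use tc tc[of i] in auto)
      also have "\<dots> = ?s \<oplus> ?t i" by (rule a_comm[OF tc C.smod_carr[OF sQ s]])
      finally have eq: "up_ring.coeff P (p \<otimes>\<^bsub>P\<^esub> q) (i + j) = ?s \<oplus> ?t i" .
      have "up_ring.coeff P (p \<otimes>\<^bsub>P\<^esub> q) (i + j) \<in> Q (i + j)" using pq(3) by (simp only: A_mult mem_Collect_eq)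
      hence "?s \<oplus> ?t i \<in> Q (i + j)" unfolding eq .
      hence "?t i \<in> Q (i + j)" by (rule C.smod_add_cancel[OF sQ s tc])
      thus False using pr[OF AI[OF pq(1)] AI[OF pq(2)], of i j] i(1) j(1) by auto
    qed
  qed
qed

lemma spread_ge:
  assumes M: "max_ideal R \<subseteq> carrier R" and Q: "\<And>i. i \<le> n \<Longrightarrow> C.gprime I (Q i)" "\<And>i. i < n \<Longrightarrow> Q i < Q (Suc i)"
    and mQ: "max_ideal R \<subseteq> Q 0 0"
  shows "enat n \<le> analytic_spread R I"
proof -
  let ?C = "\<lambda>i. {p \<in> carrier A. \<forall>n. up_ring.coeff P p n \<in> Q i n}"
  have "prime_chain A ?C n" unfolding prime_chain_def
  proof (intro conjI allI impI)
    fix i assume "i \<le> n" thus "primeideal (?C i) A" using gprime_primeideal Q(1) by blast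
  next
    fix i assume i: "i < n"
    have le: "Q i k \<subseteq> Q (Suc i) k" for k using Q(2)[OF i] by (auto simp: less_le le_fun_def)
    have "\<exists>k. Q i k \<noteq> Q (Suc i) k" using Q(2)[OF i] by (auto simp: less_le fun_eq_iff)
    then obtain k a where a: "a \<in> Q (Suc i) k" "a \<notin> Q i k" using le by blast
    have gi: "C.gideal I (Q (Suc i))" "C.gideal I (Q i)" using Q(1)[of "Suc i"] Q(1)[of i] i unfolding C.gprime_def by auto
    have aI: "a \<in> I k" using a(1) C.gidealD(1)[OF gi(1)] by blast
    hence ac: "a \<in> carrier R" using C.gringD(6)[OF gr] by blast
    have "up_ring.monom P a k \<in> ?C (Suc i)" using monom_in_A[OF aI] ac a(1) C.gidealD(2)[OF gi(1)] by auto
    moreover have "up_ring.monom P a k \<notin> ?C i" using ac a(2) by auto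
    moreover have "?C i \<subseteq> ?C (Suc i)" using le by blast
    ultimately show "?C i \<subset> ?C (Suc i)" by blast
  qed
  moreover have "(\<lambda>x. up_ring.monom P x 0) ` max_ideal R \<subseteq> ?C 0"
  proof
    fix p assume "p \<in> (\<lambda>x. up_ring.monom P x 0) ` max_ideal R"
    then obtain x where x: "x \<in> max_ideal R" "p = up_ring.monom P x 0" by auto
    have gi: "C.gideal I (Q 0)" using Q(1)[of 0] unfolding C.gprime_def by auto
    have xc: "x \<in> carrier R" using x M by auto
    have "p \<in> carrier A" using x ext_max_sub[OF M] by auto
    thus "p \<in> ?C 0" using x xc mQ C.gidealD(2)[OF gi] by auto
  qed
  ultimately show ?thesis unfolding analytic_spread_chain[OF M] by (intro Sup_upper) blast
qed

end

section \<open>Valuations of the quotient field\<close>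

lemma card_bounded_exponents:
  fixes B :: "'x set" and q :: nat
  assumes B: "finite B"
  defines "E \<equiv> {e :: 'x \<Rightarrow> nat. (\<forall>s\<in>B. e s < q) \<and> (\<forall>s. s \<notin> B \<longrightarrow> e s = 0)}"
  shows "finite E" "card E = q ^ card B"
proof -
  let ?ext = "\<lambda>(g :: 'x \<Rightarrow> nat) s. if s \<in> B then g s else 0"
  have img: "?ext ` (B \<rightarrow>\<^sub>E {..<q}) = E"
  proof
    show "?ext ` (B \<rightarrow>\<^sub>E {..<q}) \<subseteq> E" unfolding E_def by (auto simp: PiE_def Pi_def)
    show "E \<subseteq> ?ext ` (B \<rightarrow>\<^sub>E {..<q})"
    proof
      fix e assume e: "e \<in> E"
      have "e = ?ext (restrict e B)" using e unfolding E_def by auto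
      moreover have "restrict e B \<in> B \<rightarrow>\<^sub>E {..<q}" using e unfolding E_def by auto
      ultimately show "e \<in> ?ext ` (B \<rightarrow>\<^sub>E {..<q})" by blast
    qed
  qed
  have inj: "inj_on ?ext (B \<rightarrow>\<^sub>E {..<q})"
  proof (rule inj_onI)
    fix g g' assume g: "g \<in> B \<rightarrow>\<^sub>E {..<q}" "g' \<in> B \<rightarrow>\<^sub>E {..<q}" and eq: "?ext g = ?ext g'"
    show "g = g'"
    proof (rule PiE_ext[OF g])
      fix s assume "s \<in> B" thus "g s = g' s" using fun_cong[OF eq, of s] by simp
    qed
  qed
  show "finite E" unfolding img[symmetric] by (intro finite_imageI finite_PiE) (use B in auto)
  show "card E = q ^ card B" unfolding img[symmetric] card_image[OF inj] card_PiE[OF B] by simp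
qed

text \<open>The map \<open>h\<close> embeds \<open>R\<close> into its quotient field \<open>K\<close>; values of \<open>\<nu>\<close> are only meaningful on nonzero
  elements, which is why zero is treated separately in \<open>Vge\<close>.\<close>
locale valued_domain = R?: domain R + K: field K
  for R (structure) and K :: "('k, 'c) ring_scheme" +
  fixes h :: "'a \<Rightarrow> 'k" and \<nu> :: "'k \<Rightarrow> int"
  assumes qf: "quotient_field R K h" and dv: "discrete_valuation K \<nu>"
    and nonneg: "h ` carrier R \<subseteq> carrier (val_ring K \<nu>)"
begin

sublocale C: const_ring R "carrier R" by (rule R.const_ring_carrier)

lemma h_hom: "h \<in> ring_hom R K" and h_inj: "inj_on h (carrier R)"
  and K_carr: "carrier K = {h x \<otimes>\<^bsub>K\<^esub> inv\<^bsub>K\<^esub> h y | x y. x \<in> carrier R \<and> y \<in> carrier R - {\<zero>}}"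
  using qf unfolding quotient_field_def by auto

sublocale h: ring_hom_cring R K h
  by (intro ring_hom_cringI R.is_cring K.is_cring h_hom)

lemma h_zero_iff: "x \<in> carrier R \<Longrightarrow> h x = \<zero>\<^bsub>K\<^esub> \<longleftrightarrow> x = \<zero>"
  using h_inj h.hom_zero inj_onD[OF h_inj, of x \<zero>] by auto

lemma \<nu>_mult: "x \<in> carrier K \<Longrightarrow> x \<noteq> \<zero>\<^bsub>K\<^esub> \<Longrightarrow> y \<in> carrier K \<Longrightarrow> y \<noteq> \<zero>\<^bsub>K\<^esub> \<Longrightarrow> \<nu> (x \<otimes>\<^bsub>K\<^esub> y) = \<nu> x + \<nu> y"
  using dv unfolding discrete_valuation_def by auto

lemma \<nu>_add: "x \<in> carrier K \<Longrightarrow> x \<noteq> \<zero>\<^bsub>K\<^esub> \<Longrightarrow> y \<in> carrier K \<Longrightarrow> y \<noteq> \<zero>\<^bsub>K\<^esub> \<Longrightarrow> x \<oplus>\<^bsub>K\<^esub> y \<noteq> \<zero>\<^bsub>K\<^esub> \<Longrightarrow>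
    min (\<nu> x) (\<nu> y) \<le> \<nu> (x \<oplus>\<^bsub>K\<^esub> y)"
  using dv unfolding discrete_valuation_def by auto

lemma \<nu>_one: "\<nu> \<one>\<^bsub>K\<^esub> = 0"
  using \<nu>_mult[of "\<one>\<^bsub>K\<^esub>" "\<one>\<^bsub>K\<^esub>"] K.one_not_zero by simp

lemma \<nu>_minus_one: "\<nu> (\<ominus>\<^bsub>K\<^esub> \<one>\<^bsub>K\<^esub>) = 0"
proof -
  have n: "\<ominus>\<^bsub>K\<^esub> \<one>\<^bsub>K\<^esub> \<noteq> \<zero>\<^bsub>K\<^esub>" using K.one_not_zero K.a_inv_closed K.one_closed by (metis K.minus_minus K.minus_zero)
  have "\<nu> (\<ominus>\<^bsub>K\<^esub> \<one>\<^bsub>K\<^esub> \<otimes>\<^bsub>K\<^esub> \<ominus>\<^bsub>K\<^esub> \<one>\<^bsub>K\<^esub>) = \<nu> (\<ominus>\<^bsub>K\<^esub> \<one>\<^bsub>K\<^esub>) + \<nu> (\<ominus>\<^bsub>K\<^esub> \<one>\<^bsub>K\<^esub>)"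
    by (rule \<nu>_mult) (use n in auto)
  moreover have "\<ominus>\<^bsub>K\<^esub> \<one>\<^bsub>K\<^esub> \<otimes>\<^bsub>K\<^esub> \<ominus>\<^bsub>K\<^esub> \<one>\<^bsub>K\<^esub> = \<one>\<^bsub>K\<^esub>" by (simp add: K.l_minus K.r_minus)
  ultimately show ?thesis using \<nu>_one by simp
qed

lemma \<nu>_pow: "x \<in> carrier K \<Longrightarrow> x \<noteq> \<zero>\<^bsub>K\<^esub> \<Longrightarrow> x [^]\<^bsub>K\<^esub> (n::nat) \<noteq> \<zero>\<^bsub>K\<^esub> \<and> \<nu> (x [^]\<^bsub>K\<^esub> n) = int n * \<nu> x"
proof (induction n)
  case (Suc n)
  hence "x [^]\<^bsub>K\<^esub> n \<noteq> \<zero>\<^bsub>K\<^esub>" "\<nu> (x [^]\<^bsub>K\<^esub> n) = int n * \<nu> x" by auto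
  thus ?case using \<nu>_mult[of "x [^]\<^bsub>K\<^esub> n" x] Suc.prems K.integral_iff[of "x [^]\<^bsub>K\<^esub> n" x] by (auto simp: algebra_simps)
qed (auto simp: \<nu>_one)

definition Vge :: "int \<Rightarrow> 'k set" where
  "Vge n = {x \<in> carrier K. x = \<zero>\<^bsub>K\<^esub> \<or> n \<le> \<nu> x}"

lemma Vge_add: "x \<in> Vge n \<Longrightarrow> y \<in> Vge n \<Longrightarrow> x \<oplus>\<^bsub>K\<^esub> y \<in> Vge n"
  unfolding Vge_def using \<nu>_add[of x y] by (cases "x = \<zero>\<^bsub>K\<^esub>"; cases "y = \<zero>\<^bsub>K\<^esub>") force+

lemma Vge_mult: "x \<in> Vge a \<Longrightarrow> y \<in> Vge b \<Longrightarrow> x \<otimes>\<^bsub>K\<^esub> y \<in> Vge (a + b)"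
  unfolding Vge_def using \<nu>_mult[of x y] by (cases "x = \<zero>\<^bsub>K\<^esub>"; cases "y = \<zero>\<^bsub>K\<^esub>") auto

lemma Vge_cancel:
  assumes "x \<in> carrier K" "x \<noteq> \<zero>\<^bsub>K\<^esub>" "y \<in> carrier K" "x \<otimes>\<^bsub>K\<^esub> y \<in> Vge (\<nu> x + b)"
  shows "y \<in> Vge b"
  using assms \<nu>_mult[of x y] K.integral_iff[of x y] unfolding Vge_def by (cases "y = \<zero>\<^bsub>K\<^esub>") auto

lemma Vge_minus: "x \<in> Vge n \<Longrightarrow> \<ominus>\<^bsub>K\<^esub> x \<in> Vge n"
proof -
  assume x: "x \<in> Vge n"
  have "\<ominus>\<^bsub>K\<^esub> \<one>\<^bsub>K\<^esub> \<in> Vge 0" unfolding Vge_def using \<nu>_minus_one by auto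
  hence "\<ominus>\<^bsub>K\<^esub> \<one>\<^bsub>K\<^esub> \<otimes>\<^bsub>K\<^esub> x \<in> Vge (0 + n)" using x by (rule Vge_mult)
  moreover have "\<ominus>\<^bsub>K\<^esub> \<one>\<^bsub>K\<^esub> \<otimes>\<^bsub>K\<^esub> x = \<ominus>\<^bsub>K\<^esub> x" using x unfolding Vge_def by (simp add: K.l_minus)
  ultimately show ?thesis by simp
qed

lemma Vge_anti: "a \<le> b \<Longrightarrow> Vge b \<subseteq> Vge a"
  unfolding Vge_def by auto

abbreviation OV where "OV \<equiv> val_ring K \<nu>"

lemma O_carr: "carrier OV = Vge 0" and max_eq: "val_max K \<nu> = Vge 1"
  unfolding val_ring_def val_max_def Vge_def by auto

lemma O_ops: "x \<otimes>\<^bsub>OV\<^esub> y = x \<otimes>\<^bsub>K\<^esub> y" "x \<oplus>\<^bsub>OV\<^esub> y = x \<oplus>\<^bsub>K\<^esub> y" "\<one>\<^bsub>OV\<^esub> = \<one>\<^bsub>K\<^esub>" "\<zero>\<^bsub>OV\<^esub> = \<zero>\<^bsub>K\<^esub>"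
  unfolding val_ring_def by simp_all

lemma O_cring: "cring OV"
proof -
  have sub: "subcring (Vge 0) K"
  proof (rule K.subcringI')
    show "subring (Vge 0) K"
    proof (rule K.subringI)
      show "Vge 0 \<subseteq> carrier K" unfolding Vge_def by auto
      show "\<one>\<^bsub>K\<^esub> \<in> Vge 0" unfolding Vge_def using \<nu>_one by auto
      show "x \<otimes>\<^bsub>K\<^esub> y \<in> Vge 0" if "x \<in> Vge 0" "y \<in> Vge 0" for x y using Vge_mult[OF that] by simp
    qed (use Vge_minus Vge_add in auto)
  qed
  have "cring (K\<lparr>carrier := Vge 0\<rparr>)" using K.subcring_iff[of "Vge 0"] sub unfolding Vge_def by auto
  moreover have "K\<lparr>carrier := Vge 0\<rparr> = OV" unfolding val_ring_def Vge_def by simp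
  ultimately show ?thesis by simp
qed

sublocale OV: cring OV by (rule O_cring)

lemma max_ideal_O: "ideal (val_max K \<nu>) OV"
proof -
  have "const_ring.smod OV (carrier OV) (Vge 1)"
  proof (rule const_ring.smodI[OF OV.const_ring_carrier])
    show "Vge 1 \<subseteq> carrier OV" unfolding O_carr by (rule Vge_anti) simp
    show "\<zero>\<^bsub>OV\<^esub> \<in> Vge 1" unfolding Vge_def O_ops by auto
    show "x \<oplus>\<^bsub>OV\<^esub> y \<in> Vge 1" if "x \<in> Vge 1" "y \<in> Vge 1" for x y using Vge_add that O_ops by simp
    show "x \<otimes>\<^bsub>OV\<^esub> y \<in> Vge 1" if "x \<in> carrier OV" "y \<in> Vge 1" for x y
      using Vge_mult[of x 0 y 1] that O_ops O_carr by simp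
  qed
  thus ?thesis unfolding max_eq using OV.smod_iff_ideal by simp
qed

lemma h_O: "x \<in> carrier R \<Longrightarrow> h x \<in> carrier OV"
  using nonneg by auto

lemma hO_hom: "ring_hom_cring R OV h"
  by (intro ring_hom_cringI R.is_cring O_cring ring_hom_memI)
    (use h_O O_ops h.hom_mult h.hom_add h.hom_one in auto)

lemma val_ideal_iff: "x \<in> val_ideal R K h \<nu> n \<longleftrightarrow> x \<in> carrier R \<and> h x \<in> Vge (int n)"
  unfolding val_ideal_def Vge_def by auto

lemma val_ideal_smod: "C.smod (val_ideal R K h \<nu> n)"
proof (rule C.smodI)
  show "val_ideal R K h \<nu> n \<subseteq> carrier R" unfolding val_ideal_def by auto
  show "\<zero> \<in> val_ideal R K h \<nu> n" unfolding val_ideal_def by auto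
  show "a \<oplus> b \<in> val_ideal R K h \<nu> n" if "a \<in> val_ideal R K h \<nu> n" "b \<in> val_ideal R K h \<nu> n" for a b
    using that Vge_add unfolding val_ideal_iff by simp
  show "a \<otimes> b \<in> val_ideal R K h \<nu> n" if "a \<in> carrier R" "b \<in> val_ideal R K h \<nu> n" for a b
    using that Vge_mult[of "h a" 0 "h b" "int n"] h_O O_carr unfolding val_ideal_iff by simp
qed

lemma val_ideal_mult: "a \<in> val_ideal R K h \<nu> i \<Longrightarrow> b \<in> val_ideal R K h \<nu> j \<Longrightarrow> a \<otimes> b \<in> val_ideal R K h \<nu> (i + j)"
  unfolding val_ideal_iff using Vge_mult[of "h a" "int i" "h b" "int j"] by simp

lemma val_ideal_anti: "i \<le> j \<Longrightarrow> val_ideal R K h \<nu> j \<subseteq> val_ideal R K h \<nu> i"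
  using Vge_anti[of "int i" "int j"] by (auto simp: val_ideal_iff)

lemma val_ideal_0: "val_ideal R K h \<nu> 0 = carrier R"
  using h_O O_carr unfolding set_eq_iff val_ideal_iff by auto

lemma center_eq: "center R K h \<nu> = val_ideal R K h \<nu> 1"
  unfolding center_def max_eq set_eq_iff val_ideal_iff by auto

lemma \<nu>_h_nonneg: "x \<in> carrier R \<Longrightarrow> x \<noteq> \<zero> \<Longrightarrow> 0 \<le> \<nu> (h x)"
  using h_O[of x] O_carr h_zero_iff[of x] unfolding Vge_def by auto

lemma not_center: "x \<in> carrier R \<Longrightarrow> x \<notin> center R K h \<nu> \<Longrightarrow> x \<noteq> \<zero> \<and> \<nu> (h x) = 0"
  using \<nu>_h_nonneg[of x] h_zero_iff[of x] unfolding center_eq val_ideal_iff Vge_def by force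

text \<open>Multiplication by an element of value zero changes no value.\<close>
lemma not_center_cancel:
  assumes "x \<in> carrier R" "x \<notin> center R K h \<nu>" "y \<in> carrier R" "x \<otimes> y \<in> val_ideal R K h \<nu> n"
  shows "y \<in> val_ideal R K h \<nu> n"
proof -
  have x: "x \<noteq> \<zero>" "\<nu> (h x) = 0" using not_center assms by auto
  have "h y \<in> Vge (int n)"
    by (rule Vge_cancel[of "h x"]) (use assms x h_zero_iff in \<open>auto simp: val_ideal_iff\<close>)
  thus ?thesis unfolding val_ideal_iff using assms by simp
qed

lemma center_primeideal: "primeideal (center R K h \<nu>) R"
proof (rule primeidealI)
  show "ideal (center R K h \<nu>) R" unfolding center_eq using val_ideal_smod R.smod_iff_ideal by simp
  show "cring R" by (rule R.is_cring)
  have "\<one> \<notin> center R K h \<nu>" unfolding center_eq val_ideal_iff Vge_def using \<nu>_one K.one_not_zero by auto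
  thus "carrier R \<noteq> center R K h \<nu>" by auto
  show "a \<in> center R K h \<nu> \<or> b \<in> center R K h \<nu>" if "a \<in> carrier R" "b \<in> carrier R" "a \<otimes> b \<in> center R K h \<nu>" for a b
    using not_center_cancel[OF that(1) _ that(2), of 1] that(3) center_eq by auto
qed

section \<open>Growth forced by a valuation\<close>

text \<open>Requiring \<open>y\<close> to be a multiple of \<open>z\<close> allows \<open>\<nu>(y)\<close> to be made positive.\<close>
lemma common_denominator:
  assumes "finite B" "\<And>s. s \<in> B \<Longrightarrow> u s \<in> carrier K" and z: "z \<in> carrier R" "z \<noteq> \<zero>"
  shows "\<exists>y\<in>carrier R. y \<noteq> \<zero> \<and> (\<exists>w\<in>carrier R. y = z \<otimes> w) \<and> (\<forall>s\<in>B. \<exists>g\<in>carrier R. h g = u s \<otimes>\<^bsub>K\<^esub> h y)"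
  using assms(1,2)
proof (induction B rule: finite_induct)
  case empty
  show ?case using z by (intro bexI[of _ z]) (auto intro!: bexI[of _ \<one>])
next
  case (insert s B)
  then obtain y w where y: "y \<in> carrier R" "y \<noteq> \<zero>" "w \<in> carrier R" "y = z \<otimes> w" "\<And>s. s\<in>B \<Longrightarrow> \<exists>g\<in>carrier R. h g = u s \<otimes>\<^bsub>K\<^esub> h y"
    by auto
  have "u s \<in> carrier K" using insert by auto
  then obtain a b where ab: "a \<in> carrier R" "b \<in> carrier R" "b \<noteq> \<zero>" "u s = h a \<otimes>\<^bsub>K\<^esub> inv\<^bsub>K\<^esub> h b" unfolding K_carr by auto
  have hb: "h b \<in> Units K" using ab h_zero_iff[of b] K.field_Units by auto
  have "h (a \<otimes> y) = u s \<otimes>\<^bsub>K\<^esub> h (b \<otimes> y)"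
  proof -
    have c: "h a \<in> carrier K" "h b \<in> carrier K" "h y \<in> carrier K" "inv\<^bsub>K\<^esub> h b \<in> carrier K"
      using ab(1,2) y(1) K.Units_inv_closed[OF hb] by auto
    have "u s \<otimes>\<^bsub>K\<^esub> h (b \<otimes> y) = h a \<otimes>\<^bsub>K\<^esub> inv\<^bsub>K\<^esub> h b \<otimes>\<^bsub>K\<^esub> (h b \<otimes>\<^bsub>K\<^esub> h y)"
      using ab y(1) by simp
    also have "\<dots> = h a \<otimes>\<^bsub>K\<^esub> (inv\<^bsub>K\<^esub> h b \<otimes>\<^bsub>K\<^esub> h b) \<otimes>\<^bsub>K\<^esub> h y"
      using c by (simp only: K.m_assoc K.m_closed)
    also have "\<dots> = h (a \<otimes> y)" using K.Units_l_inv[OF hb] c ab(1) y(1) by simp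
    finally show ?thesis by simp
  qed
  moreover have "\<exists>g\<in>carrier R. h g = u s' \<otimes>\<^bsub>K\<^esub> h (b \<otimes> y)" if sB: "s' \<in> B" for s'
  proof -
    obtain g where g: "g \<in> carrier R" "h g = u s' \<otimes>\<^bsub>K\<^esub> h y" using y(5)[OF sB] by auto
    have "u s' \<in> carrier K" using insert.prems sB by auto
    hence "h (b \<otimes> g) = u s' \<otimes>\<^bsub>K\<^esub> h (b \<otimes> y)" using g ab y by (simp add: K.m_lcomm)
    thus ?thesis using g ab by (intro bexI[of _ "b \<otimes> g"]) auto
  qed
  moreover have "b \<otimes> y \<noteq> \<zero>" using ab y R.integral_iff by auto
  moreover have "b \<otimes> y = z \<otimes> (b \<otimes> w)" using y ab z by (simp add: R.m_lcomm)
  moreover have "b \<otimes> y \<in> carrier R" "a \<otimes> y \<in> carrier R" "b \<otimes> w \<in> carrier R" using ab y by auto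
  ultimately show ?case by (metis insert_iff)
qed

lemma OV_pow: "x [^]\<^bsub>OV\<^esub> (n::nat) = x [^]\<^bsub>K\<^esub> n"
  by (induction n) (auto simp: O_ops)

text \<open>Let \<open>u\<^sub>1, \<dots>, u\<^sub>t\<close> lift a transcendence basis of the residue field of \<open>\<nu>\<close>. After multiplication with a power
  \<open>y\<^sup>M\<close> of a common denominator the \<open>q\<^sup>t\<close> monomials with exponents below \<open>q\<close> come from \<open>R\<close>. Times \<open>f\<^sup>n\<close>
  they all have value at least \<open>n \<nu>(f) + M \<nu>(y)\<close>, and independence of their residues means that a combination of
  them with a coefficient one cannot reach the value \<open>n \<nu>(f) + (M + 1) \<nu>(y)\<close>. So each of the \<open>q\<close> windows of width
  \<open>\<nu>(y)\<close> in the filtration by values contributes \<open>q\<^sup>t\<close> steps. Since \<open>\<nu>(f) < \<alpha>\<close>, all these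
  windows lie below the value \<open>n \<alpha>\<close> that \<open>A\<^sub>n\<close> is known to have, provided \<open>n\<close> is a large enough multiple of \<open>q\<close>.\<close>
theorem hc_lower:
  assumes td: "has_trdeg (val_residue_field K \<nu>) (center_residue_field R K h \<nu>) t"
    and z0: "z0 \<in> center R K h \<nu>" "z0 \<noteq> \<zero>"
    and f: "f \<in> carrier R" "f \<noteq> \<zero>" "\<nu> (h f) < int \<alpha>"
    and A: "C.gring A" "A 0 = carrier R" "\<And>n. A n \<subseteq> val_ideal R K h \<nu> (n * \<alpha>)"
  shows "\<exists>k. \<forall>q\<ge>1. C.hc (A (k * q)) (C.fspan f A (k * q) (k * q)) (q ^ Suc t)"
proof -
  define F where "F = val_residue_field K \<nu>"
  define \<pi> where "\<pi> = (+>\<^bsub>OV\<^esub>) (val_max K \<nu>)"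
  have F_eq: "F = OV Quot val_max K \<nu>" unfolding F_def val_residue_field_def ..
  interpret Mx: ideal "val_max K \<nu>" OV by (rule max_ideal_O)
  interpret pi: ring_hom_cring OV F \<pi> unfolding F_eq \<pi>_def by (rule Mx.rcos_ring_hom_cring[OF O_cring])
  interpret hO: ring_hom_cring R OV h by (rule hO_hom)
  have F_carr: "carrier F = \<pi> ` carrier OV" unfolding F_eq \<pi>_def FactRing_simps by auto
  have pi_zero: "\<pi> x = \<zero>\<^bsub>F\<^esub>" if "x \<in> val_max K \<nu>" for x
    unfolding F_eq \<pi>_def quot_zero using Mx.a_rcos_const[OF that] .
  have pi_one: "\<one>\<^bsub>F\<^esub> \<noteq> \<zero>\<^bsub>F\<^esub>"
  proof
    assume "\<one>\<^bsub>F\<^esub> = \<zero>\<^bsub>F\<^esub>"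
    hence "\<pi> \<one>\<^bsub>OV\<^esub> = val_max K \<nu>" using pi.hom_one unfolding F_eq quot_zero by simp
    hence "\<one>\<^bsub>OV\<^esub> \<in> val_max K \<nu>" using Mx.a_rcos_self[OF OV.one_closed] unfolding \<pi>_def by simp
    thus False unfolding max_eq Vge_def O_ops using \<nu>_one K.one_not_zero by auto
  qed
  obtain B where B: "transcendence_basis F (center_residue_field R K h \<nu>) B" "finite B" "card B = t"
    using td unfolding has_trdeg_def F_def by auto
  have BF: "B \<subseteq> carrier F" and ind: "alg_independent F (center_residue_field R K h \<nu>) B"
    using B(1) unfolding transcendence_basis_def by auto
  have "\<forall>s\<in>B. \<exists>x\<in>carrier OV. \<pi> x = s" using BF F_carr by auto
  then obtain u where u: "\<And>s. s \<in> B \<Longrightarrow> u s \<in> carrier OV" "\<And>s. s \<in> B \<Longrightarrow> \<pi> (u s) = s" by metis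
  have OK: "x \<in> carrier OV \<Longrightarrow> x \<in> carrier K" for x unfolding O_carr Vge_def by auto
  have z0R: "z0 \<in> carrier R" using z0 unfolding center_def by auto
  obtain y w where y: "y \<in> carrier R" "y \<noteq> \<zero>" "w \<in> carrier R" "y = z0 \<otimes> w"
    and g0: "\<forall>s\<in>B. \<exists>g\<in>carrier R. h g = u s \<otimes>\<^bsub>K\<^esub> h y"
    using common_denominator[OF B(2), of u z0] u(1) OK z0R z0(2) by blast
  obtain g where g: "\<And>s. s \<in> B \<Longrightarrow> g s \<in> carrier R" "\<And>s. s \<in> B \<Longrightarrow> h (g s) = u s \<otimes>\<^bsub>K\<^esub> h y" using g0 by metis
  have "y \<in> center R K h \<nu>" unfolding y(4) center_eq
    using val_ideal_mult[of z0 1 w 0] z0(1) y(3) val_ideal_0 center_eq by simp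
  hence hy1: "1 \<le> \<nu> (h y)" using y(1,2) h_zero_iff[OF y(1)] unfolding center_eq val_ideal_iff Vge_def by auto
  define c where "c = nat (\<nu> (h y))"
  define \<phi> where "\<phi> = nat (\<nu> (h f))"
  have c: "\<nu> (h y) = int c" "c \<ge> 1" using hy1 unfolding c_def by auto
  have \<phi>: "\<nu> (h f) = int \<phi>" "\<phi> < \<alpha>" using \<nu>_h_nonneg[OF f(1,2)] f(3) unfolding \<phi>_def by auto
  have hfz: "h f \<noteq> \<zero>\<^bsub>K\<^esub>" "h y \<noteq> \<zero>\<^bsub>K\<^esub>" using h_zero_iff f y(1,2) by auto
  define mon where "mon e T = (\<Otimes>\<^bsub>OV\<^esub>s\<in>T. u s [^]\<^bsub>OV\<^esub> (e s :: nat))" for e :: "'k set \<Rightarrow> nat" and T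
  have uf: "(\<lambda>s. u s [^]\<^bsub>OV\<^esub> (e s :: nat)) \<in> T \<rightarrow> carrier OV" if "T \<subseteq> B" for e T
    using u(1) that by auto
  have monO: "mon e T \<in> carrier OV" if "T \<subseteq> B" for e T
    unfolding mon_def by (rule OV.finprod_closed[OF uf[OF that]])
  have lift: "\<exists>z\<in>carrier R. h z = h y [^]\<^bsub>K\<^esub> (\<Sum>s\<in>T. e s) \<otimes>\<^bsub>K\<^esub> mon e T" if T: "T \<subseteq> B" for T and e :: "'k set \<Rightarrow> nat"
    using finite_subset[OF T B(2)] T
  proof (induction T rule: finite_induct)
    case empty
    show ?case by (intro bexI[of _ \<one>]) (auto simp: mon_def O_ops)
  next
    case (insert s T)
    then obtain z where z: "z \<in> carrier R" "h z = h y [^]\<^bsub>K\<^esub> (\<Sum>s\<in>T. e s) \<otimes>\<^bsub>K\<^esub> mon e T" by auto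
    have s: "s \<in> B" "T \<subseteq> B" using insert by auto
    have cc: "u s \<in> carrier K" "h y \<in> carrier K" "mon e T \<in> carrier K" using OK[OF u(1)[OF s(1)]] y(1) OK[OF monO[OF s(2)]] by auto
    have m: "mon e (insert s T) = u s [^]\<^bsub>K\<^esub> e s \<otimes>\<^bsub>K\<^esub> mon e T"
    proof -
      have "u s [^]\<^bsub>OV\<^esub> e s \<in> carrier OV" by (rule OV.nat_pow_closed[OF u(1)[OF s(1)]])
      hence "mon e (insert s T) = u s [^]\<^bsub>OV\<^esub> e s \<otimes>\<^bsub>OV\<^esub> mon e T"
        unfolding mon_def by (rule OV.finprod_insert[OF insert.hyps(1,2) uf[OF s(2)]])
      thus ?thesis by (simp only: O_ops OV_pow)
    qed
    have "h (g s [^] e s \<otimes> z) = (u s \<otimes>\<^bsub>K\<^esub> h y) [^]\<^bsub>K\<^esub> e s \<otimes>\<^bsub>K\<^esub> (h y [^]\<^bsub>K\<^esub> (\<Sum>s\<in>T. e s) \<otimes>\<^bsub>K\<^esub> mon e T)"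
      using g[OF s(1)] z by simp
    also have "\<dots> = (h y [^]\<^bsub>K\<^esub> e s \<otimes>\<^bsub>K\<^esub> h y [^]\<^bsub>K\<^esub> (\<Sum>s\<in>T. e s)) \<otimes>\<^bsub>K\<^esub> (u s [^]\<^bsub>K\<^esub> e s \<otimes>\<^bsub>K\<^esub> mon e T)"
      using cc by (simp add: K.nat_pow_distrib K.m_ac)
    also have "\<dots> = h y [^]\<^bsub>K\<^esub> (\<Sum>s\<in>insert s T. e s) \<otimes>\<^bsub>K\<^esub> mon e (insert s T)"
      unfolding m using insert.hyps cc by (simp add: K.nat_pow_mult)
    finally show ?case using g(1)[OF s(1)] z(1) by (intro bexI[of _ "g s [^] e s \<otimes> z"]) auto
  qed
  \<comment> \<open>chosen so that \<open>n \<nu>(f) + (t q + q) c = n (\<nu>(f) + 1) \<le> n \<alpha>\<close> for \<open>n = k q\<close>\<close>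
  define k where "k = Suc t * c"
  have "C.hc (A (k * q)) (C.fspan f A (k * q) (k * q)) (q ^ Suc t)" if q: "q \<ge> 1" for q
  proof -
    define n where "n = k * q"
    let ?E = "{e :: 'k set \<Rightarrow> nat. (\<forall>s\<in>B. e s < q) \<and> (\<forall>s. s \<notin> B \<longrightarrow> e s = 0)}"
    let ?sup = "\<lambda>e :: 'k set \<Rightarrow> nat. {s. e s \<noteq> 0}"
    have E: "finite ?E" "card ?E = q ^ t" using card_bounded_exponents[OF B(2)] B(3) by auto
    have sup: "?sup e \<subseteq> B" if "e \<in> ?E" for e using that by auto
    have exz: "\<exists>z\<in>carrier R. h z = h y [^]\<^bsub>K\<^esub> M \<otimes>\<^bsub>K\<^esub> mon e (?sup e)" if e: "e \<in> ?E" and M: "M \<ge> t * q" for e and M :: nat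
    proof -
      obtain z where z: "z \<in> carrier R" "h z = h y [^]\<^bsub>K\<^esub> (\<Sum>s\<in>?sup e. e s) \<otimes>\<^bsub>K\<^esub> mon e (?sup e)" using lift[OF sup[OF e]] by blast
      have "(\<Sum>s\<in>?sup e. e s) \<le> (\<Sum>s\<in>B. e s)" using sup[OF e] B(2) by (intro sum_mono2) auto
      also have "\<dots> \<le> (\<Sum>s\<in>B. q)" using e by (intro sum_mono) (auto intro: less_imp_le)
      finally have le: "(\<Sum>s\<in>?sup e. e s) \<le> M" using B(3) M by simp
      let ?d = "M - (\<Sum>s\<in>?sup e. e s)"
      have cc: "h y \<in> carrier K" "mon e (?sup e) \<in> carrier K" using y(1) OK[OF monO[OF sup[OF e]]] by auto
      have "h (y [^] ?d \<otimes> z) = (h y [^]\<^bsub>K\<^esub> ?d \<otimes>\<^bsub>K\<^esub> h y [^]\<^bsub>K\<^esub> (\<Sum>s\<in>?sup e. e s)) \<otimes>\<^bsub>K\<^esub> mon e (?sup e)"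
        using y(1) z cc by (simp add: K.m_assoc)
      also have "\<dots> = h y [^]\<^bsub>K\<^esub> M \<otimes>\<^bsub>K\<^esub> mon e (?sup e)" using le cc by (simp add: K.nat_pow_mult)
      finally show ?thesis using y(1) z(1) by (intro bexI[of _ "y [^] ?d \<otimes> z"]) auto
    qed
    define zz where "zz M e = (SOME z. z \<in> carrier R \<and> h z = h y [^]\<^bsub>K\<^esub> M \<otimes>\<^bsub>K\<^esub> mon e (?sup e))" for M :: nat and e
    have zz': "zz M e \<in> carrier R \<and> h (zz M e) = h y [^]\<^bsub>K\<^esub> M \<otimes>\<^bsub>K\<^esub> mon e (?sup e)"
      if "e \<in> ?E" "M \<ge> t * q" for M e
      unfolding zz_def by (rule someI_ex) (use exz[OF that] in blast)
    have zz: "zz M e \<in> carrier R" "h (zz M e) = h y [^]\<^bsub>K\<^esub> M \<otimes>\<^bsub>K\<^esub> mon e (?sup e)"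
      if "e \<in> ?E" "M \<ge> t * q" for M e using zz'[OF that] by blast+
    let ?Y = "C.fspan f A n n"
    have sY: "C.smod ?Y" by (rule C.fspan_smod[OF A(1) f(1)])
    \<comment> \<open>windows of width \<open>c = \<nu>(y)\<close>; the offset \<open>t q\<close> makes room for all monomials, whose total exponent is at most \<open>t q\<close>\<close>
    define V where "V i = ?Y \<inter> val_ideal R K h \<nu> (n * \<phi> + (t * q + i) * c)" for i
    have sV: "C.smod (V i)" for i unfolding V_def by (rule C.smod_Int[OF sY val_ideal_smod])
    have fn: "f [^] n \<in> carrier R" using f by simp
    have hfn: "\<nu> (h (f [^] n)) = int (n * \<phi>)" "h (f [^] n) \<noteq> \<zero>\<^bsub>K\<^esub>" using \<nu>_pow[of "h f" n] hfz f(1) \<phi>(1) by auto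
    have step: "C.hc (V (Suc i)) (V i) (q ^ t)" for i
    proof -
      define M where "M = t * q + i"
      have M: "t * q \<le> M" unfolding M_def by simp
      have Vi: "V i = ?Y \<inter> val_ideal R K h \<nu> (n * \<phi> + M * c)" "V (Suc i) = ?Y \<inter> val_ideal R K h \<nu> (n * \<phi> + Suc M * c)"
        unfolding V_def M_def by simp_all
      have hyM: "\<nu> (h y [^]\<^bsub>K\<^esub> M) = int (M * c)" "h y [^]\<^bsub>K\<^esub> M \<noteq> \<zero>\<^bsub>K\<^esub>" using \<nu>_pow[of "h y" M] hfz y(1) c(1) by auto
      have "C.hc (V (Suc i)) (V i) (card ?E)"
      proof (rule C.indep_hc[OF E(1) sV sV])
        show "V (Suc i) \<subseteq> V i" unfolding Vi using val_ideal_anti[of "n * \<phi> + M * c" "n * \<phi> + Suc M * c"] by auto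
      next
        fix e assume e: "e \<in> ?E"
        have z: "zz M e \<in> carrier R" using zz(1)[OF e M] .
        have "f [^] n \<otimes> zz M e \<in> ?Y" by (rule C.fspan_contains[OF A(1) f(1)]) (use z A(2) in simp)
        moreover have "h y [^]\<^bsub>K\<^esub> M \<in> Vge (int (M * c))" unfolding Vge_def using hyM y(1) by simp
        from Vge_mult[OF this, of "mon e (?sup e)" 0] have "h (zz M e) \<in> Vge (int (M * c))"
          using zz(2)[OF e M] monO[OF sup[OF e]] O_carr by simp
        hence "zz M e \<in> val_ideal R K h \<nu> (M * c)" unfolding val_ideal_iff using z by simp
        moreover have "f [^] n \<in> val_ideal R K h \<nu> (n * \<phi>)" unfolding val_ideal_iff Vge_def using hfn fn by auto
        ultimately show "f [^] n \<otimes> zz M e \<in> V i" unfolding Vi using val_ideal_mult by blast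
      next
        fix r assume r: "r \<in> ?E \<rightarrow> carrier R" and rel: "(\<Oplus>e\<in>?E. r e \<otimes> (f [^] n \<otimes> zz M e)) \<in> V (Suc i)"
        \<comment> \<open>factor out the common value; the remaining sum \<open>S0\<close> has positive value, so its residue, a combination of monomials in the transcendence basis, vanishes\<close>
        define c0 where "c0 = h (f [^] n) \<otimes>\<^bsub>K\<^esub> h y [^]\<^bsub>K\<^esub> M"
        have hyO: "h y [^]\<^bsub>K\<^esub> M \<in> carrier OV" using hO.hom_closed[of "y [^] M"] y(1) by simp
        have c0O: "c0 \<in> carrier OV" unfolding c0_def using OV.m_closed[OF h_O[OF fn] hyO] O_ops by simp
        have c0: "c0 \<in> carrier K" "c0 \<noteq> \<zero>\<^bsub>K\<^esub>" "\<nu> c0 = int (n * \<phi> + M * c)"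
          using OK[OF c0O] \<nu>_mult[of "h (f [^] n)" "h y [^]\<^bsub>K\<^esub> M"] hfn hyM fn y(1) K.integral_iff[of "h (f [^] n)" "h y [^]\<^bsub>K\<^esub> M"]
          unfolding c0_def by auto
        let ?mt = "\<lambda>e. h (r e) \<otimes>\<^bsub>OV\<^esub> mon e (?sup e)"
        have rR: "r e \<in> carrier R" if "e \<in> ?E" for e using r that by blast
        have mtO: "?mt \<in> ?E \<rightarrow> carrier OV"
        proof
          fix e assume e: "e \<in> ?E"
          show "?mt e \<in> carrier OV" by (rule OV.m_closed[OF h_O[OF rR[OF e]] monO[OF sup[OF e]]])
        qed
        define S0 where "S0 = (\<Oplus>\<^bsub>OV\<^esub>e\<in>?E. ?mt e)"
        have S0O: "S0 \<in> carrier OV" unfolding S0_def by (rule OV.finsum_closed[OF mtO])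
        have wR: "(\<lambda>e. r e \<otimes> (f [^] n \<otimes> zz M e)) \<in> ?E \<rightarrow> carrier R" using rR fn zz(1)[OF _ M] by auto
        have "h (\<Oplus>e\<in>?E. r e \<otimes> (f [^] n \<otimes> zz M e)) = (\<Oplus>\<^bsub>OV\<^esub>e\<in>?E. (h \<circ> (\<lambda>e. r e \<otimes> (f [^] n \<otimes> zz M e))) e)"
          using hO.hom_finsum[OF wR] by (simp add: o_def)
        also have "\<dots> = (\<Oplus>\<^bsub>OV\<^esub>e\<in>?E. c0 \<otimes>\<^bsub>OV\<^esub> ?mt e)"
        proof (rule OV.finsum_cong'[OF refl])
          show "(\<lambda>e. c0 \<otimes>\<^bsub>OV\<^esub> ?mt e) \<in> ?E \<rightarrow> carrier OV" using mtO c0O by (auto simp: Pi_def)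
          fix e assume e: "e \<in> ?E"
          have cc: "h (r e) \<in> carrier K" "h (f [^] n) \<in> carrier K" "h y [^]\<^bsub>K\<^esub> M \<in> carrier K" "mon e (?sup e) \<in> carrier K"
            using rR[OF e] fn y(1) OK[OF monO[OF sup[OF e]]] by auto
          have "h (r e \<otimes> (f [^] n \<otimes> zz M e)) = h (r e) \<otimes>\<^bsub>K\<^esub> (h (f [^] n) \<otimes>\<^bsub>K\<^esub> (h y [^]\<^bsub>K\<^esub> M \<otimes>\<^bsub>K\<^esub> mon e (?sup e)))"
            using rR[OF e] fn zz(1)[OF e M] h.hom_mult R.m_closed zz(2)[OF e M] by metis
          also have "\<dots> = c0 \<otimes>\<^bsub>K\<^esub> (h (r e) \<otimes>\<^bsub>K\<^esub> mon e (?sup e))"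
            unfolding c0_def using cc by (simp only: K.m_ac K.m_closed)
          finally show "(h \<circ> (\<lambda>e. r e \<otimes> (f [^] n \<otimes> zz M e))) e = c0 \<otimes>\<^bsub>OV\<^esub> ?mt e" by (simp only: O_ops o_def)
        qed
        also have "\<dots> = c0 \<otimes>\<^bsub>OV\<^esub> S0" unfolding S0_def by (rule OV.finsum_rdistr[OF E(1) c0O mtO, symmetric])
        finally have hsum: "h (\<Oplus>e\<in>?E. r e \<otimes> (f [^] n \<otimes> zz M e)) = c0 \<otimes>\<^bsub>K\<^esub> S0" by (simp only: O_ops)
        have "h (\<Oplus>e\<in>?E. r e \<otimes> (f [^] n \<otimes> zz M e)) \<in> Vge (int (n * \<phi> + Suc M * c))"
          by (rule val_ideal_iff[THEN iffD1, THEN conjunct2]) (rule IntD2[OF rel[unfolded Vi(2)]])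
        hence "c0 \<otimes>\<^bsub>K\<^esub> S0 \<in> Vge (\<nu> c0 + int c)" unfolding hsum c0(3) by (simp add: algebra_simps)
        hence "S0 \<in> Vge (int c)" by (rule Vge_cancel[OF c0(1,2) OK[OF S0O]])
        hence "S0 \<in> val_max K \<nu>" unfolding max_eq using Vge_anti[of 1 "int c"] c(2) by auto
        hence "\<pi> S0 = \<zero>\<^bsub>F\<^esub>" by (rule pi_zero)
        moreover have "\<pi> S0 = (\<Oplus>\<^bsub>F\<^esub>e\<in>?E. (\<pi> \<circ> ?mt) e)" unfolding S0_def using pi.hom_finsum[OF mtO] by (simp add: o_def)
        moreover have "\<dots> = (\<Oplus>\<^bsub>F\<^esub>e\<in>?E. \<pi> (h (r e)) \<otimes>\<^bsub>F\<^esub> (\<Otimes>\<^bsub>F\<^esub>s\<in>?sup e. s [^]\<^bsub>F\<^esub> e s))"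
        proof (rule pi.S.finsum_cong'[OF refl])
          have eq: "(\<pi> \<circ> ?mt) e = \<pi> (h (r e)) \<otimes>\<^bsub>F\<^esub> (\<Otimes>\<^bsub>F\<^esub>s\<in>?sup e. s [^]\<^bsub>F\<^esub> e s)" if e: "e \<in> ?E" for e
          proof -
            have "\<pi> (mon e (?sup e)) = (\<Otimes>\<^bsub>F\<^esub>s\<in>?sup e. (\<pi> \<circ> (\<lambda>s. u s [^]\<^bsub>OV\<^esub> e s)) s)"
              unfolding mon_def using pi.hom_finprod[OF uf[OF sup[OF e]]] by (simp add: o_def)
            also have "\<dots> = (\<Otimes>\<^bsub>F\<^esub>s\<in>?sup e. s [^]\<^bsub>F\<^esub> e s)"
            proof (rule pi.S.finprod_cong'[OF refl])
              show "(\<lambda>s. s [^]\<^bsub>F\<^esub> e s) \<in> ?sup e \<rightarrow> carrier F" using sup[OF e] BF by auto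
              show "(\<pi> \<circ> (\<lambda>s. u s [^]\<^bsub>OV\<^esub> e s)) s = s [^]\<^bsub>F\<^esub> e s" if "s \<in> ?sup e" for s
                using u[of s] sup[OF e] that by (auto simp: o_def)
            qed
            finally show ?thesis using pi.hom_mult[OF h_O[OF rR[OF e]] monO[OF sup[OF e]]] by (simp only: o_def)
          qed
          show "(\<pi> \<circ> ?mt) e = \<pi> (h (r e)) \<otimes>\<^bsub>F\<^esub> (\<Otimes>\<^bsub>F\<^esub>s\<in>?sup e. s [^]\<^bsub>F\<^esub> e s)" if "e \<in> ?E" for e by (rule eq[OF that])
          show "(\<lambda>e. \<pi> (h (r e)) \<otimes>\<^bsub>F\<^esub> (\<Otimes>\<^bsub>F\<^esub>s\<in>?sup e. s [^]\<^bsub>F\<^esub> e s)) \<in> ?E \<rightarrow> carrier F"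
          proof
            fix e assume e: "e \<in> ?E"
            have "?mt e \<in> carrier OV" using mtO e by blast
            hence "(\<pi> \<circ> ?mt) e \<in> carrier F" by simp
            thus "\<pi> (h (r e)) \<otimes>\<^bsub>F\<^esub> (\<Otimes>\<^bsub>F\<^esub>s\<in>?sup e. s [^]\<^bsub>F\<^esub> e s) \<in> carrier F" using eq[OF e] by simp
          qed
        qed
        ultimately have zero: "(\<Oplus>\<^bsub>F\<^esub>e\<in>?E. \<pi> (h (r e)) \<otimes>\<^bsub>F\<^esub> (\<Otimes>\<^bsub>F\<^esub>s\<in>?sup e. s [^]\<^bsub>F\<^esub> e s)) = \<zero>\<^bsub>F\<^esub>" by simp
        have res: "\<pi> (h x) \<in> center_residue_field R K h \<nu>" if x: "x \<in> carrier R" for x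
        proof -
          have "\<one> \<notin> center R K h \<nu>" using R.primeideal_one[OF center_primeideal] .
          moreover have "h x = h x \<otimes>\<^bsub>K\<^esub> inv\<^bsub>K\<^esub> h \<one>" using x by simp
          ultimately have "h x \<in> localization R K h (center R K h \<nu>)" unfolding localization_def using x by blast
          thus ?thesis unfolding center_residue_field_def \<pi>_def by blast
        qed
        have all0: "\<forall>e\<in>?E. \<pi> (h (r e)) = \<zero>\<^bsub>F\<^esub>"
        proof (rule ind[unfolded alg_independent_def, rule_format, of ?E "\<lambda>e. \<pi> (h (r e))", THEN ballI])
          show "finite ?E \<and> (\<forall>e\<in>?E. finite (?sup e) \<and> ?sup e \<subseteq> B \<and> \<pi> (h (r e)) \<in> center_residue_field R K h \<nu>) \<and>
            (\<Oplus>\<^bsub>F\<^esub>e\<in>?E. \<pi> (h (r e)) \<otimes>\<^bsub>F\<^esub> (\<Otimes>\<^bsub>F\<^esub>s\<in>?sup e. s [^]\<^bsub>F\<^esub> e s)) = \<zero>\<^bsub>F\<^esub>"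
            using E(1) sup finite_subset[OF sup B(2)] res rR zero by blast
        qed
        have one: "\<pi> (h \<one>) = \<one>\<^bsub>F\<^esub>" using hO.hom_one pi.hom_one by simp
        show "\<forall>e\<in>?E. r e \<noteq> \<one>"
        proof (rule ballI, rule notI)
          fix e assume e: "e \<in> ?E" and re: "r e = \<one>"
          have "\<pi> (h (r e)) = \<zero>\<^bsub>F\<^esub>" by (rule bspec[OF all0 e])
          thus False using pi_one unfolding re one by (rule notE[rotated])
        qed
      qed
      thus ?thesis using E(2) by simp
    qed
    have "C.hc (V q) (V 0) (q * q ^ t)" by (rule C.hc_iterate[where V = V, OF _ sV]) (rule step)
    moreover have "A n \<subseteq> V q"
    proof -
      have "n * \<phi> + (t * q + q) * c = n * Suc \<phi>" unfolding n_def k_def by (simp add: algebra_simps)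
      also have "\<dots> \<le> n * \<alpha>" using \<phi>(2) by (intro mult_left_mono) auto
      finally have "A n \<subseteq> val_ideal R K h \<nu> (n * \<phi> + (t * q + q) * c)" using A(3)[of n] val_ideal_anti by blast
      moreover have "A n \<subseteq> ?Y" using C.fspan_mono[OF A(1) f(1), of 0 n n] by simp
      ultimately show ?thesis unfolding V_def by blast
    qed
    moreover have "V 0 \<subseteq> ?Y" unfolding V_def by blast
    ultimately have "C.hc (A n) ?Y (q * q ^ t)" by (rule C.hc_mono)
    thus ?thesis by (simp add: n_def)
  qed
  thus ?thesis by blast
qed

end

section \<open>Truncated filtrations\<close>

lemma filtration_gring:
  assumes R: "cring R" and F: "filtration R I"
  shows "const_ring.gring R (carrier R) I"
proof -
  interpret cring R by (rule R)
  interpret C: const_ring R "carrier R" by (rule const_ring_carrier)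
  have idl: "ideal (I n) R" and I0: "I 0 = carrier R" and prod: "ideal_prod R (I i) (I j) \<subseteq> I (i + j)" for n i j
    using F unfolding filtration_def by auto
  have s: "C.smod (I n)" for n using smod_iff_ideal idl by simp
  show ?thesis
  proof (rule C.gringI)
    show "I n \<subseteq> carrier R" "\<zero>\<^bsub>R\<^esub> \<in> I n" for n using C.smod_sub[OF s] C.smod_0[OF s] by auto
    show "a \<oplus>\<^bsub>R\<^esub> b \<in> I n" if "a \<in> I n" "b \<in> I n" for n a b using C.smod_add[OF s that] .
    show "a \<otimes>\<^bsub>R\<^esub> b \<in> I (i + j)" if "a \<in> I i" "b \<in> I j" for i j a b
      using prod ideal_prod.prod[OF that] by blast
  qed (use I0 in simp)
qed

lemma ideal_prod_least:
  assumes "const_ring.smod R (carrier R) N" "cring R" "\<And>a b. a \<in> I \<Longrightarrow> b \<in> J \<Longrightarrow> a \<otimes>\<^bsub>R\<^esub> b \<in> N"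
  shows "ideal_prod R I J \<subseteq> N"
proof
  interpret cring R by (rule assms(2))
  interpret C: const_ring R "carrier R" by (rule const_ring_carrier)
  fix x assume "x \<in> ideal_prod R I J"
  thus "x \<in> N" by induction (use assms(3) C.smod_add[OF assms(1)] in auto)
qed

context
  fixes R :: "('a, 'b) ring_scheme" (structure) and I :: "nat \<Rightarrow> 'a set" and b :: nat
  assumes R: "local_ring R" and F: "filtration R I" and b: "b \<ge> 1"
begin

interpretation R: cring R by (rule local_ringD(1)[OF R])
interpretation C: const_ring R "carrier R" by (rule R.const_ring_carrier)
interpretation L: local_base R "carrier R" "max_ideal R" by (rule local_ring_base[OF R])

lemma trunc_low: "n \<le> b \<Longrightarrow> truncated R I b n = I n"
  by (subst truncated.simps) simp

lemma trunc_high: "n > b \<Longrightarrow> truncated R I b n =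
    genideal R (\<Union>i\<in>{1..<n}. ideal_prod R (truncated R I b i) (truncated R I b (n - i)))"
  by (subst truncated.simps) simp

lemma trunc_high_sub:
  assumes "\<And>i. i < n \<Longrightarrow> truncated R I b i \<subseteq> carrier R"
  shows "(\<Union>i\<in>{1..<n}. ideal_prod R (truncated R I b i) (truncated R I b (n - i))) \<subseteq> carrier R"
proof -
  have "ideal_prod R (truncated R I b i) (truncated R I b (n - i)) \<subseteq> carrier R" if "i \<in> {1..<n}" for i
  proof (rule ideal_prod_least[OF C.smod_Z R.is_cring])
    have "truncated R I b i \<subseteq> carrier R" "truncated R I b (n - i) \<subseteq> carrier R"
      using assms[of i] assms[of "n - i"] that by auto
    thus "x \<otimes> y \<in> carrier R" if "x \<in> truncated R I b i" "y \<in> truncated R I b (n - i)" for x y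
      using that by blast
  qed
  thus ?thesis by blast
qed

lemma trunc_smod: "C.smod (truncated R I b n)"
proof (induction n rule: less_induct)
  case (less n)
  show ?case
  proof (cases "n \<le> b")
    case True
    thus ?thesis using F R.smod_iff_ideal unfolding filtration_def by (simp add: trunc_low)
  next
    case False
    have "(\<Union>i\<in>{1..<n}. ideal_prod R (truncated R I b i) (truncated R I b (n - i))) \<subseteq> carrier R"
      by (rule trunc_high_sub) (rule C.smod_sub[OF less.IH])
    from R.genideal_ideal[OF this] show ?thesis using False R.smod_iff_ideal by (simp add: trunc_high)
  qed
qed

lemma I0: "I 0 = carrier R" using F unfolding filtration_def by auto

lemma trunc_gring: "C.gring (truncated R I b)"
proof (rule C.gringI)
  show "truncated R I b n \<subseteq> carrier R" "\<zero> \<in> truncated R I b n" for n using C.smod_sub[OF trunc_smod] C.smod_0[OF trunc_smod] by auto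
  show "x \<oplus> y \<in> truncated R I b n" if "x \<in> truncated R I b n" "y \<in> truncated R I b n" for n x y
    using C.smod_add[OF trunc_smod that] .
  show "carrier R \<subseteq> truncated R I b 0" using I0 by (simp add: trunc_low)
  show "x \<otimes> y \<in> truncated R I b (i + j)" if xy: "x \<in> truncated R I b i" "y \<in> truncated R I b j" for i j x y
  proof (cases "i + j \<le> b")
    case True
    thus ?thesis using xy C.gringD(5)[OF filtration_gring[OF R.is_cring F], of x i y j] by (simp add: trunc_low)
  next
    case False
    have c: "x \<in> carrier R" "y \<in> carrier R" using xy C.smod_carr[OF trunc_smod] by auto
    show ?thesis
    proof (cases "i = 0 \<or> j = 0")
      case True
      thus ?thesis using xy c C.smod_mult[OF trunc_smod, of x y j] C.smod_mult[OF trunc_smod, of y x i] R.m_comm[OF c] by auto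
    next
      case ij: False
      have "i \<in> {1..<i + j}" "i + j - i = j" using ij by auto
      hence "x \<otimes> y \<in> (\<Union>i'\<in>{1..<i + j}. ideal_prod R (truncated R I b i') (truncated R I b (i + j - i')))"
        using ideal_prod.prod[OF xy] by (intro UN_I[of i]) simp_all
      moreover have "(\<Union>i'\<in>{1..<i + j}. ideal_prod R (truncated R I b i') (truncated R I b (i + j - i'))) \<subseteq> carrier R"
        by (rule trunc_high_sub) (rule C.smod_sub[OF trunc_smod])
      ultimately show ?thesis using R.genideal_self trunc_high[of "i + j"] False by auto
    qed
  qed
qed

lemma trunc_least:
  assumes A: "C.gring A" and IA: "\<And>n. 1 \<le> n \<Longrightarrow> n \<le> b \<Longrightarrow> I n \<subseteq> A n"
  shows "truncated R I b n \<subseteq> A n"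
proof (induction n rule: less_induct)
  case (less n)
  consider "n = 0" | "1 \<le> n" "n \<le> b" | "n > b" by linarith
  thus ?case
  proof cases
    case 1
    thus ?thesis using C.gringD(4)[OF A] C.smod_sub[OF trunc_smod, of 0] by blast
  next
    case 2
    thus ?thesis using IA by (simp add: trunc_low)
  next
    case 3
    have "ideal_prod R (truncated R I b i) (truncated R I b (n - i)) \<subseteq> A n" if i: "i \<in> {1..<n}" for i
    proof (rule ideal_prod_least[OF C.gring_smod[OF A] R.is_cring])
      fix x y assume xy: "x \<in> truncated R I b i" "y \<in> truncated R I b (n - i)"
      have "x \<in> A i" "y \<in> A (n - i)" using less.IH[of i] less.IH[of "n - i"] xy i by auto
      from C.gringD(5)[OF A this] show "x \<otimes> y \<in> A n" using i by simp
    qed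
    hence "(\<Union>i\<in>{1..<n}. ideal_prod R (truncated R I b i) (truncated R I b (n - i))) \<subseteq> A n" by blast
    thus ?thesis unfolding trunc_high[OF 3] using R.genideal_minimal R.smod_iff_ideal C.gring_smod[OF A] by blast
  qed
qed

text \<open>The truncation is generated by generators of \<open>I\<^sub>1, \<dots>, I\<^sub>b\<close> in their degrees.\<close>
lemma trunc_gacc: "C.gacc (truncated R I b)"
proof -
  interpret N: noetherian_ring R by (rule local_ringD(2)[OF R])
  have "\<exists>G. finite G \<and> G \<subseteq> carrier R \<and> I n = Idl G" for n
    using N.finetely_gen[of "I n"] F unfolding filtration_def by auto
  then obtain g where g: "\<And>n. finite (g n)" "\<And>n. g n \<subseteq> carrier R" "\<And>n. I n = Idl (g n)" by metis
  define G where "G = (\<Union>i\<in>{1..b}. (\<lambda>x. (x, i)) ` g i)"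
  have G: "finite G" "G \<subseteq> carrier R \<times> UNIV" unfolding G_def using g by auto
  have A: "C.gring (C.gal G)" by (rule C.gal_gring[OF G(2)])
  have "C.gal G = truncated R I b"
  proof (intro ext equalityI)
    fix n
    show "C.gal G n \<subseteq> truncated R I b n"
    proof (rule C.gal_least[OF trunc_gring])
      fix x e assume "(x, e) \<in> G"
      hence e: "e \<in> {1..b}" "x \<in> g e" unfolding G_def by auto
      have "x \<in> I e" using e R.genideal_self[OF g(2)[of e]] unfolding g(3)[of e] by blast
      thus "x \<in> truncated R I b e" using e by (simp add: trunc_low)
    qed
    show "truncated R I b n \<subseteq> C.gal G n"
    proof (rule trunc_least[OF A])
      fix n assume n: "1 \<le> n" "n \<le> b"
      have "g n \<subseteq> C.gal G n" using n by (auto simp: G_def intro!: C.gal_gen)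
      thus "I n \<subseteq> C.gal G n" unfolding g(3)[of n] using R.genideal_minimal R.smod_iff_ideal C.gring_smod[OF A] by blast
    qed
  qed
  thus ?thesis using L.hilbert_basis[OF G] by simp
qed

end

section \<open>A valuation centred at the maximal ideal\<close>

lemma primeideal_local:
  assumes "local_ring R" "primeideal P R" shows "P \<subseteq> max_ideal R"
  using local_ring_proper_ideal[OF assms(1)] assms(2) primeideal.axioms(1) primeideal.I_notcarr by metis

lemma max_ideal_prime:
  assumes "local_ring R" shows "primeideal (max_ideal R) R"
  using cring.maximalideal_prime[OF local_ringD(1,3)[OF assms]] .

text \<open>Every chain of primes can be prolonged to end at the maximal ideal.\<close>
lemma krull_dim_le_height:
  assumes R: "local_ring R" shows "krull_dim R \<le> height R (max_ideal R)"
  unfolding krull_dim_def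
proof (rule Sup_least)
  fix d assume "d \<in> {enat n |n. \<exists>C. prime_chain R C n}"
  then obtain n C where C: "prime_chain R C n" "d = enat n" by auto
  show "d \<le> height R (max_ideal R)"
  proof (cases "C n = max_ideal R")
    case True
    thus ?thesis unfolding height_def using C by (intro Sup_upper) auto
  next
    case False
    have "primeideal (C n) R" using C unfolding prime_chain_def by auto
    hence lt: "C n \<subset> max_ideal R" using primeideal_local[OF R] False by blast
    let ?D = "\<lambda>i. if i \<le> n then C i else max_ideal R"
    have "prime_chain R ?D (Suc n)"
      using C(1) lt max_ideal_prime[OF R] unfolding prime_chain_def by (auto simp: le_Suc_eq less_Suc_eq)
    hence "enat (Suc n) \<le> height R (max_ideal R)" unfolding height_def
      by (intro Sup_upper) (auto intro!: exI[of _ "Suc n"] exI[of _ ?D])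
    moreover have "d \<le> enat (Suc n)" using C by simp
    ultimately show ?thesis by (rule order_trans[rotated])
  qed
qed

lemma valued_domainI:
  assumes "domain R" "quotient_field R K h" "divisorial_valuation R K h \<nu>"
  shows "valued_domain R K h \<nu>"
  using assms unfolding valued_domain_def valued_domain_axioms_def quotient_field_def divisorial_valuation_def by auto

text \<open>The growth forced by \<open>\<nu>\<close> is of order \<open>t + 1\<close>, where \<open>t\<close> is the transcendence degree, and
  \<open>t + 1\<close> is the height of the centre, that is, the dimension of \<open>R\<close>. The generators of the truncation satisfy the
  lower bound on values, and hence so do all its components.\<close>
theorem spread_truncated_ge:
  assumes R: "local_ring R" and dom: "domain R" and qf: "quotient_field R K h"
    and F: "filtration R I" and b: "b \<ge> 1"
    and \<nu>: "divisorial_valuation R K h \<nu>" and cen: "center R K h \<nu> = max_ideal R"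
    and I\<nu>: "\<And>n. n \<ge> 1 \<Longrightarrow> I n \<subseteq> val_ideal R K h \<nu> (n * \<alpha>)"
    and f: "f \<in> carrier R" "f \<notin> val_ideal R K h \<nu> \<alpha>" and fm: "\<And>x. x \<in> max_ideal R \<Longrightarrow> f \<otimes>\<^bsub>R\<^esub> x \<in> I 1"
  shows "krull_dim R \<le> analytic_spread R (truncated R I b)"
proof -
  interpret V: valued_domain R K h \<nu> by (rule valued_domainI[OF dom qf \<nu>])
  interpret L: local_base R "carrier R" "max_ideal R" by (rule local_ring_base[OF R])
  let ?A = "truncated R I b"
  have A: "V.C.gring ?A" by (rule trunc_gring[OF R F b])
  interpret Re: rees R ?A by (unfold_locales) (rule A)
  obtain t where t: "has_trdeg (val_residue_field K \<nu>) (center_residue_field R K h \<nu>) t"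
    "enat t + 1 = height R (center R K h \<nu>)" using \<nu> unfolding divisorial_valuation_def by auto
  have ht: "height R (max_ideal R) = enat (Suc t)" using t(2) unfolding cen by (simp add: one_enat_def)
  have "\<exists>z0\<in>max_ideal R. z0 \<noteq> \<zero>\<^bsub>R\<^esub>"
  proof (rule ccontr)
    assume "\<not> ?thesis"
    hence M0: "max_ideal R \<subseteq> {\<zero>\<^bsub>R\<^esub>}" by blast
    have "height R (max_ideal R) \<le> 0" unfolding height_def
    proof (rule Sup_least)
      fix d assume "d \<in> {enat n |n. \<exists>C. prime_chain R C n \<and> C n = max_ideal R}"
      then obtain n C where C: "prime_chain R C n" "C n = max_ideal R" "d = enat n" by auto
      show "d \<le> 0"
      proof (cases n)
        case (Suc n')
        hence lt: "C n' \<subset> max_ideal R" and pr: "primeideal (C n') R" using C unfolding prime_chain_def by auto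
        have "\<zero>\<^bsub>R\<^esub> \<in> C n'" using pr primeideal.axioms(1) ideal.axioms(1) additive_subgroup.zero_closed by blast
        thus ?thesis using lt M0 by blast
      qed (use C in \<open>simp add: zero_enat_def\<close>)
    qed
    thus False unfolding ht by (simp add: zero_enat_def)
  qed
  then obtain z0 where z0: "z0 \<in> center R K h \<nu>" "z0 \<noteq> \<zero>\<^bsub>R\<^esub>" unfolding cen by blast
  have f0: "f \<noteq> \<zero>\<^bsub>R\<^esub>" using f(2) V.C.smod_0[OF V.val_ideal_smod] by blast
  have fv: "\<nu> (h f) < int \<alpha>" using f V.h_zero_iff[OF f(1)] f0 unfolding V.val_ideal_iff V.Vge_def by auto
  have Vg: "V.C.gring (\<lambda>n. val_ideal R K h \<nu> (n * \<alpha>))"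
  proof (rule V.C.gringI)
    show "val_ideal R K h \<nu> (n * \<alpha>) \<subseteq> carrier R" "\<zero>\<^bsub>R\<^esub> \<in> val_ideal R K h \<nu> (n * \<alpha>)" for n
      using V.C.smod_sub[OF V.val_ideal_smod] V.C.smod_0[OF V.val_ideal_smod] by auto
    show "x \<oplus>\<^bsub>R\<^esub> y \<in> val_ideal R K h \<nu> (n * \<alpha>)" if "x \<in> val_ideal R K h \<nu> (n * \<alpha>)" "y \<in> val_ideal R K h \<nu> (n * \<alpha>)" for n x y
      using V.C.smod_add[OF V.val_ideal_smod that] .
    show "carrier R \<subseteq> val_ideal R K h \<nu> (0 * \<alpha>)" using V.val_ideal_0 by simp
    show "x \<otimes>\<^bsub>R\<^esub> y \<in> val_ideal R K h \<nu> ((i + j) * \<alpha>)" if "x \<in> val_ideal R K h \<nu> (i * \<alpha>)" "y \<in> val_ideal R K h \<nu> (j * \<alpha>)" for i j x y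
      using V.val_ideal_mult[OF that] by (simp add: algebra_simps)
  qed
  have Aval: "?A n \<subseteq> val_ideal R K h \<nu> (n * \<alpha>)" for n
    by (rule trunc_least[OF R F b Vg I\<nu>])
  have A0: "?A 0 = carrier R" using trunc_low[OF R F b, of 0] I0[OF R F b] by simp
  obtain k where k: "\<And>q. q \<ge> 1 \<Longrightarrow> V.C.hc (?A (k * q)) (V.C.fspan f ?A (k * q) (k * q)) (q ^ Suc t)"
    using V.hc_lower[OF t(1) z0 f(1) f0 fv A A0 Aval] by blast
  have A1: "?A 1 = I 1" by (rule trunc_low[OF R F b b])
  obtain Q where Q: "\<forall>i\<le>Suc t. V.C.gprime ?A (Q i)" "\<forall>i<Suc t. Q i < Q (Suc i)" "max_ideal R \<subseteq> Q 0 0"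
    using L.gchain_of_growth[OF A A0 trunc_gacc[OF R F b] f(1) _ k] fm A1 by auto
  have "enat (Suc t) \<le> analytic_spread R ?A"
    by (rule Re.spread_ge[of _ Q]) (use Q L.m(2) in auto)
  moreover have "krull_dim R \<le> enat (Suc t)" using krull_dim_le_height[OF R] ht by simp
  ultimately show ?thesis by (rule order_trans[rotated])
qed

section \<open>Parameters\<close>

context local_base
begin

lemma zprimeD:
  assumes "zprime P"
  shows "smod P" "P \<subseteq> Z" "\<one> \<notin> P" "a \<in> Z \<Longrightarrow> b \<in> Z \<Longrightarrow> a \<otimes> b \<in> P \<Longrightarrow> a \<in> P \<or> b \<in> P"
  using assms unfolding zprime_def by auto

lemma zprime_mult: "zprime P \<Longrightarrow> a \<in> Z \<Longrightarrow> b \<in> P \<Longrightarrow> a \<otimes> b \<in> P" "zprime P \<Longrightarrow> a \<in> P \<Longrightarrow> b \<in> Z \<Longrightarrow> a \<otimes> b \<in> P"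
proof -
  show 1: "zprime P \<Longrightarrow> a \<in> Z \<Longrightarrow> b \<in> P \<Longrightarrow> a \<otimes> b \<in> P" for a b using smod_mult zprimeD(1) by blast
  assume P: "zprime P" "a \<in> P" "b \<in> Z"
  have "a \<in> carrier S" using P zprimeD(2)[OF P(1)] by auto
  thus "a \<otimes> b \<in> P" using 1[OF P(1,3,2)] m_comm[of a b] P by simp
qed

text \<open>Any such set contains all minimal primes over \<open>N\<close>.\<close>
definition primes_cover :: "'a set \<Rightarrow> 'a set set \<Rightarrow> bool" where
  "primes_cover N Ps \<longleftrightarrow> finite Ps \<and> (\<forall>P\<in>Ps. zprime P \<and> N \<subseteq> P) \<and> (\<forall>P. zprime P \<longrightarrow> N \<subseteq> P \<longrightarrow> (\<exists>Q\<in>Ps. Q \<subseteq> P))"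

text \<open>Noetherian induction: for a maximal counterexample \<open>M\<close> and \<open>u v \<in> M\<close> with neither factor in \<open>M\<close>, a
  prime over \<open>M\<close> lies over \<open>M + (u)\<close> or over \<open>M + (v)\<close>.\<close>
lemma finite_primes_above:
  assumes "smod N" "N \<subseteq> Z"
  shows "\<exists>Ps. primes_cover N Ps"
proof (rule ccontr)
  let ?Q = "\<lambda>N. \<not> (\<exists>Ps. primes_cover N Ps)"
  assume "?Q N"
  then obtain M where M: "smod M" "M \<subseteq> Z" "?Q M" and M4: "\<forall>N'. smod N' \<longrightarrow> N' \<subseteq> Z \<longrightarrow> M \<subset> N' \<longrightarrow> \<not> ?Q N'"
    using max_smod[OF assms, of ?Q] by auto
  have M': "\<exists>Ps. primes_cover N' Ps" if "smod N' \<and> N' \<subseteq> Z \<and> M \<subset> N'" for N' using M4 that by simp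
  show False
  proof (cases "zprime M")
    case True
    hence "primes_cover M {M}" unfolding primes_cover_def by simp
    thus False using M(3) by blast
  next
    case np: False
    show False
    proof (cases "\<one> \<in> M")
      case True
      have "\<not> M \<subseteq> P" if "zprime P" for P using True zprimeD(3)[OF that] by blast
      hence "primes_cover M {}" unfolding primes_cover_def by simp
      thus False using M(3) by blast
    next
      case False
      then obtain u v where uv: "u \<in> Z" "v \<in> Z" "u \<otimes> v \<in> M" "u \<notin> M" "v \<notin> M"
        using np False M(1,2) unfolding zprime_def by auto
      have *: "smod (sadd M (scale u Z)) \<and> sadd M (scale u Z) \<subseteq> Z \<and> M \<subset> sadd M (scale u Z)" if u: "u \<in> Z" "u \<notin> M" for u
      proof -
        have "u \<otimes> \<one> \<in> scale u Z" unfolding scale_def by blast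
        hence "u \<in> sadd M (scale u Z)" using sadd_sup2[OF smod_sub[OF smod_sZ[OF u(1)]] M(1)] u by auto
        moreover have "M \<subseteq> sadd M (scale u Z)" using sadd_sup1[OF smod_sub[OF M(1)] smod_sZ[OF u(1)]] .
        ultimately show ?thesis using u smod_sadd[OF M(1) smod_sZ[OF u(1)]] sadd_least[OF smod_Z M(2) scale_sub[OF smod_Z u(1)]] by blast
      qed
      obtain P1 where P1: "primes_cover (sadd M (scale u Z)) P1" using M'[OF *[OF uv(1,4)]] by blast
      obtain P2 where P2: "primes_cover (sadd M (scale v Z)) P2" using M'[OF *[OF uv(2,5)]] by blast
      have "\<exists>Q\<in>P1 \<union> P2. Q \<subseteq> P" if P: "zprime P" "M \<subseteq> P" for P
      proof -
        have in1: "sadd M (scale w Z) \<subseteq> P" if w: "w \<in> P" for w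
        proof (rule sadd_least[OF zprimeD(1)[OF P(1)] P(2)])
          show "scale w Z \<subseteq> P" unfolding scale_def using zprime_mult(2)[OF P(1) w] by blast
        qed
        have "u \<in> P \<or> v \<in> P" using zprimeD(4)[OF P(1) uv(1,2)] uv(3) P(2) by blast
        thus ?thesis
        proof
          assume "u \<in> P"
          then obtain Q where "Q \<in> P1" "Q \<subseteq> P" using in1[of u] P1 P(1) unfolding primes_cover_def by auto
          thus ?thesis by blast
        next
          assume "v \<in> P"
          then obtain Q where "Q \<in> P2" "Q \<subseteq> P" using in1[of v] P2 P(1) unfolding primes_cover_def by auto
          thus ?thesis by blast
        qed
      qed
      moreover have "zprime P \<and> M \<subseteq> P" if "P \<in> P1 \<union> P2" for P
      proof (cases "P \<in> P1")
        case True
        hence "zprime P" "sadd M (scale u Z) \<subseteq> P" using P1 unfolding primes_cover_def by auto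
        thus ?thesis using *[OF uv(1,4)] by blast
      next
        case False
        hence "zprime P" "sadd M (scale v Z) \<subseteq> P" using P2 that unfolding primes_cover_def by auto
        thus ?thesis using *[OF uv(2,5)] by blast
      qed
      ultimately have "primes_cover M (P1 \<union> P2)" using P1 P2 unfolding primes_cover_def by auto
      thus False using M(3) by blast
    qed
  qed
qed

text \<open>A prime contained in another one can be dropped. If none of the others is contained in \<open>P\<close>, an \<open>x\<close> avoiding
  all others but lying in \<open>P\<close> is corrected by an element in all the others outside \<open>P\<close>.\<close>
lemma prime_avoidance:
  assumes "finite Ps" "\<And>P. P \<in> Ps \<Longrightarrow> zprime P" "\<And>P. P \<in> Ps \<Longrightarrow> \<not> m \<subseteq> P"
  shows "\<exists>x\<in>m. \<forall>P\<in>Ps. x \<notin> P"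
  using assms
proof (induction "card Ps" arbitrary: Ps rule: less_induct)
  case less
  show ?case
  proof (cases "Ps = {}")
    case True
    thus ?thesis using smod_0[OF m(1)] by blast
  next
    case False
    then obtain P where P: "P \<in> Ps" by blast
    show ?thesis
    proof (cases "\<exists>Q\<in>Ps. Q \<noteq> P \<and> Q \<subseteq> P")
      case True
      then obtain Q where Q: "Q \<in> Ps" "Q \<noteq> P" "Q \<subseteq> P" by blast
      have "card (Ps - {Q}) < card Ps" using Q(1) less.prems(1) by (meson card_Diff1_less)
      from less.hyps[OF this] obtain x where x: "x \<in> m" "\<forall>P\<in>Ps - {Q}. x \<notin> P" using less.prems by auto
      have "x \<notin> Q" using x(2) P Q by blast
      thus ?thesis using x by blast
    next
      case anti: False
      have "card (Ps - {P}) < card Ps" using P less.prems(1) by (meson card_Diff1_less)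
      from less.hyps[OF this] obtain x where x: "x \<in> m" "\<forall>Q\<in>Ps - {P}. x \<notin> Q" using less.prems by auto
      show ?thesis
      proof (cases "x \<in> P")
        case False
        thus ?thesis using x by blast
      next
        case xP: True
        have "\<exists>z\<in>m. z \<notin> P \<and> (\<forall>Q\<in>T. z \<in> Q)" if "T \<subseteq> Ps - {P}" for T
          using finite_subset[OF that finite_Diff[OF less.prems(1)]] that
        proof (induction T rule: finite_induct)
          case empty
          show ?case using less.prems(3)[OF P] by blast
        next
          case (insert Q T)
          then obtain z where z: "z \<in> m" "z \<notin> P" "\<forall>Q\<in>T. z \<in> Q" by blast
          have Q: "Q \<in> Ps" "Q \<noteq> P" using insert.prems by auto
          then obtain w where w: "w \<in> Q" "w \<notin> P" using anti by blast
          have wZ: "w \<in> Z" using w zprimeD(2)[OF less.prems(2)[OF Q(1)]] by blast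
          have zZ: "z \<in> Z" using z m by blast
          have "w \<otimes> z \<in> m" using smod_mult[OF m(1) wZ z(1)] .
          moreover have "w \<otimes> z \<notin> P" using zprimeD(4)[OF less.prems(2)[OF P] wZ zZ] w z by blast
          moreover have "w \<otimes> z \<in> Q" by (rule zprime_mult(2)[OF less.prems(2)[OF Q(1)] w(1) zZ])
          moreover have "w \<otimes> z \<in> Q'" if "Q' \<in> T" for Q'
            by (rule zprime_mult(1)[OF less.prems(2) wZ]) (use that insert.prems z(3) in auto)
          ultimately show ?case by blast
        qed
        from this[OF order_refl] obtain z where z: "z \<in> m" "z \<notin> P" "\<forall>Q\<in>Ps - {P}. z \<in> Q" by blast
        have c: "x \<in> carrier S" "z \<in> carrier S" using x z smod_carr[OF m(1)] by auto
        have "x \<oplus> z \<in> m" using smod_add[OF m(1) x(1) z(1)] .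
        moreover have "x \<oplus> z \<notin> P" using smod_add_cancel[OF zprimeD(1)[OF less.prems(2)[OF P]] xP c(2)] z(2) by blast
        moreover have "x \<oplus> z \<notin> Q" if Q: "Q \<in> Ps - {P}" for Q
        proof
          assume "x \<oplus> z \<in> Q"
          hence "z \<oplus> x \<in> Q" using c by (simp add: a_comm)
          hence "x \<in> Q" using smod_add_cancel[OF zprimeD(1)[OF less.prems(2)], of Q z x] Q z(3) c by blast
          thus False using x(2) Q by blast
        qed
        ultimately show ?thesis by blast
      qed
    qed
  qed
qed

definition zchain :: "'a set \<Rightarrow> nat \<Rightarrow> bool" where
  "zchain N n \<longleftrightarrow> (\<exists>C. (\<forall>i\<le>n. zprime (C i)) \<and> (\<forall>i<n. C i \<subset> C (Suc i)) \<and> N \<subseteq> C 0)"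

text \<open>Adding to \<open>N\<close> an element of \<open>m\<close> that avoids the minimal primes other than \<open>m\<close> shortens chains: below
  a chain over the larger ideal there is room for a minimal prime over \<open>N\<close>. Once there is no chain of length one, \<open>m\<close> is the only prime and the colength is finite.\<close>
lemma parameters:
  assumes "smod N" "N \<subseteq> Z" "\<not> zchain N (Suc e)"
  shows "\<exists>xs c. set xs \<subseteq> m \<and> length xs \<le> e \<and> len (sgen N xs 1) Z \<le> enat c"
  using assms
proof (induction e arbitrary: N)
  case 0
  have "\<exists>c::nat. len N Z \<le> enat c"
  proof (rule finite_len[OF 0(1,2)])
    fix P assume P: "zprime P" "N \<subseteq> P"
    show "P = m"
    proof (rule ccontr)
      assume "P \<noteq> m"
      hence lt: "P \<subset> m" using proper_sub_m[OF zprimeD(1,2,3)[OF P(1)]] by blast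
      have "zchain N (Suc 0)" unfolding zchain_def
        by (rule exI[of _ "\<lambda>i. if i = 0 then P else m"]) (use P lt zprime_m in auto)
      thus False using 0(3) by simp
    qed
  qed
  then obtain c :: nat where "len N Z \<le> enat c" by blast
  thus ?case by (intro exI[of _ "[]"] exI[of _ c]) simp
next
  case (Suc e)
  obtain Ps where Ps: "finite Ps" "\<forall>P\<in>Ps. zprime P \<and> N \<subseteq> P" "\<forall>P. zprime P \<longrightarrow> N \<subseteq> P \<longrightarrow> (\<exists>Q\<in>Ps. Q \<subseteq> P)"
    using finite_primes_above[OF Suc.prems(1,2)] unfolding primes_cover_def by auto
  have "\<exists>x\<in>m. \<forall>P\<in>Ps - {m}. x \<notin> P"
  proof (rule prime_avoidance)
    fix P assume P: "P \<in> Ps - {m}"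
    show "zprime P" using P Ps by blast
    hence "P \<subseteq> m" using proper_sub_m zprimeD(1-3) by blast
    thus "\<not> m \<subseteq> P" using P by blast
  qed (use Ps in simp)
  then obtain x where x: "x \<in> m" "\<And>P. P \<in> Ps - {m} \<Longrightarrow> x \<notin> P" by blast
  have xZ: "x \<in> Z" using x m by auto
  let ?N = "sadd N (scale x Z)"
  have sN: "smod ?N" using smod_sadd[OF Suc.prems(1) smod_sZ[OF xZ]] .
  have NZ: "?N \<subseteq> Z" using sadd_least[OF smod_Z Suc.prems(2) scale_sub[OF smod_Z xZ]] .
  have "\<not> zchain ?N (Suc e)"
  proof
    assume "zchain ?N (Suc e)"
    then obtain C where C: "\<forall>i\<le>Suc e. zprime (C i)" "\<forall>i<Suc e. C i \<subset> C (Suc i)" "?N \<subseteq> C 0" unfolding zchain_def by blast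
    have C0: "zprime (C 0)" using C(1) by simp
    have NC: "N \<subseteq> C 0" using C(3) sadd_sup1[OF smod_sub[OF Suc.prems(1)] smod_sZ[OF xZ]] by blast
    have "x \<otimes> \<one> \<in> scale x Z" unfolding scale_def by blast
    hence "x \<in> ?N" using sadd_sup2[OF smod_sub[OF smod_sZ[OF xZ]] Suc.prems(1)] xZ by auto
    hence xC: "x \<in> C 0" using C(3) by blast
    obtain Q where Q: "Q \<in> Ps" "Q \<subseteq> C 0" using Ps(3) C0 NC by blast
    have "C 0 \<subset> C (Suc 0)" "C (Suc 0) \<subseteq> m" using C(1,2) proper_sub_m zprimeD(1-3) by auto
    hence "Q \<noteq> m" using Q(2) by blast
    hence "x \<notin> Q" using x(2) Q by blast
    hence lt: "Q \<subset> C 0" using Q(2) xC by blast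
    have "zchain N (Suc (Suc e))" unfolding zchain_def
    proof (intro exI[of _ "\<lambda>i. case i of 0 \<Rightarrow> Q | Suc i \<Rightarrow> C i"] conjI allI impI)
      fix i assume "i \<le> Suc (Suc e)" thus "zprime (case i of 0 \<Rightarrow> Q | Suc i \<Rightarrow> C i)" using C(1) Ps(2) Q(1) by (cases i) auto
    next
      fix i assume "i < Suc (Suc e)"
      thus "(case i of 0 \<Rightarrow> Q | Suc i \<Rightarrow> C i) \<subset> (case Suc i of 0 \<Rightarrow> Q | Suc i \<Rightarrow> C i)"
        using C(2) lt by (cases i) auto
    qed (use Ps(2) Q(1) in auto)
    thus False using Suc.prems(3) by simp
  qed
  from Suc.IH[OF sN NZ this] obtain xs c where xs: "set xs \<subseteq> m" "length xs \<le> e" "len (sgen ?N xs 1) Z \<le> enat c" by blast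
  have "sgen N (x # xs) 1 = sgen ?N xs 1" using xZ by simp
  thus ?case using xs x(1) by (intro exI[of _ "x # xs"] exI[of _ c]) auto
qed

lemma sgen_contains: "smod N \<Longrightarrow> set xs \<subseteq> Z \<Longrightarrow> x \<in> set xs \<Longrightarrow> x [^] s \<in> sgen N xs s"
proof (induction xs arbitrary: N)
  case (Cons y ys)
  have y: "y [^] s \<in> Z" using Cons.prems by auto
  have sN: "smod (sadd N (scale (y [^] s) Z))" by (rule smod_sadd[OF Cons.prems(1) smod_sZ[OF y]])
  show ?case
  proof (cases "x = y")
    case True
    have "y [^] s \<otimes> \<one> \<in> scale (y [^] s) Z" unfolding scale_def by blast
    hence "y [^] s \<in> sadd N (scale (y [^] s) Z)" using sadd_sup2[OF smod_sub[OF smod_sZ[OF y]] Cons.prems(1)] y by auto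
    thus ?thesis using sgen_sub[OF sN, of ys s] Cons.prems(2) True by auto
  next
    case False
    thus ?thesis using Cons.IH[OF sN] Cons.prems by auto
  qed
qed simp

text \<open>A crude bound by the number of generators of \<open>m\<close>, uniform in \<open>N\<close>; it covers the case in which no
  bound on the dimension is at hand.\<close>
lemma parameters_exist:
  "\<exists>xs. set xs \<subseteq> m \<and> (\<forall>N. smod N \<longrightarrow> N \<subseteq> Z \<longrightarrow> len (sgen N xs 1) Z \<le> enat 1)"
proof -
  obtain F where F: "finite F" "F \<subseteq> m" "\<And>K. smod K \<Longrightarrow> F \<subseteq> K \<Longrightarrow> m \<subseteq> K" using finitely_generated[OF m(1,2)] by blast
  obtain xs where xs: "set xs = F" using finite_list[OF F(1)] by blast
  have xsZ: "set xs \<subseteq> Z" using xs F(2) m(2) by auto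
  have "len (sgen N xs 1) Z \<le> enat 1" if N: "smod N" for N
  proof -
    have "F \<subseteq> sgen N xs 1"
    proof
      fix x assume x: "x \<in> F"
      have "x [^] (1::nat) \<in> sgen N xs 1" by (rule sgen_contains[OF N xsZ]) (use x xs in simp)
      thus "x \<in> sgen N xs 1" using x xs xsZ by auto
    qed
    hence "m \<subseteq> sgen N xs 1" using F(3)[OF sgen_smod[OF N xsZ]] by blast
    hence "len (sgen N xs 1) Z \<le> len m Z" by (rule len_mono) simp
    also have "\<dots> \<le> enat 1" using len_m by (simp add: one_enat_def)
    finally show ?thesis .
  qed
  thus ?thesis using xs F(2) by blast
qed

end

section \<open>Images of local rings\<close>

text \<open>Applied to \<open>R \<rightarrow> R/p\<close>, embedded as constants in \<open>(R/p)[t]\<close>.\<close>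
lemma local_base_image:
  assumes R: "local_ring R" and psi: "ring_hom_cring R Y \<psi>"
    and ker: "\<And>r. r \<in> carrier R \<Longrightarrow> \<psi> r = \<zero>\<^bsub>Y\<^esub> \<Longrightarrow> r \<in> max_ideal R"
  shows "local_base Y (\<psi> ` carrier R) (\<psi> ` max_ideal R)"
proof -
  interpret h: ring_hom_cring R Y \<psi> by (rule psi)
  interpret L: local_base R "carrier R" "max_ideal R" by (rule local_ring_base[OF R])
  have sub: "subring (\<psi> ` carrier R) Y" 
    by (rule ring_hom_ring.img_is_subring[OF ring_hom_ringI2[OF h.R.ring_axioms h.S.ring_axioms h.homh] h.R.carrier_is_subring])
  interpret C: const_ring Y "\<psi> ` carrier R" by (intro const_ring.intro const_ring_axioms.intro h.S.is_cring sub)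
  have mc: "r \<in> max_ideal R \<Longrightarrow> r \<in> carrier R" for r using L.m(2) by auto
  have sm: "C.smod (\<psi> ` N)" if N: "L.smod N" for N
  proof (rule C.smodI)
    have NR: "r \<in> N \<Longrightarrow> r \<in> carrier R" for r using L.smod_carr[OF N] .
    show "\<psi> ` N \<subseteq> carrier Y" using NR by auto
    show "\<zero>\<^bsub>Y\<^esub> \<in> \<psi> ` N" using L.smod_0[OF N] h.hom_zero by (metis imageI)
    show "a \<oplus>\<^bsub>Y\<^esub> b \<in> \<psi> ` N" if ab: "a \<in> \<psi> ` N" "b \<in> \<psi> ` N" for a b
    proof -
      obtain r s where rs: "r \<in> N" "s \<in> N" "a = \<psi> r" "b = \<psi> s" using ab by auto
      have "a \<oplus>\<^bsub>Y\<^esub> b = \<psi> (r \<oplus>\<^bsub>R\<^esub> s)" using rs NR by simp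
      thus ?thesis using L.smod_add[OF N rs(1,2)] by simp
    qed
    show "a \<otimes>\<^bsub>Y\<^esub> b \<in> \<psi> ` N" if ab: "a \<in> \<psi> ` carrier R" "b \<in> \<psi> ` N" for a b
    proof -
      obtain r s where rs: "r \<in> carrier R" "s \<in> N" "a = \<psi> r" "b = \<psi> s" using ab by auto
      have "a \<otimes>\<^bsub>Y\<^esub> b = \<psi> (r \<otimes>\<^bsub>R\<^esub> s)" using rs NR by simp
      thus ?thesis using L.smod_mult[OF N rs(1,2)] by simp
    qed
  qed
  show ?thesis
  proof (unfold_locales)
    show "C.smod (\<psi> ` max_ideal R)" by (rule sm[OF L.m(1)])
    show "\<psi> ` max_ideal R \<subseteq> \<psi> ` carrier R" using L.m(2) by blast
    show "\<one>\<^bsub>Y\<^esub> \<notin> \<psi> ` max_ideal R"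
    proof
      assume "\<one>\<^bsub>Y\<^esub> \<in> \<psi> ` max_ideal R"
      then obtain r where r: "r \<in> max_ideal R" "\<psi> r = \<one>\<^bsub>Y\<^esub>" by auto
      have rR: "r \<in> carrier R" using mc[OF r(1)] .
      have "\<psi> (\<one>\<^bsub>R\<^esub> \<ominus>\<^bsub>R\<^esub> r) = \<one>\<^bsub>Y\<^esub> \<ominus>\<^bsub>Y\<^esub> \<psi> r" using rR by (simp add: a_minus_def)
      also have "\<dots> = \<zero>\<^bsub>Y\<^esub>" unfolding r(2) by (simp add: a_minus_def h.S.r_neg)
      finally have "\<one>\<^bsub>R\<^esub> \<ominus>\<^bsub>R\<^esub> r \<in> max_ideal R" using ker[of "\<one>\<^bsub>R\<^esub> \<ominus>\<^bsub>R\<^esub> r"] rR by simp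
      thus False using L.one_minus_m[OF r(1)] by simp
    qed
    fix z assume z: "z \<in> \<psi> ` carrier R" "z \<notin> \<psi> ` max_ideal R"
    then obtain r where r: "r \<in> carrier R" "z = \<psi> r" "r \<notin> max_ideal R" by auto
    obtain w where w: "w \<in> carrier R" "r \<otimes>\<^bsub>R\<^esub> w = \<one>\<^bsub>R\<^esub>" using L.units[OF r(1,3)] by blast
    have "\<psi> r \<otimes>\<^bsub>Y\<^esub> \<psi> w = \<one>\<^bsub>Y\<^esub>" using w r h.hom_mult[of r w] h.hom_one by simp
    thus "\<exists>w\<in>\<psi> ` carrier R. z \<otimes>\<^bsub>Y\<^esub> w = \<one>\<^bsub>Y\<^esub>" using w(1) r(2) by blast
  next
    fix N assume N: "\<And>i::nat. C.smod (N i)" "\<And>i. N i \<subseteq> \<psi> ` carrier R" "\<And>i. N i \<subseteq> N (Suc i)"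
    let ?N = "\<lambda>i. {r \<in> carrier R. \<psi> r \<in> N i}"
    have "L.smod (?N i)" for i
      by (rule L.smodI) (use C.smod_0[OF N(1)] C.smod_add[OF N(1)] C.smod_mult[OF N(1)] in auto)
    moreover have "?N i \<subseteq> carrier R" "?N i \<subseteq> ?N (Suc i)" for i using N(3) by auto
    ultimately obtain k where k: "\<forall>i\<ge>k. ?N i = ?N k" using L.acc_Z[of ?N] by blast
    have im: "N i = \<psi> ` ?N i" for i using N(2)[of i] by auto
    have "N i = N k" if "i \<ge> k" for i using k that im[of i] im[of k] by metis
    thus "\<exists>k. \<forall>i\<ge>k. N i = N k" by blast
  qed
qed

text \<open>Preimages of a strict chain in the image are a strict chain.\<close>
lemma len_image_le:
  assumes R: "cring R" and psi: "ring_hom_cring R Y \<psi>"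
  shows "const_ring.len Y (\<psi> ` carrier R) N (\<psi> ` carrier R) \<le> const_ring.len R (carrier R) {r \<in> carrier R. \<psi> r \<in> N} (carrier R)"
proof -
  interpret h: ring_hom_cring R Y \<psi> by (rule psi)
  interpret D: const_ring R "carrier R" by (rule cring.const_ring_carrier[OF R])
  have sub: "subring (\<psi> ` carrier R) Y" 
    by (rule ring_hom_ring.img_is_subring[OF ring_hom_ringI2[OF h.R.ring_axioms h.S.ring_axioms h.homh] h.R.carrier_is_subring])
  interpret C: const_ring Y "\<psi> ` carrier R" by (intro const_ring.intro const_ring_axioms.intro h.S.is_cring sub)
  show ?thesis
  proof (rule C.len_leI)
    fix n assume "C.hc N (\<psi> ` carrier R) n"
    then obtain K where K: "C.schain N (\<psi> ` carrier R) K n" unfolding C.hc_def by auto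
    let ?K = "\<lambda>i. {r \<in> carrier R. \<psi> r \<in> K i}"
    have sK: "i \<le> n \<Longrightarrow> C.smod (K i)" for i using K unfolding C.schain_def by auto
    have KZ: "i \<le> n \<Longrightarrow> K i \<subseteq> \<psi> ` carrier R" for i
      using C.schain_mono[OF K, of i n] K unfolding C.schain_def by auto
    have "D.schain {r \<in> carrier R. \<psi> r \<in> N} (carrier R) ?K n"
      unfolding D.schain_def
    proof (intro conjI allI impI)
      fix i assume i: "i \<le> n"
      show "D.smod (?K i)"
        by (rule D.smodI) (use C.smod_0[OF sK[OF i]] C.smod_add[OF sK[OF i]] C.smod_mult[OF sK[OF i]] in auto)
    next
      fix i assume i: "i < n"
      have lt: "K i \<subset> K (Suc i)" using K i unfolding C.schain_def by auto
      then obtain z where z: "z \<in> K (Suc i)" "z \<notin> K i" by auto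
      then obtain r where "r \<in> carrier R" "z = \<psi> r" using KZ[of "Suc i"] i by auto
      thus "?K i \<subset> ?K (Suc i)" using lt z by auto
    next
      show "{r \<in> carrier R. \<psi> r \<in> N} \<subseteq> ?K 0" using K unfolding C.schain_def by auto
    qed auto
    thus "enat n \<le> D.len {r \<in> carrier R. \<psi> r \<in> N} (carrier R)" using D.len_ge unfolding D.hc_def by blast
  qed
qed

section \<open>A prime below the special fibre\<close>

context rees
begin

text \<open>The contraction to the Rees ring of the extension of \<open>N\<close> to the polynomial ring.\<close>
definition extn :: "'a set \<Rightarrow> (nat \<Rightarrow> 'a) set" where
  "extn N = {q \<in> carrier A. \<forall>n. up_ring.coeff P q n \<in> N}"

text \<open>For ideals this is equivalent to \<open>extn N \<subseteq> Q\<close>, but it can be tested one coefficient at a time.\<close>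
definition hsub :: "'a set \<Rightarrow> (nat \<Rightarrow> 'a) set \<Rightarrow> bool" where
  "hsub N Q \<longleftrightarrow> (\<forall>i. \<forall>g\<in>N \<inter> I i. up_ring.monom P g i \<in> Q)"

lemma I_carr: "a \<in> I n \<Longrightarrow> a \<in> carrier R" using C.gringD(6)[OF gr] .

lemma Q_facts:
  assumes Q: "primeideal Q A"
  shows "Q \<subseteq> carrier A" "\<zero>\<^bsub>P\<^esub> \<in> Q" "p \<in> Q \<Longrightarrow> q \<in> Q \<Longrightarrow> p \<oplus>\<^bsub>P\<^esub> q \<in> Q"
    "p \<in> carrier A \<Longrightarrow> q \<in> Q \<Longrightarrow> p \<otimes>\<^bsub>P\<^esub> q \<in> Q"
    "p \<in> carrier A \<Longrightarrow> q \<in> carrier A \<Longrightarrow> p \<otimes>\<^bsub>P\<^esub> q \<in> Q \<Longrightarrow> p \<in> Q \<or> q \<in> Q" "\<one>\<^bsub>P\<^esub> \<notin> Q"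
proof -
  interpret Q: primeideal Q A by (rule Q)
  show "Q \<subseteq> carrier A" by (rule Q.a_subset)
  show "\<zero>\<^bsub>P\<^esub> \<in> Q" using Q.zero_closed by (simp add: A_zero)
  show "p \<in> Q \<Longrightarrow> q \<in> Q \<Longrightarrow> p \<oplus>\<^bsub>P\<^esub> q \<in> Q" using Q.a_closed[of p q] by (simp add: A_add)
  show "p \<in> carrier A \<Longrightarrow> q \<in> Q \<Longrightarrow> p \<otimes>\<^bsub>P\<^esub> q \<in> Q" using Q.I_l_closed[of q p] by (simp add: A_mult)
  show "p \<in> carrier A \<Longrightarrow> q \<in> carrier A \<Longrightarrow> p \<otimes>\<^bsub>P\<^esub> q \<in> Q \<Longrightarrow> p \<in> Q \<or> q \<in> Q" using Q.I_prime[of p q] by (simp add: A_mult)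
  show "\<one>\<^bsub>P\<^esub> \<notin> Q" using A.primeideal_one[OF Q] by (simp add: A_one)
qed

lemma monom_prod: "a \<in> I i \<Longrightarrow> b \<in> I j \<Longrightarrow> up_ring.monom P (a \<otimes> b) (i + j) = up_ring.monom P a i \<otimes>\<^bsub>P\<^esub> up_ring.monom P b j"
  using UP.monom_mult[of a b i j] I_carr by simp

lemma monom_prime:
  assumes Q: "primeideal Q A" and ab: "a \<in> I i" "b \<in> I j" "up_ring.monom P (a \<otimes> b) (i + j) \<in> Q"
  shows "up_ring.monom P a i \<in> Q \<or> up_ring.monom P b j \<in> Q"
  using Q_facts(5)[OF Q monom_in_A[OF ab(1)] monom_in_A[OF ab(2)]] ab(3) monom_prod[OF ab(1,2)] by simp

lemma I_pow: "a \<in> I i \<Longrightarrow> a [^] (n::nat) \<in> I (n * i)"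
proof (induction n)
  case 0
  show ?case using I0 by simp
next
  case (Suc n)
  show ?case using C.gringD(5)[OF gr Suc.IH[OF Suc.prems] Suc.prems] by (simp add: add.commute)
qed

lemma monom_pow_prime:
  assumes Q: "primeideal Q A" and a: "a \<in> I i"
  shows "up_ring.monom P (a [^] Suc n) (Suc n * i) \<in> Q \<Longrightarrow> up_ring.monom P a i \<in> Q"
proof (induction n)
  case 0
  thus ?case using I_carr[OF a] by simp
next
  case (Suc n)
  have "up_ring.monom P (a [^] Suc n \<otimes> a) (Suc n * i + i) \<in> Q" using Suc.prems by (simp add: add.commute)
  from monom_prime[OF Q I_pow[OF a] a this] show ?case using Suc.IH by blast
qed

lemma extn_sub:
  assumes Q: "primeideal Q A" and N: "hsub N Q"
  shows "extn N \<subseteq> Q"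
proof
  fix q assume q: "q \<in> extn N"
  hence qA: "q \<in> carrier A" "q \<in> carrier P" and qN: "\<And>n. up_ring.coeff P q n \<in> N \<inter> I n"
    unfolding extn_def A_carrier by auto
  interpret U: const_ring P "(\<lambda>c. up_ring.monom P c 0) ` carrier R"
  proof (intro const_ring.intro const_ring_axioms.intro)
    show "cring P" by (rule UP.P.is_cring)
    show "subring ((\<lambda>c. up_ring.monom P c 0) ` carrier R) P"
    proof -
      interpret cs: ring_hom_ring R P "\<lambda>c. up_ring.monom P c 0"
        by (rule ring_hom_ringI2[OF ring_axioms UP.P.ring_axioms UP.const_ring_hom])
      show ?thesis by (rule cs.img_is_subring[OF carrier_is_subring])
    qed
  qed
  have sQ: "U.smod Q"
  proof (rule U.smodI)
    show "Q \<subseteq> carrier P" using Q_facts(1)[OF Q] unfolding A_carrier by auto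
    show "z \<otimes>\<^bsub>P\<^esub> a \<in> Q" if "z \<in> (\<lambda>c. up_ring.monom P c 0) ` carrier R" "a \<in> Q" for z a
      using Q_facts(4)[OF Q _ that(2), of z] that(1) monom_in_A[of _ 0] I0 by auto
  qed (use Q_facts(2,3)[OF Q] in auto)
  have "(\<Oplus>\<^bsub>P\<^esub>i\<in>{..deg R q}. up_ring.monom P (up_ring.coeff P q i) i) \<in> Q"
    by (rule U.smod_finsum[OF sQ]) (use N qN in \<open>auto simp: hsub_def\<close>)
  thus "q \<in> Q" using UP.up_repr[OF qA(2)] by simp
qed

text \<open>Take \<open>p\<close> maximal among the ideals that contain \<open>x\<close>, have infinite colength and satisfy \<open>hsub p Q\<close>. The
  ideal \<open>xR\<close> is one of them: an element \<open>x r\<close> of \<open>I\<^sub>i\<close> has \<open>r \<in> I\<^sub>i\<close>, and \<open>x\<close> lies in \<open>Q\<close>. To see that \<open>p\<close> is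
  prime, let \<open>u v \<in> p\<close> and compare \<open>p + (u)\<close> with \<open>p : u\<close>, whose product lies in \<open>p\<close>. They cannot
  both have finite colength. If both violate \<open>hsub\<close>, two homogeneous elements outside \<open>Q\<close> have a product in
  \<open>Q\<close>. If one has finite colength and the other contains \<open>g\<close> with \<open>g t\<^sup>i \<notin> Q\<close>, then a power of \<open>g\<close> lies
  in the first and thus a higher power of \<open>g t\<^sup>i\<close> in \<open>Q\<close>.\<close>
lemma exists_prime:
  assumes R: "local_ring R" and Q: "primeideal Q A"
    and MQ: "(\<lambda>c. up_ring.monom P c 0) ` max_ideal R \<subseteq> Q"
    and IM: "\<And>n. n \<ge> 1 \<Longrightarrow> I n \<subseteq> max_ideal R"
    and x: "x \<in> max_ideal R" and cancel: "\<And>n z. z \<in> carrier R \<Longrightarrow> x \<otimes> z \<in> I n \<Longrightarrow> z \<in> I n"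
    and inf: "\<And>c::nat. \<not> C.len (C.scale x (carrier R)) (carrier R) \<le> enat c"
  shows "\<exists>p. primeideal p R \<and> x \<in> p \<and> p \<noteq> max_ideal R \<and> hsub p Q"
proof -
  interpret L: local_base R "carrier R" "max_ideal R" by (rule local_ring_base[OF R])
  have xR: "x \<in> carrier R" using x L.m(2) by auto
  let ?a0 = "C.scale x (carrier R)"
  have s0: "C.smod ?a0" by (rule C.smod_sZ[OF xR])
  have a0c: "?a0 \<subseteq> carrier R" using C.smod_sub[OF s0] .
  have "x \<otimes> \<one> \<in> ?a0" unfolding C.scale_def by blast
  hence x0: "x \<in> ?a0" using xR by simp
  have h0: "hsub ?a0 Q" unfolding hsub_def
  proof (intro allI ballI)
    fix i g assume g: "g \<in> ?a0 \<inter> I i"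
    then obtain r where r: "r \<in> carrier R" "g = x \<otimes> r" unfolding C.scale_def by auto
    have rI: "r \<in> I i" using cancel[OF r(1), of i] g r(2) by simp
    have "up_ring.monom P (x \<otimes> r) (0 + i) = up_ring.monom P x 0 \<otimes>\<^bsub>P\<^esub> up_ring.monom P r i"
      using UP.monom_mult[OF xR r(1), of 0 i] by simp
    also have "\<dots> = up_ring.monom P r i \<otimes>\<^bsub>P\<^esub> up_ring.monom P x 0" using xR r(1) by (intro UP.P.m_comm) auto
    also have "\<dots> \<in> Q" using Q_facts(4)[OF Q monom_in_A[OF rI], of "up_ring.monom P x 0"] MQ x by auto
    finally show "up_ring.monom P g i \<in> Q" using r by simp
  qed
  let ?Q = "\<lambda>N. x \<in> N \<and> hsub N Q \<and> (\<forall>c::nat. \<not> C.len N (carrier R) \<le> enat c)"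
  have Q0: "?Q ?a0" using x0 h0 inf by blast
  obtain p where p: "C.smod p" "p \<subseteq> carrier R" "?Q p" and
    pmax: "\<forall>N'. C.smod N' \<longrightarrow> N' \<subseteq> carrier R \<longrightarrow> p \<subset> N' \<longrightarrow> \<not> ?Q N'"
    using L.max_smod[OF s0 a0c, of ?Q] Q0 by auto
  have infp: "\<And>c::nat. \<not> C.len p (carrier R) \<le> enat c" using p(3) by blast
  have one_len: "C.len N (carrier R) \<le> enat 0" if "C.smod N" "\<one> \<in> N" for N
  proof -
    have "carrier R \<subseteq> N" using C.smod_mult[OF that(1), of _ \<one>] that(2) by force
    thus ?thesis using C.len_eq_0[OF C.smod_Z] by (simp add: zero_enat_def)
  qed
  have p1: "\<one> \<notin> p" using one_len[OF p(1)] infp by blast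
  \<comment> \<open>the mixed case: one factor of finite colength, the other with a homogeneous element outside \<open>Q\<close>\<close>
  have no_pair: False
    if g: "g \<in> a1" "g \<in> I i" "up_ring.monom P g i \<notin> Q" "g \<in> max_ideal R"
      and a2: "C.smod a2" "a2 \<subseteq> carrier R" "C.len a2 (carrier R) \<le> enat c"
      and prod: "\<And>u v. u \<in> a1 \<Longrightarrow> v \<in> a2 \<Longrightarrow> u \<otimes> v \<in> p" for g a1 a2 i and c :: nat
  proof -
    obtain k :: nat where k: "g [^] k \<in> a2" using L.power_in_finite_len[OF a2 g(4)] by blast
    have gR: "g \<in> carrier R" using I_carr[OF g(2)] .
    have "g \<otimes> g [^] k \<in> p" by (rule prod[OF g(1) k])
    moreover have "g \<otimes> g [^] k = g [^] Suc k" using gR by (simp add: m_comm)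
    ultimately have "g [^] Suc k \<in> p \<inter> I (Suc k * i)" using I_pow[OF g(2), of "Suc k"] by simp
    hence "up_ring.monom P (g [^] Suc k) (Suc k * i) \<in> Q" using p(3) unfolding hsub_def by blast
    hence "up_ring.monom P g i \<in> Q" by (rule monom_pow_prime[OF Q g(2)])
    thus False using g(3) by simp
  qed
  \<comment> \<open>in positive degree \<open>g \<in> I\<^sub>i \<subseteq> m\<close>; in degree zero \<open>g\<close> is in \<open>m\<close> or a unit\<close>
  have in_M: "g \<in> max_ideal R \<or> \<one> \<in> N" if N: "C.smod N" "g \<in> N" "g \<in> I i" "up_ring.monom P g i \<notin> Q" for N g i
  proof (cases "i = 0")
    case True
    show ?thesis
    proof (cases "g \<in> max_ideal R")
      case False
      have gR: "g \<in> carrier R" using I_carr[OF N(3)] .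
      have "\<one> \<in> N" by (rule L.smod_unit[OF N(1) gR False]) (use gR N(2) in auto)
      thus ?thesis by simp
    qed simp
  next
    case False
    thus ?thesis using IM[of i] N(3) by auto
  qed
  have "C.zprime p" unfolding C.zprime_def
  proof (intro conjI ballI impI)
    fix u v assume uv: "u \<in> carrier R" "v \<in> carrier R" "u \<otimes> v \<in> p"
    show "u \<in> p \<or> v \<in> p"
    proof (rule ccontr)
      assume "\<not> ?thesis"
      hence n: "u \<notin> p" "v \<notin> p" by auto
      let ?a1 = "C.sadd p (C.scale u (carrier R))" and ?a2 = "C.zcolon p u"
      have s1: "C.smod ?a1" using C.smod_sadd[OF p(1) C.smod_sZ[OF uv(1)]] .
      have s2: "C.smod ?a2" by (rule C.smod_zcolon[OF p(1) uv(1)])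
      have c1: "?a1 \<subseteq> carrier R" "?a2 \<subseteq> carrier R" using C.smod_sub s1 s2 by auto
      have "u \<otimes> \<one> \<in> C.scale u (carrier R)" unfolding C.scale_def by blast
      hence u1: "u \<in> ?a1" using C.sadd_sup2[OF C.smod_sub[OF C.smod_sZ[OF uv(1)]] p(1)] uv(1) by auto
      have "p \<subseteq> ?a1" by (rule C.sadd_sup1[OF p(2) C.smod_sZ[OF uv(1)]])
      hence l1: "p \<subset> ?a1" using u1 n by blast
      have "p \<subseteq> ?a2" unfolding C.zcolon_def using p(2) C.smod_mult[OF p(1) uv(1)] by auto
      moreover have v2: "v \<in> ?a2" unfolding C.zcolon_def using uv by simp
      ultimately have l2: "p \<subset> ?a2" using n by blast
      have prod: "s \<otimes> r \<in> p" if r: "r \<in> ?a1" and s: "s \<in> ?a2" for r s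
      proof -
        obtain a b where ab: "a \<in> p" "b \<in> carrier R" "r = a \<oplus> u \<otimes> b" using r unfolding C.sadd_def C.scale_def by auto
        have s': "s \<in> carrier R" "u \<otimes> s \<in> p" using s unfolding C.zcolon_def by auto
        have aR: "a \<in> carrier R" using ab p(2) by auto
        have "s \<otimes> r = s \<otimes> a \<oplus> b \<otimes> (u \<otimes> s)" unfolding ab(3) using aR ab(2) uv(1) s'(1) by algebra
        moreover have "s \<otimes> a \<oplus> b \<otimes> (u \<otimes> s) \<in> p"
          by (rule C.smod_add[OF p(1) C.smod_mult[OF p(1) s'(1) ab(1)] C.smod_mult[OF p(1) ab(2) s'(2)]])
        ultimately show ?thesis by simp
      qed
      have prod': "r \<otimes> s \<in> p" if rs: "r \<in> ?a1" "s \<in> ?a2" for r s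
      proof -
        have "r \<otimes> s = s \<otimes> r" by (rule m_comm[OF subsetD[OF c1(1) rs(1)] subsetD[OF c1(2) rs(2)]])
        thus ?thesis using prod[OF rs] by simp
      qed
      have xp: "x \<in> ?a1" "x \<in> ?a2" using p(3) l1 l2 by auto
      have "\<not> ?Q ?a1" using pmax s1 c1 l1 by blast
      hence q1: "\<not> hsub ?a1 Q \<or> (\<exists>c::nat. C.len ?a1 (carrier R) \<le> enat c)" using xp by blast
      have "\<not> ?Q ?a2" using pmax s2 c1 l2 by blast
      hence q2: "\<not> hsub ?a2 Q \<or> (\<exists>c::nat. C.len ?a2 (carrier R) \<le> enat c)" using xp by blast
      have nofin: "\<not> ((\<exists>c::nat. C.len ?a1 (carrier R) \<le> enat c) \<and> (\<exists>c::nat. C.len ?a2 (carrier R) \<le> enat c))"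
      proof
        assume "(\<exists>c::nat. C.len ?a1 (carrier R) \<le> enat c) \<and> (\<exists>c::nat. C.len ?a2 (carrier R) \<le> enat c)"
        then obtain c d :: nat where cd: "C.len ?a1 (carrier R) \<le> enat c" "C.len ?a2 (carrier R) \<le> enat d" by blast
        have "C.len p (carrier R) \<le> enat d + enat c"
          using C.len_colon[OF p(1,2) uv(1)] add_mono[OF cd(2,1)] by (rule order_trans)
        thus False using infp[of "d + c"] by simp
      qed
      show False
      proof (cases "hsub ?a1 Q")
        case True
        then obtain c :: nat where c: "C.len ?a1 (carrier R) \<le> enat c" using q1 by blast
        hence "\<not> hsub ?a2 Q" using q2 nofin by blast
        then obtain i g where g: "g \<in> ?a2" "g \<in> I i" "up_ring.monom P g i \<notin> Q" unfolding hsub_def by blast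
        have "\<one> \<notin> ?a2" using n uv(1) unfolding C.zcolon_def by auto
        hence gM: "g \<in> max_ideal R" using in_M[OF s2 g] by blast
        show False by (rule no_pair[OF g gM s1 c1(1) c]) (use prod in blast)
      next
        case False
        then obtain i g where g: "g \<in> ?a1" "g \<in> I i" "up_ring.monom P g i \<notin> Q" unfolding hsub_def by blast
        show False
        proof (cases "hsub ?a2 Q")
          case True
          then obtain c :: nat where c: "C.len ?a2 (carrier R) \<le> enat c" using q2 by blast
          have "\<one> \<notin> ?a1" using one_len[OF s1] nofin c by blast
          hence gM: "g \<in> max_ideal R" using in_M[OF s1 g] by blast
          show False by (rule no_pair[OF g gM s2 c1(2) c]) (use prod' in blast)
        next
          case False
          then obtain j g' where g': "g' \<in> ?a2" "g' \<in> I j" "up_ring.monom P g' j \<notin> Q" unfolding hsub_def by blast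
          have "g \<otimes> g' \<in> p \<inter> I (i + j)" using prod'[OF g(1) g'(1)] C.gringD(5)[OF gr g(2) g'(2)] by blast
          hence "up_ring.monom P (g \<otimes> g') (i + j) \<in> Q" using p(3) unfolding hsub_def by blast
          thus False using monom_prime[OF Q g(2) g'(2)] g(3) g'(3) by blast
        qed
      qed
    qed
  qed (use p p1 in auto)
  hence "primeideal p R"
  proof -
    assume zp: "C.zprime p"
    show ?thesis
    proof (rule primeidealI)
      show "ideal p R" using p(1) smod_iff_ideal by simp
      show "carrier R \<noteq> p" using p1 by auto
      show "a \<in> p \<or> b \<in> p" if "a \<in> carrier R" "b \<in> carrier R" "a \<otimes> b \<in> p" for a b using L.zprimeD(4)[OF zp that] .
    qed (rule is_cring)
  qed
  moreover have "p \<noteq> max_ideal R" using infp[of 1] L.len_m by (auto simp: one_enat_def)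
  ultimately show ?thesis using p(3) by blast
qed

end

section \<open>Chains of primes over the maximal ideal\<close>

lemma rees_ring_all: 
  assumes "cring R" shows "rees_ring R (\<lambda>_. carrier R) = UP R"
proof -
  interpret cring R by (rule assms)
  interpret UP: UP_cring R "UP R" by unfold_locales simp_all
  have "{p \<in> carrier (UP R). \<forall>n. up_ring.coeff (UP R) p n \<in> carrier R} = carrier (UP R)" by auto
  thus ?thesis unfolding rees_ring_def by simp
qed

text \<open>A polynomial ring is a Rees ring for the constant filtration, so the criterion for graded primes applies.\<close>
lemma (in rees) extend_prime:
  assumes p: "primeideal p R"
  shows "primeideal {q \<in> carrier P. \<forall>n. up_ring.coeff P q n \<in> p} P"
proof -
  interpret p: primeideal p R by (rule p)
  have "C.gring (\<lambda>_. carrier R)" by (rule C.gringI) auto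
  then interpret Full: rees R "\<lambda>_. carrier R" by unfold_locales
  have "C.gprime (\<lambda>_. carrier R) (\<lambda>_. p)"
    unfolding C.gprime_def
  proof (intro conjI allI ballI impI)
    show "C.gideal (\<lambda>_. carrier R) (\<lambda>_. p)" by (rule C.gidealI) (use p.I_l_closed p.a_subset in auto)
    show "(\<lambda>_::nat. p) \<noteq> (\<lambda>_. carrier R)" using p.I_notcarr by (metis (full_types))
    show "a \<in> p \<or> b \<in> p" if "a \<in> carrier R" "b \<in> carrier R" "a \<otimes> b \<in> p" for a b using p.I_prime[OF that] .
  qed
  from Full.gprime_primeideal[OF this] show ?thesis unfolding rees_ring_all[OF is_cring] .
qed

text \<open>By \<open>exists_prime\<close> the chain contains the kernel of the Rees ring mapping to \<open>(R/p)[t]\<close>, so its image is a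
  chain of primes in the image ring, to which \<open>dim_bound\<close> applies. The bound \<open>e\<close> is required only for primes
  containing \<open>x\<close>, where one dimension is lost.\<close>
lemma (in rees) fibre_chain_bound:
  assumes R: "local_ring R" and Q: "prime_chain A Q n"
    and MQ: "(\<lambda>c. up_ring.monom P c 0) ` max_ideal R \<subseteq> Q 0"
    and IM: "\<And>n. n \<ge> 1 \<Longrightarrow> I n \<subseteq> max_ideal R" and dec: "\<And>n. n \<ge> 1 \<Longrightarrow> I n \<subseteq> I 1"
    and x: "x \<in> max_ideal R" and cancel: "\<And>n z. z \<in> carrier R \<Longrightarrow> x \<otimes> z \<in> I n \<Longrightarrow> z \<in> I n"
    and inf: "\<And>c::nat. \<not> C.len (C.scale x (carrier R)) (carrier R) \<le> enat c"
    and par: "\<And>p. primeideal p R \<Longrightarrow> x \<in> p \<Longrightarrow>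
      \<exists>xs c. set xs \<subseteq> max_ideal R \<and> length xs \<le> e \<and> C.len (C.sgen p xs 1) (carrier R) \<le> enat c"
  shows "n \<le> e"
proof (cases n)
  case (Suc n')
  interpret L: local_base R "carrier R" "max_ideal R" by (rule local_ring_base[OF R])
  have Qp: "i \<le> n \<Longrightarrow> primeideal (Q i) A" and Qs: "i < n \<Longrightarrow> Q i \<subset> Q (Suc i)" for i using Q unfolding prime_chain_def by auto
  have Q0Q: "i \<le> n \<Longrightarrow> Q 0 \<subseteq> Q i" for i
  proof (induction i)
    case (Suc i)
    thus ?case using Qs[of i] by auto
  qed simp
  have Q0: "primeideal (Q 0) A" using Qp by simp
  obtain p where p: "primeideal p R" "x \<in> p" "p \<noteq> max_ideal R" "hsub p (Q 0)"
    using exists_prime[OF R Q0 MQ IM x cancel inf] by blast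
  interpret p: primeideal p R by (rule p(1))
  have pM: "p \<subset> max_ideal R" using primeideal_local[OF R p(1)] p(3) by blast
  define E where "E = {q \<in> carrier P. \<forall>n. up_ring.coeff P q n \<in> p}"
  have Epr: "primeideal E P" unfolding E_def by (rule extend_prime[OF p(1)])
  interpret E: primeideal E P by (rule Epr)
  define Y where "Y = P Quot E"
  define \<phi> where "\<phi> = (+>\<^bsub>P\<^esub>) E"
  interpret Yd: domain Y unfolding Y_def by (rule E.quotient_is_domain)
  interpret phi: ring_hom_cring P Y \<phi> unfolding Y_def \<phi>_def by (rule E.rcos_ring_hom_cring)
  have AP: "q \<in> carrier A \<Longrightarrow> q \<in> carrier P" for q unfolding A_carrier by auto
  have EQ: "E \<inter> carrier A \<subseteq> Q i" if "i \<le> n" for i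
    using extn_sub[OF Q0 p(4)] Q0Q[OF that] AP unfolding extn_def E_def by auto
  have phi_zero: "\<phi> q = \<zero>\<^bsub>Y\<^esub> \<longleftrightarrow> q \<in> E" if q: "q \<in> carrier P" for q
  proof
    assume "\<phi> q = \<zero>\<^bsub>Y\<^esub>"
    hence "E +>\<^bsub>P\<^esub> q = E" unfolding Y_def \<phi>_def quot_zero .
    thus "q \<in> E" using E.a_rcos_self[OF q] by simp
  next
    assume "q \<in> E"
    thus "\<phi> q = \<zero>\<^bsub>Y\<^esub>" unfolding Y_def \<phi>_def quot_zero by (rule E.a_rcos_const)
  qed
  \<comment> \<open>membership in the chain can be tested in the image\<close>
  have phi_Q: "q \<in> Q i" if i: "i \<le> n" and q: "q \<in> carrier A" and im: "\<phi> q \<in> \<phi> ` Q i" for q i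
  proof -
    obtain q' where q': "q' \<in> Q i" "\<phi> q = \<phi> q'" using im by auto
    have q'A: "q' \<in> carrier A" using q'(1) Q_facts(1)[OF Qp[OF i]] by auto
    have c: "q \<in> carrier P" "q' \<in> carrier P" using q q'A AP by auto
    have "\<phi> (q \<ominus>\<^bsub>P\<^esub> q') = \<phi> q \<oplus>\<^bsub>Y\<^esub> \<ominus>\<^bsub>Y\<^esub> \<phi> q'" unfolding a_minus_def using c by simp
    also have "\<dots> = \<zero>\<^bsub>Y\<^esub>" using q'(2) c by (simp add: Yd.r_neg)
    finally have "q \<ominus>\<^bsub>P\<^esub> q' \<in> E" using phi_zero[OF UP.P.minus_closed[OF c]] by simp
    moreover have "q \<ominus>\<^bsub>P\<^esub> q' \<in> carrier A"
      unfolding a_minus_def by (rule subringE(7)[OF rees_subring q subringE(5)[OF rees_subring q'A]])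
    ultimately have "q \<ominus>\<^bsub>P\<^esub> q' \<in> Q i" using EQ[OF i] by blast
    hence "(q \<ominus>\<^bsub>P\<^esub> q') \<oplus>\<^bsub>P\<^esub> q' \<in> Q i" using Q_facts(3)[OF Qp[OF i]] q'(1) by blast
    moreover have "(q \<ominus>\<^bsub>P\<^esub> q') \<oplus>\<^bsub>P\<^esub> q' = q" using c by (simp add: a_minus_def UP.P.a_assoc UP.P.l_neg)
    ultimately show ?thesis by simp
  qed
  define con where "con c = up_ring.monom P c 0" for c
  define \<psi> where "\<psi> c = \<phi> (con c)" for c
  have conP: "c \<in> carrier R \<Longrightarrow> con c \<in> carrier P" and conA: "c \<in> carrier R \<Longrightarrow> con c \<in> carrier A" for c
    unfolding con_def using monom_in_A[of c 0] I0 by auto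
  have con_hom: "con \<in> ring_hom R P" using UP.const_ring_hom unfolding con_def[abs_def] .
  have psi: "ring_hom_cring R Y \<psi>"
  proof (rule ring_hom_cringI[OF is_cring Yd.is_cring])
    show "\<psi> \<in> ring_hom R Y" unfolding \<psi>_def using ring_hom_trans[OF con_hom phi.homh] by (simp add: comp_def)
  qed
  interpret psi: ring_hom_cring R Y \<psi> by (rule psi)
  have psi_zero: "\<psi> c = \<zero>\<^bsub>Y\<^esub> \<longleftrightarrow> c \<in> p" if c: "c \<in> carrier R" for c
  proof -
    have "con c \<in> E \<longleftrightarrow> c \<in> p" unfolding E_def con_def using c p.zero_closed by (auto split: if_splits)
    thus ?thesis unfolding \<psi>_def phi_zero[OF conP[OF c]] .
  qed
  have LBl: "local_base Y (\<psi> ` carrier R) (\<psi> ` max_ideal R)"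
    by (rule local_base_image[OF R psi]) (use psi_zero pM in blast)
  interpret LB: local_base Y "\<psi> ` carrier R" "\<psi> ` max_ideal R" by (rule LBl)
  let ?Z = "\<psi> ` carrier R"
  define t where "t = \<phi> (up_ring.monom P \<one> 1)"
  have tY: "t \<in> carrier Y" unfolding t_def by simp
  have m1: "\<phi> (up_ring.monom P c i) = t [^]\<^bsub>Y\<^esub> i \<otimes>\<^bsub>Y\<^esub> \<psi> c" if c: "c \<in> carrier R" for c and i :: nat
  proof (induction i)
    case 0
    show ?case using c unfolding \<psi>_def con_def by simp
  next
    case (Suc i)
    have "up_ring.monom P c (Suc i) = up_ring.monom P (\<one> \<otimes> c) (1 + i)" using c by simp
    also have "\<dots> = up_ring.monom P \<one> 1 \<otimes>\<^bsub>P\<^esub> up_ring.monom P c i" by (rule UP.monom_mult) (use c in auto)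
    finally have "\<phi> (up_ring.monom P c (Suc i)) = t \<otimes>\<^bsub>Y\<^esub> (t [^]\<^bsub>Y\<^esub> i \<otimes>\<^bsub>Y\<^esub> \<psi> c)"
      using Suc.IH c unfolding t_def by simp
    also have "\<dots> = t [^]\<^bsub>Y\<^esub> Suc i \<otimes>\<^bsub>Y\<^esub> \<psi> c" using tY c by (simp add: Yd.m_ac)
    finally show ?case .
  qed
  \<comment> \<open>if all \<open>I\<^sub>n\<close> were in \<open>p\<close>, the image would consist of constants, and a larger prime would contain a unit\<close>
  have "\<not> I 1 \<subseteq> p"
  proof
    assume Ip: "I 1 \<subseteq> p"
    have 0: "0 < n" using Suc by simp
    obtain q where q: "q \<in> Q 1" "q \<notin> Q 0" using Qs[OF 0] by auto
    have 1: "1 \<le> n" using 0 by simp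
    have qA: "q \<in> carrier A" using q(1) Q_facts(1)[OF Qp[OF 1]] by auto
    let ?c = "up_ring.coeff P q 0"
    have cR: "?c \<in> carrier R" using AP[OF qA] by simp
    let ?d = "q \<ominus>\<^bsub>P\<^esub> con ?c"
    have dA: "?d \<in> carrier A" unfolding a_minus_def by (rule subringE(7)[OF rees_subring qA subringE(5)[OF rees_subring conA[OF cR]]])
    have "up_ring.coeff P ?d k \<in> p" for k
    proof (cases "k = 0")
      case True
      have "up_ring.coeff P ?d 0 = \<zero>" unfolding a_minus_def con_def using AP[OF qA] cR by (simp add: r_neg)
      thus ?thesis using True p.zero_closed by simp
    next
      case False
      have "up_ring.coeff P ?d k = up_ring.coeff P q k" unfolding a_minus_def con_def using AP[OF qA] cR False by simp
      moreover have "up_ring.coeff P q k \<in> I k" using qA unfolding A_carrier by auto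
      ultimately show ?thesis using dec[of k] False Ip by auto
    qed
    hence dE: "?d \<in> E \<inter> carrier A" unfolding E_def using dA AP by auto
    have qd: "q = ?d \<oplus>\<^bsub>P\<^esub> con ?c" using AP[OF qA] conP[OF cR] by (simp add: a_minus_def UP.P.a_assoc UP.P.l_neg)
    have cM: "?c \<notin> max_ideal R"
    proof
      assume "?c \<in> max_ideal R"
      hence "con ?c \<in> Q 0" using MQ unfolding con_def by auto
      hence "q \<in> Q 0" using qd Q_facts(3)[OF Q0, of ?d "con ?c"] dE EQ[of 0] by auto
      thus False using q(2) by simp
    qed
    have phic: "\<phi> (con ?c) \<in> \<phi> ` Q 1"
    proof -
      have "\<phi> q = \<phi> ?d \<oplus>\<^bsub>Y\<^esub> \<phi> (con ?c)" using qd phi.hom_add[of ?d "con ?c"] AP[OF dA] conP[OF cR] by simp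
      also have "\<dots> = \<phi> (con ?c)" using phi_zero[OF AP[OF dA]] dE conP[OF cR] by simp
      finally show ?thesis using q(1) by (metis imageI)
    qed
    have "con ?c \<in> Q 1" by (rule phi_Q[OF 1 conA[OF cR] phic])
    obtain w where w: "w \<in> carrier R" "?c \<otimes> w = \<one>" using L.units[OF cR cM] by blast
    have "con w \<otimes>\<^bsub>P\<^esub> con ?c \<in> Q 1" by (rule Q_facts(4)[OF Qp[OF 1] conA[OF w(1)] \<open>con ?c \<in> Q 1\<close>])
    moreover have "con w \<otimes>\<^bsub>P\<^esub> con ?c = con (w \<otimes> ?c)" using ring_hom_mult[OF con_hom w(1) cR] by simp
    moreover have "con (w \<otimes> ?c) = \<one>\<^bsub>P\<^esub>" using w m_comm[OF cR w(1)] ring_hom_one[OF con_hom] by simp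
    ultimately show False using Q_facts(6)[OF Qp[OF 1]] by simp
  qed
  then obtain g where g: "g \<in> I 1" "g \<notin> p" by blast
  have gR: "g \<in> carrier R" using I_carr[OF g(1)] .
  obtain xs c where xs: "set xs \<subseteq> max_ideal R" "length xs \<le> e" "C.len (C.sgen p xs 1) (carrier R) \<le> enat c"
    using par[OF p(1,2)] by blast
  have xsR: "set xs \<subseteq> carrier R" using xs(1) L.m(2) by auto
  let ?T = "\<phi> ` carrier A" and ?P = "\<lambda>i. \<phi> ` Q i"
  have "n \<le> length (map \<psi> xs)"
  proof (rule LB.dim_bound[where t = t and T = ?T and P = ?P and n = n and h = "\<psi> g" and xs = "map \<psi> xs" and c = c])
    show "domain Y" by (rule Yd.domain_axioms)
    show "t \<in> carrier Y" by (rule tY)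
    show "?Z \<subseteq> ?T" unfolding \<psi>_def using conA by blast
    show "a \<oplus>\<^bsub>Y\<^esub> b \<in> ?T" if "a \<in> ?T" "b \<in> ?T" for a b
    proof -
      obtain r s where rs: "r \<in> carrier A" "s \<in> carrier A" "a = \<phi> r" "b = \<phi> s" using \<open>a \<in> ?T\<close> \<open>b \<in> ?T\<close> by auto
      have "a \<oplus>\<^bsub>Y\<^esub> b = \<phi> (r \<oplus>\<^bsub>P\<^esub> s)" using rs AP by simp
      thus ?thesis using subringE(7)[OF rees_subring rs(1,2)] by blast
    qed
    show "a \<otimes>\<^bsub>Y\<^esub> b \<in> ?T" if "a \<in> ?T" "b \<in> ?T" for a b
    proof -
      obtain r s where rs: "r \<in> carrier A" "s \<in> carrier A" "a = \<phi> r" "b = \<phi> s" using \<open>a \<in> ?T\<close> \<open>b \<in> ?T\<close> by auto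
      have "a \<otimes>\<^bsub>Y\<^esub> b = \<phi> (r \<otimes>\<^bsub>P\<^esub> s)" using rs AP by simp
      thus ?thesis using subringE(6)[OF rees_subring rs(1,2)] by blast
    qed
    show "?T \<subseteq> (\<Union>D. LB.pol t ?Z D)"
    proof
      fix y assume "y \<in> ?T"
      then obtain q where q: "q \<in> carrier A" "y = \<phi> q" by auto
      have cf: "(\<lambda>i. up_ring.monom P (up_ring.coeff P q i) i) \<in> {..deg R q} \<rightarrow> carrier P" using AP[OF q(1)] by auto
      have "\<phi> q = \<phi> (\<Oplus>\<^bsub>P\<^esub>i\<in>{..deg R q}. up_ring.monom P (up_ring.coeff P q i) i)" using UP.up_repr[OF AP[OF q(1)]] by simp
      also have "\<dots> = (\<Oplus>\<^bsub>Y\<^esub>i\<in>{..deg R q}. (\<phi> \<circ> (\<lambda>i. up_ring.monom P (up_ring.coeff P q i) i)) i)"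
        using phi.hom_finsum[OF cf] by (simp add: o_def)
      also have "\<dots> \<in> LB.pol t ?Z (deg R q)"
      proof (rule LB.smod_finsum[OF LB.pol_smod[OF tY LB.smod_Z]])
        fix i assume i: "i \<in> {..deg R q}"
        have "(\<phi> \<circ> (\<lambda>i. up_ring.monom P (up_ring.coeff P q i) i)) i = t [^]\<^bsub>Y\<^esub> i \<otimes>\<^bsub>Y\<^esub> \<psi> (up_ring.coeff P q i)"
          using m1[of "up_ring.coeff P q i" i] AP[OF q(1)] by simp
        also have "\<dots> \<in> LB.pol t ?Z i" by (rule LB.pol_top[OF tY LB.smod_Z]) (use AP[OF q(1)] in auto)
        finally show "(\<phi> \<circ> (\<lambda>i. up_ring.monom P (up_ring.coeff P q i) i)) i \<in> LB.pol t ?Z (deg R q)"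
          using LB.pol_mono[OF tY LB.smod_Z, of i "deg R q"] i by auto
      qed simp
      finally show "y \<in> (\<Union>D. LB.pol t ?Z D)" using q(2) by blast
    qed
    show "?P i \<subseteq> ?T" if "i \<le> n" for i using Q_facts(1)[OF Qp[OF that]] by blast
    show "\<zero>\<^bsub>Y\<^esub> \<in> ?P i" if "i \<le> n" for i using Q_facts(2)[OF Qp[OF that]] phi.hom_zero by (metis imageI)
    show "\<one>\<^bsub>Y\<^esub> \<notin> ?P i" if i: "i \<le> n" for i
    proof
      assume "\<one>\<^bsub>Y\<^esub> \<in> ?P i"
      hence "\<phi> \<one>\<^bsub>P\<^esub> \<in> ?P i" by simp
      hence "\<one>\<^bsub>P\<^esub> \<in> Q i" by (rule phi_Q[OF i subringE(3)[OF rees_subring]])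
      thus False using Q_facts(6)[OF Qp[OF i]] by simp
    qed
    show "a \<oplus>\<^bsub>Y\<^esub> b \<in> ?P i" if i: "i \<le> n" and ab: "a \<in> ?P i" "b \<in> ?P i" for i a b
    proof -
      obtain r s where rs: "r \<in> Q i" "s \<in> Q i" "a = \<phi> r" "b = \<phi> s" using ab by auto
      have "a \<oplus>\<^bsub>Y\<^esub> b = \<phi> (r \<oplus>\<^bsub>P\<^esub> s)" using rs AP Q_facts(1)[OF Qp[OF i]] by (simp add: subset_eq)
      thus ?thesis using Q_facts(3)[OF Qp[OF i] rs(1,2)] by blast
    qed
    show "a \<otimes>\<^bsub>Y\<^esub> b \<in> ?P i" if i: "i \<le> n" and ab: "a \<in> ?T" "b \<in> ?P i" for i a b
    proof -
      obtain r s where rs: "r \<in> carrier A" "s \<in> Q i" "a = \<phi> r" "b = \<phi> s" using ab by auto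
      have "a \<otimes>\<^bsub>Y\<^esub> b = \<phi> (r \<otimes>\<^bsub>P\<^esub> s)" using rs AP Q_facts(1)[OF Qp[OF i]] by (simp add: subset_eq)
      thus ?thesis using Q_facts(4)[OF Qp[OF i] rs(1,2)] by blast
    qed
    show "a \<in> ?P i \<or> b \<in> ?P i" if i: "i \<le> n" and ab: "a \<in> ?T" "b \<in> ?T" "a \<otimes>\<^bsub>Y\<^esub> b \<in> ?P i" for i a b
    proof -
      obtain r s where rs: "r \<in> carrier A" "s \<in> carrier A" "a = \<phi> r" "b = \<phi> s" using ab by auto
      have "\<phi> (r \<otimes>\<^bsub>P\<^esub> s) \<in> ?P i" using rs AP ab(3) by simp
      hence "r \<otimes>\<^bsub>P\<^esub> s \<in> Q i" by (rule phi_Q[OF i subringE(6)[OF rees_subring rs(1,2)]])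
      thus ?thesis using Q_facts(5)[OF Qp[OF i] rs(1,2)] rs by blast
    qed
    show "?P i \<subset> ?P (Suc i)" if i: "i < n" for i
    proof -
      obtain q where q: "q \<in> Q (Suc i)" "q \<notin> Q i" using Qs[OF i] by auto
      have Si: "Suc i \<le> n" and ii: "i \<le> n" using i by auto
      have "q \<in> carrier A" using q(1) Q_facts(1)[OF Qp[OF Si]] by auto
      hence "\<phi> q \<notin> ?P i" using phi_Q[OF ii, of q] q(2) by blast
      thus ?thesis using Qs[OF i] q(1) by blast
    qed
    show "\<psi> ` max_ideal R \<subseteq> ?P 0" using MQ unfolding \<psi>_def con_def by auto
    show "\<psi> g \<in> ?Z" using gR by blast
    show "\<psi> g \<noteq> \<zero>\<^bsub>Y\<^esub>" using psi_zero[OF gR] g(2) by simp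
    show "\<psi> g \<otimes>\<^bsub>Y\<^esub> t \<in> ?T"
    proof -
      have "\<phi> (up_ring.monom P g 1) = t \<otimes>\<^bsub>Y\<^esub> \<psi> g" using m1[OF gR, of 1] tY by simp
      also have "\<dots> = \<psi> g \<otimes>\<^bsub>Y\<^esub> t" using tY gR by (intro Yd.m_comm) auto
      finally show ?thesis using monom_in_A[OF g(1)] by (metis imageI)
    qed
    show "\<psi> ` max_ideal R \<noteq> {\<zero>\<^bsub>Y\<^esub>}"
    proof -
      obtain z where z: "z \<in> max_ideal R" "z \<notin> p" using pM by auto
      have "\<psi> z \<noteq> \<zero>\<^bsub>Y\<^esub>" using psi_zero[of z] z L.m(2) by auto
      thus ?thesis using z(1) by blast
    qed
    show "set (map \<psi> xs) \<subseteq> \<psi> ` max_ideal R" using xs(1) by auto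
    show "LB.len (LB.sgen {\<zero>\<^bsub>Y\<^esub>} (map \<psi> xs) 1) ?Z \<le> enat c"
    proof -
      let ?N = "LB.sgen {\<zero>\<^bsub>Y\<^esub>} (map \<psi> xs) 1"
      have xsZ: "set (map \<psi> xs) \<subseteq> ?Z" using xsR by auto
      have sN: "LB.smod ?N" by (rule LB.sgen_smod[OF LB.smod_zero xsZ])
      have "C.smod {r \<in> carrier R. \<psi> r \<in> ?N}"
        by (rule C.smodI) (use LB.smod_0[OF sN] LB.smod_add[OF sN] LB.smod_mult[OF sN] in auto)
      moreover have "p \<subseteq> {r \<in> carrier R. \<psi> r \<in> ?N}" 
      proof
        fix c assume c: "c \<in> p"
        hence "c \<in> carrier R" using p.a_subset by blast
        thus "c \<in> {r \<in> carrier R. \<psi> r \<in> ?N}" using c psi_zero[of c] LB.smod_0[OF sN] by simp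
      qed
      moreover have "y \<in> carrier R \<and> y [^] (1::nat) \<in> {r \<in> carrier R. \<psi> r \<in> ?N}" if y: "y \<in> set xs" for y
      proof -
        have yR: "y \<in> carrier R" using y xsR by auto
        have "\<psi> y [^]\<^bsub>Y\<^esub> (1::nat) \<in> ?N" by (rule LB.sgen_contains[OF LB.smod_zero xsZ]) (use y in auto)
        thus ?thesis using yR by simp
      qed
      ultimately have "C.sgen p xs 1 \<subseteq> {r \<in> carrier R. \<psi> r \<in> ?N}" by (rule C.sgen_least)
      hence "C.len {r \<in> carrier R. \<psi> r \<in> ?N} (carrier R) \<le> enat c"
        using C.len_mono[OF _ order_refl] xs(3) by (meson order_trans)
      thus ?thesis using len_image_le[OF is_cring psi, of ?N] by (rule order_trans[rotated])
    qed
  qed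
  thus ?thesis using xs(2) by simp
qed simp

section \<open>No valuation centred at the maximal ideal\<close>

text \<open>If \<open>R/xR\<close> had finite length, the images of the value ideals \<open>V\<^sub>n\<close> in it would become stationary, so
  \<open>V\<^sub>n = V\<^sub>n\<^sub>+\<^sub>1 + (xR \<inter> V\<^sub>n) = V\<^sub>n\<^sub>+\<^sub>1 + x V\<^sub>n\<close> for large \<open>n\<close>, since \<open>\<nu>(x) = 0\<close>. By Nakayama \<open>V\<^sub>n = V\<^sub>n\<^sub>+\<^sub>1\<close>
  from some point on, but powers of \<open>w\<close> have finite values tending to infinity.\<close>
lemma (in valued_domain) infinite_colength:
  assumes R: "local_ring R" and x: "x \<in> max_ideal R" "x \<notin> center R K h \<nu>"
    and w: "w \<in> center R K h \<nu>" "w \<noteq> \<zero>"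
  shows "\<not> C.len (C.scale x (carrier R)) (carrier R) \<le> enat c"
proof
  assume len: "C.len (C.scale x (carrier R)) (carrier R) \<le> enat c"
  interpret L: local_base R "carrier R" "max_ideal R" by (rule local_ring_base[OF R])
  have xR: "x \<in> carrier R" using x L.m(2) by auto
  have wR: "w \<in> carrier R" using w unfolding center_def by auto
  let ?x = "C.scale x (carrier R)" and ?V = "val_ideal R K h \<nu>"
  have sx: "C.smod ?x" by (rule C.smod_sZ[OF xR])
  define W where "W n = C.sadd (?V n) ?x" for n
  have sW: "C.smod (W n)" for n unfolding W_def by (rule C.smod_sadd[OF val_ideal_smod sx])
  have Wdec: "W (Suc n) \<subseteq> W n" for n unfolding W_def using C.sadd_mono[OF val_ideal_anti order_refl] by simp
  have Wm: "i \<le> j \<Longrightarrow> W j \<subseteq> W i" for i j using lift_Suc_antimono_le[of W] Wdec by blast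
  have xW: "?x \<subseteq> W n" for n unfolding W_def by (rule C.sadd_sup2[OF C.smod_sub[OF sx] val_ideal_smod])
  have "\<exists>n0. \<forall>n\<ge>n0. W (Suc n) = W n"
  proof (rule ccontr)
    assume "\<not> ?thesis"
    hence ex: "\<And>n0. \<exists>n\<ge>n0. W (Suc n) \<noteq> W n" by blast
    have "\<exists>N. C.hc (W N) (W 0) k" for k
    proof (induction k)
      case 0
      show ?case using C.hc_0[OF sW order_refl order_refl] by blast
    next
      case (Suc k)
      then obtain N where N: "C.hc (W N) (W 0) k" by blast
      obtain n where n: "n \<ge> N" "W (Suc n) \<noteq> W n" using ex by blast
      have "C.hc (W (Suc n)) (W n) (Suc 0)"
        by (rule C.hc_Suc[OF C.hc_0[OF sW order_refl order_refl] sW]) (use Wdec n(2) in blast)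
      hence "C.hc (W (Suc n)) (W N) (Suc 0)" using C.hc_mono[OF _ order_refl Wm[OF n(1)]] by blast
      from C.hc_trans[OF this N] show ?case by auto
    qed
    then obtain N where "C.hc (W N) (W 0) (Suc c)" by blast
    hence "C.hc ?x (carrier R) (Suc c)" using C.hc_mono[OF _ xW C.smod_sub[OF sW]] by blast
    from order_trans[OF C.len_ge[OF this] len] show False by simp
  qed
  then obtain n0 where n0: "\<And>n. n \<ge> n0 \<Longrightarrow> W (Suc n) = W n" by blast
  have stable: "?V n \<subseteq> ?V (Suc n)" if n: "n \<ge> n0" for n
  proof
    fix u assume u: "u \<in> ?V n"
    show "u \<in> ?V (Suc n)"
    proof (rule L.nakayama[OF val_ideal_smod _ _ x(1) _ u])
      show "?V (Suc n) \<subseteq> carrier R" "?V n \<subseteq> carrier R" using C.smod_sub[OF val_ideal_smod] by auto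
      fix u assume u: "u \<in> ?V n"
      have "u \<in> W (Suc n)" unfolding n0[OF n] unfolding W_def
        using C.sadd_sup1[OF C.smod_sub[OF val_ideal_smod] sx] u by blast
      then obtain v r where vr: "v \<in> ?V (Suc n)" "r \<in> carrier R" "u = v \<oplus> x \<otimes> r"
        unfolding W_def C.sadd_def C.scale_def by auto
      have "v \<in> ?V n" using vr(1) val_ideal_anti[of n "Suc n"] by auto
      moreover have xr: "x \<otimes> r \<in> carrier R" using xR vr(2) by simp
      ultimately have "x \<otimes> r \<in> ?V n" using C.smod_add_cancel[OF val_ideal_smod _ xr] u vr(3) by blast
      hence "r \<in> ?V n" by (rule not_center_cancel[OF xR x(2) vr(2)])
      thus "\<exists>n'\<in>?V (Suc n). \<exists>v\<in>?V n. u = n' \<oplus> x \<otimes> v" using vr by blast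
    qed
  qed
  have hw: "h w \<in> carrier K" "h w \<noteq> \<zero>\<^bsub>K\<^esub>" using wR w(2) h_zero_iff by auto
  have w1: "1 \<le> \<nu> (h w)" using w(1) hw unfolding center_eq val_ideal_iff Vge_def by auto
  define d where "d = nat (\<nu> (h w))"
  have d: "\<nu> (h w) = int d" "d \<ge> 1" using w1 unfolding d_def by auto
  let ?u = "w [^] n0"
  have hu: "h ?u \<noteq> \<zero>\<^bsub>K\<^esub>" "\<nu> (h ?u) = int (n0 * d)" using \<nu>_pow[OF hw, of n0] wR d(1) by auto
  have "?u \<in> ?V (n0 * d)" unfolding val_ideal_iff Vge_def using wR hu by auto
  moreover have "n0 \<le> n0 * d" using d(2) by simp
  ultimately have "?u \<in> ?V (Suc (n0 * d))" using stable by blast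
  thus False unfolding val_ideal_iff Vge_def using hu by auto
qed

lemma (in cring) zprime_iff_primeideal: "const_ring.zprime R (carrier R) N \<longleftrightarrow> primeideal N R"
proof -
  interpret C: const_ring R "carrier R" by (rule const_ring_carrier)
  show ?thesis
  proof
    assume N: "C.zprime N"
    show "primeideal N R"
    proof (rule primeidealI[OF _ is_cring])
      show "ideal N R" using N smod_iff_ideal unfolding C.zprime_def by simp
      show "carrier R \<noteq> N" using N unfolding C.zprime_def by auto
      show "a \<in> N \<or> b \<in> N" if "a \<in> carrier R" "b \<in> carrier R" "a \<otimes> b \<in> N" for a b
        using N that unfolding C.zprime_def by simp
    qed
  next
    assume N: "primeideal N R"
    then interpret N: primeideal N R .
    show "C.zprime N" unfolding C.zprime_def
    proof (intro conjI ballI impI)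
      show "C.smod N" using smod_iff_ideal N.is_ideal by simp
      show "N \<subseteq> carrier R" by (rule N.a_subset)
      show "\<one> \<notin> N" by (rule primeideal_one[OF N])
      show "a \<in> N \<or> b \<in> N" if "a \<in> carrier R" "b \<in> carrier R" "a \<otimes> b \<in> N" for a b
        using N.I_prime[OF that] .
    qed
  qed
qed

text \<open>Cancelling \<open>x\<close> modulo the filtration costs one dimension: every prime in question contains the
  nonzero element \<open>x\<close>, so a chain above it can be prolonged downwards by the zero ideal.\<close>
theorem spread_lt_of_avoiding:
  assumes R: "local_ring R" and dom: "domain R" and F: "filtration R I"
    and IM: "\<And>n. n \<ge> 1 \<Longrightarrow> I n \<subseteq> max_ideal R"
    and x: "x \<in> max_ideal R" "x \<noteq> \<zero>\<^bsub>R\<^esub>" and cancel: "\<And>n z. z \<in> carrier R \<Longrightarrow> x \<otimes>\<^bsub>R\<^esub> z \<in> I n \<Longrightarrow> z \<in> I n"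
    and inf: "\<And>c::nat. \<not> const_ring.len R (carrier R) (const_ring.scale R x (carrier R)) (carrier R) \<le> enat c"
  shows "analytic_spread R I < krull_dim R"
proof -
  interpret L: local_base R "carrier R" "max_ideal R" by (rule local_ring_base[OF R])
  interpret D: domain R by (rule dom)
  interpret Re: rees R I by (unfold_locales) (rule filtration_gring[OF L.is_cring F])
  have dec: "I n \<subseteq> I 1" if "n \<ge> 1" for n
    using that by (induction n rule: dec_induct) (use F in \<open>simp_all add: filtration_def subset_iff\<close>)
  have zp: "L.zprime N \<longleftrightarrow> primeideal N R" for N by (rule L.zprime_iff_primeideal)
  have zero: "primeideal {\<zero>\<^bsub>R\<^esub>} R" by (rule D.zeroprimeideal)
  have bound: "analytic_spread R I \<le> enat e"
    if par: "\<And>p. primeideal p R \<Longrightarrow> x \<in> p \<Longrightarrow>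
      \<exists>xs c. set xs \<subseteq> max_ideal R \<and> length xs \<le> e \<and> L.len (L.sgen p xs 1) (carrier R) \<le> enat c" for e
    unfolding Re.analytic_spread_chain[OF L.m(2)]
  proof (rule Sup_least)
    fix d assume "d \<in> {enat n |n. \<exists>C. prime_chain Re.A C n \<and> (\<lambda>x. up_ring.monom Re.P x 0) ` max_ideal R \<subseteq> C 0}"
    then obtain n Q where Q: "prime_chain Re.A Q n" "(\<lambda>x. up_ring.monom Re.P x 0) ` max_ideal R \<subseteq> Q 0" "d = enat n" by auto
    have "n \<le> e" by (rule Re.fibre_chain_bound[OF R Q(1,2) IM dec x(1) cancel inf par])
    thus "d \<le> enat e" using Q(3) by simp
  qed
  show ?thesis
  proof (cases "krull_dim R")
    \<comment> \<open>a uniform finite bound for the spread is enough here\<close>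
    case infinity
    obtain xs where xs: "set xs \<subseteq> max_ideal R" "\<And>N. L.smod N \<Longrightarrow> N \<subseteq> carrier R \<Longrightarrow> L.len (L.sgen N xs 1) (carrier R) \<le> enat 1"
      using L.parameters_exist by blast
    have "analytic_spread R I \<le> enat (length xs)"
    proof (rule bound)
      fix p assume "primeideal p R"
      hence "L.zprime p" using zp by simp
      hence "L.len (L.sgen p xs 1) (carrier R) \<le> enat 1" using xs(2) L.zprimeD(1,2) by blast
      thus "\<exists>xs' c. set xs' \<subseteq> max_ideal R \<and> length xs' \<le> length xs \<and> L.len (L.sgen p xs' 1) (carrier R) \<le> enat c"
        using xs(1) by blast
    qed
    thus ?thesis unfolding infinity by (rule le_less_trans) simp
  next
    case (enat d)
    have ex: "prime_chain R C n \<Longrightarrow> n \<le> d" for C n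
    proof -
      assume "prime_chain R C n"
      hence "enat n \<le> krull_dim R" unfolding krull_dim_def by (intro Sup_upper) auto
      thus ?thesis using enat by simp
    qed
    have ext: "prime_chain R (\<lambda>i. case i of 0 \<Rightarrow> {\<zero>\<^bsub>R\<^esub>} | Suc i \<Rightarrow> C i) (Suc n)"
      if C: "\<And>i. i \<le> n \<Longrightarrow> primeideal (C i) R" "\<And>i. i < n \<Longrightarrow> C i \<subset> C (Suc i)" "x \<in> C 0" for C n
      unfolding prime_chain_def
    proof (intro conjI allI impI)
      fix i assume "i \<le> Suc n"
      thus "primeideal (case i of 0 \<Rightarrow> {\<zero>\<^bsub>R\<^esub>} | Suc i \<Rightarrow> C i) R" using C(1) zero by (cases i) auto
    next
      fix i assume i: "i < Suc n"
      have "\<zero>\<^bsub>R\<^esub> \<in> C 0" using C(1)[of 0] primeideal.axioms(1) ideal.axioms(1) additive_subgroup.zero_closed by blast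
      hence "{\<zero>\<^bsub>R\<^esub>} \<subset> C 0" using C(3) x(2) by blast
      thus "(case i of 0 \<Rightarrow> {\<zero>\<^bsub>R\<^esub>} | Suc i \<Rightarrow> C i) \<subset> (case Suc i of 0 \<Rightarrow> {\<zero>\<^bsub>R\<^esub>} | Suc i \<Rightarrow> C i)"
        using C(2) i by (cases i) auto
    qed
    have "Suc 0 \<le> d" by (rule ex[OF ext[of 0 "\<lambda>_. max_ideal R"]]) (use max_ideal_prime[OF R] x(1) in auto)
    then obtain e where e: "d = Suc e" by (cases d) auto
    have "analytic_spread R I \<le> enat e"
    proof (rule bound)
      fix p assume p: "primeideal p R" "x \<in> p"
      have pz: "L.smod p" "p \<subseteq> carrier R" using p(1) zp L.zprimeD(1,2) by blast+
      have "\<not> L.zchain p (Suc e)"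
      proof
        assume "L.zchain p (Suc e)"
        then obtain C where C: "\<forall>i\<le>Suc e. L.zprime (C i)" "\<forall>i<Suc e. C i \<subset> C (Suc i)" "p \<subseteq> C 0" unfolding L.zchain_def by blast
        have "Suc (Suc e) \<le> d" by (rule ex[OF ext[of "Suc e" C]]) (use C zp p(2) in auto)
        thus False using e by simp
      qed
      thus "\<exists>xs c. set xs \<subseteq> max_ideal R \<and> length xs \<le> e \<and> L.len (L.sgen p xs 1) (carrier R) \<le> enat c"
        using L.parameters[OF pz] by blast
    qed
    thus ?thesis using enat e by (simp add: le_less_trans)
  qed
qed

section \<open>Divisorial filtrations\<close>

theorem corollary1p6:
  fixes R :: "('a, 'b) ring_scheme" and K :: "('k, 'c) ring_scheme" and h :: "'a \<Rightarrow> 'k"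
    and I :: "nat \<Rightarrow> 'a set" and \<nu> :: "nat \<Rightarrow> 'k \<Rightarrow> int" and a :: "nat \<Rightarrow> nat"
    and r b :: nat
  assumes "local_ring R" and "domain R" and "quotient_field R K h"
    and "divisorial_filtration R K h I"
    and "\<And>i. i \<in> {1..r} \<Longrightarrow> divisorial_valuation R K h (\<nu> i)"
    and "\<And>n. n \<ge> 1 \<Longrightarrow> I n = carrier R \<inter> (\<Inter>i\<in>{1..r}. val_ideal R K h (\<nu> i) (n * a i))"
    and "minimal_primary_decomposition R {1..r} (\<lambda>i. val_ideal R K h (\<nu> i) (a i)) (I 1)"
    and "b \<ge> 1" and "analytic_spread R (truncated R I b) < krull_dim R"
  shows "analytic_spread R I < krull_dim R"
proof -
  note R = assms(1) and dom = assms(2) and qf = assms(3) and div = assms(5) and In = assms(6)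
    and dec = assms(7) and b = assms(8) and spread = assms(9)
  have F: "filtration R I" using assms(4) unfolding divisorial_filtration_def by simp
  interpret D: domain R by (rule dom)
  interpret L: local_base R "carrier R" "max_ideal R" by (rule local_ring_base[OF R])
  have I0': "I 0 = carrier R" using F unfolding filtration_def by simp
  show ?thesis
  proof (cases "r = 0")
    case True
    \<comment> \<open>no valuations: the filtration is constant and equals its truncation\<close>
    have Iall: "I n = carrier R" for n using In[of n] I0' True by (cases n) auto
    have "truncated R I b n = I n" for n
    proof (rule equalityI)
      show "truncated R I b n \<subseteq> I n" using L.smod_sub[OF trunc_smod[OF R F b]] unfolding Iall[of n] .
      have "carrier R \<subseteq> truncated R I b n"
      proof (induction n rule: less_induct)
        case (less n)
        show ?case
        proof (cases "n \<le> b")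
          case True
          thus ?thesis using trunc_low[OF R F b True] Iall[of n] by simp
        next
          case False
          have "\<one>\<^bsub>R\<^esub> \<in> truncated R I b 1" using trunc_low[OF R F b b] Iall[of 1] by simp
          moreover have "\<one>\<^bsub>R\<^esub> \<in> truncated R I b (n - 1)" using less.IH[of "n - 1"] False by auto
          ultimately have "\<one>\<^bsub>R\<^esub> \<otimes>\<^bsub>R\<^esub> \<one>\<^bsub>R\<^esub> \<in> truncated R I b (1 + (n - 1))"
            by (rule L.gringD(5)[OF trunc_gring[OF R F b]])
          hence "\<one>\<^bsub>R\<^esub> \<in> truncated R I b n" using False b by simp
          thus ?thesis using L.smod_mult[OF trunc_smod[OF R F b], of _ "\<one>\<^bsub>R\<^esub>" n] by force
        qed
      qed
      thus "I n \<subseteq> truncated R I b n" unfolding Iall[of n] .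
    qed
    hence "truncated R I b = I" by blast
    thus ?thesis using spread by simp
  next
    case r0: False
    have V: "valued_domain R K h (\<nu> i)" if "i \<in> {1..r}" for i by (rule valued_domainI[OF dom qf div[OF that]])
    have prim: "\<And>i. i \<in> {1..r} \<Longrightarrow> primary_ideal R (val_ideal R K h (\<nu> i) (a i))"
      and irr: "\<And>i. i \<in> {1..r} \<Longrightarrow> \<not> carrier R \<inter> (\<Inter>j\<in>{1..r} - {i}. val_ideal R K h (\<nu> j) (a j)) \<subseteq> val_ideal R K h (\<nu> i) (a i)"
      using dec unfolding minimal_primary_decomposition_def by auto
    have ai: "a i \<ge> 1" if i: "i \<in> {1..r}" for i
    proof (rule ccontr)
      assume "\<not> ?thesis"
      hence "a i = 0" by simp
      hence "val_ideal R K h (\<nu> i) (a i) = carrier R" using valued_domain.val_ideal_0[OF V[OF i]] by simp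
      thus False using prim[OF i] unfolding primary_ideal_def by simp
    qed
    show ?thesis
    proof (cases "\<exists>i\<in>{1..r}. center R K h (\<nu> i) = max_ideal R")
      case True
      then obtain i where i: "i \<in> {1..r}" "center R K h (\<nu> i) = max_ideal R" by blast
      interpret Vi: valued_domain R K h "\<nu> i" by (rule V[OF i(1)])
      let ?J = "carrier R \<inter> (\<Inter>j\<in>{1..r} - {i}. val_ideal R K h (\<nu> j) (a j))" and ?Vi = "val_ideal R K h (\<nu> i) (a i)"
      let ?p = "\<lambda>f. f \<in> ?J \<and> f \<notin> ?Vi"
      have fin: "f \<noteq> \<zero>\<^bsub>R\<^esub> \<and> 0 \<le> \<nu> i (h f) \<and> \<nu> i (h f) < int (a i)" if f: "?p f" for f
      proof -
        have fR: "f \<in> carrier R" using f by simp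
        have f0: "f \<noteq> \<zero>\<^bsub>R\<^esub>" using f L.smod_0[OF Vi.val_ideal_smod] by blast
        have "\<nu> i (h f) < int (a i)" using f fR Vi.h_zero_iff[OF fR] f0 unfolding Vi.val_ideal_iff Vi.Vge_def by auto
        thus ?thesis using f0 Vi.\<nu>_h_nonneg[OF fR f0] by simp
      qed
      obtain f0 where f0: "?p f0" using irr[OF i(1)] by blast
      have "\<forall>y. ?p y \<longrightarrow> nat (\<nu> i (h y)) < a i" using fin by force
      \<comment> \<open>the values \<open>\<nu>\<^sub>i\<close> outside the \<open>i\<close>-th component are bounded, so an element with the greatest value exists\<close>
      from ex_has_greatest_nat[of ?p, OF f0 this] obtain f where f: "?p f" "\<And>y. ?p y \<Longrightarrow> nat (\<nu> i (h y)) \<le> nat (\<nu> i (h f))" by blast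
      have fR: "f \<in> carrier R" using f(1) by simp
      \<comment> \<open>multiplying by \<open>x \<in> m\<close> raises the value, so by maximality the product enters the last component\<close>
      have fm: "f \<otimes>\<^bsub>R\<^esub> x \<in> I 1" if x: "x \<in> max_ideal R" for x
      proof -
        have xR: "x \<in> carrier R" using x L.m(2) by auto
        have fxJ: "f \<otimes>\<^bsub>R\<^esub> x \<in> ?J"
        proof (intro IntI INT_I)
          show "f \<otimes>\<^bsub>R\<^esub> x \<in> carrier R" using fR xR by simp
          fix j assume j: "j \<in> {1..r} - {i}"
          interpret Vj: valued_domain R K h "\<nu> j" by (rule V) (use j in auto)
          have "x \<otimes>\<^bsub>R\<^esub> f \<in> val_ideal R K h (\<nu> j) (a j)" using L.smod_mult[OF Vj.val_ideal_smod xR] f(1) j by blast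
          thus "f \<otimes>\<^bsub>R\<^esub> x \<in> val_ideal R K h (\<nu> j) (a j)" using D.m_comm[OF fR xR] by simp
        qed
        have "f \<otimes>\<^bsub>R\<^esub> x \<in> ?Vi"
        proof (rule ccontr)
          assume n: "f \<otimes>\<^bsub>R\<^esub> x \<notin> ?Vi"
          hence pfx: "?p (f \<otimes>\<^bsub>R\<^esub> x)" using fxJ by blast
          have x0: "x \<noteq> \<zero>\<^bsub>R\<^esub>" using fin[OF pfx] fR by auto
          have hx: "h x \<noteq> \<zero>\<^bsub>K\<^esub>" "h f \<noteq> \<zero>\<^bsub>K\<^esub>" using Vi.h_zero_iff xR x0 fR fin[OF f(1)] by auto
          have "1 \<le> \<nu> i (h x)" using x hx unfolding i(2)[symmetric] Vi.center_eq Vi.val_ideal_iff Vi.Vge_def by auto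
          moreover have "\<nu> i (h (f \<otimes>\<^bsub>R\<^esub> x)) = \<nu> i (h f) + \<nu> i (h x)" using Vi.\<nu>_mult[of "h f" "h x"] hx fR xR by simp
          moreover have "nat (\<nu> i (h (f \<otimes>\<^bsub>R\<^esub> x))) \<le> nat (\<nu> i (h f))" by (rule f(2)[OF pfx])
          ultimately show False using fin[OF f(1)] by linarith
        qed
        hence "f \<otimes>\<^bsub>R\<^esub> x \<in> carrier R \<inter> (\<Inter>j\<in>{1..r}. val_ideal R K h (\<nu> j) (1 * a j))" using fxJ by auto
        thus ?thesis using In[of 1] by simp
      qed
      have "krull_dim R \<le> analytic_spread R (truncated R I b)"
      proof (rule spread_truncated_ge[OF R dom qf F b div[OF i(1)] i(2) _ fR _ fm])
        show "f \<notin> ?Vi" using f(1) by simp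
        show "I n \<subseteq> val_ideal R K h (\<nu> i) (n * a i)" if "n \<ge> 1" for n using In[OF that] i(1) by blast
      qed
      thus ?thesis using spread by simp
    next
      case False
      have cp: "primeideal (center R K h (\<nu> i)) R" if "i \<in> {1..r}" for i
        using valued_domain.center_primeideal[OF V[OF that]] .
      have czp: "L.zprime (center R K h (\<nu> i))" if i: "i \<in> {1..r}" for i
        using D.zprime_iff_primeideal cp[OF i] by simp
      have "\<exists>x\<in>max_ideal R. \<forall>Q\<in>(\<lambda>i. center R K h (\<nu> i)) ` {1..r}. x \<notin> Q"
      proof (rule L.prime_avoidance)
        fix Q assume "Q \<in> (\<lambda>i. center R K h (\<nu> i)) ` {1..r}"
        then obtain i where i: "i \<in> {1..r}" "Q = center R K h (\<nu> i)" by auto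
        show "L.zprime Q" using czp i by simp
        show "\<not> max_ideal R \<subseteq> Q" using primeideal_local[OF R cp[OF i(1)]] False i by blast
      qed simp
      then obtain x where x: "x \<in> max_ideal R" "\<And>i. i \<in> {1..r} \<Longrightarrow> x \<notin> center R K h (\<nu> i)" by auto
      have xR: "x \<in> carrier R" using x(1) L.m(2) by auto
      have r1: "1 \<in> {1..r}" using r0 by auto
      interpret V1: valued_domain R K h "\<nu> 1" by (rule V[OF r1])
      have x0: "x \<noteq> \<zero>\<^bsub>R\<^esub>" using V1.not_center[OF xR x(2)[OF r1]] by simp
      \<comment> \<open>the centre has height at least one by the definition of divisorial valuations, so it is nonzero\<close>
      have "\<exists>w. w \<in> center R K h (\<nu> 1) \<and> w \<noteq> \<zero>\<^bsub>R\<^esub>"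
      proof (rule ccontr)
        assume no: "\<not> ?thesis"
        obtain t where t: "enat t + 1 = height R (center R K h (\<nu> 1))" using div[OF r1] unfolding divisorial_valuation_def by auto
        have "height R (center R K h (\<nu> 1)) \<le> 0" unfolding height_def
        proof (rule Sup_least)
          fix d assume "d \<in> {enat n |n. \<exists>C. prime_chain R C n \<and> C n = center R K h (\<nu> 1)}"
          then obtain n C where C: "prime_chain R C n" "C n = center R K h (\<nu> 1)" "d = enat n" by auto
          show "d \<le> 0"
          proof (cases n)
            case (Suc n')
            hence lt: "C n' \<subset> center R K h (\<nu> 1)" and pr: "primeideal (C n') R" using C unfolding prime_chain_def by auto
            have "\<zero>\<^bsub>R\<^esub> \<in> C n'" using pr primeideal.axioms(1) ideal.axioms(1) additive_subgroup.zero_closed by blast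
            thus ?thesis using lt no by blast
          qed (use C in \<open>simp add: zero_enat_def\<close>)
        qed
        thus False unfolding t[symmetric] by (simp add: zero_enat_def one_enat_def)
      qed
      then obtain w where w: "w \<in> center R K h (\<nu> 1)" "w \<noteq> \<zero>\<^bsub>R\<^esub>" by blast
      show ?thesis
      proof (rule spread_lt_of_avoiding[OF R dom F _ x(1) x0])
        show "I n \<subseteq> max_ideal R" if n: "n \<ge> 1" for n
        proof -
          have "I n \<subseteq> val_ideal R K h (\<nu> 1) (n * a 1)" using In[OF n] r1 by blast
          also have "\<dots> \<subseteq> val_ideal R K h (\<nu> 1) 1" by (rule V1.val_ideal_anti) (use n ai[OF r1] in simp)
          also have "\<dots> \<subseteq> max_ideal R" using primeideal_local[OF R cp[OF r1]] V1.center_eq by simp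
          finally show ?thesis .
        qed
        show "z \<in> I n" if z: "z \<in> carrier R" "x \<otimes>\<^bsub>R\<^esub> z \<in> I n" for n z
        proof (cases "n = 0")
          case True
          thus ?thesis using z I0' by simp
        next
          case False
          hence n: "n \<ge> 1" by simp
          have "z \<in> val_ideal R K h (\<nu> i) (n * a i)" if i: "i \<in> {1..r}" for i
          proof -
            have "x \<otimes>\<^bsub>R\<^esub> z \<in> val_ideal R K h (\<nu> i) (n * a i)" using z(2) In[OF n] i by blast
            thus ?thesis by (rule valued_domain.not_center_cancel[OF V[OF i] xR x(2)[OF i] z(1)])
          qed
          thus ?thesis using In[OF n] z(1) by blast
        qed
        show "\<not> L.len (L.scale x (carrier R)) (carrier R) \<le> enat c" for c :: nat
          using V1.infinite_colength[OF R x(1) x(2)[OF r1] w] .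
      qed
    qed
  qed
qed

end
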